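(* Let $(\mathcal{T}_h)$ be a family of quadrilateral meshes of $\Omega$ satisfying the shape-regularity condition $h_K\le\varrho\rho_K$ for all $K\in \mathcal{T}_h$, with a constant $\varrho>2$ independent of $h$. Assume moreover that for every $\bar q\in\bar W_h$ there exists $\mathbf v\in V_h$ with $$\|\bar q\|_0^2\lesssim\int_\Omega \bar q\,\mathrm{div}\,\mathbf v\,d\mathbf x,\qquad |\mathbf v|_1^2\lesssim\|\bar q\|_0^2 .$$ Let $(\boldsymbol\sigma,\mathbf u)\in\Sigma\times V$ be the solution of $$a(\boldsymbol\sigma,\boldsymbol\tau)-\int_\Omega\boldsymbol\tau:\varepsilon(\mathbf u)\,d\mathbf x=0\ \ \forall\boldsymbol\tau\in\Sigma,\qquad \int_\Omega\boldsymbol\sigma:\varepsilon(\mathbf v)\,d\mathbf x=F(\mathbf v)\ \ \forall\mathbf v\in V.$$ Then there is a unique $(\boldsymbol\sigma_h,\mathbf u_h)\in\Sigma_h^{PS}\times V_h$ such that $$a(\boldsymbol\sigma_h,\boldsymbol\tau)-\int_\Omega\boldsymbol\tau:\varepsilon(\mathbf u_h)\,d\mathbf x=0\ \ \forall\boldsymbol\tau\in\Sigma_h^{PS},\qquad \int_\Omega\boldsymbol\sigma_h:\varepsilon(\mathbf v)\,d\mathbf x=F(\mathbf v)\ \ \forall\mathbf v\in V_h,$$ and it satisfies $$\|\boldsymbol\sigma-\boldsymbol\sigma_h\|_0+|\mathbf u-\mathbf u_h|_1\lesssim\inf_{\boldsymbol\tau\in\Sigma_h^{PS}}\|\boldsymbol\sigma-\boldsymbol\tau\|_0+\inf_{\mathbf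 v\in V_h}|\mathbf u-\mathbf v|_1 .$$ In addition, with $p_h=-\frac12 \mathrm{tr}\,\boldsymbol\sigma_h$ and $p=-(\mu+\lambda)\,\mathrm{div}\,\mathbf u=-\frac12\mathrm{tr}\,\boldsymbol\sigma$, $$\|p-p_h\|_0\lesssim\inf_{\boldsymbol\tau\in\Sigma_h^{PS}}\|\boldsymbol\sigma-\boldsymbol\tau\|_0+\inf_{\mathbf v\in V_h}|\mathbf u-\mathbf v|_1 .$$
   Context: **Continuous setting.** $\Omega\subset\mathbb R^2$ is a convex polygonal domain whose boundary is split into disjoint parts $\Gamma=\Gamma_D\cup\Gamma_N$ with $\mathrm{meas}(\Gamma_D)>0$, and either $\mathrm{meas}(\Gamma_N)>0$ or $\Gamma_N=\emptyset$. $\mu>0$ and $\lambda>0$ are the Lamé parameters ($\mu$ fixed, $\lambda$ arbitrary, possibly tending to $\infty$). $\varepsilon(\mathbf u)=(\nabla\mathbf u+\nabla^T\mathbf u)/2$; $\boldsymbol\sigma:\boldsymbol\tau=\sum_{i,j}\boldsymbol\sigma_{ij}\boldsymbol\tau_{ij}$; $\mathrm{tr}\,\boldsymbol\tau=\boldsymbol\tau_{11}+\boldsymbol\tau_{22}$. $V=\{\mathbf u\in H^1(\Omega)^2:\mathbf u|_{\Gamma_D}=0\}$. $\Sigma=L^2(\Omega;\mathbb R^{2\times2}_{sym})$ if $\mathrm{meas}(\Gamma_N)>0$, and $\Sigma=\{\boldsymbol\tau\in L^2(\Omega;\mathbb R^{2\times2}_{sym}):\int_\Omega\mathrm{tr}\,\boldsymbol\tau\,d\mathbf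 x=0\}$ if $\Gamma_N=\emptyset$. $\|\cdot\|_0$ is the $L^2(\Omega)$ norm, $|\cdot|_1$ the $H^1(\Omega)$ seminorm. $$a(\boldsymbol\sigma,\boldsymbol\tau)=\frac1{2\mu}\int_\Omega\Big(\boldsymbol\sigma:\boldsymbol\tau-\frac{\lambda}{2(\mu+\lambda)}\mathrm{tr}\,\boldsymbol\sigma\,\mathrm{tr}\,\boldsymbol\tau\Big)d\mathbf x,$$ and $F(\mathbf v)=\int_\Omega\mathbf f\cdot\mathbf v\,d\mathbf x+\int_{\Gamma_N}\mathbf g\cdot\mathbf v\,ds$ (a bounded linear functional on $V$, integrals read as duality pairings if necessary, with $\mathbf f\in V'$, $\mathbf g\in H^{-1/2}(\Gamma_N)$). **Meshes.** $\mathcal{T}_h$ is a conforming mesh of $\Omega$ by convex quadrilaterals; $h_K$ is the diameter of $K$, $h=\max_K h_K$. For $K$ with vertices $Z_i=(x_i,y_i)$, $1\le i\le4$ (counterclockwise), $T_i$ is the triangle with vertices $Z_{i-1},Z_i,Z_{i+1}$ (indices mod 4) and $\rho_K=\min_i$ (diameter of the circle inscribed in $T_i$). With $\hat K=[-1,1]^2$, the bilinear map $F_K:\hat K\to K$ sending $(-1,-1),(1,-1),(1,1),(-1,1)$ to $Z_1,Z_2,Z_3,Z_4$ is $x=a_0+a_1\xi+a_2\eta+a_{12}\xi\eta$, $y=b_0+b_1\xi+b_2\eta+b_{12}\xi\eta$, where $a_1=\frac14(-x_1+x_2+x_3-x_4)$, $a_2=\frac14(-x_1-x_2+x_3+x_4)$,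 $a_{12}=\frac14(x_1-x_2+x_3-x_4)$, and $b_1,b_2,b_{12}$ are given by the same formulas with $y_i$. Standing convention on the ordering of the nodes: $a_1>0$, $b_2>0$, $|b_1|\le a_1$, $|a_2|\lesssim b_2$. **Discrete spaces.** $V_h=\{\mathbf v\in V:\mathbf v|_K\circ F_K\in Q_1(\hat K)^2\ \forall K\in \mathcal{T}_h\}$, $Q_1$ being polynomials of degree $\le1$ in each variable. $\Sigma_h^{PS}$ is the set of $\boldsymbol\tau\in\Sigma$ such that for every $K$ there is $\beta\in\mathbb R^5$ with $\hat{\boldsymbol\tau}=\boldsymbol\tau|_K\circ F_K$ given by $\hat{\boldsymbol\tau}_{11}=\beta_1+\eta\beta_4+\frac{a_2^2}{b_2^2}\xi\beta_5$, $\hat{\boldsymbol\tau}_{22}=\beta_2+\frac{b_1^2}{a_1^2}\eta\beta_4+\xi\beta_5$, $\hat{\boldsymbol\tau}_{12}=\beta_3+\frac{b_1}{a_1}\eta\beta_4+\frac{a_2}{b_2}\xi\beta_5$. $\bar W_h$ is the space of functions in $L^2(\Omega)$ that are constant on each $K\in \mathcal{T}_h$. **Notation.** $a\lesssim b$ means $a\le Cb$ with a generic constant $C>0$ independent of $h$ and $\lambda$. *)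

theory Defs
  imports "HOL-Analysis.Analysis"
begin

section \<open>Convex polygons and arc length on their boundary\<close>

definition convex_polygonal_domain :: "(real^2) set \<Rightarrow> bool" where
  "convex_polygonal_domain \<Omega> \<longleftrightarrow>
     \<Omega> \<noteq> {} \<and> open \<Omega> \<and> convex \<Omega> \<and> polytope (closure \<Omega>)"

text \<open>
  Arc-length measure on the boundary of the polygon: every edge with end points \<open>a\<close>, \<open>b\<close> is
  parametrised by \<open>t \<mapsto> (1 - t) a + t b\<close>, \<open>0 \<le> t \<le> 1\<close>, with density \<open>dist a b\<close>.  The factor
  \<open>1/2\<close> is there because the set of ordered pairs contains each edge twice, as \<open>(a, b)\<close> and
  as \<open>(b, a)\<close>.
\<close>

definition edge_ends :: "(real^2) set \<Rightarrow> ((real^2) \<times> (real^2)) set" where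
  "edge_ends \<Omega> = {(a, b). closed_segment a b edge_of closure \<Omega>}"

definition arclength :: "(real^2) set \<Rightarrow> (real^2) measure" where
  "arclength \<Omega> =
     distr
       (density (count_space (edge_ends \<Omega>) \<Otimes>\<^sub>M lborel)
          (\<lambda>((a, b), t). ennreal (dist a b / 2) * indicator {0..1} t))
       borel (\<lambda>((a, b), t). (1 - t) *\<^sub>R a + t *\<^sub>R b)"


section \<open>Lebesgue and Sobolev spaces\<close>

text \<open>
  Elements of the function spaces are represented by functions on the whole plane; only their
  values on \<open>\<Omega>\<close> up to null sets matter.  On \<open>real^2^2\<close> the inner product is
  \<open>\<sigma> : \<tau>\<close>, so that \<open>norm\<close> is the Frobenius norm.
\<close>

definition L2 :: "(real^2) set \<Rightarrow> (real^2 \<Rightarrow> 'b::euclidean_space) set" where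
  "L2 \<Omega> = {f. f \<in> borel_measurable (lebesgue_on \<Omega>) \<and>
               integrable (lebesgue_on \<Omega>) (\<lambda>x. (norm (f x))\<^sup>2)}"

definition L2_norm :: "(real^2) set \<Rightarrow> (real^2 \<Rightarrow> 'b::euclidean_space) \<Rightarrow> real" where
  "L2_norm \<Omega> f = sqrt (LINT x|lebesgue_on \<Omega>. (norm (f x))\<^sup>2)"

text \<open>
  \<open>C\<^sup>\<infinity>\<close> functions on the plane; \<open>D i j\<close> is the partial derivative of order \<open>i\<close> in the first
  and of order \<open>j\<close> in the second variable.
\<close>

definition smooth :: "(real^2 \<Rightarrow> 'b::real_normed_vector) \<Rightarrow> bool" where
  "smooth f \<longleftrightarrow>
     (\<exists>D. D 0 0 = f \<and>
        (\<forall>i j x. (D i j has_derivative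
                   (\<lambda>h. h$1 *\<^sub>R D (Suc i) j x + h$2 *\<^sub>R D i (Suc j) x)) (at x)))"

definition test_function :: "(real^2) set \<Rightarrow> (real^2 \<Rightarrow> real) \<Rightarrow> bool" where
  "test_function \<Omega> \<phi> \<longleftrightarrow>
     smooth \<phi> \<and> compact (closure {x. \<phi> x \<noteq> 0}) \<and> closure {x. \<phi> x \<noteq> 0} \<subseteq> \<Omega>"

definition has_weak_gradient ::
    "(real^2) set \<Rightarrow> (real^2 \<Rightarrow> real^2) \<Rightarrow> (real^2 \<Rightarrow> real^2^2) \<Rightarrow> bool" where
  "has_weak_gradient \<Omega> u G \<longleftrightarrow>
     u \<in> L2 \<Omega> \<and> G \<in> L2 \<Omega> \<and>
     (\<forall>\<phi>. test_function \<Omega> \<phi> \<longrightarrow>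
        (\<forall>i j. (LINT x|lebesgue_on \<Omega>. u x $ i * frechet_derivative \<phi> (at x) (axis j 1)) =
               - (LINT x|lebesgue_on \<Omega>. G x $ i $ j * \<phi> x)))"

definition H1 :: "(real^2) set \<Rightarrow> (real^2 \<Rightarrow> real^2) set" where
  "H1 \<Omega> = {u. \<exists>G. has_weak_gradient \<Omega> u G}"

text \<open>The weak gradient is unique up to null sets, so the choice of a representative is harmless.\<close>

definition weak_grad :: "(real^2) set \<Rightarrow> (real^2 \<Rightarrow> real^2) \<Rightarrow> real^2 \<Rightarrow> real^2^2" where
  "weak_grad \<Omega> u = (SOME G. has_weak_gradient \<Omega> u G)"

definition H1_seminorm :: "(real^2) set \<Rightarrow> (real^2 \<Rightarrow> real^2) \<Rightarrow> real" where
  "H1_seminorm \<Omega> u = L2_norm \<Omega> (weak_grad \<Omega> u)"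

definition H1_norm :: "(real^2) set \<Rightarrow> (real^2 \<Rightarrow> real^2) \<Rightarrow> real" where
  "H1_norm \<Omega> u = sqrt ((L2_norm \<Omega> u)\<^sup>2 + (H1_seminorm \<Omega> u)\<^sup>2)"

definition strain :: "(real^2) set \<Rightarrow> (real^2 \<Rightarrow> real^2) \<Rightarrow> real^2 \<Rightarrow> real^2^2" where
  "strain \<Omega> u x = (1/2) *\<^sub>R (weak_grad \<Omega> u x + transpose (weak_grad \<Omega> u x))"

definition divergence :: "(real^2) set \<Rightarrow> (real^2 \<Rightarrow> real^2) \<Rightarrow> real^2 \<Rightarrow> real" where
  "divergence \<Omega> u x = trace (weak_grad \<Omega> u x)"

text \<open>
  The trace operator is the continuous extension to \<open>H\<^sup>1(\<Omega>)\<close> of the restriction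
  \<open>\<phi> \<mapsto> \<phi>|\<^bsub>\<partial>\<Omega>\<^esub>\<close>, defined on functions that are smooth up to the boundary, with values in
  \<open>L\<^sup>2(\<partial>\<Omega>)\<close>; the predicate describes its graph.
\<close>

definition has_boundary_trace ::
    "(real^2) set \<Rightarrow> (real^2 \<Rightarrow> real^2) \<Rightarrow> (real^2 \<Rightarrow> real^2) \<Rightarrow> bool" where
  "has_boundary_trace \<Omega> u g \<longleftrightarrow>
     g \<in> borel_measurable borel \<and>
     (\<exists>\<phi> :: nat \<Rightarrow> real^2 \<Rightarrow> real^2. (\<forall>n. smooth (\<phi> n)) \<and>
        (\<lambda>n. H1_norm \<Omega> (\<lambda>x. u x - \<phi> n x)) \<longlonglongrightarrow> 0 \<and>
        (\<lambda>n. \<integral>\<^sup>+ x. ennreal ((norm (g x - \<phi> n x))\<^sup>2) \<partial>arclength \<Omega>) \<longlonglongrightarrow> 0)"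


section \<open>The continuous problem\<close>

definition disp_space :: "(real^2) set \<Rightarrow> (real^2) set \<Rightarrow> (real^2 \<Rightarrow> real^2) set" where
  "disp_space \<Omega> \<Gamma>D =
     {u \<in> H1 \<Omega>. \<exists>g. has_boundary_trace \<Omega> u g \<and>
                    (AE x in arclength \<Omega>. x \<in> \<Gamma>D \<longrightarrow> g x = 0)}"

definition stress_space :: "(real^2) set \<Rightarrow> (real^2) set \<Rightarrow> (real^2 \<Rightarrow> real^2^2) set" where
  "stress_space \<Omega> \<Gamma>N =
     {\<tau> \<in> L2 \<Omega>. (AE x in lebesgue_on \<Omega>. transpose (\<tau> x) = \<tau> x) \<and>
                 (\<Gamma>N = {} \<longrightarrow> (LINT x|lebesgue_on \<Omega>. trace (\<tau> x)) = 0)}"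

definition form_a ::
    "(real^2) set \<Rightarrow> real \<Rightarrow> real \<Rightarrow> (real^2 \<Rightarrow> real^2^2) \<Rightarrow> (real^2 \<Rightarrow> real^2^2) \<Rightarrow> real" where
  "form_a \<Omega> \<mu> lam \<sigma> \<tau> =
     1 / (2 * \<mu>) *
     (LINT x|lebesgue_on \<Omega>.
        \<sigma> x \<bullet> \<tau> x - lam / (2 * (\<mu> + lam)) * trace (\<sigma> x) * trace (\<tau> x))"

definition strain_pairing ::
    "(real^2) set \<Rightarrow> (real^2 \<Rightarrow> real^2^2) \<Rightarrow> (real^2 \<Rightarrow> real^2) \<Rightarrow> real" where
  "strain_pairing \<Omega> \<tau> v = (LINT x|lebesgue_on \<Omega>. \<tau> x \<bullet> strain \<Omega> v x)"

text \<open>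
  The load \<open>F\<close>.  Since the volume force ranges over all of \<open>V'\<close>, the functionals
  \<open>v \<mapsto> \<langle>f, v\<rangle> + \<langle>g, v\<rangle>\<^bsub>\<Gamma>N\<^esub>\<close> are exactly the bounded linear functionals on \<open>V\<close>.
\<close>

definition bounded_functional_on :: "(real^2) set \<Rightarrow> (real^2 \<Rightarrow> real^2) set
    \<Rightarrow> ((real^2 \<Rightarrow> real^2) \<Rightarrow> real) \<Rightarrow> bool" where
  "bounded_functional_on \<Omega> V F \<longleftrightarrow>
     (\<forall>u\<in>V. \<forall>v\<in>V. F (\<lambda>x. u x + v x) = F u + F v) \<and>
     (\<forall>c. \<forall>v\<in>V. F (\<lambda>x. c *\<^sub>R v x) = c * F v) \<and>
     (\<exists>B. \<forall>v\<in>V. \<bar>F v\<bar> \<le> B * H1_norm \<Omega> v)"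

text \<open>The mixed variational problem on \<open>S \<times> W\<close>, for the continuous and the discrete spaces.\<close>

definition mixed_solution ::
    "(real^2) set \<Rightarrow> real \<Rightarrow> real \<Rightarrow> ((real^2 \<Rightarrow> real^2) \<Rightarrow> real) \<Rightarrow>
     (real^2 \<Rightarrow> real^2^2) set \<Rightarrow> (real^2 \<Rightarrow> real^2) set \<Rightarrow>
     (real^2 \<Rightarrow> real^2^2) \<Rightarrow> (real^2 \<Rightarrow> real^2) \<Rightarrow> bool" where
  "mixed_solution \<Omega> \<mu> lam F S W \<sigma> u \<longleftrightarrow>
     \<sigma> \<in> S \<and> u \<in> W \<and>
     (\<forall>\<tau>\<in>S. form_a \<Omega> \<mu> lam \<sigma> \<tau> - strain_pairing \<Omega> \<tau> u = 0) \<and>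
     (\<forall>v\<in>W. strain_pairing \<Omega> \<sigma> v = F v)"


section \<open>Quadrilateral meshes\<close>

text \<open>
  A quadrilateral is the ordered family of its vertices.  In the index type \<open>4\<close> arithmetic is
  modulo 4, so \<open>Z $ (i - 1)\<close>, \<open>Z $ i\<close>, \<open>Z $ (i + 1)\<close> are cyclically consecutive vertices.
\<close>

type_synonym quad = "real^2^4"

definition quad_hull :: "quad \<Rightarrow> (real^2) set" where
  "quad_hull Z = convex hull (range (($) Z))"

definition corner_triangle :: "quad \<Rightarrow> 4 \<Rightarrow> (real^2) set" where
  "corner_triangle Z i = convex hull {Z $ (i - 1), Z $ i, Z $ (i + 1)}"

definition cross2 :: "real^2 \<Rightarrow> real^2 \<Rightarrow> real" where
  "cross2 v w = v$1 * w$2 - v$2 * w$1"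

text \<open>A left turn at each of the four vertices: strictly convex and counterclockwise.\<close>

definition convex_quad :: "quad \<Rightarrow> bool" where
  "convex_quad Z \<longleftrightarrow> (\<forall>i. cross2 (Z $ i - Z $ (i - 1)) (Z $ (i + 1) - Z $ i) > 0)"

text \<open>The inscribed circle of a triangle bounds the largest disc contained in it.\<close>

definition incircle_diameter :: "(real^2) set \<Rightarrow> real" where
  "incircle_diameter T = Sup {2 * r |r. r \<ge> 0 \<and> (\<exists>c. cball c r \<subseteq> T)}"

definition rho :: "quad \<Rightarrow> real" where
  "rho Z = (MIN i. incircle_diameter (corner_triangle Z i))"

text \<open>
  The coefficients of the bilinear map: \<open>a\<^sub>k\<close> is the first and \<open>b\<^sub>k\<close> the second component of
  \<open>coef\<^sub>k\<close>.
\<close>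

definition coef0 :: "quad \<Rightarrow> real^2" where
  "coef0 Z = (1/4) *\<^sub>R (Z$1 + Z$2 + Z$3 + Z$4)"

definition coef1 :: "quad \<Rightarrow> real^2" where
  "coef1 Z = (1/4) *\<^sub>R (- Z$1 + Z$2 + Z$3 - Z$4)"

definition coef2 :: "quad \<Rightarrow> real^2" where
  "coef2 Z = (1/4) *\<^sub>R (- Z$1 - Z$2 + Z$3 + Z$4)"

definition coef12 :: "quad \<Rightarrow> real^2" where
  "coef12 Z = (1/4) *\<^sub>R (Z$1 - Z$2 + Z$3 - Z$4)"

definition ref_square :: "(real^2) set" where
  "ref_square = {z. \<forall>i. \<bar>z $ i\<bar> \<le> 1}"

definition bilinear_map :: "quad \<Rightarrow> real^2 \<Rightarrow> real^2" where
  "bilinear_map Z z =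
     coef0 Z + z$1 *\<^sub>R coef1 Z + z$2 *\<^sub>R coef2 Z + (z$1 * z$2) *\<^sub>R coef12 Z"

definition conforming_mesh :: "(real^2) set \<Rightarrow> quad set \<Rightarrow> bool" where
  "conforming_mesh \<Omega> T \<longleftrightarrow>
     finite T \<and> (\<forall>K\<in>T. convex_quad K) \<and> closure \<Omega> = (\<Union>K\<in>T. quad_hull K) \<and>
     (\<forall>K\<in>T. \<forall>L\<in>T. K \<noteq> L \<longrightarrow>
        interior (quad_hull K) \<inter> interior (quad_hull L) = {} \<and>
        (quad_hull K \<inter> quad_hull L) face_of quad_hull K \<and>
        (quad_hull K \<inter> quad_hull L) face_of quad_hull L)"

definition shape_regular :: "real \<Rightarrow> quad set \<Rightarrow> bool" where
  "shape_regular \<rho> T \<longleftrightarrow> (\<forall>K\<in>T. diameter (quad_hull K) \<le> \<rho> * rho K)"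

text \<open>
  Ordering of the nodes, \<open>a\<^sub>1 > 0\<close>, \<open>b\<^sub>2 > 0\<close>, \<open>\<bar>b\<^sub>1\<bar> \<le> a\<^sub>1\<close>, \<open>\<bar>a\<^sub>2\<bar> \<le> c b\<^sub>2\<close>; the constant \<open>c\<close> is to be
  shared by all meshes of a family.
\<close>

definition node_ordering :: "real \<Rightarrow> quad set \<Rightarrow> bool" where
  "node_ordering c T \<longleftrightarrow>
     (\<forall>K\<in>T. coef1 K $ 1 > 0 \<and> coef2 K $ 2 > 0 \<and>
             \<bar>coef1 K $ 2\<bar> \<le> coef1 K $ 1 \<and> \<bar>coef2 K $ 1\<bar> \<le> c * coef2 K $ 2)"


section \<open>Discrete spaces\<close>

definition Vh :: "(real^2) set \<Rightarrow> (real^2) set \<Rightarrow> quad set \<Rightarrow> (real^2 \<Rightarrow> real^2) set" where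
  "Vh \<Omega> \<Gamma>D T =
     {v \<in> disp_space \<Omega> \<Gamma>D. \<forall>K\<in>T. \<exists>c0 c1 c2 c12 :: real^2.
        AE z in lebesgue_on ref_square.
          v (bilinear_map K z) = c0 + z$1 *\<^sub>R c1 + z$2 *\<^sub>R c2 + (z$1 * z$2) *\<^sub>R c12}"

text \<open>The entry \<open>\<tau>\<^sub>2\<^sub>1\<close> is determined by the symmetry required in \<^const>\<open>stress_space\<close>.\<close>

definition Sigma_PS :: "(real^2) set \<Rightarrow> (real^2) set \<Rightarrow> quad set \<Rightarrow> (real^2 \<Rightarrow> real^2^2) set" where
  "Sigma_PS \<Omega> \<Gamma>N T =
     {\<tau> \<in> stress_space \<Omega> \<Gamma>N. \<forall>K\<in>T. \<exists>\<beta> :: real^5.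
        let a1 = coef1 K $ 1; b1 = coef1 K $ 2; a2 = coef2 K $ 1; b2 = coef2 K $ 2 in
        AE z in lebesgue_on ref_square.
          let \<xi> = z$1; \<eta> = z$2; t = \<tau> (bilinear_map K z) in
          t$1$1 = \<beta>$1 + \<eta> * \<beta>$4 + a2\<^sup>2 / b2\<^sup>2 * \<xi> * \<beta>$5 \<and>
          t$2$2 = \<beta>$2 + b1\<^sup>2 / a1\<^sup>2 * \<eta> * \<beta>$4 + \<xi> * \<beta>$5 \<and>
          t$1$2 = \<beta>$3 + b1 / a1 * \<eta> * \<beta>$4 + a2 / b2 * \<xi> * \<beta>$5}"

definition Wbar :: "(real^2) set \<Rightarrow> quad set \<Rightarrow> (real^2 \<Rightarrow> real) set" where
  "Wbar \<Omega> T = {q \<in> L2 \<Omega>. \<forall>K\<in>T. \<exists>c. AE x in lebesgue_on (quad_hull K). q x = c}"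

definition best_approx ::
    "(real^2) set \<Rightarrow> (real^2 \<Rightarrow> real^2^2) set \<Rightarrow> (real^2 \<Rightarrow> real^2) set \<Rightarrow>
     (real^2 \<Rightarrow> real^2^2) \<Rightarrow> (real^2 \<Rightarrow> real^2) \<Rightarrow> real" where
  "best_approx \<Omega> S W \<sigma> u =
     (INF \<tau>\<in>S. L2_norm \<Omega> (\<lambda>x. \<sigma> x - \<tau> x)) + (INF v\<in>W. H1_seminorm \<Omega> (\<lambda>x. u x - v x))"

end

theory Submission
  imports Defs
begin

text \<open>
 Why the method is stable uniformly in \<open>\<lambda>\<close> and in the mesh. The form \<open>a\<close> is bounded uniformly in \<open>\<lambda>\<close>, but as
 \<open>\<lambda> \<rightarrow> \<infinity>\<close> it controls only the deviator of a stress (\<open>form_a_dev\<close>). Three facts about the discrete spaces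
 make up for this.

 \<^item> Strains are seen by stresses. On an element with Jacobian \<open>J\<close>, the field \<open>J \<nabla>v\<close> of an isoparametric bilinear
 function is affine in the reference coordinates (\<open>isoparametric_weak_gradient\<close>), and its non-constant part is
 determined by the value in the centre and by one vector \<open>D\<close>. The two non-constant stress modes are the rank-one
 matrices \<open>A\<^sub>1 A\<^sub>1\<^sup>T\<close> and \<open>A\<^sub>2 A\<^sub>2\<^sup>T\<close> up to scaling, \<open>A\<^sub>1\<close> and \<open>A\<^sub>2\<close> being the axes of the element; they test \<open>D\<close> against
 \<open>A\<^sub>1\<close> and \<open>A\<^sub>2\<close>, hence control it (\<open>local_stability\<close>). Summed over the elements this is the inf-sup condition
 \<open>discrete_infsup\<close>.

 \<^item> Traces oscillate no more than deviators. The trace of a rank-one matrix \<open>a a\<^sup>T\<close> is bounded by its deviator, so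
 the trace of a discrete stress is, up to its deviator, constant on each element (\<open>trace_oscillation\<close>).

 \<^item> Elementwise constant traces are tested by the assumed discrete stability of the divergence. Consequently the
 full norm of a discrete stress is bounded by its deviator and its action on discrete strains
 (\<open>stress_norm_from_deviator\<close>).

 The difference between the discrete solution and any discrete competitor solves the discrete problem with a right
 hand side given by the approximation errors; the three facts and a quadratic absorption argument bound it
 (\<open>stability\<close>). Strains control displacements by Korn's inequality (\<open>korn_disp_space\<close>), and quasi-optimality follows.
 With zero data the same estimate gives uniqueness. As the discrete spaces are finite dimensional modulo null
 functions and the mixed form is symmetric, uniqueness gives existence (\<open>symmetric_problem_solvable\<close>). The pressure
 estimate follows from the stress estimate because \<open>p = - (tr \<sigma>)/2\<close>, which is the first equation tested with
 multiples of the identity (\<open>trace_stress_divergence\<close>). If \<open>\<Gamma>\<^sub>N\<close> is empty, a displacement in \<open>V\<close> has a divergence of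
 mean zero (\<open>divergence_integral_zero\<close>), so the divergence condition fails for the constant \<open>1\<close>; hence there is then
 no mesh in the family.

 Korn's inequality on \<open>V\<close> is obtained for smooth functions and extended by density. On a square it is local: cut
 off at a corner, and a combination of dilations makes its first component vanish on the boundary, where
 Korn's inequality is an integration by parts. Affine images of this estimate are glued along overlapping
 parallelograms covering the polygon, and the remaining infinitesimal rigid motion is read off on one edge.
\<close>

abbreviation (input) leb :: "'a::euclidean_space set => 'a measure" where "leb S == lebesgue_on S"
abbreviation (input) scale (infixr "*R" 75) where "r *R x == r *\<^sub>R x"
abbreviation (input) cont where "cont f == continuous_on UNIV f"
abbreviation (input) int01 where "int01 f == integral {0..1::real} f"
abbreviation (input) RS where "RS == lebesgue_on ref_square"
lemmas lint_add = Bochner_Integration.integral_add and lint_diff = Bochner_Integration.integral_diff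
 and lint_sum = Bochner_Integration.integral_sum and lint_cong = Bochner_Integration.integral_cong
 and lintegrable_add = Bochner_Integration.integrable_add and lintegrable_cong = Bochner_Integration.integrable_cong
 and lintegrable_bound = Bochner_Integration.integrable_bound
 and hk_integral_cong = Henstock_Kurzweil_Integration.integral_cong

section \<open>Integrals over the unit square\<close>

definition cont2 :: "(real => real => real) => bool" where
 "cont2 f \<longleftrightarrow> cont (%p. f (fst p) (snd p))"

definition sqint :: "(real => real => real) => real" where
 "sqint f = int01 (%x. int01 (%y. f x y))"

abbreviation (input) sqn where "sqn f == sqint (\<lambda>x y. (f x y)^2)"

named_theorems cont2_intros

lemma cont2_compose:
 assumes "cont2 f" "continuous_on S g" "continuous_on S h"
 shows "continuous_on S (%x. f (g x) (h x))"
proof -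
 have "continuous_on S (%x. (g x, h x))" using assms by (intro continuous_intros)
 from continuous_on_compose2[OF assms(1)[unfolded cont2_def] this] show ?thesis by simp
qed

lemma cont2_const [cont2_intros]: "cont2 (%x y. c)"
 and cont2_fst [cont2_intros]: "cont g ==> cont2 (%x y. g x)"
 and cont2_snd [cont2_intros]: "cont g ==> cont2 (%x y. g y)" unfolding cont2_def
 by (auto intro!: continuous_intros intro: continuous_on_compose2[where g=g])

lemma cont2_add [cont2_intros]: "cont2 f ==> cont2 g ==> cont2 (%x y. f x y + g x y)"
 and cont2_diff [cont2_intros]: "cont2 f ==> cont2 g ==> cont2 (%x y. f x y - g x y)"
 and cont2_mult [cont2_intros]: "cont2 f ==> cont2 g ==> cont2 (%x y. f x y * g x y)"
 and cont2_minus [cont2_intros]: "cont2 f ==> cont2 (%x y. - f x y)"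
 and cont2_power [cont2_intros]: "cont2 f ==> cont2 (%x y. f x y ^ n)"
 and cont2_divide [cont2_intros]: "cont2 f ==> cont2 (%x y. f x y / c)" unfolding cont2_def divide_inverse by (auto intro!: continuous_intros)

lemma cont2_scale:
 "cont2 f ==> cont2 (%x y. f (a * x) y)" "cont2 f ==> cont2 (%x y. f x (b * y))"
 "cont2 f ==> cont2 (%x y. f (a * x) (b * y))"
 and cont2_swap: "cont2 f ==> cont2 (%x y. f y x)" unfolding cont2_def by (rule cont2_compose[unfolded cont2_def]; auto intro!: continuous_intros)+

lemma cont2_continuous:
 assumes "cont2 f"
 shows "continuous_on S (%x. f x y)" "continuous_on S (%y. f x y)" "continuous_on S (f x)" by (rule cont2_compose[OF assms]; intro continuous_intros)+

lemma cont2_integral_snd [cont2_intros]: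
 assumes "cont2 f"
 shows "continuous_on S (%x. int01 (%y. f x y))"
proof -
 have "continuous_on (S \<times> cbox 0 1) (%(x, t). f x t)" unfolding split_beta by (rule cont2_compose[OF assms]) (intro continuous_intros)+
 from integral_continuous_on_param[OF this] show ?thesis by simp
qed

lemma cont2_integral_fst [cont2_intros]:
 assumes "cont2 f"
 shows "continuous_on S (%y. int01 (%x. f x y))" using cont2_integral_snd[OF cont2_swap[OF assms]] .

lemma sqint_cbox:
 assumes "cont2 f"
 shows "sqint f = integral (cbox (0,0) (1,1)) (%p. f (fst p) (snd p))" using integral_prod_continuous[of 0 0 1 1 "%p. f (fst p) (snd p)"]
  continuous_on_subset[OF assms[unfolded cont2_def]] by (simp add: sqint_def)

lemma sqint_integrable:
 assumes "cont2 f"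
 shows "(%p. f (fst p) (snd p)) integrable_on (cbox (0,0) (1,1))"
 by (rule integrable_continuous, rule continuous_on_subset[OF assms[unfolded cont2_def]]) auto

lemma sqint_add: "cont2 f ==> cont2 g ==> sqint (%x y. f x y + g x y) = sqint f + sqint g"
 by (simp add: sqint_cbox cont2_add integral_add sqint_integrable)

lemma sqint_diff: "cont2 f ==> cont2 g ==> sqint (%x y. f x y - g x y) = sqint f - sqint g"
 by (simp add: sqint_cbox cont2_diff integral_diff sqint_integrable)

lemma sqint_cmult: "sqint (%x y. c * f x y) = c * sqint f"
 by (simp add: sqint_def)

lemma sqint_mono:
 assumes "cont2 f" "cont2 g" "!!x y. 0 <= x ==> x <= 1 ==> 0 <= y ==> y <= 1 ==> f x y <= g x y"
 shows "sqint f <= sqint g" unfolding sqint_cbox[OF assms(1)] sqint_cbox[OF assms(2)]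
 by (rule integral_le[OF sqint_integrable sqint_integrable]) (auto intro: assms simp: cbox_Pair_eq)

lemma sqint_nonneg: "cont2 f ==> (!!x y. 0 <= x ==> x <= 1 ==> 0 <= y ==> y <= 1 ==> 0 <= f x y) ==> 0 <= sqint f"
 using sqint_mono[of "%x y. 0" f] by (simp add: cont2_intros sqint_def)

lemma sqint_swap:
 assumes "cont2 f" shows "sqint (%x y. f y x) = sqint f"
proof -
 have "continuous_on (cbox (0,0) (1,1)) (%(x,y). f x y)" using continuous_on_subset[OF assms[unfolded cont2_def]] by (simp add: split_beta)
 from integral_swap_continuous[OF this] show ?thesis by (simp add: sqint_def)
qed

lemma sqint_fst: "sqint (%x y. g x) = int01 g"
 by (simp add: sqint_def)

lemma sqint_snd: "sqint (%x y. g y) = int01 g"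
 by (simp add: sqint_def)

lemma integral_scale_vanishing:
 fixes g :: "real => real"
 assumes "cont g" "!!x. x >= 1 ==> g x = 0"
 shows "int01 (%x. g (4 * x)) = int01 g / 4"
proof -
 have i: "g integrable_on {0..4}" using continuous_on_subset[OF assms(1)] by (intro integrable_continuous_interval) auto
 have "((%x. g (4 * x + 0)) has_integral (1 / \<bar>4\<bar>^DIM(real)) *R integral {0..4} g) ((%x. (1/4) *R x + -((1/4) *R 0)) ` cbox 0 4)"
  using has_integral_affinity[of g "integral {0..4} g" 0 4 4 0] i by (simp add: has_integral_integral)
 moreover have "((%x. (1/4) *R x + -((1/4) *R 0)) ` cbox 0 4) = {0..1::real}" by (simp add: image_affinity_atLeastAtMost cbox_interval)
 ultimately have "((%x. g (4 * x)) has_integral (1 / 4) * integral {0..4} g) {0..1}" by simp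
 hence "int01 (%x. g (4 * x)) = integral {0..4} g / 4" by (simp add: integral_unique)
 also have "integral {0..4} g = int01 g + integral {1..4} g" using Henstock_Kurzweil_Integration.integral_combine[of 0 1 4 g] i by simp
 also have "integral {1..4} g = integral {1..4::real} (%x. 0)" by (rule hk_integral_cong) (use assms in auto)
 finally show ?thesis by simp
qed

lemma sqint_scale_fst:
 assumes "cont2 f" "!!x y. x >= 1 ==> f x y = 0"
 shows "sqint (%x y. f (4 * x) y) = sqint f / 4" unfolding sqint_def by (rule integral_scale_vanishing[where g="%x. int01 (f x)"])
  (use assms in \<open>auto intro!: cont2_integral_snd simp: assms(2)[THEN ext]\<close>)

lemma sqint_scale_snd:
 assumes "cont2 f" "!!x y. y >= 1 ==> f x y = 0"
 shows "sqint (%x y. f x (4 * y)) = sqint f / 4"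
proof -
 have "sqint (%x y. f x (4 * y)) = sqint (%x y. (%x y. f y x) (4 * x) y)"
  using sqint_swap[of "%x y. f x (4*y)", OF cont2_scale(2)[OF assms(1)]] by simp
 also have "... = sqint (%x y. f y x) / 4" by (rule sqint_scale_fst) (use assms in \<open>auto intro: cont2_swap\<close>)
 finally show ?thesis using sqint_swap[OF assms(1)] by simp
qed

lemma sqint_scale_both:
 assumes "cont2 f" "!!x y. x >= 1 ==> f x y = 0" "!!x y. y >= 1 ==> f x y = 0"
 shows "sqint (%x y. f (4 * x) (4 * y)) = sqint f / 16" using sqint_scale_fst[of "%x y. f x (4 * y)"] sqint_scale_snd[of f] assms
 by (simp add: cont2_scale)

lemma integral_deriv_vanishing:
 assumes "!!x. (g has_real_derivative g' x) (at x)" "g 0 = 0" "g 1 = (0::real)"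
 shows "int01 g' = 0"
proof -
 have "(g' has_integral g 1 - g 0) {0..1}" by (rule fundamental_theorem_of_calculus)
   (auto intro!: has_field_derivative_at_within assms simp flip: has_real_derivative_iff_has_vector_derivative)
 thus ?thesis using assms by (simp add: integral_unique)
qed

lemma sqint_deriv_vanishing:
 assumes "!!x y. ((%x. h x y) has_real_derivative hx x y) (at x)"
  and "cont2 hx" "!!y. h 0 y = 0" "!!y. h 1 y = 0"
 shows "sqint hx = 0"
proof -
 have "sqint hx = sqint (%x y. hx y x)" using sqint_swap[OF assms(2)] by simp
 also have "int01 (%x. hx x y) = 0" for y using integral_deriv_vanishing[of "%x. h x y" "%x. hx x y"] assms by auto
 hence "sqint (%x y. hx y x) = 0" unfolding sqint_def by simp
 finally show ?thesis .
qed

section \<open>Korn's inequality near a corner of the unit square\<close>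

text \<open>If \<open>U1\<close> vanishes on the boundary, both sides integrate \<open>- U1 \<partial>\<^sub>x\<partial>\<^sub>y U2\<close>. Only the mixed derivative of \<open>U2\<close> enters,
 so its value on the boundary is arbitrary.\<close>

lemma jacobian_integral_symmetry:
 assumes U1: "!!x y. ((%x. U1 x y) has_real_derivative U1x x y) (at x)"
   "!!x y. ((%y. U1 x y) has_real_derivative U1y x y) (at y)"
  and U2: "!!x y. ((%y. U2x x y) has_real_derivative U2xy x y) (at y)"
   "!!x y. ((%x. U2y x y) has_real_derivative U2xy x y) (at x)"
  and c: "cont2 U1" "cont2 U1x" "cont2 U1y" "cont2 U2x" "cont2 U2y" "cont2 U2xy"
  and z: "!!y. U1 0 y = 0" "!!y. U1 1 y = 0" "!!x. U1 x 0 = 0" "!!x. U1 x 1 = 0"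
 shows "sqint (%x y. U1x x y * U2y x y) = sqint (%x y. U1y x y * U2x x y)"
proof -
 have "sqint (%x y. U1x x y * U2y x y + U1 x y * U2xy x y) = 0" by (rule sqint_deriv_vanishing[where h="%x y. U1 x y * U2y x y"])
   (auto intro!: derivative_eq_intros U1 U2 cont2_intros c simp: z)
 moreover have "sqint (%x y. (%x y. U1y y x * U2x y x + U1 y x * U2xy y x) x y) = 0" by (rule sqint_deriv_vanishing[where h="%x y. U1 y x * U2x y x"])
   (auto intro!: derivative_eq_intros U1 U2 cont2_intros cont2_swap[OF c(1)] 
     cont2_swap[OF c(3)] cont2_swap[OF c(4)] cont2_swap[OF c(6)] simp: z)
 moreover have "sqint (%x y. (%x y. U1y y x * U2x y x + U1 y x * U2xy y x) x y)
   = sqint (%x y. U1y x y * U2x x y + U1 x y * U2xy x y)" by (rule sqint_swap[where f="%x y. U1y x y * U2x x y + U1 x y * U2xy x y"])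
   (auto intro!: cont2_intros c)
 ultimately show ?thesis by (simp add: sqint_add c cont2_mult)
qed

text \<open>By \<open>jacobian_integral_symmetry\<close> the square of the curl integrates to that of the shear minus four times the product
 of the diagonal strains. The first component of \<open>v\<close> need not vanish where \<open>x = 0\<close> or \<open>y = 0\<close>, but that of the combination
 \<open>U\<close> of \<open>v\<close> with dilated copies does. The weights make the shear of \<open>U\<close> a combination of dilated shears, and its curl is
 \<open>(I - X) (I - 4Y) curl v\<close>, where \<open>X\<close>, \<open>Y\<close> scale one coordinate by 4. On functions that vanish far out \<open>X\<close> and \<open>Y\<close> halve
 the \<open>L\<^sup>2\<close> norm, so \<open>4Y\<close> doubles it, and both factors are bounded below.\<close>

lemma korn_zero_far_sides:
 assumes v1: "!!x y. ((%x. v1 x y) has_real_derivative v1x x y) (at x)"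
   "!!x y. ((%y. v1 x y) has_real_derivative v1y x y) (at y)"
  and v2: "!!x y. ((%x. v2 x y) has_real_derivative v2x x y) (at x)"
   "!!x y. ((%y. v2 x y) has_real_derivative v2y x y) (at y)"
  and v2': "!!x y. ((%y. v2x x y) has_real_derivative v2xy x y) (at y)"
   "!!x y. ((%x. v2y x y) has_real_derivative v2xy x y) (at x)"
  and c: "cont2 v1" "cont2 v1x" "cont2 v1y" "cont2 v2x" "cont2 v2y" "cont2 v2xy"
  and z: "!!x y. x >= 1 \<or> y >= 1 ==> v1 x y = 0 & v1x x y = 0 & v1y x y = 0 & v2x x y = 0 & v2y x y = 0"
 shows "sqint (%x y. (v1y x y - v2x x y)^2) <=
  2120 * (sqn v1x + sqn v2y + sqint (%x y. (v1y x y + v2x x y)^2))"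
proof -
 note cs = c cont2_scale[OF c(1)] cont2_scale[OF c(2)] cont2_scale[OF c(3)] cont2_scale[OF c(4)]
  cont2_scale[OF c(5)] cont2_scale[OF c(6)]
 note c_intros = cont2_add cont2_diff cont2_mult cont2_power cont2_const cs
 define U1 where "U1 = (%x y. v1 x y - v1 (4*x) y - v1 x (4*y) + v1 (4*x) (4*y))"
 define U1x where "U1x = (%x y. v1x x y - 4 * v1x (4*x) y - v1x x (4*y) + 4 * v1x (4*x) (4*y))"
 define U1y where "U1y = (%x y. v1y x y - v1y (4*x) y - 4 * v1y x (4*y) + 4 * v1y (4*x) (4*y))"
 define U2x where "U2x = (%x y. v2x x y - v2x (4*x) y - 4 * v2x x (4*y) + 4 * v2x (4*x) (4*y))"
 define U2y where "U2y = (%x y. v2y x y - (1/4) * v2y (4*x) y - 16 * v2y x (4*y) + 4 * v2y (4*x) (4*y))"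
 define U2xy where "U2xy = (%x y. v2xy x y - v2xy (4*x) y - 16 * v2xy x (4*y) + 16 * v2xy (4*x) (4*y))"
 note U_defs = U1_def U1x_def U1y_def U2x_def U2y_def U2xy_def
 have cU: "cont2 U1" "cont2 U1x" "cont2 U1y" "cont2 U2x" "cont2 U2y" "cont2 U2xy" unfolding U_defs by (intro c_intros)+
 define A D S where "A = sqn v1x" and "D = sqn v2y"
  and "S = sqint (%x y. (v1y x y + v2x x y)^2)"
 have ADS: "A >= 0" "D >= 0" "S >= 0" unfolding A_def D_def S_def by (auto intro!: sqint_nonneg c_intros)
 have four: "(p + q + r + t)^2 <= 4 * (p^2 + q^2 + r^2 + t^2)" for p q r t :: real
  using sum_squares_ge_zero[of "p-q" "p-r"] sum_squares_ge_zero[of "p-t" "q-r"]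
   sum_squares_ge_zero[of "q-t" "r-t"] by (simp add: power2_eq_square algebra_simps)
 have bound: "sqint (%x y. (f x y - \<alpha> * f (4*x) y - \<beta> * f x (4*y) + \<gamma> * f (4*x) (4*y))^2)
   <= 4 * (1 + \<alpha>^2/4 + \<beta>^2/4 + \<gamma>^2/16) * sqn f"
  if f: "cont2 f" and fz: "!!x y. x >= 1 \<or> y >= 1 ==> f x y = 0" for f \<alpha> \<beta> \<gamma>
 proof -
  let ?g = "%x y. (f x y)^2"
  have g: "cont2 ?g" using f by (intro cont2_power)
  have gz: "x >= 1 \<or> y >= 1 ==> ?g x y = 0" for x y using fz by simp
  have "sqint (%x y. (f x y - \<alpha> * f (4*x) y - \<beta> * f x (4*y) + \<gamma> * f (4*x) (4*y))^2)
   <= sqint (%x y. 4 * (?g x y + \<alpha>^2 * ?g (4*x) y + \<beta>^2 * ?g x (4*y) + \<gamma>^2 * ?g (4*x) (4*y)))"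
  proof (rule sqint_mono)
   fix x y
   show "(f x y - \<alpha> * f (4*x) y - \<beta> * f x (4*y) + \<gamma> * f (4*x) (4*y))^2 <=
    4 * (?g x y + \<alpha>^2 * ?g (4*x) y + \<beta>^2 * ?g x (4*y) + \<gamma>^2 * ?g (4*x) (4*y))"
    using four[of "f x y" "- \<alpha> * f (4*x) y" "- \<beta> * f x (4*y)" "\<gamma> * f (4*x) (4*y)"] by (simp add: power_mult_distrib)
  qed (intro cont2_intros f cont2_scale[OF f])+
  also have "... = 4 * (sqint ?g + \<alpha>^2 * sqint (%x y. ?g (4*x) y) + \<beta>^2 * sqint (%x y. ?g x (4*y))
    + \<gamma>^2 * sqint (%x y. ?g (4*x) (4*y)))" by (simp add: sqint_cmult sqint_add cont2_add cont2_mult cont2_const cont2_power cont2_scale f)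
  also have "sqint (%x y. ?g (4*x) y) = sqint ?g / 4" by (rule sqint_scale_fst[OF g]) (use gz in auto)
  also have "sqint (%x y. ?g x (4*y)) = sqint ?g / 4" by (rule sqint_scale_snd[OF g]) (use gz in auto)
  also have "sqint (%x y. ?g (4*x) (4*y)) = sqint ?g / 16" by (rule sqint_scale_both[OF g]) (use gz in auto)
  finally show ?thesis by (simp add: algebra_simps)
 qed
 \<comment> \<open>the coefficients 1, 4, 16 of the dilations are squared, and the factors \<open>1/4\<close>, \<open>1/16\<close> come from the Jacobians\<close>
 have bA: "sqn U1x <= 25 * A" using bound[OF c(2), of 4 1 4] z unfolding U1x_def A_def by simp
 have bD: "sqn U2y <= 265 * D" using bound[OF c(5), of "1/4" 16 4] z ADS unfolding U2y_def D_def by (simp add: power2_eq_square)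
 have bS: "sqint (%x y. (U1y x y + U2x x y)^2) <= 25 * S" using bound[OF cont2_add[OF c(3,4)], of 1 4 4] z unfolding U1y_def U2x_def S_def
  by (simp add: algebra_simps)
 have sym: "sqint (%x y. U1x x y * U2y x y) = sqint (%x y. U1y x y * U2x x y)"
 proof (rule jacobian_integral_symmetry[OF _ _ _ _ cU])
  fix x y
  note ch = DERIV_chain'[where f="%x. 4 * x" and D=4]
  show "((%x. U1 x y) has_real_derivative U1x x y) (at x)"
   "((%y. U1 x y) has_real_derivative U1y x y) (at y)" unfolding U_defs by (auto intro!: derivative_eq_intros v1 ch[OF _ v1(1)] ch[OF _ v1(2)])
  show "((%y. U2x x y) has_real_derivative U2xy x y) (at y)"
   "((%x. U2y x y) has_real_derivative U2xy x y) (at x)" unfolding U_defs by (auto intro!: derivative_eq_intros v2' ch[OF _ v2'(1)] ch[OF _ v2'(2)])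
  show "U1 0 y = 0" "U1 x 0 = 0" "U1 1 y = 0" "U1 x 1 = 0" using z by (auto simp: U1_def)
 qed
 have "sqint (%x y. (U1y x y - U2x x y)^2)
   = sqint (%x y. (U1y x y + U2x x y)^2) - 4 * sqint (%x y. U1x x y * U2y x y)" unfolding sym
  by (subst sqint_cmult[symmetric], subst sqint_diff[symmetric]) (auto intro!: c_intros cU simp: power2_eq_square algebra_simps)
 also have "- 4 * sqint (%x y. U1x x y * U2y x y) <= sqint (%x y. 2 * ((U1x x y)^2 + (U2y x y)^2))" unfolding sqint_cmult[symmetric]
 proof (rule sqint_mono)
  show "- 4 * (U1x x y * U2y x y) <= 2 * ((U1x x y)^2 + (U2y x y)^2)" for x y
   using zero_le_power2[of "U1x x y + U2y x y"] by (simp add: power2_eq_square algebra_simps)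
 qed (intro c_intros cU)+
 hence "sqint (%x y. (U1y x y + U2x x y)^2) - 4 * sqint (%x y. U1x x y * U2y x y)
  <= 25 * S + 2 * (25 * A + 265 * D)" using bA bD bS by (simp add: sqint_cmult sqint_add cont2_power cont2_mult cont2_const cU)
 finally have curlU: "sqint (%x y. (U1y x y - U2x x y)^2) <= 25 * S + 50 * A + 530 * D" by simp
 define f where "f = (%x y. v1y x y - v2x x y)"
 define g where "g = (%x y. f x y - 4 * f x (4*y))"
 have cf: "cont2 f" and cg: "cont2 g" unfolding f_def g_def by (intro c_intros cont2_scale)+
 have fz: "x >= 1 \<or> y >= 1 ==> f x y = 0" for x y using z by (simp add: f_def)
 have gz: "x >= 1 ==> g x y = 0" for x y using fz by (simp add: g_def)
 have Ug: "U1y x y - U2x x y = g x y - g (4*x) y" for x y by (simp add: U_defs g_def f_def)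
 have "sqint (%x y. (4 * f x (4*y))^2) <= sqint (%x y. 2 * (g x y)^2 + 2 * (f x y)^2)"
 proof (rule sqint_mono)
  show "(4 * f x (4*y))^2 <= 2 * (g x y)^2 + 2 * (f x y)^2" for x y
   using zero_le_power2[of "g x y + f x y"] by (simp add: g_def power2_eq_square algebra_simps)
 qed (intro c_intros cf cg cont2_scale[OF cg] cont2_scale[OF cf])+
 moreover have "sqint (%x y. (4 * f x (4*y))^2) = 4 * sqn f"
  using sqint_scale_snd[of "%x y. (f x y)^2"] fz cf by (simp add: power_mult_distrib sqint_cmult cont2_power)
 ultimately have fg: "sqn f <= sqn g" by (simp add: sqint_add sqint_cmult cont2_mult cont2_const cont2_power cf cg)
 have "sqn g <= sqint (%x y. 2 * (g x y - g (4*x) y)^2 + 2 * (g (4*x) y)^2)"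
 proof (rule sqint_mono)
  show "(g x y)^2 <= 2 * (g x y - g (4*x) y)^2 + 2 * (g (4*x) y)^2" for x y
   using zero_le_power2[of "g x y - 2 * g (4*x) y"] by (simp add: power2_eq_square algebra_simps)
 qed (intro c_intros cf cg cont2_scale[OF cg] cont2_scale[OF cf])+
 moreover have "sqint (%x y. (g (4*x) y)^2) = sqn g / 4" using sqint_scale_fst[of "%x y. (g x y)^2"] gz cg by (simp add: cont2_power)
 ultimately have "sqn g <= 4 * sqint (%x y. (g x y - g (4*x) y)^2)"
  by (simp add: sqint_add sqint_cmult cont2_mult cont2_const cont2_power cont2_diff cont2_scale cf cg)
 also have "sqint (%x y. (g x y - g (4*x) y)^2) <= 25 * S + 50 * A + 530 * D" using curlU unfolding Ug .
 finally have "sqn f <= 4 * (25 * S + 50 * A + 530 * D)" using fg by simp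
 also have "... <= 2120 * (A + D + S)" using ADS by simp
 finally show ?thesis unfolding f_def A_def D_def S_def .
qed

lemma integral_jensen:
 fixes g :: "real => real"
 assumes "continuous_on {0..1} g"
 shows "(int01 g)^2 <= int01 (%x. (g x)^2)"
proof -
 define m where "m = int01 g"
 have i: "g integrable_on {0..1}" "(%x. (g x)^2) integrable_on {0..1}" "(%x. (2 * m) * g x) integrable_on {0..1}"
  using assms by (auto intro!: integrable_continuous_interval continuous_intros)
 have "0 <= int01 (%x. (g x - m)^2)" using assms by (intro integral_nonneg integrable_continuous_interval continuous_intros) auto
 also have "... = int01 (%x. ((g x)^2 - (2 * m) * g x) + m^2)" by (rule hk_integral_cong) (simp add: power2_eq_square algebra_simps)
 also have "... = int01 (%x. (g x)^2) - (2 * m) * m + m^2"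
 proof (subst integral_add)
  show "(%x. (g x)^2 - 2 * m * g x) integrable_on {0..1}" using i by (intro integrable_diff)
  show "int01 (%x. (g x)^2 - 2 * m * g x) + int01 (%x::real. m^2)
   = int01 (%x. (g x)^2) - 2 * m * m + m^2" using integral_diff[OF i(2,3)] by (simp add: m_def)
 qed auto
 finally show ?thesis by (simp add: m_def power2_eq_square)
qed

lemma weighted_integral_square:
 fixes g w :: "real => real"
 assumes "continuous_on {0..1} g" "continuous_on {0..1} w"
  and "!!x. 0 <= x ==> x <= 1 ==> \<bar>w x\<bar> <= B"
 shows "(int01 (%x. g x * w x))^2 <= B^2 * int01 (%x. (g x)^2)"
proof -
 have "(int01 (%x. g x * w x))^2 <= int01 (%x. (g x * w x)^2)" using assms by (intro integral_jensen continuous_intros)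
 also have "... <= int01 (%x. B^2 * (g x)^2)"
 proof (rule integral_le)
  fix x :: real assume "x : {0..1}"
  hence "(w x)^2 <= B^2" using assms(3)[of x] abs_le_square_iff[of "w x" B] by auto
  thus "(g x * w x)^2 <= B^2 * (g x)^2" by (simp add: power_mult_distrib mult.commute[of "(g x)^2"] mult_right_mono)
 qed (use assms in \<open>auto intro!: integrable_continuous_interval continuous_intros\<close>)
 finally show ?thesis by simp
qed

lemma oscillation_square:
 fixes g :: "real => real"
 assumes d: "!!x. (g has_real_derivative g' x) (at x)" and c: "cont g'"
  and x: "0 <= x" "x <= 1" "0 <= t" "t <= 1"
 shows "(g x - g t)^2 <= int01 (%x. (g' x)^2)"
proof -
 have cs: "continuous_on S g'" for S using c continuous_on_subset by blast
 have *: "(g x - g t)^2 <= int01 (%x. (g' x)^2)" if "t <= x" "0 <= t" "x <= 1" for x t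
 proof -
  have "(g' has_integral g x - g t) {t..x}" by (rule fundamental_theorem_of_calculus)
    (auto intro!: has_field_derivative_at_within d that simp flip: has_real_derivative_iff_has_vector_derivative)
  hence "\<bar>g x - g t\<bar> = \<bar>integral {t..x} g'\<bar>" by (simp add: integral_unique)
  also have "... <= integral {t..x} (%x. \<bar>g' x\<bar>)" using integral_norm_bound_integral[of g' "{t..x}" "%x. \<bar>g' x\<bar>"] cs
   by (auto intro!: integrable_continuous_interval continuous_intros)
  also have "... <= int01 (%x. \<bar>g' x\<bar>)" using cs that by (intro integral_subset_le integrable_continuous_interval continuous_intros) auto
  finally have "\<bar>g x - g t\<bar> <= int01 (%x. \<bar>g' x\<bar>)" .
  hence "(g x - g t)^2 <= (int01 (%x. \<bar>g' x\<bar>))^2" by (metis abs_ge_zero power2_abs power_mono)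
  also have "... <= int01 (%x. \<bar>g' x\<bar>^2)" using cs by (intro integral_jensen continuous_intros)
  finally show ?thesis by simp
 qed
 show ?thesis using *[of t x] *[of x t] x by (cases "t <= x") (auto simp: power2_commute)
qed

text \<open>A normalised weight reproduces constants, so on each line \<open>u\<close> minus its average is a weighted oscillation.\<close>

lemma weighted_average_L2:
 assumes u: "!!x y. ((%x. u x y) has_real_derivative ux x y) (at x)"
  and c: "cont2 u" "cont2 ux" and w: "cont w" "int01 w = 1"
   "!!x. 0 <= x ==> x <= 1 ==> \<bar>w x\<bar> <= 3/2"
 shows "sqint (%x y. (u x y - int01 (%t. u t y * w t))^2) <= (9/4) * sqn ux"
proof -
 have ws: "continuous_on S w" for S using w(1) continuous_on_subset by blast
 note uc = cont2_continuous[OF c(1)] cont2_continuous[OF c(2)]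
 have cF: "cont (%y. int01 (%t. u t y * w t))" by (intro cont2_integral_fst cont2_intros c w)
 have "sqint (%x y. (u x y - int01 (%t. u t y * w t))^2) <=
  sqint (%x y. (9/4) * int01 (%t. (ux t y)^2))"
 proof (rule sqint_mono)
  fix x y :: real assume x: "0 <= x" "x <= 1"
  have "int01 (%t. (u x y - u t y) * w t) = int01 (%t. u x y * w t - u t y * w t)" by (simp add: algebra_simps)
  also have "... = u x y * 1 - int01 (%t. u t y * w t)"
   by (subst integral_diff) (auto intro!: integrable_continuous_interval continuous_intros ws uc simp: w)
  finally have "(u x y - int01 (%t. u t y * w t))^2
   = (int01 (%t. (u x y - u t y) * w t))^2" by simp
  also have "... <= (3/2)^2 * int01 (%t. (u x y - u t y)^2)" by (rule weighted_integral_square[OF _ _ w(3)]) (auto intro!: continuous_intros ws uc)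
  also have "int01 (%t. (u x y - u t y)^2) <= int01 (%t::real. int01 (%t. (ux t y)^2))"
  proof (rule integral_le)
   fix t :: real assume "t : {0..1}"
   thus "(u x y - u t y)^2 <= int01 (%t. (ux t y)^2)" using oscillation_square[of "%x. u x y" "%x. ux x y" x t] u x by (auto intro: uc)
  qed (auto intro!: integrable_continuous_interval continuous_intros uc)
  finally show "(u x y - int01 (%t. u t y * w t))^2 <= (9/4) * int01 (%t. (ux t y)^2)" by (simp add: power2_eq_square)
 next
  show "cont2 (%x y. (u x y - int01 (%t. u t y * w t))^2)" by (intro cont2_intros c cF)
  show "cont2 (%x y. (9/4) * int01 (%t. (ux t y)^2))" by (rule cont2_snd) (intro continuous_intros cont2_integral_fst cont2_intros c)
 qed
 also have "... = (9/4) * sqn ux" using sqint_swap[of "%x y. (ux x y)^2"] c by (simp add: sqint_cmult sqint_snd cont2_power) (simp add: sqint_def)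
 finally show ?thesis .
qed

text \<open>A probability density that vanishes at both ends, so that an average against it can be integrated by parts without
 boundary terms.\<close>

definition hump :: "real => real" where "hump x = 6 * x * (1 - x)"

lemma hump: "continuous_on S hump" "int01 hump = 1"
 "0 <= x ==> x <= 1 ==> \<bar>hump x\<bar> <= 3/2" "(hump has_real_derivative 6 - 12 * x) (at x)"
 "hump 0 = 0" "hump 1 = 0"
proof -
 show "continuous_on S hump" unfolding hump_def by (intro continuous_intros)
 have "(hump has_integral (3 * 1^2 - 2 * 1^3) - (3 * 0^2 - 2 * 0^3)) {0..1}" by (rule fundamental_theorem_of_calculus)
   (auto intro!: derivative_eq_intros simp: hump_def power2_eq_square algebra_simps
    simp flip: has_real_derivative_iff_has_vector_derivative)
 thus "int01 hump = 1" by (simp add: integral_unique)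
 show "\<bar>hump x\<bar> <= 3/2" if "0 <= x" "x <= 1"
 proof -
  have "0 <= hump x" using that by (simp add: hump_def)
  moreover have "hump x <= 3/2" using zero_le_power2[of "2 * x - 1"] by (simp add: hump_def power2_eq_square algebra_simps)
  ultimately show ?thesis by simp
 qed
 show "(hump has_real_derivative 6 - 12 * x) (at x)" unfolding hump_def by (auto intro!: derivative_eq_intros simp: algebra_simps)
 show "hump 0 = 0" "hump 1 = 0" by (auto simp: hump_def)
qed

text \<open>Let \<open>F y\<close> be the average of \<open>u1\<close> over the row \<open>y\<close>. Its derivative is an average of the shear minus one of \<open>\<partial>\<^sub>x u2\<close>, and
 integration by parts turns the latter into \<open>- k\<close> if \<open>u2\<close> is replaced by \<open>m x\<close>. So \<open>u1\<close> is close to \<open>F\<close>, and \<open>F\<close> to an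
 affine function of slope \<open>k\<close>.\<close>

lemma near_affine_step:
 assumes u1: "!!x y. ((%x. u1 x y) has_real_derivative u1x x y) (at x)"
   "!!x y. ((%y. u1 x y) has_real_derivative u1y x y) (at y)"
  and u2: "!!x y. ((%x. u2 x y) has_real_derivative u2x x y) (at x)"
  and c: "cont2 u1" "cont2 u1x" "cont2 u1y" "cont2 u2" "cont2 u2x" and m: "cont m"
  and k: "k = int01 (%t. m t * (6 - 12 * t))"
 shows "EX a. sqint (%x y. (u1 x y - a - k * y)^2) <= (9/2) * sqn u1x
  + 9 * sqint (%x y. (u1y x y + u2x x y)^2) + 144 * sqint (%x y. (u2 x y - m x)^2)"
proof -
 define F where "F = (%y. int01 (%t. u1 t y * hump t))"
 define F' where "F' = (%y. int01 (%t. u1y t y * hump t))"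
 have ms: "continuous_on S m" for S using m continuous_on_subset by blast
 note ci = continuous_intros cont2_continuous[OF c(1)] cont2_continuous[OF c(2)]
  cont2_continuous[OF c(3)] cont2_continuous[OF c(4)] cont2_continuous[OF c(5)] ms hump(1)
 have cF: "cont F" "cont F'" unfolding F_def F'_def by (intro cont2_integral_fst cont2_intros c hump)+
 have dF: "(F has_real_derivative F' y) (at y)" for y
 proof -
  have "((%y. integral (cbox 0 1) (%t. u1 t y * hump t)) has_field_derivative
    integral (cbox 0 1) (%t. u1y t y * hump t)) (at y within UNIV)"
  proof (rule leibniz_rule_field_derivative)
   show "continuous_on (UNIV \<times> cbox 0 1) (%(x, t). u1y t x * hump t)" unfolding split_beta
    by (intro continuous_intros cont2_compose[OF c(3)] continuous_on_compose2[OF hump(1)[of UNIV]]) auto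
  qed (auto intro!: derivative_eq_intros u1 integrable_continuous_interval ci)
  thus ?thesis by (simp add: F_def F'_def)
 qed
 define R where "R = (%y. int01 (%t. (u2 t y - m t)^2))"
 define S where "S = (%y. int01 (%t. (u1y t y + u2x t y)^2))"
 have cR: "cont R" and cS: "cont S" unfolding R_def S_def by (intro cont2_integral_fst cont2_intros c m)+
 have e: "(F' y - k)^2 <= (9/2) * S y + 72 * R y" for y
 proof -
  have "int01 (%t. u2x t y * hump t + u2 t y * (6 - 12 * t)) = 0" by (rule integral_deriv_vanishing[where g="%t. u2 t y * hump t"])
    (auto intro!: derivative_eq_intros u2 hump)
  hence parts: "int01 (%t. u2x t y * hump t) + int01 (%t. u2 t y * (6 - 12 * t)) = 0"
   by (subst (asm) integral_add) (auto intro!: integrable_continuous_interval ci)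
  have eq: "F' y - k = int01 (%t. (u1y t y + u2x t y) * hump t)
    + int01 (%t. (u2 t y - m t) * (6 - 12 * t))"
  proof -
   have "int01 (%t. (u1y t y + u2x t y) * hump t) = F' y + int01 (%t. u2x t y * hump t)"
    unfolding F'_def distrib_right by (rule integral_add) (auto intro!: integrable_continuous_interval ci)
   moreover have "int01 (%t. (u2 t y - m t) * (6 - 12 * t)) =
     int01 (%t. u2 t y * (6 - 12 * t)) - k" unfolding k left_diff_distrib by (rule integral_diff) (auto intro!: integrable_continuous_interval ci)
   ultimately show ?thesis using parts by simp
  qed
  have b1: "(int01 (%t. (u1y t y + u2x t y) * hump t))^2 <= (3/2)^2 * S y"
   unfolding S_def by (rule weighted_integral_square[OF _ _ hump(3)]) (auto intro!: ci)
  have b2: "(int01 (%t. (u2 t y - m t) * (6 - 12 * t)))^2 <= 6^2 * R y" unfolding R_def by (rule weighted_integral_square) (auto intro!: ci)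
  have sq: "(p + q)^2 <= (9/2) * s + 72 * r" if "p^2 <= (3/2)^2 * s" "q^2 <= 6^2 * r" for p q r s :: real
   using zero_le_power2[of "p - q"] that by (simp add: power2_eq_square algebra_simps)
  show ?thesis unfolding eq by (rule sq[OF b1 b2])
 qed
 have "sqint (%x y. (u1 x y - F 0 - k * y)^2) <=
   sqint (%x y. 2 * (u1 x y - F y)^2 + 2 * int01 (%y. (F' y - k)^2))"
 proof (rule sqint_mono)
  fix x y :: real assume y: "0 <= y" "y <= 1"
  have "((F y - k * y) - (F 0 - k * 0))^2 <= int01 (%y. (F' y - k)^2)" by (rule oscillation_square[where g="%y. F y - k * y"])
    (use y in \<open>auto intro!: derivative_eq_intros dF continuous_intros cF\<close>)
  moreover have "(u1 x y - F 0 - k * y)^2 <= 2 * (u1 x y - F y)^2 + 2 * ((F y - k * y) - (F 0 - k * 0))^2"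
   using zero_le_power2[of "(u1 x y - F y) - ((F y - k * y) - (F 0 - k * 0))"] by (simp add: power2_eq_square algebra_simps)
  ultimately show "(u1 x y - F 0 - k * y)^2 <= 2 * (u1 x y - F y)^2 + 2 * int01 (%y. (F' y - k)^2)" by linarith
 qed (intro cont2_intros c cF continuous_intros)+
 also have "... = 2 * sqint (%x y. (u1 x y - F y)^2) + 2 * int01 (%y. (F' y - k)^2)"
  by (subst sqint_add) (auto intro!: cont2_intros c cF simp: sqint_cmult sqint_snd)
 also have "sqint (%x y. (u1 x y - F y)^2) <= (9/4) * sqn u1x" unfolding F_def by (rule weighted_average_L2[OF u1(1) c(1,2) hump(1,2)]) (rule hump(3))
 also have "int01 (%y. (F' y - k)^2) <= int01 (%y. (9/2) * S y + 72 * R y)" using cF cR cS continuous_on_subset e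
  by (intro integral_le integrable_continuous_interval continuous_intros) auto
 also have "... = (9/2) * int01 S + 72 * int01 R" using continuous_on_subset[OF cR] continuous_on_subset[OF cS]
  by (subst integral_add) (auto intro!: integrable_continuous_interval continuous_intros)
 also have "int01 S = sqint (%x y. (u1y x y + u2x x y)^2)" unfolding S_def using sqint_swap[of "%x y. (u1y x y + u2x x y)^2"]
  by (simp add: cont2_add cont2_power c) (simp add: sqint_def)
 also have "int01 R = sqint (%x y. (u2 x y - m x)^2)" unfolding R_def using sqint_swap[of "%x y. (u2 x y - m x)^2"]
  by (simp add: cont2_diff cont2_power c cont2_fst m) (simp add: sqint_def)
 finally show ?thesis by (intro exI[of _ "F 0"]) simp
qed

text \<open>The previous step is used twice: with the column averages of \<open>u2\<close> for \<open>m\<close>, and, components exchanged, with the affine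
 function just found. The two affine functions fit together to an infinitesimal rigid motion because \<open>hump\<close> has
 integral one.\<close>

lemma square_rigid_motion_L2:
 assumes u1: "!!x y. ((%x. u1 x y) has_real_derivative u1x x y) (at x)"
   "!!x y. ((%y. u1 x y) has_real_derivative u1y x y) (at y)"
  and u2: "!!x y. ((%x. u2 x y) has_real_derivative u2x x y) (at x)"
   "!!x y. ((%y. u2 x y) has_real_derivative u2y x y) (at y)"
  and c: "cont2 u1" "cont2 u1x" "cont2 u1y" "cont2 u2" "cont2 u2x" "cont2 u2y"
 defines "E \<equiv> sqn u1x + sqn u2y + sqint (%x y. (u1y x y + u2x x y)^2)"
 shows "EX a b k. sqint (%x y. (u1 x y - a - k * y)^2) <= 324 * E \<and>
   sqint (%x y. (u2 x y - b + k * x)^2) <= 46665 * E"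
proof -
 have E: "sqn u1x >= 0" "sqn u2y >= 0"
  "sqint (%x y. (u1y x y + u2x x y)^2) >= 0" by (auto intro!: sqint_nonneg cont2_intros c)
 note cw = c[THEN cont2_swap]
 define H where "H = (%x. int01 (%t. u2 x t * hump t))"
 have cH: "cont H" unfolding H_def by (intro cont2_integral_snd cont2_intros c hump)
 define k where "k = int01 (%t. H t * (6 - 12 * t))"
 have R: "sqint (%x y. (u2 x y - H x)^2) <= (9/4) * sqn u2y"
 proof -
  have "sqint (%x y. ((%x y. u2 y x) x y - int01 (%t. (%x y. u2 y x) t y * hump t))^2)
   <= (9/4) * sqint (%x y. (u2y y x)^2)" by (rule weighted_average_L2[OF _ _ _ hump(1,2)]) (auto intro!: u2 cw dest: hump(3))
  hence "sqint (%x y. (u2 y x - H y)^2) <= (9/4) * sqint (%x y. (u2y y x)^2)" by (simp add: H_def)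
  thus ?thesis using sqint_swap[of "%x y. (u2 x y - H x)^2"] sqint_swap[of "%x y. (u2y x y)^2"] by (simp add: cont2_diff cont2_power c cont2_fst cH)
 qed
 obtain a where a: "sqint (%x y. (u1 x y - a - k * y)^2) <= (9/2) * sqn u1x
  + 9 * sqint (%x y. (u1y x y + u2x x y)^2) + 144 * sqint (%x y. (u2 x y - H x)^2)" using near_affine_step[OF u1 u2(1) c(1-5) cH k_def] by blast
 have 1: "sqint (%x y. (u1 x y - a - k * y)^2) <= 324 * E" using a R E unfolding E_def distrib_left by linarith
 \<comment> \<open>the first moment of \<open>6 - 12 t\<close> is \<open>- 1\<close>, so the slope passed on to \<open>u2\<close> is the negative of that of \<open>u1\<close>\<close>
 have km: "- k = int01 (%t. (a + k * t) * (6 - 12 * t))"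
 proof -
  have "((%t. (a + k * t) * (6 - 12 * t)) has_integral
    (a * (6 * 1 - 6 * 1^2) + k * (3 * 1^2 - 4 * 1^3)) - (a * (6 * 0 - 6 * 0^2) + k * (3 * 0^2 - 4 * 0^3))) {0..1}"
   by (rule fundamental_theorem_of_calculus) (auto intro!: derivative_eq_intros simp: power2_eq_square algebra_simps
     simp flip: has_real_derivative_iff_has_vector_derivative)
  thus ?thesis by (simp add: integral_unique)
 qed
 have "EX b. sqint (%x y. ((%x y. u2 y x) x y - b - (- k) * y)^2) <= (9/2) * sqint (%x y. (u2y y x)^2)
  + 9 * sqint (%x y. (u2x y x + u1y y x)^2) + 144 * sqint (%x y. (u1 y x - (a + k * x))^2)" by (rule near_affine_step[where m="%t. a + k * t"])
   (auto intro!: u1 u2 cw km continuous_intros)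
 then obtain b where b: "sqint (%x y. (u2 y x - b + k * y)^2) <= (9/2) * sqint (%x y. (u2y y x)^2)
  + 9 * sqint (%x y. (u2x y x + u1y y x)^2) + 144 * sqint (%x y. (u1 y x - (a + k * x))^2)" by auto
 have s: "sqint (%x y. (u2 y x - b + k * y)^2) = sqint (%x y. (u2 x y - b + k * x)^2)"
   "sqint (%x y. (u2y y x)^2) = sqn u2y"
   "sqint (%x y. (u2x y x + u1y y x)^2) = sqint (%x y. (u1y x y + u2x x y)^2)"
   "sqint (%x y. (u1 y x - (a + k * x))^2) = sqint (%x y. (u1 x y - a - k * y)^2)"
    apply (rule sqint_swap[where f="%x y. (u2 x y - b + k * x)^2"], intro cont2_intros c continuous_intros)
   apply (rule sqint_swap[where f="%x y. (u2y x y)^2"], intro cont2_intros c continuous_intros)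
   apply (subst sqint_swap[where f="%x y. (u2x x y + u1y x y)^2"], intro cont2_intros c continuous_intros)
   apply (simp add: add.commute)
  apply (subst sqint_swap[where f="%x y. (u1 x y - (a + k * y))^2"], intro cont2_intros c continuous_intros)
  apply (simp add: algebra_simps)
  done
 have "sqint (%x y. (u2 x y - b + k * x)^2) <= 46665 * E" using b[unfolded s] 1 E unfolding E_def distrib_left by linarith
 with 1 show ?thesis by blast
qed

text \<open>A continuously differentiable cut-off function towards the far sides.\<close>

definition ramp3 :: "real => real" where "ramp3 t = (max 0 (1 - t)) ^ 3"
definition ramp3' :: "real => real" where "ramp3' t = - 3 * (max 0 (1 - t)) ^ 2"

lemma ramp3_deriv: "(ramp3 has_real_derivative ramp3' t) (at t)"
proof (cases t "1::real" rule: linorder_cases)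
 case less
 have "((%t. (1 - t) ^ 3) has_real_derivative ramp3' t) (at t)" using less by (auto intro!: derivative_eq_intros simp: ramp3'_def)
 thus ?thesis by (rule DERIV_cong_ev[THEN iffD1, rotated -1])
   (use less eventually_nhds_in_open[of "{..<1}" t] in \<open>auto simp: ramp3_def elim!: eventually_mono\<close>)
next
 case greater
 have "((%t. 0) has_real_derivative ramp3' t) (at t)" using greater by (auto intro!: derivative_eq_intros simp: ramp3'_def)
 thus ?thesis by (rule DERIV_cong_ev[THEN iffD1, rotated -1])
   (use greater eventually_nhds_in_open[of "{1<..}" t] in \<open>auto simp: ramp3_def elim!: eventually_mono\<close>)
next
 case equal
 have "((%s. (ramp3 s - ramp3 1) / (s - 1)) \<longlongrightarrow> 0) (at 1)"
 proof (rule Lim_null_comparison)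
  show "\<forall>\<^sub>F s in at 1. norm ((ramp3 s - ramp3 1) / (s - 1)) <= \<bar>s - 1\<bar> ^ 2"
  proof (rule eventually_at_filter[THEN iffD2], rule always_eventually, intro allI impI)
   fix s :: real assume "s ~= 1"
   moreover have "\<bar>ramp3 s\<bar> <= \<bar>s - 1\<bar> ^ 3" unfolding ramp3_def by (simp add: power_abs power_mono)
   ultimately show "norm ((ramp3 s - ramp3 1) / (s - 1)) <= \<bar>s - 1\<bar> ^ 2"
    by (simp add: ramp3_def divide_simps power3_eq_cube power2_eq_square)
  qed
  show "((%s. \<bar>s - 1\<bar> ^ 2) \<longlongrightarrow> 0) (at (1::real))" by (auto intro!: tendsto_eq_intros)
 qed
 thus ?thesis using equal by (simp add: has_field_derivative_iff ramp3'_def)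
qed

lemma ramp3_continuous: "continuous_on S ramp3" "continuous_on S ramp3'"
 unfolding ramp3_def ramp3'_def by (intro continuous_intros)+

lemma ramp3_bounds:
 assumes "0 <= t" "t <= 1"
 shows "\<bar>ramp3 t\<bar> <= 1" "\<bar>ramp3' t\<bar> <= 3" using assms by (auto simp: ramp3_def ramp3'_def power_le_one abs_mult)

lemma ramp3_zero: "t >= 1 ==> ramp3 t = 0" "t >= 1 ==> ramp3' t = 0"
 by (auto simp: ramp3_def ramp3'_def)

text \<open>Subtract the rigid motion of \<open>square_rigid_motion_L2\<close> and cut off; derivatives of the cut-off functions multiply only the
 difference, which is already controlled in \<open>L\<^sup>2\<close>.\<close>

lemma square_korn:
 assumes u1: "!!x y. ((%x. u1 x y) has_real_derivative u1x x y) (at x)"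
   "!!x y. ((%y. u1 x y) has_real_derivative u1y x y) (at y)"
  and u2: "!!x y. ((%x. u2 x y) has_real_derivative u2x x y) (at x)"
   "!!x y. ((%y. u2 x y) has_real_derivative u2y x y) (at y)"
  and u2': "!!x y. ((%y. u2x x y) has_real_derivative u2xy x y) (at y)"
   "!!x y. ((%x. u2y x y) has_real_derivative u2xy x y) (at x)"
  and c: "cont2 u1" "cont2 u1x" "cont2 u1y" "cont2 u2" "cont2 u2x" "cont2 u2y" "cont2 u2xy"
 defines "E \<equiv> sqn u1x + sqn u2y + sqint (%x y. (u1y x y + u2x x y)^2)"
 shows "EX k. sqint (%x y. (ramp3 x * ramp3 y * (u1y x y - u2x x y - k))^2) <= 10 ^ 10 * E"
proof -
 obtain a b k where rm: "sqint (%x y. (u1 x y - a - k * y)^2) <= 324 * E"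
   "sqint (%x y. (u2 x y - b + k * x)^2) <= 46665 * E" using square_rigid_motion_L2[OF u1 u2 c(1-6)] unfolding E_def by blast
 define W1 W2 where "W1 = (%x y. u1 x y - a - k * y)" and "W2 = (%x y. u2 x y - b + k * x)"
 define s where "s = (%x y. u1y x y + u2x x y)"
 have cid: "cont2 (%x y. k * y)" "cont2 (%x y. k * x)" by (intro cont2_intros continuous_intros)+
 have cr: "cont2 (%x y. ramp3 x)" "cont2 (%x y. ramp3 y)" "cont2 (%x y. ramp3' x)" "cont2 (%x y. ramp3' y)" by (intro cont2_intros ramp3_continuous)+
 note ci = cont2_add cont2_diff cont2_mult cont2_power cont2_const c cid cr
 have cW: "cont2 W1" "cont2 W2" "cont2 s" unfolding W1_def W2_def s_def by (intro ci)+
 define v1x v1y v2x v2y v2xy where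
  "v1x = (%x y. ramp3' x * ramp3 y * W1 x y + ramp3 x * ramp3 y * u1x x y)" and
  "v1y = (%x y. ramp3 x * ramp3' y * W1 x y + ramp3 x * ramp3 y * (u1y x y - k))" and
  "v2x = (%x y. ramp3' x * ramp3 y * W2 x y + ramp3 x * ramp3 y * (u2x x y + k))" and
  "v2y = (%x y. ramp3 x * ramp3' y * W2 x y + ramp3 x * ramp3 y * u2y x y)" and
  "v2xy = (%x y. ramp3' x * ramp3' y * W2 x y + ramp3' x * ramp3 y * u2y x y
    + ramp3 x * ramp3' y * (u2x x y + k) + ramp3 x * ramp3 y * u2xy x y)"
 note v_defs = v1x_def v1y_def v2x_def v2y_def v2xy_def
 have cv: "cont2 v1x" "cont2 v1y" "cont2 v2x" "cont2 v2y" "cont2 v2xy" unfolding v_defs by (intro ci cW)+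
 note civ = ci cW cv
 have V: "sqint (%x y. (v1y x y - v2x x y)^2) <=
  2120 * (sqn v1x + sqn v2y + sqint (%x y. (v1y x y + v2x x y)^2))"
 proof (rule korn_zero_far_sides[where ?v1.0="%x y. ramp3 x * ramp3 y * W1 x y" and
    ?v2.0="%x y. ramp3 x * ramp3 y * W2 x y" and v2xy=v2xy])
  fix x y
  show "((%x. ramp3 x * ramp3 y * W1 x y) has_real_derivative v1x x y) (at x)"
   "((%y. ramp3 x * ramp3 y * W1 x y) has_real_derivative v1y x y) (at y)"
   "((%x. ramp3 x * ramp3 y * W2 x y) has_real_derivative v2x x y) (at x)"
   "((%y. ramp3 x * ramp3 y * W2 x y) has_real_derivative v2y x y) (at y)"
   "((%y. v2x x y) has_real_derivative v2xy x y) (at y)"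
   "((%x. v2y x y) has_real_derivative v2xy x y) (at x)" unfolding v_defs W1_def W2_def
   by (auto intro!: derivative_eq_intros ramp3_deriv u1 u2 u2' simp: algebra_simps)
  show "1 <= x \<or> 1 <= y ==> ramp3 x * ramp3 y * W1 x y = 0 & v1x x y = 0 & v1y x y = 0 & v2x x y = 0 & v2y x y = 0"
   by (auto simp: v_defs ramp3_zero)
 qed (intro civ)+
 let ?n = "%f. sqn f"
 have sq: "\<bar>p\<bar> <= 1 ==> p^2 <= 1" "\<bar>p\<bar> <= 3 ==> p^2 <= 9" for p :: real
  using abs_le_square_iff[of p 1] abs_le_square_iff[of p 3] by auto
 have prod: "(p * q * w)^2 <= c * w^2" if "p^2 <= 1" "q^2 <= c" for p q w c :: real
 proof -
  have "p^2 * q^2 <= 1 * c" using that by (intro mult_mono) auto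
  thus ?thesis by (simp add: power_mult_distrib mult_right_mono)
 qed
 have two: "(p + q)^2 <= 2 * p^2 + 2 * q^2" and twod: "(p - q)^2 <= 2 * p^2 + 2 * q^2" for p q :: real
  using zero_le_power2[of "p - q"] zero_le_power2[of "p + q"] by (simp_all add: power2_eq_square algebra_simps)
 have three: "(p + q + r)^2 <= 3 * p^2 + 3 * q^2 + 3 * r^2" for p q r :: real
  using zero_le_power2[of "p - q"] zero_le_power2[of "p - r"] zero_le_power2[of "q - r"] by (simp add: power2_eq_square algebra_simps)
 have bnd: "(ramp3' x * ramp3 y * w)^2 <= 9 * w^2" "(ramp3 x * ramp3' y * w)^2 <= 9 * w^2"
  "(ramp3 x * ramp3 y * w)^2 <= 1 * w^2" if "0 <= x" "x <= 1" "0 <= y" "y <= 1" for x y w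
 proof -
  note b = ramp3_bounds[OF that(1,2)] ramp3_bounds[OF that(3,4)]
  show "(ramp3 x * ramp3' y * w)^2 <= 9 * w^2" "(ramp3 x * ramp3 y * w)^2 <= 1 * w^2" by (intro prod sq b)+
  have "(ramp3 y * ramp3' x * w)^2 <= 9 * w^2" by (intro prod sq b)
  thus "(ramp3' x * ramp3 y * w)^2 <= 9 * w^2" by (simp add: mult.commute)
 qed
 have n1: "?n v1x <= 18 * ?n W1 + 2 * ?n u1x"
 proof -
  have "?n v1x <= sqint (%x y. 18 * (W1 x y)^2 + 2 * (u1x x y)^2)"
  proof (rule sqint_mono)
   fix x y :: real assume xy: "0 <= x" "x <= 1" "0 <= y" "y <= 1"
   show "(v1x x y)^2 <= 18 * (W1 x y)^2 + 2 * (u1x x y)^2" unfolding v_defs using two[of "ramp3' x * ramp3 y * W1 x y" "ramp3 x * ramp3 y * u1x x y"]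
     bnd(1)[OF xy, of "W1 x y"] bnd(3)[OF xy, of "u1x x y"] by linarith
  qed (intro civ)+
  thus ?thesis by (simp add: sqint_add sqint_cmult civ)
 qed
 have n2: "?n v2y <= 18 * ?n W2 + 2 * ?n u2y"
 proof -
  have "?n v2y <= sqint (%x y. 18 * (W2 x y)^2 + 2 * (u2y x y)^2)"
  proof (rule sqint_mono)
   fix x y :: real assume xy: "0 <= x" "x <= 1" "0 <= y" "y <= 1"
   show "(v2y x y)^2 <= 18 * (W2 x y)^2 + 2 * (u2y x y)^2" unfolding v_defs using two[of "ramp3 x * ramp3' y * W2 x y" "ramp3 x * ramp3 y * u2y x y"]
     bnd(2)[OF xy, of "W2 x y"] bnd(3)[OF xy, of "u2y x y"] by linarith
  qed (intro civ)+
  thus ?thesis by (simp add: sqint_add sqint_cmult civ)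
 qed
 have n3: "sqint (%x y. (v1y x y + v2x x y)^2) <= 27 * ?n W1 + 27 * ?n W2 + 3 * ?n s"
 proof -
  have "sqint (%x y. (v1y x y + v2x x y)^2) <= sqint (%x y. 27 * (W1 x y)^2 + 27 * (W2 x y)^2 + 3 * (s x y)^2)"
  proof (rule sqint_mono)
   fix x y :: real assume xy: "0 <= x" "x <= 1" "0 <= y" "y <= 1"
   have eq: "v1y x y + v2x x y = ramp3 x * ramp3' y * W1 x y + ramp3' x * ramp3 y * W2 x y
     + ramp3 x * ramp3 y * s x y" unfolding v_defs s_def by (simp add: algebra_simps)
   show "(v1y x y + v2x x y)^2 <= 27 * (W1 x y)^2 + 27 * (W2 x y)^2 + 3 * (s x y)^2"
    unfolding eq using three[of "ramp3 x * ramp3' y * W1 x y" "ramp3' x * ramp3 y * W2 x y" "ramp3 x * ramp3 y * s x y"]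
     bnd(2)[OF xy, of "W1 x y"] bnd(1)[OF xy, of "W2 x y"] bnd(3)[OF xy, of "s x y"] by linarith
  qed (intro civ)+
  thus ?thesis by (simp add: sqint_add sqint_cmult civ)
 qed
 have n4: "sqint (%x y. (ramp3 x * ramp3 y * (u1y x y - u2x x y - 2 * k))^2)
   <= 2 * sqint (%x y. (v1y x y - v2x x y)^2) + 36 * ?n W1 + 36 * ?n W2"
 proof -
  have "sqint (%x y. (ramp3 x * ramp3 y * (u1y x y - u2x x y - 2 * k))^2)
   <= sqint (%x y. 2 * (v1y x y - v2x x y)^2 + 36 * (W1 x y)^2 + 36 * (W2 x y)^2)"
  proof (rule sqint_mono)
   fix x y :: real assume xy: "0 <= x" "x <= 1" "0 <= y" "y <= 1"
   let ?d = "ramp3 x * ramp3' y * W1 x y - ramp3' x * ramp3 y * W2 x y"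
   have eq: "ramp3 x * ramp3 y * (u1y x y - u2x x y - 2 * k) = (v1y x y - v2x x y) - ?d" unfolding v_defs by (simp add: algebra_simps)
   show "(ramp3 x * ramp3 y * (u1y x y - u2x x y - 2 * k))^2 <=
     2 * (v1y x y - v2x x y)^2 + 36 * (W1 x y)^2 + 36 * (W2 x y)^2" unfolding eq using twod[of "v1y x y - v2x x y" ?d]
     twod[of "ramp3 x * ramp3' y * W1 x y" "ramp3' x * ramp3 y * W2 x y"]
     bnd(2)[OF xy, of "W1 x y"] bnd(1)[OF xy, of "W2 x y"] by linarith
  qed (intro civ)+
  thus ?thesis by (simp add: sqint_add sqint_cmult civ)
 qed
 have E0: "?n u1x >= 0" "?n u2y >= 0" "?n s >= 0" by (auto intro!: sqint_nonneg civ)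
 have E: "E = ?n u1x + ?n u2y + ?n s" unfolding E_def s_def ..
 have rm': "?n W1 <= 324 * E" "?n W2 <= 46665 * E" using rm by (simp_all add: W1_def W2_def)
 define N1 N2 N3 A D S P Q where N: "N1 = ?n v1x" "N2 = ?n v2y" "N3 = sqint (%x y. (v1y x y + v2x x y)^2)"
  "A = ?n u1x" "D = ?n u2y" "S = ?n s" "P = ?n W1" "Q = ?n W2"
 define Z where "Z = sqint (%x y. (v1y x y - v2x x y)^2)"
 have "2 * Z + 36 * P + 36 * Q <= 10 ^ 10 * E" using n1 n2 n3 V rm' E0 unfolding E N[symmetric] Z_def[symmetric] by (simp add: E)
 thus ?thesis using n4 unfolding N Z_def by (intro exI[of _ "2 * k"]) linarith
qed

section \<open>Integrals over parallelograms\<close>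

lemma integrable_lebesgue_on_iff:
 fixes f :: "'a::euclidean_space => 'b::euclidean_space"
 assumes "S : sets lebesgue"
 shows "integrable (leb S) f \<longleftrightarrow> f absolutely_integrable_on S"
 using assms by (simp add: integrable_restrict_space set_integrable_def)

lemma change_of_variables_scalar:
 fixes f :: "real^2 => real" and g :: "real^2 => real^2"
 assumes S: "S : sets lebesgue"
  and g: "!!x. x : S ==> (g has_derivative g' x) (at x within S)"
  and inj: "inj_on g S"
 shows "integrable (leb (g ` S)) f \<longleftrightarrow>
      integrable (leb S) (%x. \<bar>det (matrix (g' x))\<bar> * f (g x))"
  and "(LINT x|leb (g ` S). f x) = (LINT x|leb S. \<bar>det (matrix (g' x))\<bar> * f (g x))"
  and "g ` S : sets lebesgue"
proof -
 define L where "L = (%r::real. r *R (axis 1 1 :: real^1))"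
 have bl: "bounded_linear L" unfolding L_def by (rule bounded_linear_scaleR_left)
 have bn: "bounded_linear (%v::real^1. v $ 1)" by (rule bounded_linear_vec_nth)
 have nL: "L r $ 1 = r" for r by (simp add: L_def axis_def)
 have abs: "(%x. L (h x)) absolutely_integrable_on T \<longleftrightarrow> h absolutely_integrable_on T" for h and T :: "(real^2) set"
  using absolutely_integrable_linear[OF _ bl, where f=h]
   absolutely_integrable_linear[OF _ bn, where f="%x. L (h x)"] by (auto simp: o_def nL)
 have int: "integral T (%x. L (h x)) = L (integral T h)" if "h absolutely_integrable_on T" for h and T :: "(real^2) set"
  using integral_linear[OF set_lebesgue_integral_eq_integral(1)[OF that] bl] by (simp add: o_def)
 have Ls: "c *R L r = L (c * r)" for c r by (simp add: L_def)
 let ?F = "%x. \<bar>det (matrix (g' x))\<bar> * f (g x)"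
 show gS: "g ` S : sets lebesgue" by (rule differentiable_image_in_sets_lebesgue[OF S])
   (use g in \<open>auto simp: differentiable_on_def differentiable_def\<close>)
 have main: "(?F absolutely_integrable_on S & integral S (%x. L (?F x)) = b)
  \<longleftrightarrow> (f absolutely_integrable_on (g ` S) & integral (g ` S) (%x. L (f x)) = b)" for b
  using has_absolute_integral_change_of_variables[OF S g inj, of "%x. L (f x)" b] unfolding Ls abs .
 hence i: "?F absolutely_integrable_on S \<longleftrightarrow> f absolutely_integrable_on (g ` S)" by blast
 thus ii: "integrable (leb (g ` S)) f \<longleftrightarrow> integrable (leb S) ?F" by (simp add: integrable_lebesgue_on_iff S gS)
 show "(LINT x|leb (g ` S). f x) = (LINT x|leb S. ?F x)"
 proof (cases "integrable (leb (g ` S)) f")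
  case True
  hence a: "f absolutely_integrable_on (g ` S)" "?F absolutely_integrable_on S" using i by (auto simp: integrable_lebesgue_on_iff gS)
  have "L (integral S ?F) = L (integral (g ` S) f)" using main[of "integral S (%x. L (?F x))"] a int[OF a(1)] int[OF a(2)] by simp
  hence "integral S ?F = integral (g ` S) f" using nL by metis
  thus ?thesis using True ii by (simp add: lebesgue_integral_eq_integral S gS)
 next
  case False
  with ii show ?thesis by (simp add: not_integrable_integral_eq)
 qed
qed

definition vec2 :: "2 => real => real => real^2" where
 "vec2 i x y = x *R axis i 1 + y *R axis (i + 1) 1"

lemma index2: "i + 1 ~= (i :: 2)" "(UNIV :: 2 set) = {i, i + 1}" "i + 1 + 1 = (i::2)" 
proof -
 have *: "i = 1 \<or> i = 2" by (rule exhaust_2)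
 thus "i + 1 ~= i" "i + 1 + 1 = i" by auto
 show "(UNIV :: 2 set) = {i, i + 1}" using * by (auto simp: UNIV_2)
qed

lemma vec2_nth [simp]: "vec2 i x y $ i = x" "vec2 i x y $ (i + 1) = y"
 using index2(1)[of i] by (auto simp: vec2_def axis_def)

lemma continuous_vec2 [continuous_intros]:
 "continuous_on S f ==> continuous_on S g ==> continuous_on S (%x. vec2 i (f x) (g x))" unfolding vec2_def by (intro continuous_intros)

lemma lborel_vec2:
 "lborel = distr (lborel \<Otimes>\<^sub>M lborel) borel (%(x, y). vec2 i x y)"
proof (rule lborel_eqI)
 have m: "(%(x, y). vec2 i x y) : lborel \<Otimes>\<^sub>M lborel \<rightarrow>\<^sub>M borel" unfolding lborel_prod split_beta
  by (simp, intro borel_measurable_continuous_onI continuous_intros)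
 fix l u :: "real^2"
 assume le: "!!b. b : Basis ==> l \<bullet> b <= u \<bullet> b"
 have le': "l $ j <= u $ j" for j using le[of "axis j 1"] by (simp add: inner_axis axis_in_Basis_iff)
 have B: "(Basis :: (real^2) set) = {axis i 1, axis (i + 1) 1}" unfolding Basis_vec_def index2(2)[of i] by auto
 have box: "(%(x, y). vec2 i x y) -` box l u \<inter> space (lborel \<Otimes>\<^sub>M lborel)
   = {l $ i <..< u $ i} \<times> {l $ (i + 1) <..< u $ (i + 1)}" unfolding box_def B by (auto simp: inner_axis space_pair_measure)
 have "emeasure (distr (lborel \<Otimes>\<^sub>M lborel) borel (%(x, y). vec2 i x y)) (box l u)
  = emeasure (lborel \<Otimes>\<^sub>M lborel) ({l $ i <..< u $ i} \<times> {l $ (i + 1) <..< u $ (i + 1)})"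
  by (subst emeasure_distr[OF m]) (auto simp: box)
 also have "... = ennreal (u $ i - l $ i) * ennreal (u $ (i + 1) - l $ (i + 1))" by (subst lborel.emeasure_pair_measure_Times) (auto simp: le')
 also have "... = ennreal (\<Prod>b\<in>Basis. (u - l) \<bullet> b)" unfolding B using index2(1)[of i] le'
  by (simp add: inner_axis axis_eq_axis ennreal_mult)
 finally show "emeasure (distr (lborel \<Otimes>\<^sub>M lborel) borel (%(x, y). vec2 i x y)) (box l u)
  = ennreal (\<Prod>b\<in>Basis. (u - l) \<bullet> b)" .
qed simp

lemma vec2_measurable [measurable]: "(%(x, y). vec2 i x y) : borel_measurable (lborel \<Otimes>\<^sub>M lborel)"
 unfolding lborel_prod split_beta by (simp, intro borel_measurable_continuous_onI continuous_intros)

lemma integral_lborel_vec2: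
 fixes f :: "real^2 => real"
 assumes [measurable]: "f : borel_measurable borel"
 shows "(LINT z|lborel. f z) = (LINT p|lborel. f (vec2 i (fst p) (snd p)))"
  and "integrable lborel f \<longleftrightarrow> integrable lborel (%p. f (vec2 i (fst p) (snd p)))"
proof -
 note m = vec2_measurable[of i]
 have "(LINT z|lborel. f z) = (LINT p|(lborel \<Otimes>\<^sub>M lborel). f (case p of (x, y) => vec2 i x y))"
  by (subst lborel_vec2[of i], rule integral_distr[OF m]) simp
 thus "(LINT z|lborel. f z) = (LINT p|lborel. f (vec2 i (fst p) (snd p)))" by (simp add: split_beta lborel_prod)
 have "integrable lborel f \<longleftrightarrow> integrable (lborel \<Otimes>\<^sub>M lborel) (%p. f (case p of (x, y) => vec2 i x y))"
  by (subst lborel_vec2[of i], rule integrable_distr_eq[OF m]) simp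
 thus "integrable lborel f \<longleftrightarrow> integrable lborel (%p. f (vec2 i (fst p) (snd p)))" by (simp add: split_beta lborel_prod)
qed

lemma vec2_mem_cbox:
 "vec2 i x y : cbox l u \<longleftrightarrow> x : {l $ i..u $ i} & y : {l $ (i + 1)..u $ (i + 1)}"
proof -
 have "vec2 i x y : cbox l u \<longleftrightarrow> (ALL j:{i, i + 1}. l $ j <= vec2 i x y $ j & vec2 i x y $ j <= u $ j)"
  unfolding index2(2)[of i, symmetric] by (simp add: mem_box_cart)
 thus ?thesis by auto
qed

lemma integral_lebesgue_on_lborel:
 fixes f :: "'a::euclidean_space => real"
 assumes "S : sets borel" "f : borel_measurable borel"
 shows "(LINT z|leb S. f z) = (LINT z|lborel. indicator S z * f z)" using assms by (subst integral_restrict_space) (auto intro!: integral_completion)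

lemma integral_cbox_vec2:
 fixes h :: "real^2 => real"
 assumes "cont h"
 shows "(LINT z|leb (cbox l u). h z) =
  integral {l $ i..u $ i} (%x. integral {l $ (i + 1)..u $ (i + 1)} (%y. h (vec2 i x y)))"
proof -
 have hm: "h : borel_measurable borel" using assms by (rule borel_measurable_continuous_onI)
 let ?C = "cbox (l $ i, l $ (i + 1)) (u $ i, u $ (i + 1))"
 let ?h = "%p. h (vec2 i (fst p) (snd p))"
 have c: "continuous_on S ?h" for S by (rule continuous_on_compose2[OF assms]) (auto intro!: continuous_intros)
 have "(LINT z|leb (cbox l u). h z) = (LINT z|lborel. indicator (cbox l u) z * h z)" by (rule integral_lebesgue_on_lborel[OF _ hm]) simp
 also have "... = (LINT p|lborel. indicator (cbox l u) (vec2 i (fst p) (snd p)) * ?h p)" by (rule integral_lborel_vec2) (use hm in measurable)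
 also have "... = (LINT p|lborel. indicator ?C p * ?h p)" by (rule lint_cong) (auto simp: indicator_def vec2_mem_cbox cbox_Pair_eq)
 also have "... = (LINT p|leb ?C. ?h p)" by (rule integral_lebesgue_on_lborel[symmetric]) (auto intro!: borel_measurable_continuous_onI c)
 also have "... = integral ?C ?h" by (rule lebesgue_integral_eq_integral)
   (auto intro!: absolutely_integrable_imp_integrable absolutely_integrable_continuous c)
 also have "... = integral (cbox (l $ i) (u $ i)) (%x. integral (cbox (l $ (i + 1)) (u $ (i + 1))) (%y. ?h (x, y)))"
  by (rule integral_prod_continuous[OF c])
 finally show ?thesis by simp
qed

definition par :: "real^2 => real^2 => real^2 => (real^2) set" where
 "par p a b = {p + x *R a + y *R b | x y. x : {0..1} & y : {0..1}}"

lemma par_image: "par p a b = (%z::real^2. p + z $ 1 *R a + z $ 2 *R b) ` cbox 0 1" (is "_ = ?T ` _")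
proof (rule set_eqI, rule iffI)
 fix w assume "w : par p a b"
 then obtain x y where w: "w = p + x *R a + y *R b" and "x : {0..1}" "y : {0..1}" by (auto simp: par_def)
 hence "vec2 1 x y : cbox 0 1" by (simp add: vec2_mem_cbox)
 moreover have "w = ?T (vec2 1 x y)" using w vec2_nth[of 1 x y] by simp
 ultimately show "w : ?T ` cbox 0 1" by blast
next
 fix w assume "w : ?T ` cbox 0 1"
 thus "w : par p a b" by (fastforce simp: par_def mem_box_cart)
qed

lemma vec_nth_has_derivative: "((%x. x $ i) has_derivative (%z. z $ i)) F"
 by (rule bounded_linear_imp_has_derivative[OF bounded_linear_vec_nth])

lemma compact_par: "compact (par p a b)"
 unfolding par_image by (intro compact_continuous_image continuous_intros compact_cbox)

lemma inverse_par_map: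
 assumes "cross2 a b ~= 0" "z = p + x *R a + y *R b"
 shows "x = cross2 (z - p) b / cross2 a b" "y = cross2 a (z - p) / cross2 a b" using assms by (auto simp: cross2_def field_simps)

lemma par_map_inverse:
 assumes "cross2 a b ~= 0"
 shows "p + (cross2 (z - p) b / cross2 a b) *R a + (cross2 a (z - p) / cross2 a b) *R b = z"
proof -
 have "(p + (cross2 (z - p) b / cross2 a b) *R a + (cross2 a (z - p) / cross2 a b) *R b) $ j = z $ j" for j
 proof -
  have "cross2 a b * p $ j + cross2 (z - p) b * a $ j + cross2 a (z - p) * b $ j = cross2 a b * z $ j"
   using exhaust_2[of j] by (auto simp: cross2_def algebra_simps)
  hence "(cross2 a b * p $ j + cross2 (z - p) b * a $ j + cross2 a (z - p) * b $ j) / cross2 a b = z $ j" using assms by simp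
  thus ?thesis using assms by (simp add: add_divide_distrib)
 qed
 thus ?thesis by (simp add: vec_eq_iff)
qed

lemma integral_par:
 fixes h :: "real^2 => real"
 assumes h: "cont h" and d: "cross2 a b ~= 0"
 shows "(LINT z|leb (par p a b). h z) = \<bar>cross2 a b\<bar> * sqint (%x y. h (p + x *R a + y *R b))"
proof -
 let ?T = "%z::real^2. p + z $ 1 *R a + z $ 2 *R b"
 let ?T' = "%z::real^2. z $ 1 *R a + z $ 2 *R b"
 have der: "(?T has_derivative ?T') (at z within S)" for z S by (auto intro!: derivative_eq_intros vec_nth_has_derivative)
 have inj: "inj_on ?T S" for S
 proof (rule inj_onI)
  fix z w assume eq: "?T z = ?T w"
  from inverse_par_map[where p=p and x="z$1" and y="z$2", OF d refl]
   inverse_par_map[where p=p and x="w$1" and y="w$2", OF d refl] eq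
  have "z $ 1 = w $ 1" "z $ 2 = w $ 2" by metis+
  thus "z = w" by (simp add: vec_eq_iff forall_2)
 qed
 have det: "det (matrix ?T') = cross2 a b" by (simp add: det_2 matrix_def axis_def cross2_def)
 have "(LINT z|leb (par p a b). h z) = (LINT z|leb (cbox 0 1). \<bar>cross2 a b\<bar> * h (?T z))" unfolding par_image
  using change_of_variables_scalar(2)[OF _ der inj, of "cbox 0 1" h] by (simp add: det)
 also have "... = \<bar>cross2 a b\<bar> * (LINT z|leb (cbox 0 1). h (?T z))" by simp
 also have "(LINT z|leb (cbox 0 1). h (?T z)) = sqint (%x y. h (p + x *R a + y *R b))" by (subst integral_cbox_vec2[where i=1])
   (auto intro!: continuous_on_compose2[OF h] continuous_intros
    simp: sqint_def vec2_nth[of 1, simplified])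
 finally show ?thesis .
qed

lemma integrable_continuous_bounded:
 fixes h :: "real^2 => 'b::euclidean_space"
 assumes "cont h" "P : sets lebesgue" "bounded P"
 shows "integrable (leb P) h"
proof -
 obtain l u where lu: "P <= cbox l u" using bounded_subset_cbox_symmetric[OF assms(3)] by blast
 have "h absolutely_integrable_on (cbox l u)" by (rule absolutely_integrable_continuous, rule continuous_on_subset[OF assms(1)]) simp
 hence "h absolutely_integrable_on P" by (rule set_integrable_subset) (use assms lu in auto)
 thus ?thesis using assms by (simp add: integrable_lebesgue_on_iff)
qed

lemma integral_mono_set:
 fixes h :: "real^2 => real"
 assumes "integrable (leb Q) h" "P : sets lebesgue" "Q : sets lebesgue" "P <= Q" "!!x. h x >= 0"
 shows "(LINT z|leb P. h z) <= (LINT z|leb Q. h z)"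
proof -
 have i: "set_integrable lebesgue Q h" "set_integrable lebesgue P h"
  using assms set_integrable_subset[of lebesgue Q h P] by (auto simp: integrable_lebesgue_on_iff)
 show ?thesis using assms i unfolding set_integrable_def by (simp add: integral_restrict_space) (rule integral_mono, auto simp: indicator_def)
qed

section \<open>Functions that are nearly constant on a set\<close>

text \<open>\<open>g u\<close> will be the curl or a component of \<open>u\<close>, and \<open>N u\<close> its energy, so that Korn's and Poincare's inequalities are glued
 by the same argument.\<close>

definition near_const ::
  "'u set => ('u => real^2 => real) => ('u => real) => (real^2) set => bool" where
 "near_const X g N P \<longleftrightarrow> P : sets lebesgue & bounded P \<and> (EX C>=0. ALL u:X. EX k. (LINT z|leb P. (g u z - k)^2) <= C * N u)"

lemma near_const_subset:
 assumes "near_const X g N Q" "P : sets lebesgue" "P <= Q"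
  and "!!u. u : X ==> cont (g u)"
 shows "near_const X g N P"
proof -
 from assms(1) obtain C where Q: "Q : sets lebesgue" "bounded Q" "C >= 0"
  and C: "!!u. u : X ==> EX k. (LINT z|leb Q. (g u z - k)^2) <= C * N u" unfolding near_const_def by blast
 have "EX k. (LINT z|leb P. (g u z - k)^2) <= C * N u" if u: "u : X" for u
 proof -
  obtain k where k: "(LINT z|leb Q. (g u z - k)^2) <= C * N u" using C[OF u] by blast
  have "(LINT z|leb P. (g u z - k)^2) <= (LINT z|leb Q. (g u z - k)^2)" by (rule integral_mono_set[OF integrable_continuous_bounded])
    (use assms u Q in \<open>auto intro!: continuous_intros\<close>)
  with k show ?thesis by (intro exI[of _ k]) linarith
 qed
 thus ?thesis unfolding near_const_def using assms Q bounded_subset[OF Q(2)] by blast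
qed

text \<open>On the overlap both constants are close to the same function, hence to each other.\<close>

lemma near_const_Un:
 assumes P: "near_const X g N P" and Q: "near_const X g N Q"
  and pos: "measure lebesgue (P \<inter> Q) > 0"
  and g: "!!u. u : X ==> cont (g u)" and N: "!!u. u : X ==> N u >= 0"
 shows "near_const X g N (P \<union> Q)"
proof -
 from P obtain C1 where P': "P : sets lebesgue" "bounded P" "C1 >= 0"
  and C1: "!!u. u : X ==> EX k. (LINT z|leb P. (g u z - k)^2) <= C1 * N u" unfolding near_const_def by blast
 from Q obtain C2 where Q': "Q : sets lebesgue" "bounded Q" "C2 >= 0"
  and C2: "!!u. u : X ==> EX k. (LINT z|leb Q. (g u z - k)^2) <= C2 * N u" unfolding near_const_def by blast
 define m where "m = measure lebesgue (P \<inter> Q)"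
 define q where "q = measure lebesgue Q"
 \<comment> \<open>the difference of the two constants, squared, is at most \<open>2 (C1 + C2) N u / m\<close>\<close>
 define C where "C = C1 + 2 * C2 + 2 * q * (2 * (C1 + C2) / m)"
 have q: "q >= 0" by (simp add: q_def)
 have C: "C >= 0" unfolding C_def using P' Q' pos q by (simp add: m_def)
 have sq: "(s - t)^2 <= 2 * r^2 + 2 * w^2" if "s - t = r - w" for r s t w :: real
  using zero_le_power2[of "r + w"] unfolding that by (simp add: power2_eq_square algebra_simps)
 have "EX k. (LINT z|leb (P \<union> Q). (g u z - k)^2) <= C * N u" if u: "u : X" for u
 proof -
  obtain k1 where k1: "(LINT z|leb P. (g u z - k1)^2) <= C1 * N u" using C1[OF u] by blast
  obtain k2 where k2: "(LINT z|leb Q. (g u z - k2)^2) <= C2 * N u" using C2[OF u] by blast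
  have i: "integrable (leb S) (%z. (g u z - k)^2)" "integrable (leb S) (%z. c::real)" if "S : sets lebesgue" "bounded S" for S k c
   by (rule integrable_continuous_bounded[OF _ that], intro continuous_intros g u)+
  have PQ: "P \<inter> Q : sets lebesgue" "bounded (P \<inter> Q)" "P \<union> Q : sets lebesgue" "bounded (P \<union> Q)" using P' Q' by auto
  have "(k1 - k2)^2 * m = (LINT z|leb (P \<inter> Q). (k1 - k2)^2)" using PQ by (simp add: m_def measure_restrict_space)
  also have "... <= (LINT z|leb (P \<inter> Q). 2 * (g u z - k2)^2 + 2 * (g u z - k1)^2)"
   by (rule integral_mono) (auto intro!: i PQ lintegrable_add integrable_mult_right sq)
  also have "... = 2 * (LINT z|leb (P \<inter> Q). (g u z - k2)^2) + 2 * (LINT z|leb (P \<inter> Q). (g u z - k1)^2)"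
   using i[OF PQ(1,2)] by (simp add: lint_add)
  also have "(LINT z|leb (P \<inter> Q). (g u z - k2)^2) <= (LINT z|leb Q. (g u z - k2)^2)" by (rule integral_mono_set) (use i PQ P' Q' in auto)
  also have "(LINT z|leb (P \<inter> Q). (g u z - k1)^2) <= (LINT z|leb P. (g u z - k1)^2)" by (rule integral_mono_set) (use i PQ P' Q' in auto)
  finally have "(k1 - k2)^2 * m <= 2 * (C1 + C2) * N u" using k1 k2 by (simp add: algebra_simps)
  hence kk: "(k1 - k2)^2 <= 2 * (C1 + C2) / m * N u" using pos unfolding m_def[symmetric] by (simp add: field_simps)
  have "(LINT z|leb (P \<union> Q). (g u z - k1)^2)
    <= (LINT z|leb P. (g u z - k1)^2) + (LINT z|leb Q. (g u z - k1)^2)"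
  proof -
   have s: "set_integrable lebesgue S (%z. (g u z - k1)^2)" if "S : sets lebesgue" "bounded S" for S
    using i(1)[OF that] that by (simp add: integrable_lebesgue_on_iff)
   have "(\<integral>z. indicator (P \<union> Q) z *R (g u z - k1)^2 \<partial>lebesgue)
     <= (\<integral>z. indicator P z *R (g u z - k1)^2 + indicator Q z *R (g u z - k1)^2 \<partial>lebesgue)"
   proof (rule integral_mono)
    show "integrable lebesgue (%z. indicator (P \<union> Q) z *R (g u z - k1)^2)" using s[OF PQ(3,4)] unfolding set_integrable_def .
    show "integrable lebesgue (%z. indicator P z *R (g u z - k1)^2 + indicator Q z *R (g u z - k1)^2)"
     by (rule lintegrable_add) (use s P' Q' in \<open>auto simp: set_integrable_def\<close>)
   qed (auto simp: indicator_def)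
   also have "... = (\<integral>z. indicator P z *R (g u z - k1)^2 \<partial>lebesgue) + (\<integral>z. indicator Q z *R (g u z - k1)^2 \<partial>lebesgue)"
    by (rule lint_add) (use s P' Q' in \<open>auto simp: set_integrable_def\<close>)
   finally show ?thesis using P' Q' PQ by (simp add: integral_restrict_space)
  qed
  also have "(LINT z|leb Q. (g u z - k1)^2) <= (LINT z|leb Q. 2 * (g u z - k2)^2 + 2 * (k1 - k2)^2)"
   by (rule integral_mono) (use Q' in \<open>auto intro!: i lintegrable_add integrable_mult_right sq\<close>)
  also have "... = 2 * (LINT z|leb Q. (g u z - k2)^2) + 2 * (k1 - k2)^2 * q"
   using i[OF Q'(1,2)] Q' by (simp add: lint_add q_def measure_restrict_space)
  also have "2 * (k1 - k2)^2 * q <= 2 * (2 * (C1 + C2) / m * N u) * q" using kk q by (intro mult_right_mono) auto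
  finally have "(LINT z|leb (P \<union> Q). (g u z - k1)^2) <= C * N u" using k1 k2 unfolding C_def by (simp add: algebra_simps)
  thus ?thesis ..
 qed
 thus ?thesis unfolding near_const_def using P' Q' C by auto
qed

lemma near_const_Un_interior:
 assumes "near_const X g N P" "near_const X g N Q" "interior P \<inter> interior Q ~= {}"
  and "!!u. u : X ==> cont (g u)" "!!u. u : X ==> N u >= 0"
 shows "near_const X g N (P \<union> Q)"
proof (rule near_const_Un[OF assms(1,2) _ assms(4,5)])
 have "open (interior P \<inter> interior Q)" by auto
 hence "\<not> negligible (interior P \<inter> interior Q)" using open_not_negligible assms(3) by blast
 hence "\<not> negligible (P \<inter> Q)" using negligible_subset[of "P \<inter> Q" "interior P \<inter> interior Q"] interior_subset by blast
 moreover have "P \<inter> Q : lmeasurable" using assms(1,2) by (intro bounded_set_imp_lmeasurable) (auto simp: near_const_def)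
 ultimately show "measure lebesgue (P \<inter> Q) > 0" by (simp add: negligible_iff_measure zero_less_measure_iff)
qed

section \<open>Korn's inequality on parallelograms\<close>

definition C1_grad :: "(real^2 => real^2) => (real^2 => real^2^2) => bool" where
 "C1_grad u G \<longleftrightarrow> (ALL z. (u has_derivative (%h. G z *v h)) (at z)) & cont G"

definition symm :: "real^2^2 => real^2^2" where "symm A = (1/2) *R (A + transpose A)"
definition curl2 :: "real^2^2 => real" where "curl2 A = A $ 1 $ 2 - A $ 2 $ 1"

lemma norm_matrix_vector_le: "norm (A *v x) <= norm A * norm (x::real^2)" for A :: "real^2^2"
proof -
 have "(norm (A *v x))^2 = (\<Sum>i\<in>UNIV. (A $ i \<bullet> x)^2)" by (simp add: norm_vec_def L2_set_def sum_nonneg matrix_vector_mul_component)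
 also have "... <= (\<Sum>i\<in>UNIV. (norm (A $ i))^2 * (norm x)^2)" by (intro sum_mono) (metis Cauchy_Schwarz_ineq power2_norm_eq_inner)
 also have "... = (norm A)^2 * (norm x)^2" by (simp add: norm_vec_def L2_set_def sum_nonneg sum_distrib_right)
 finally have "(norm (A *v x))^2 <= (norm A * norm x)^2" by (simp add: power_mult_distrib)
 thus ?thesis by (rule power2_le_imp_le) simp
qed

lemma inner_matrix_le: "(a \<bullet> (A *v b))^2 <= (norm a)^2 * (norm b)^2 * (norm A)^2"
 for A :: "real^2^2" and a b :: "real^2"
proof -
 have "\<bar>a \<bullet> (A *v b)\<bar> <= norm a * norm (A *v b)" by (rule Cauchy_Schwarz_ineq2)
 also have "... <= norm a * (norm A * norm b)" by (intro mult_left_mono norm_matrix_vector_le) auto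
 finally have "\<bar>a \<bullet> (A *v b)\<bar> <= \<bar>norm a * (norm A * norm b)\<bar>" by simp
 hence "(a \<bullet> (A *v b))^2 <= (norm a * (norm A * norm b))^2" by (rule abs_le_square_iff[THEN iffD1])
 thus ?thesis by (simp add: power_mult_distrib ac_simps)
qed

lemma cross2_eq: "a \<bullet> (A *v b) - b \<bullet> (A *v a) = cross2 a b * curl2 A"
 by (simp add: cross2_def curl2_def inner_vec_def matrix_vector_mult_def sum_2 algebra_simps)

lemma symm_eq: "a \<bullet> (A *v b) + b \<bullet> (A *v a) = 2 * (a \<bullet> (symm A *v b))"
 by (simp add: symm_def inner_vec_def matrix_vector_mult_def transpose_def sum_2 algebra_simps)

lemma continuous_symm [continuous_intros]:
 "continuous_on S f ==> continuous_on S (%x. symm (f x))" unfolding symm_def transpose_def by (intro continuous_intros)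

lemma continuous_curl2 [continuous_intros]:
 "continuous_on S f ==> continuous_on S (%x. curl2 (f x))" unfolding curl2_def by (intro continuous_intros)

lemma smooth_C1_grad:
 assumes D: "!!i j x. (D i j has_derivative (%h. h$1 *R D (Suc i) j x + h$2 *R D i (Suc j) x)) (at x)"
 shows "C1_grad (D 0 0) (%z. \<chi> i j. if j = 1 then D 1 0 z $ i else D 0 1 z $ i)"
proof -
 have c: "cont (D i j)" for i j using D by (meson continuous_at_imp_continuous_on has_derivative_continuous)
 have c': "cont (%z. if j = 1 then D 1 0 z $ i else D 0 1 z $ i)" for i and j :: 2 by (cases "j = 1") (auto intro!: continuous_intros c)
 have "(%h::real^2. (\<chi> i j. if j = 1 then D 1 0 z $ i else D 0 1 z $ i) *v h)
   = (%h. h $ 1 *R D (Suc 0) 0 z + h $ 2 *R D 0 (Suc 0) z)" for z by (simp add: fun_eq_iff vec_eq_iff matrix_vector_mult_def sum_2 mult.commute)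
 hence "(D 0 0 has_derivative (%h::real^2. (\<chi> i j. if j = 1 then D 1 0 z $ i else D 0 1 z $ i) *v h)) (at z)" for z
  using D[of 0 0 z] by (simp only:)
 moreover have "cont (%z. (\<chi> i j. if j = 1 then D 1 0 z $ i else D 0 1 z $ i) :: real^2^2)" by (intro continuous_on_vec_lambda c')
 ultimately show ?thesis unfolding C1_grad_def by (intro conjI allI)
qed

lemma smooth_has_C1_grad:
 fixes \<phi> :: "real^2 => real^2"
 assumes "smooth \<phi>"
 obtains G where "C1_grad \<phi> G"
proof -
 obtain D where D0: "D 0 0 = \<phi>" and D: "!!i j x. (D i j has_derivative (%h. h$1 *R D (Suc i) j x + h$2 *R D i (Suc j) x)) (at x)"
  using assms unfolding smooth_def by blast
 show ?thesis by (rule that, rule smooth_C1_grad[of D, unfolded D0, OF D])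
qed

lemma has_derivative_along_line:
 fixes f :: "real^2 => 'b::real_inner"
 assumes "!!z. (f has_derivative f' z) (at z)"
 shows "((%t. c \<bullet> f (q + t *R v)) has_real_derivative c \<bullet> f' (q + t *R v) v) (at t)"
proof -
 have "((%t. q + t *R v) has_derivative (%t. t *R v)) (at t)" by (auto intro!: derivative_eq_intros)
 from has_derivative_compose[OF this assms]
 have "((%t. f (q + t *R v)) has_derivative (%s. f' (q + t *R v) (s *R v))) (at t)" .
 hence "((%t. c \<bullet> f (q + t *R v)) has_derivative (%s. c \<bullet> f' (q + t *R v) (s *R v))) (at t)" by (rule has_derivative_inner_right)
 moreover have "f' z (s *R v) = s *R f' z v" for z s using has_derivative_linear[OF assms] by (rule linear_scale)
 ultimately show ?thesis by (simp add: has_field_derivative_def mult_commute_abs)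
qed

lemma cont2_par:
 fixes h :: "real^2 => real"
 assumes "cont h"
 shows "cont2 (%x y. h (p + x *R a + y *R b))" unfolding cont2_def by (rule continuous_on_compose2[OF assms]) (auto intro!: continuous_intros)

lemma sets_par [simp]: "par p a b : sets lebesgue" and bounded_par [simp]: "bounded (par p a b)"
 using compact_par[of p a b] by (auto intro: compact_imp_bounded lmeasurable_compact[THEN fmeasurableD])

text \<open>Pull back by \<open>u\<^sub>1 = a \<bullet> \<phi>\<close>, \<open>u\<^sub>2 = b \<bullet> \<phi>\<close>: the strain of \<open>u\<close> is that of \<open>\<phi>\<close> tested with \<open>a\<close> and \<open>b\<close>, and its curl is that of
 \<open>\<phi>\<close> times \<open>cross2 a b\<close>. On the fraction \<open>2/3\<close> each cut-off function is at least \<open>1/27\<close>, and four such corner pieces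
 still overlap.\<close>

lemma korn_par:
 assumes d: "cross2 a b ~= 0"
 shows "EX C>=0. ALL \<phi> G. smooth \<phi> & C1_grad \<phi> G --> (EX k. (LINT z|leb (par p ((2/3) *R a) ((2/3) *R b)). (curl2 (G z) - k)^2)
    <= C * (LINT z|leb (par p a b). (norm (symm (G z)))^2))"
proof -
 define c where "c = cross2 a b"
 define M where "M = (norm a)^4 + (norm b)^4 + 4 * ((norm a)^2 * (norm b)^2)"
 define C where "C = 27^4 * (10^10 * M / c^2)"
 have c: "c ~= 0" "c^2 > 0" using d by (auto simp: c_def)
 have M: "M >= 0" by (simp add: M_def)
 have C: "C >= 0" using M by (simp add: C_def)
 let ?P = "%x y. p + x *R a + y *R b"
 have main: "EX k. (LINT z|leb (par p ((2/3) *R a) ((2/3) *R b)). (curl2 (G z) - k)^2)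
    <= C * (LINT z|leb (par p a b). (norm (symm (G z)))^2)" if phi: "smooth \<phi>" and G: "C1_grad \<phi> G" for \<phi> G
 proof -
  obtain D where D0: "D 0 0 = \<phi>" and D: "!!i j x. (D i j has_derivative (%h. h$1 *R D (Suc i) j x + h$2 *R D i (Suc j) x)) (at x)"
   using phi unfolding smooth_def by blast
  have cD: "cont (D i j)" for i j using D by (meson continuous_at_imp_continuous_on has_derivative_continuous)
  have GD: "G z *v h = h$1 *R D 1 0 z + h$2 *R D 0 1 z" for z h
  proof -
   have "(\<phi> has_derivative (%h. G z *v h)) (at z)" using G by (simp add: C1_grad_def)
   moreover have "(\<phi> has_derivative (%h. h$1 *R D 1 0 z + h$2 *R D 0 1 z)) (at z)" using D[of 0 0 z] D0 by simp
   ultimately have "(%h. G z *v h) = (%h. h$1 *R D 1 0 z + h$2 *R D 0 1 z)" by (rule has_derivative_unique)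
   thus ?thesis by (rule fun_cong)
  qed
  have cG: "cont G" using G by (simp add: C1_grad_def)
  have px: "?P x y = (p + y *R b) + x *R a" for x y by simp
  define u1 u1x u1y u2 u2x u2y where
   "u1 = (%x y. a \<bullet> D 0 0 (?P x y))" and
   "u1x = (%x y. a \<bullet> (G (?P x y) *v a))" and
   "u1y = (%x y. a \<bullet> (G (?P x y) *v b))" and
   "u2 = (%x y. b \<bullet> D 0 0 (?P x y))" and
   "u2x = (%x y. b \<bullet> (G (?P x y) *v a))" and
   "u2y = (%x y. b \<bullet> (G (?P x y) *v b))"
  define u2xy where "u2xy = (%x y. b \<bullet> (a$1 *R (b$1 *R D 2 0 (?P x y) + b$2 *R D 1 1 (?P x y))
    + a$2 *R (b$1 *R D 1 1 (?P x y) + b$2 *R D 0 2 (?P x y))))"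
  note u_defs = u1_def u1x_def u1y_def u2_def u2x_def u2y_def u2xy_def
  have cu: "cont2 u1" "cont2 u1x" "cont2 u1y" "cont2 u2" "cont2 u2x" "cont2 u2y" "cont2 u2xy" unfolding u_defs GD
   by (rule cont2_par[where h="%z. _ \<bullet> D 0 0 z"] cont2_par[where h="%z. _ \<bullet> (_ *R D 1 0 z + _ *R D 0 1 z)"]
    cont2_par[where h="%z. b \<bullet> (a$1 *R (b$1 *R D 2 0 z + b$2 *R D 1 1 z)
    + a$2 *R (b$1 *R D 1 1 z + b$2 *R D 0 2 z))"], intro continuous_intros cD)+
  have line: "((%t. c \<bullet> D i j (q + t *R v)) has_real_derivative
    c \<bullet> (v$1 *R D (Suc i) j (q + t *R v) + v$2 *R D i (Suc j) (q + t *R v))) (at t)" for c v q t i j by (rule has_derivative_along_line[OF D])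
  note lx = line[where v=a] and ly = line[where v=b]
  obtain k where k: "sqint (%x y. (ramp3 x * ramp3 y * (u1y x y - u2x x y - k))^2)
   <= 10 ^ 10 * (sqn u1x + sqn u2y + sqint (%x y. (u1y x y + u2x x y)^2))"
  proof (rule exE[OF square_korn[of u1 u1x u1y u2 u2x u2y u2xy]])
   fix x y
   show "((%x. u1 x y) has_real_derivative u1x x y) (at x)"
    unfolding u_defs px GD using lx[where t=x and q="p + y *R b" and i=0 and j=0 and c=a] by simp
   show "((%y. u1 x y) has_real_derivative u1y x y) (at y)" unfolding u_defs GD using ly[where t=y and q="p + x *R a" and i=0 and j=0 and c=a] by simp
   show "((%x. u2 x y) has_real_derivative u2x x y) (at x)"
    unfolding u_defs px GD using lx[where t=x and q="p + y *R b" and i=0 and j=0 and c=b] by simp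
   show "((%y. u2 x y) has_real_derivative u2y x y) (at y)" unfolding u_defs GD using ly[where t=y and q="p + x *R a" and i=0 and j=0 and c=b] by simp
   show "((%y. u2x x y) has_real_derivative u2xy x y) (at y)" unfolding u_defs GD inner_add_right inner_scaleR_right
    using ly[where t=y and q="p + x *R a" and i=1 and j=0 and c=b]
     ly[where t=y and q="p + x *R a" and i=0 and j=1 and c=b] by (auto intro!: derivative_eq_intros simp: numeral_2_eq_2 inner_add_right)
   show "((%x. u2y x y) has_real_derivative u2xy x y) (at x)" unfolding u_defs GD px inner_add_right inner_scaleR_right
    using lx[where t=x and q="p + y *R b" and i=1 and j=0 and c=b]
     lx[where t=x and q="p + y *R b" and i=0 and j=1 and c=b]
    by (auto intro!: derivative_eq_intros simp: numeral_2_eq_2 inner_add_right algebra_simps)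
  qed (use cu in auto)
  let ?X = "%z. cross2 (z - p) b / c" and ?Y = "%z. cross2 a (z - p) / c"
  define h where "h = (%z. (ramp3 (?X z) * ramp3 (?Y z) * (c * curl2 (G z) - k))^2)"
  have ch: "cont h" unfolding h_def cross2_def divide_inverse
   by (intro continuous_intros continuous_on_compose2[OF ramp3_continuous(1)[of UNIV]] cG) auto
  have h_eq: "h (?P x y) = (ramp3 x * ramp3 y * (u1y x y - u2x x y - k))^2" for x y
   using inverse_par_map[OF d refl, where p=p and x=x and y=y, symmetric] cross2_eq[of a "G (?P x y)" b] unfolding h_def u_defs by (simp add: c_def)
  let ?S = "%z. (norm (symm (G z)))^2"
  have cS: "cont ?S" by (intro continuous_intros cG)
  have "sqn u1x + sqn u2y + sqint (%x y. (u1y x y + u2x x y)^2)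
   = sqint (%x y. (u1x x y)^2 + (u2y x y)^2 + (u1y x y + u2x x y)^2)" by (simp add: sqint_add cont2_add cont2_power cu)
  also have "... <= sqint (%x y. M * ?S (?P x y))"
  proof (rule sqint_mono)
   fix x y
   let ?A = "G (?P x y)"
   have "2 * u1x x y = 2 * (a \<bullet> (symm ?A *v a))" "2 * u2y x y = 2 * (b \<bullet> (symm ?A *v b))"
    "u1y x y + u2x x y = 2 * (a \<bullet> (symm ?A *v b))" unfolding u_defs by (simp_all flip: symm_eq)
   hence e: "u1x x y = a \<bullet> (symm ?A *v a)" "u2y x y = b \<bullet> (symm ?A *v b)"
    "u1y x y + u2x x y = 2 * (a \<bullet> (symm ?A *v b))" by simp_all
   show "(u1x x y)^2 + (u2y x y)^2 + (u1y x y + u2x x y)^2 <= M * ?S (?P x y)" unfolding e M_def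
    using inner_matrix_le[of a "symm ?A" a] inner_matrix_le[of b "symm ?A" b] inner_matrix_le[of a "symm ?A" b]
    by (simp add: algebra_simps power2_eq_square power4_eq_xxxx)
  next
   show "cont2 (%x y. M * ?S (?P x y))" by (rule cont2_par[where h="%z. M * ?S z"]) (intro continuous_intros cG)
  qed (intro cont2_add cont2_power cu)+
  also have "... = M * sqint (%x y. ?S (?P x y))" by (rule sqint_cmult)
  finally have e: "sqn u1x + sqn u2y + sqint (%x y. (u1y x y + u2x x y)^2)
   <= M * sqint (%x y. ?S (?P x y))" .
  have "sqint (%x y. h (?P x y)) <= 10^10 * (M * sqint (%x y. ?S (?P x y)))"
   unfolding h_eq by (rule order_trans[OF k], rule mult_left_mono[OF e]) simp
  hence "\<bar>c\<bar> * sqint (%x y. h (?P x y)) <= \<bar>c\<bar> * (10^10 * (M * sqint (%x y. ?S (?P x y))))" by (rule mult_left_mono) simp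
  hence H: "(LINT z|leb (par p a b). h z) <= 10^10 * M * (LINT z|leb (par p a b). ?S z)"
   unfolding integral_par[OF ch d] integral_par[OF cS d] c_def by (simp add: ac_simps)
  let ?Q = "par p ((2/3) *R a) ((2/3) *R b)"
  have QP: "?Q <= par p a b"
  proof
   fix z assume "z : ?Q"
   then obtain x y where "z = p + x *R ((2/3) *R a) + y *R ((2/3) *R b)" "x : {0..1}" "y : {0..1}" unfolding par_def by blast
   hence "z = p + (x*2/3) *R a + (y*2/3) *R b" "x*2/3 : {0..1}" "y*2/3 : {0..1}" by auto
   thus "z : par p a b" unfolding par_def by blast
  qed
  have "(LINT z|leb ?Q. (curl2 (G z) - k / c)^2) <= (LINT z|leb ?Q. (27^4 / c^2) * h z)"
  proof (rule integral_mono)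
   fix z assume "z : space (leb ?Q)"
   then obtain x y where z: "z = p + x *R ((2/3) *R a) + y *R ((2/3) *R b)" "x : {0..1}" "y : {0..1}" unfolding par_def by auto
   hence z': "z = ?P (x*2/3) (y*2/3)" by simp
   have r: "ramp3 (t*2/3) >= 1/27" if "t : {0..1}" for t using power_mono[of "1/3" "1 - t*2/3" 3] that by (simp add: ramp3_def power3_eq_cube)
   have "1/27 * (1/27) <= ramp3 (x*2/3) * ramp3 (y*2/3)" using r[OF z(2)] r[OF z(3)] by (intro mult_mono) auto
   hence "(1/27 * (1/27))^2 <= (ramp3 (x*2/3) * ramp3 (y*2/3))^2" by (rule power_mono) simp
   hence "(1/27 * (1/27))^2 * (c * curl2 (G z) - k)^2
     <= (ramp3 (x*2/3) * ramp3 (y*2/3))^2 * (c * curl2 (G z) - k)^2" by (rule mult_right_mono) simp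
   moreover have "?X z = x*2/3" "?Y z = y*2/3" using inverse_par_map[OF d z'] unfolding c_def by (simp_all only:)
   ultimately have "(1/27 * (1/27))^2 * (c * curl2 (G z) - k)^2 <= h z" by (simp only: h_def power_mult_distrib)
   moreover have "(c * curl2 (G z) - k)^2 = c^2 * (curl2 (G z) - k / c)^2" unfolding power_mult_distrib[symmetric] right_diff_distrib using c by simp
   ultimately have "(1/27 * (1/27))^2 * (c^2 * (curl2 (G z) - k / c)^2) <= h z" by (simp only:)
   moreover have "q <= (27^4 / c^2) * H" if "(1/27 * (1/27))^2 * (c^2 * q) <= H" for q H using that c by (simp add: field_simps)
   ultimately show "(curl2 (G z) - k / c)^2 <= (27^4 / c^2) * h z" by (simp only:)
  qed (intro integrable_continuous_bounded continuous_intros cG ch sets_par bounded_par)+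
  also have "... = (27^4 / c^2) * (LINT z|leb ?Q. h z)" by (rule integral_mult_right_zero)
  also have "... <= (27^4 / c^2) * (10^10 * M * (LINT z|leb (par p a b). ?S z))"
  proof (rule mult_left_mono[OF order_trans[OF _ H]])
   show "(LINT z|leb ?Q. h z) <= (LINT z|leb (par p a b). h z)"
    by (rule integral_mono_set[OF integrable_continuous_bounded[OF ch sets_par bounded_par] sets_par sets_par QP]) (simp add: h_def)
  qed simp
  also have "... = C * (LINT z|leb (par p a b). ?S z)" by (simp add: C_def)
  finally show ?thesis ..
 qed
 show ?thesis
 proof (rule exI[of _ C], intro conjI C allI impI)
  fix \<phi> G assume "smooth \<phi> & C1_grad \<phi> G"
  thus "EX k. (LINT z|leb (par p ((2/3) *R a) ((2/3) *R b)). (curl2 (G z) - k)^2)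
    <= C * (LINT z|leb (par p a b). (norm (symm (G z)))^2)" by (elim conjE) (rule main)
 qed
qed

section \<open>Covering convex polygons by parallelograms\<close>

lemma par_interior:
 assumes "cross2 a b ~= 0" "0 < x" "x < 1" "0 < y" "y < 1"
 shows "p + x *R a + y *R b : interior (par p a b)"
proof -
 let ?X = "%z. cross2 (z - p) b / cross2 a b" and ?Y = "%z. cross2 a (z - p) / cross2 a b"
 let ?O = "{z. 0 < ?X z} \<inter> {z. ?X z < 1} \<inter> ({z. 0 < ?Y z} \<inter> {z. ?Y z < 1})"
 have c: "cont ?X" "cont ?Y" unfolding cross2_def divide_inverse by (intro continuous_intros)+
 have "open ?O" by (intro open_Int open_Collect_less c continuous_on_const)
 moreover have "?O <= par p a b"
 proof
  fix z assume "z : ?O"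
  hence "?X z : {0..1}" "?Y z : {0..1}" by auto
  with par_map_inverse[OF assms(1), of p z] show "z : par p a b" unfolding par_def by (smt (verit) mem_Collect_eq)
 qed
 moreover have "p + x *R a + y *R b : ?O" using inverse_par_map[OF assms(1) refl, where p=p and x=x and y=y, symmetric] assms by simp
 ultimately show ?thesis using interior_maximal by blast
qed

lemma convex_hull_3_par:
 "par A ((1/2) *R (B - A)) ((1/2) *R (C - A)) <= convex hull {A, B, C}"
proof
 fix z assume "z : par A ((1/2) *R (B - A)) ((1/2) *R (C - A))"
 then obtain x y where z: "z = A + x *R ((1/2) *R (B - A)) + y *R ((1/2) *R (C - A))"
  and xy: "x : {0..1}" "y : {0..1}" unfolding par_def by blast
 have "z = (1 - x/2 - y/2) *R A + (x/2) *R B + (y/2) *R C" unfolding z by (simp add: algebra_simps scaleR_left_diff_distrib)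
 moreover have "0 <= 1 - x/2 - y/2" "0 <= x/2" "0 <= y/2" "(1 - x/2 - y/2) + x/2 + y/2 = 1" using xy by auto
 ultimately show "z : convex hull {A, B, C}" unfolding convex_hull_3 by blast
qed

text \<open>Of the three barycentric coordinates of a point, two are at most \<open>1/2\<close>.\<close>

lemma triangle_covered_by_par:
 "convex hull {A, B, C} <= par A ((1/2) *R (B - A)) ((1/2) *R (C - A))
  \<union> par B ((1/2) *R (A - B)) ((1/2) *R (C - B)) \<union> par C ((1/2) *R (A - C)) ((1/2) *R (B - C))"
proof
 fix z assume "z : convex hull {A, B, C}"
 then obtain u v w where uvw: "0 <= u" "0 <= v" "0 <= w" "u + v + w = 1" and z: "z = u *R A + v *R B + w *R C" unfolding convex_hull_3 by blast
 have mem: "q : par P ((1/2) *R (Q - P)) ((1/2) *R (R - P))" if "q = r *R P + s *R Q + t *R R" "r + s + t = 1" "0 <= s" "s <= 1/2" "0 <= t" "t <= 1/2"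
  for q P Q R :: "real^2" and r s t
 proof -
  have r: "r = 1 - s - t" using that by simp
  have "q = P + (2 * s) *R ((1/2) *R (Q - P)) + (2 * t) *R ((1/2) *R (R - P))"
   unfolding that(1) r by (simp add: algebra_simps scaleR_left_diff_distrib)
  moreover have "2 * s : {0..1}" "2 * t : {0..1}" using that by auto
  ultimately show ?thesis unfolding par_def by blast
 qed
 consider "v <= 1/2" "w <= 1/2" | "v > 1/2" | "w > 1/2" by linarith
 thus "z : par A ((1/2) *R (B - A)) ((1/2) *R (C - A))
  \<union> par B ((1/2) *R (A - B)) ((1/2) *R (C - B)) \<union> par C ((1/2) *R (A - C)) ((1/2) *R (B - C))"
 proof cases
  case 1 then show ?thesis using mem[OF z] uvw by auto
 next
  case 2
  have "z = v *R B + u *R A + w *R C" using z by simp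
  thus ?thesis using mem[of z v B u A w C] uvw 2 by auto
 next
  case 3
  have "z = w *R C + u *R A + v *R B" using z by simp
  thus ?thesis using mem[of z w C u A v B] uvw 3 by auto
 qed
qed

lemma cross2_linear_level_negligible:
 assumes "d ~= 0"
 shows "negligible {z. cross2 d (z - A) = 0}"
proof -
 define n :: "real^2" where "n = (\<chi> i. if i = 1 then - d $ 2 else d $ 1)"
 have nz: "n ~= 0" using assms by (auto simp: n_def vec_eq_iff forall_2)
 have "{z. cross2 d (z - A) = 0} = {z. n \<bullet> z = n \<bullet> A}" by (auto simp: cross2_def n_def inner_vec_def sum_2 algebra_simps)
 thus ?thesis using negligible_hyperplane[of n] nz by simp
qed

lemma degenerate_triangle_negligible:
 fixes A B C :: "real^2"
 assumes "cross2 (B - A) (C - A) = 0"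
 shows "negligible (convex hull {A, B, C})"
proof (cases "B = A & C = A")
 case True then show ?thesis by simp
next
 case False
 define d where "d = (if B = A then C - A else B - A)"
 have "d ~= 0" using False by (auto simp: d_def)
 moreover have "convex hull {A, B, C} <= {z. cross2 d (z - A) = 0}"
 proof
  fix z assume "z : convex hull {A, B, C}"
  then obtain u v w where uvw: "u + v + w = 1" and z: "z = u *R A + v *R B + w *R C" unfolding convex_hull_3 by blast
  have u: "u = 1 - v - w" using uvw by simp
  have "z - A = v *R (B - A) + w *R (C - A)" unfolding z u by (simp add: algebra_simps)
  hence "cross2 d (z - A) = cross2 d (v *R (B - A) + w *R (C - A))" by simp
  also have "... = v * cross2 d (B - A) + w * cross2 d (C - A)" by (simp add: cross2_def algebra_simps)
  also have "... = 0" using assms by (auto simp: d_def cross2_def)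
  finally show "z : {z. cross2 d (z - A) = 0}" by simp
 qed
 ultimately show ?thesis using cross2_linear_level_negligible negligible_subset by blast
qed

lemma caratheodory_triangles:
 fixes V :: "(real^2) set"
 shows "convex hull V = (\<Union>A\<in>V. \<Union>B\<in>V. \<Union>C\<in>V. convex hull {A, B, C})"
proof (rule set_eqI, rule iffI)
 fix z assume "z : convex hull V"
 then obtain s where s: "finite s" "s <= V" "card s <= DIM(real^2) + 1" "z : convex hull s" unfolding caratheodory[of V] by blast
 have "s ~= {}" using s by auto
 have "EX A B C. s = {A, B, C}"
 proof -
  have "card s <= 3" using s by simp
  moreover have "card s ~= 0" using s \<open>s ~= {}\<close> by auto
  ultimately consider "card s = 1" | "card s = 2" | "card s = 3" by linarith
  thus ?thesis
  proof cases
   case 1 then show ?thesis by (auto simp: card_1_singleton_iff)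
  next
   case 2 then show ?thesis by (auto simp: card_2_iff)
  next
   case 3 then show ?thesis by (auto simp: card_3_iff)
  qed
 qed
 thus "z : (\<Union>A\<in>V. \<Union>B\<in>V. \<Union>C\<in>V. convex hull {A, B, C})" using s by auto
next
 fix z assume "z : (\<Union>A\<in>V. \<Union>B\<in>V. \<Union>C\<in>V. convex hull {A, B, C})"
 then obtain A B C where "A : V" "B : V" "C : V" "z : convex hull {A, B, C}" by blast
 thus "z : convex hull V" using hull_mono[of "{A,B,C}" V convex] by auto
qed

text \<open>Thicken the segment between the two points.\<close>

lemma connecting_par:
 fixes S :: "(real^2) set"
 assumes S: "convex S" and x: "x : interior S" and y: "y : interior S" and "x ~= y"
 obtains p a b where "par p a b <= S" "cross2 a b ~= 0"
  "!!s. 0 < s ==> s < 1 ==> x + s *R (y - x) : interior (par p a b)"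
proof -
 define d where "d = y - x"
 define n :: "real^2" where "n = (\<chi> i. if i = 1 then - d $ 2 else d $ 1)"
 have dn: "cross2 d n > 0" "d ~= 0"
 proof -
  show "d ~= 0" using assms by (simp add: d_def)
  hence "d$1 ~= 0 \<or> d$2 ~= 0" by (auto simp: vec_eq_iff forall_2)
  moreover have "cross2 d n = (d$1)^2 + (d$2)^2" by (simp add: cross2_def n_def power2_eq_square)
  ultimately show "cross2 d n > 0" by (simp add: sum_power2_gt_zero_iff)
 qed
 hence nn: "norm n > 0" by (auto simp: cross2_def)
 obtain e1 where e1: "e1 > 0" "ball x e1 <= S" using x by (auto simp: mem_interior)
 obtain e2 where e2: "e2 > 0" "ball y e2 <= S" using y by (auto simp: mem_interior)
 define t where "t = min e1 e2 / (2 * norm n)"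
 have t: "t > 0" using e1 e2 nn by (simp add: t_def)
 have tn: "\<bar>r\<bar> <= 1 ==> norm ((r * t) *R n) < min e1 e2" for r
 proof -
  assume r: "\<bar>r\<bar> <= 1"
  have "norm ((r * t) *R n) = \<bar>r\<bar> * (t * norm n)" using t by (simp add: abs_mult)
  also have "... <= 1 * (t * norm n)" using r t by (intro mult_right_mono) auto
  also have "... < min e1 e2" using e1 e2 nn by (auto simp: t_def min_def)
  finally show ?thesis .
 qed
 let ?p = "x - t *R n" and ?b = "(2 * t) *R n"
 have d0: "cross2 d ?b ~= 0" using dn t by (simp add: cross2_def algebra_simps)
 have "par ?p d ?b <= S"
 proof
  fix z assume "z : par ?p d ?b"
  then obtain s r where z: "z = ?p + s *R d + r *R ?b" and sr: "s : {0..1}" "r : {0..1}" unfolding par_def by blast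
  let ?v = "((2 * r - 1) * t) *R n"
  have v: "norm ?v < min e1 e2" using sr by (intro tn) auto
  have "x + ?v : S" "y + ?v : S" using e1 e2 v by (auto simp: dist_norm subset_eq)
  hence "(1 - s) *R (x + ?v) + s *R (y + ?v) : S" using S sr by (intro convexD) auto
  moreover have "z = (1 - s) *R (x + ?v) + s *R (y + ?v)" unfolding z d_def by (simp add: algebra_simps)
  ultimately show "z : S" by simp
 qed
 moreover have "x + s *R (y - x) : interior (par ?p d ?b)" if "0 < s" "s < 1" for s
  using par_interior[OF d0 that, of "1/2" ?p] by (simp add: d_def algebra_simps)
 ultimately show ?thesis using that d0 by blast
qed

text \<open>A thin parallelogram overlaps both the union so far and the next set.\<close>

lemma near_const_finite_Union:
 fixes S :: "(real^2) set"
 assumes S: "convex S"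
  and par: "!!p a b. par p a b <= S ==> cross2 a b ~= 0 ==> near_const X g N (par p a b)"
  and g: "!!u. u : X ==> cont (g u)" and N: "!!u. u : X ==> N u >= 0"
  and F: "finite F" "F ~= {}" "!!P. P : F ==> near_const X g N P & P <= S & interior P ~= {}"
 shows "near_const X g N (\<Union>F)" using F
proof (induction F rule: finite_ne_induct)
 case (singleton P) then show ?case by simp
next
 case (insert P F)
 let ?Q = "\<Union>F"
 have Q: "near_const X g N ?Q" "?Q <= S" using insert by auto
 obtain P' where "P' : F" using insert by auto
 hence "interior P' <= interior ?Q" "interior P' ~= {}" using insert.prems by (auto intro!: interior_mono)
 then obtain x where x: "x : interior ?Q" by blast
 have P: "near_const X g N P" "P <= S" "interior P ~= {}" using insert.prems by auto
 have "infinite (interior P)" using P(3) open_interior finite_imp_not_open by blast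
 then obtain y where y: "y : interior P" "y ~= x" by (metis finite.emptyI finite.insertI finite_subset singletonI subsetI insertI1)
 have xy: "x : interior S" "y : interior S" using x y Q P interior_mono by blast+
 obtain p a b where R: "par p a b <= S" "cross2 a b ~= 0"
  and seg: "!!s. 0 < s ==> s < 1 ==> x + s *R (y - x) : interior (par p a b)" using connecting_par[OF S xy] y(2) by metis
 let ?R = "par p a b"
 have meet: "interior A \<inter> interior ?R ~= {}" if l: "((%s. x + s *R (y - x)) \<longlongrightarrow> l) F" "F <= at s0 within {0<..<1}"
   "F ~= bot" "l : interior A" for A l F s0
 proof -
  have "\<forall>\<^sub>F s in F. x + s *R (y - x) : interior A" using topological_tendstoD[OF l(1)] l(4) by blast
  moreover have "\<forall>\<^sub>F s in F. s : {0<..<1}" using l(2) by (auto simp: le_filter_def eventually_at_filter)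
  ultimately have "\<forall>\<^sub>F s in F. x + s *R (y - x) : interior A \<inter> interior ?R" by eventually_elim (use seg in auto)
  thus ?thesis using l(3) eventually_happens' by blast
 qed
 have "interior ?Q \<inter> interior ?R ~= {}"
 proof (rule meet)
  show "((%s. x + s *R (y - x)) \<longlongrightarrow> x) (at 0 within {0<..<1})" by (auto intro!: tendsto_eq_intros)
  show "at (0::real) within {0<..<1} ~= bot" by (simp add: at_within_eq_bot_iff closure_greaterThanLessThan)
 qed (use x in auto)
 hence 1: "near_const X g N (?Q \<union> ?R)" by (rule near_const_Un_interior[OF Q(1) par[OF R]]) (use g N in auto)
 have "interior P \<inter> interior ?R ~= {}"
 proof (rule meet)
  show "((%s. x + s *R (y - x)) \<longlongrightarrow> y) (at 1 within {0<..<1})" by (auto intro!: tendsto_eq_intros)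
  show "at (1::real) within {0<..<1} ~= bot" by (simp add: at_within_eq_bot_iff closure_greaterThanLessThan)
 qed (use y in auto)
 hence "interior (?Q \<union> ?R) \<inter> interior P ~= {}" using interior_mono[of ?R "?Q \<union> ?R"] by blast
 hence 2: "near_const X g N (?Q \<union> ?R \<union> P)" by (rule near_const_Un_interior[OF 1 P(1)]) (use g N in auto)
 have "P \<union> ?Q : sets lebesgue" using P(1) Q(1) by (auto simp: near_const_def)
 thus ?case using near_const_subset[OF 2, of "P \<union> ?Q"] g by auto
qed

lemma near_const_null:
 assumes P: "near_const X g N P" and S: "S : sets lebesgue" "bounded S" and n: "negligible (S - P)"
  and g: "!!u. u : X ==> cont (g u)"
 shows "near_const X g N S"
proof -
 have Ps: "P : sets lebesgue" using P by (simp add: near_const_def)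
 have "near_const X g N (S \<inter> P)" by (rule near_const_subset[OF P]) (use S Ps g in auto)
 moreover have "(LINT z|leb S. f z) = (LINT z|leb (S \<inter> P). f z)" if "f : borel_measurable borel" for f :: "real^2 => real"
 proof -
  have m: "f : borel_measurable lebesgue" using measurable_completion[of f lborel borel] that by simp
  have "AE z in lebesgue. z ~: S - P" using n[unfolded negligible_iff_null_sets] by (rule AE_not_in)
  hence "AE z in lebesgue. indicator S z *R f z = indicator (S \<inter> P) z *R f z" by eventually_elim (auto simp: indicator_def)
  thus ?thesis using S Ps m by (simp add: integral_restrict_space) (rule integral_cong_AE, auto)
 qed
 moreover have "(%z. (g u z - k)^2) : borel_measurable borel" if "u : X" for u k by (intro borel_measurable_continuous_onI continuous_intros g that)
 ultimately show ?thesis using S unfolding near_const_def by simp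
qed

text \<open>By Caratheodory's theorem the triangles spanned by the vertices cover the polygon, degenerate ones are null sets, and
 each of the others is covered by three parallelograms inside it.\<close>

lemma near_const_polygon:
 fixes S :: "(real^2) set"
 assumes S: "S = convex hull V" "finite V" "interior S ~= {}"
  and par: "!!p a b. par p a b <= S ==> cross2 a b ~= 0 ==> near_const X g N (par p a b)"
  and g: "!!u. u : X ==> cont (g u)" and N: "!!u. u : X ==> N u >= 0"
 shows "near_const X g N S"
proof -
 define T where "T = {t : V \<times> V \<times> V. cross2 (fst (snd t) - fst t) (snd (snd t) - fst t) ~= 0}"
 define f where "f = (%A B C. par A ((1/2) *R (B - A)) ((1/2) *R (C - A :: real^2)))"
 define F where "F = (%t. f (fst t) (fst (snd t)) (snd (snd t))) ` T"
 have finF: "finite F" unfolding F_def T_def using S(2) by auto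
 have FI: "f A B C : F" if "A : V" "B : V" "C : V" "cross2 (B - A) (C - A) ~= 0" for A B C
  unfolding F_def by (rule image_eqI[of _ _ "(A, B, C)"]) (use that in \<open>auto simp: T_def\<close>)
 define Z where "Z = (\<Union>A\<in>V. \<Union>B\<in>V. \<Union>C\<in>V. if cross2 (B - A) (C - A) = 0 then convex hull {A, B, C} else {})"
 have UN: "negligible (\<Union>i\<in>V. h i)" if "!!i. i : V ==> negligible (h i)" for h :: "real^2 => (real^2) set"
  using that S(2) by (intro negligible_Union) auto
 have Z: "negligible Z" unfolding Z_def by (intro UN) (simp add: degenerate_triangle_negligible)
 have SF: "S <= \<Union>F \<union> Z"
 proof
  fix z assume "z : S"
  then obtain A B C where ABC: "A : V" "B : V" "C : V" and z: "z : convex hull {A, B, C}" unfolding S(1) caratheodory_triangles[of V] by blast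
  show "z : \<Union>F \<union> Z"
  proof (cases "cross2 (B - A) (C - A) = 0")
   case True then show ?thesis unfolding Z_def using ABC z by fastforce
  next
   case False
   have c: "cross2 (A - B) (C - B) ~= 0" "cross2 (A - C) (B - C) ~= 0" using False by (auto simp: cross2_def algebra_simps)
   have "f A B C : F" "f B A C : F" "f C A B : F" using FI ABC False c by auto
   thus ?thesis using triangle_covered_by_par[of A B C] z unfolding f_def by blast
  qed
 qed
 have "compact S" unfolding S(1) by (intro finite_imp_compact_convex_hull S)
 hence Sm: "S : sets lebesgue" "bounded S" by (auto intro: compact_imp_bounded lmeasurable_compact[THEN fmeasurableD])
 have "F ~= {}"
 proof
  assume "F = {}"
  hence "negligible S" using SF Z negligible_subset by auto
  thus False using S(3) negligible_subset[of S "interior S"] interior_subset open_not_negligible[of "interior S"] by blast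
 qed
 have "near_const X g N (\<Union>F)"
 proof (rule near_const_finite_Union[where S=S, OF _ par g N finF \<open>F ~= {}\<close>])
  show "convex S" unfolding S(1) by (rule convex_convex_hull)
  fix P assume "P : F"
  then obtain t where t: "t : T" and Pt: "P = f (fst t) (fst (snd t)) (snd (snd t))" unfolding F_def by (rule imageE)
  define A B C where "A = fst t" and "B = fst (snd t)" and "C = snd (snd t)"
  have P: "P = par A ((1/2) *R (B - A)) ((1/2) *R (C - A))" and ABC: "A : V" "B : V" "C : V"
   and c: "cross2 (B - A) (C - A) ~= 0" using t Pt by (auto simp: T_def f_def A_def B_def C_def)
  have c': "cross2 ((1/2) *R (B - A)) ((1/2) *R (C - A)) ~= 0" using c by (auto simp: cross2_def)
  have "convex hull {A, B, C} <= S" unfolding S(1) using ABC by (intro hull_mono) auto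
  hence "P <= S" unfolding P using convex_hull_3_par by blast
  moreover from this have "near_const X g N P" unfolding P using par c' by blast
  moreover have "interior P ~= {}" unfolding P using par_interior[OF c', of "1/2" "1/2" A] by auto
  ultimately show "near_const X g N P & P <= S & interior P ~= {}" by blast
 qed auto
 moreover have "negligible (S - \<Union>F)" using Z negligible_subset SF by (metis Diff_subset_conv)
 ultimately show ?thesis using near_const_null Sm g by blast
qed

lemma continuous_matrix_vector_mult [continuous_intros]:
 "continuous_on S f ==> continuous_on S (%x. f x *v (v :: real^2))" for f :: "_ => real^2^2"
 unfolding matrix_vector_mult_def by (intro continuous_on_vec_lambda continuous_intros)

section \<open>Korn's inequality for smooth functions on convex polygons\<close>

text \<open>The four corner pieces given by \<open>korn_par\<close>, one for each choice of the corner, overlap and cover the parallelogram.\<close>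

lemma near_const_par_curl:
 fixes S :: "(real^2) set"
 assumes S: "S : sets lebesgue" "bounded S" and PS: "par p a b <= S" and d: "cross2 a b ~= 0"
 shows "near_const {(\<phi>, G). smooth \<phi> & C1_grad \<phi> G} (%u z. curl2 (snd u z)) (%u. LINT z|leb S. (norm (symm (snd u z)))^2) (par p a b)"
  (is "near_const ?X ?g ?N _")
proof -
 have g: "cont (?g u)" and N: "?N u >= 0" if "u : ?X" for u using that by (auto simp: C1_grad_def intro!: continuous_intros)
 define Q where "Q = (%p a b. par p ((2/3) *R a) ((2/3) *R (b :: real^2)))"
 have Q: "near_const ?X ?g ?N (Q q v w)" if sub: "par q v w <= S" and d: "cross2 v w ~= 0" for q v w
 proof -
  obtain C where C: "C >= 0" and *: "!!\<phi> G. smooth \<phi> & C1_grad \<phi> G ==>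
   EX k. (LINT z|leb (Q q v w). (curl2 (G z) - k)^2)
    <= C * (LINT z|leb (par q v w). (norm (symm (G z)))^2)" using korn_par[OF d, of q] unfolding Q_def by blast
  have "EX k. (LINT z|leb (Q q v w). (?g u z - k)^2) <= C * ?N u" if u: "u : ?X" for u
  proof -
   have c: "cont (snd u)" using u by (auto simp: C1_grad_def)
   obtain k where "(LINT z|leb (Q q v w). (?g u z - k)^2)
     <= C * (LINT z|leb (par q v w). (norm (symm (snd u z)))^2)" using *[of "fst u" "snd u"] u by (auto simp: case_prod_beta)
   also have "... <= C * ?N u" by (intro mult_left_mono[OF _ C] integral_mono_set integrable_continuous_bounded continuous_intros c S sub)
     auto
   finally show ?thesis ..
  qed
  thus ?thesis unfolding near_const_def using C by (auto simp: Q_def)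
 qed
 have corner: "par q v w = par p a b ==> cross2 v w ~= 0 ==> near_const ?X ?g ?N (Q q v w)" for q v w using Q PS by simp
 have parI: "z : par q v w" if "z = q + x *R v + y *R w" "0 <= x" "x <= 1" "0 <= y" "y <= 1" for z q v w x y using that unfolding par_def by auto
 have flip1: "par (q + v) (- v) w = par q v w" for q v w
 proof -
  have "par (q + v) (- v) w <= par q v w" for q v w
  proof
   fix z assume "z : par (q + v) (- v) w"
   then obtain x y where "z = q + v + x *R (- v) + y *R w" "0 <= x" "x <= 1" "0 <= y" "y <= 1" unfolding par_def by auto
   thus "z : par q v w" by (intro parI[of z q "1 - x" v y w]) (auto simp: algebra_simps)
  qed
  from this[of q v w] this[of "q + v" "- v" w] show ?thesis by auto
 qed
 have comm: "par q v w = par q w v" for q v w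
 proof -
  have "par q v w <= par q w v" for q v w
  proof
   fix z assume "z : par q v w"
   then obtain x y where "z = q + x *R v + y *R w" "0 <= x" "x <= 1" "0 <= y" "y <= 1" unfolding par_def by auto
   thus "z : par q w v" by (intro parI[of z q y w x v]) auto
  qed
  thus ?thesis by blast
 qed
 have flip2: "par (q + w) v (- w) = par q v w" for q v w using flip1[of q w v] comm by metis
 have e2: "par (p + a) (- a) b = par p a b" by (rule flip1)
 have e3: "par (p + b) a (- b) = par p a b" by (rule flip2)
 have e4: "par (p + a + b) (- a) (- b) = par p a b" using flip2[of "p + a" b "- a"] e2 by simp
 have d': "cross2 (- a) b ~= 0" "cross2 a (- b) ~= 0" "cross2 (- a) (- b) ~= 0" using d by (auto simp: cross2_def)
 let ?m = "p + (1/2) *R a + (1/2) *R b"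
 have mid: "?m : interior (Q q v w)" if "?m = q + (1/2) *R v + (1/2) *R w" "cross2 v w ~= 0" for q v w
 proof -
  have "cross2 ((2/3) *R v) ((2/3) *R w) ~= 0" using that by (auto simp: cross2_def)
  from par_interior[OF this, of "3/4" "3/4" q] show ?thesis unfolding that(1) by (simp add: Q_def)
 qed
 have hv: "(1/2) *R v + (1/2) *R v = v" for v :: "real^2" by (simp flip: scaleR_left_distrib)
 let ?Q1 = "Q p a b" and ?Q2 = "Q (p + a) (- a) b" and ?Q3 = "Q (p + b) a (- b)" and ?Q4 = "Q (p + a + b) (- a) (- b)"
 have m: "?m : interior ?Q1" "?m : interior ?Q2" "?m : interior ?Q3" "?m : interior ?Q4" by (intro mid d d'; simp add: vec_eq_iff)+
 have n: "near_const ?X ?g ?N ?Q1" "near_const ?X ?g ?N ?Q2" "near_const ?X ?g ?N ?Q3" "near_const ?X ?g ?N ?Q4" by (intro corner refl e2 e3 e4 d d')+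
 have "near_const ?X ?g ?N (?Q1 \<union> ?Q2)" by (rule near_const_Un_interior[OF n(1,2)]) (use m g N in auto)
 hence "near_const ?X ?g ?N (?Q1 \<union> ?Q2 \<union> ?Q3)"
  by (rule near_const_Un_interior[OF _ n(3)]) (use m g N interior_mono[of ?Q1 "?Q1 \<union> ?Q2"] in auto)
 hence U: "near_const ?X ?g ?N (?Q1 \<union> ?Q2 \<union> ?Q3 \<union> ?Q4)"
  by (rule near_const_Un_interior[OF _ n(4)]) (use m g N interior_mono[of ?Q1 "?Q1 \<union> ?Q2 \<union> ?Q3"] in auto)
 have "par p a b <= ?Q1 \<union> ?Q2 \<union> ?Q3 \<union> ?Q4"
 proof
  fix z assume "z : par p a b"
  then obtain x y where z: "z = p + x *R a + y *R b" and xy: "0 <= x" "x <= 1" "0 <= y" "y <= 1" unfolding par_def by auto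
  have QI: "z : Q q v w" if "z = q + s *R v + t *R w" "0 <= s" "s <= 2/3" "0 <= t" "t <= 2/3" for q v w s t
   unfolding Q_def using that by (intro parI[of z q "3/2 * s" _ "3/2 * t"]) auto
  consider "x <= 1/2" "y <= 1/2" | "x >= 1/2" "y <= 1/2" | "x <= 1/2" "y >= 1/2" | "x >= 1/2" "y >= 1/2" by linarith
  thus "z : ?Q1 \<union> ?Q2 \<union> ?Q3 \<union> ?Q4"
  proof cases
   case 1 then have "z : ?Q1" using z xy by (intro QI[of p x a y b]) auto
   thus ?thesis by blast
  next
   case 2 then have "z : ?Q2" using xy by (intro QI[of "p + a" "1 - x" "- a" y b]) (auto simp: z algebra_simps)
   thus ?thesis by blast
  next
   case 3 then have "z : ?Q3" using xy by (intro QI[of "p + b" x a "1 - y" "- b"]) (auto simp: z algebra_simps)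
   thus ?thesis by blast
  next
   case 4 then have "z : ?Q4" using xy by (intro QI[of "p + a + b" "1 - x" "- a" "1 - y" "- b"]) (auto simp: z algebra_simps)
   thus ?thesis by blast
  qed
 qed
 thus ?thesis by (intro near_const_subset[OF U]) (use g in auto)
qed

lemma near_const_par_component:
 fixes S :: "(real^2) set"
 assumes S: "S : sets lebesgue" "bounded S" and PS: "par p a b <= S" and d: "cross2 a b ~= 0"
 shows "near_const {(f, G). C1_grad f G} (%u z. fst u z $ i) (%u. LINT z|leb S. (norm (snd u z))^2) (par p a b)" (is "near_const ?X ?g ?N _")
proof -
 define C where "C = 9/2 * (norm a)^2 + 9 * (norm b)^2"
 have C: "C >= 0" by (simp add: C_def)
 have "EX k. (LINT z|leb (par p a b). (?g u z - k)^2) <= C * ?N u" if u: "u : ?X" for u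
 proof -
  define f G where "f = fst u" and "G = snd u"
  have fd: "(f has_derivative (%h. G z *v h)) (at z)" for z using u by (auto simp: C1_grad_def f_def G_def)
  have cG: "cont G" using u by (auto simp: C1_grad_def f_def G_def)
  have cf: "cont f" using fd by (meson continuous_at_imp_continuous_on has_derivative_continuous)
  let ?P = "%x y. p + x *R a + y *R b" and ?e = "axis i 1 :: real^2"
  have px: "?P x y = (p + y *R b) + x *R a" for x y by simp
  have line: "((%t. f (q + t *R v) $ i) has_real_derivative (?e \<bullet> (G (q + t *R v) *v v))) (at t)" for q v t
   using has_derivative_along_line[OF fd, where c="?e" and q=q and v=v and t=t] by (simp add: inner_axis')
  define ux uy where "ux = (%x y. ?e \<bullet> (G (?P x y) *v a))" and "uy = (%x y. ?e \<bullet> (G (?P x y) *v b))"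
  have cu: "cont2 ux" "cont2 uy" unfolding ux_def uy_def by (rule cont2_par[where h="%z. ?e \<bullet> (G z *v _)"],
     intro continuous_intros cG)+
  have "EX k. sqint (%x y. (f (?P x y) $ i - k - 0 * y)^2) <= (9/2) * sqn ux
   + 9 * sqint (%x y. (uy x y + 0)^2) + 144 * sqint (%x y. (0 - 0)^2)"
  proof (rule near_affine_step[where ?u2.0="%x y. 0" and ?u2x="%x y. 0" and m="%x. 0"])
   show "((%x. f (?P x y) $ i) has_real_derivative ux x y) (at x)" for x y unfolding ux_def px using line[of "p + y *R b" a x] .
   show "((%y. f (?P x y) $ i) has_real_derivative uy x y) (at y)" for x y unfolding uy_def using line[of "p + x *R a" b y] .
   show "cont2 (%x y. f (?P x y) $ i)" by (rule cont2_par[where h="%z. f z $ i"]) (intro continuous_intros cf)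
  qed (auto intro!: cu cont2_const)
  then obtain k where "sqint (%x y. (f (?P x y) $ i - k)^2) <= (9/2) * sqn ux + 9 * sqn uy" by (auto simp: sqint_def)
  also have "... = sqint (%x y. (9/2) * (ux x y)^2 + 9 * (uy x y)^2)" by (simp only: sqint_add sqint_cmult cont2_mult cont2_const cont2_power cu)
  also have "... <= sqint (%x y. C * (norm (G (?P x y)))^2)"
  proof (rule sqint_mono)
   fix x y
   show "(9/2) * (ux x y)^2 + 9 * (uy x y)^2 <= C * (norm (G (?P x y)))^2"
    using inner_matrix_le[of ?e "G (?P x y)" a] inner_matrix_le[of ?e "G (?P x y)" b] by (simp add: ux_def uy_def C_def algebra_simps)
   show "cont2 (%x y. C * (norm (G (?P x y)))^2)" by (rule cont2_par[where h="%z. C * (norm (G z))^2"]) (intro continuous_intros cG)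
  qed (intro cont2_add cont2_mult cont2_const cont2_power cu)+
  finally have "\<bar>cross2 a b\<bar> * sqint (%x y. (f (?P x y) $ i - k)^2) <= \<bar>cross2 a b\<bar> * sqint (%x y. C * (norm (G (?P x y)))^2)"
   by (rule mult_left_mono) simp
  hence "(LINT z|leb (par p a b). (f z $ i - k)^2) <= (LINT z|leb (par p a b). C * (norm (G z))^2)"
   by (subst (1 2) integral_par[OF _ d]) (intro continuous_intros cf cG)+
  also have "... <= (LINT z|leb S. C * (norm (G z))^2)"
   by (intro integral_mono_set integrable_continuous_bounded continuous_intros cG S PS) (auto simp: C)
  finally show ?thesis unfolding f_def G_def by (intro exI[of _ k]) simp
 qed
 thus ?thesis unfolding near_const_def using C by auto
qed

text \<open>On the segments \<open>y \<mapsto> p + x a + y b\<close> the value at \<open>y = 0\<close> differs from any other one by an integral of the gradient.\<close>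

lemma trace_par:
 assumes f: "C1_grad f G" and d: "cross2 a b ~= 0"
 shows "int01 (%x. (norm (f (p + x *R a)))^2) <=
  (2 / \<bar>cross2 a b\<bar>) * (LINT z|leb (par p a b). (norm (f z))^2 + 2 * (norm b)^2 * (norm (G z))^2)"
proof -
 have fd: "(f has_derivative (%h. G z *v h)) (at z)" for z using f by (auto simp: C1_grad_def)
 have cG: "cont G" using f by (auto simp: C1_grad_def)
 have cf: "cont f" using fd by (meson continuous_at_imp_continuous_on has_derivative_continuous)
 let ?P = "%x y. p + x *R a + y *R b"
 let ?n = "%z. (norm (f z))^2" and ?B = "2 * (norm b)^2" 
 have n2: "(norm v)^2 = (v$1)^2 + (v$2)^2" for v :: "real^2" by (simp add: norm_vec_def L2_set_def sum_2 sum_nonneg)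
 have cS: "cont2 (%x y. (norm (G (?P x y)))^2)" by (rule cont2_par[where h="%z. (norm (G z))^2"]) (intro continuous_intros cG)
 have cF: "cont2 (%x y. ?n (?P x y))" by (rule cont2_par[where h="?n"]) (intro continuous_intros cf)
 have pt: "?n (p + x *R a) <= 2 * ?n (?P x y) + 2 * (?B * int01 (%y. (norm (G (?P x y)))^2))" if y: "0 <= y" "y <= 1" for x y
 proof -
  have comp: "(f (p + x *R a) $ i)^2 <= 2 * (f (?P x y) $ i)^2 + 2 * ((norm b)^2 * int01 (%y. (norm (G (?P x y)))^2))" for i
  proof -
   let ?e = "axis i 1 :: real^2"
   define uy where "uy = (%x y. ?e \<bullet> (G (?P x y) *v b))"
   have cu: "cont2 uy" unfolding uy_def by (rule cont2_par[where h="%z. ?e \<bullet> (G z *v _)"],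
      intro continuous_intros cG)
   have "(f (?P x 0) $ i - f (?P x y) $ i)^2 <= int01 (%y. (uy x y)^2)"
   proof (rule oscillation_square[where g="%y. f (?P x y) $ i"])
    show "((%y. f (?P x y) $ i) has_real_derivative uy x t) (at t)" for t unfolding uy_def
     using has_derivative_along_line[OF fd, where c="?e" and q="p + x *R a" and v=b and t=t] by (simp add: inner_axis')
   qed (use y in \<open>auto intro: cont2_continuous[OF cu]\<close>)
   also have "... <= int01 (%y. (norm b)^2 * (norm (G (?P x y)))^2)"
   proof (rule integral_le)
    show "(%y. (uy x y)^2) integrable_on {0..1}" "(%y. (norm b)^2 * (norm (G (?P x y)))^2) integrable_on {0..1}"
     by (intro integrable_continuous_interval continuous_intros cont2_continuous[OF cu] cont2_continuous[OF cS])+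
    show "(uy x y)^2 <= (norm b)^2 * (norm (G (?P x y)))^2" for y using inner_matrix_le[of ?e "G (?P x y)" b] by (simp add: uy_def)
   qed
   finally have "(f (p + x *R a) $ i - f (?P x y) $ i)^2 <= (norm b)^2 * int01 (%y. (norm (G (?P x y)))^2)" by simp
   moreover have "r^2 <= 2 * s^2 + 2 * (r - s)^2" for r s :: real using zero_le_power2[of "r - 2 * s"] by (simp add: power2_eq_square algebra_simps)
   ultimately show ?thesis by (smt (verit, best))
  qed
  show ?thesis using comp[of 1] comp[of 2] unfolding n2[of "f _"] by (simp add: algebra_simps)
 qed
 have "int01 (%x. ?n (p + x *R a)) = sqint (%x y. ?n (p + x *R a))" by (rule sqint_fst[symmetric])
 also have "... <= sqint (%x y. 2 * ?n (?P x y) + 2 * (?B * int01 (%y. (norm (G (?P x y)))^2)))"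
 proof (rule sqint_mono)
  show "cont2 (%x y. ?n (p + x *R a))" by (rule cont2_fst) (intro continuous_intros continuous_on_compose2[OF cf]; simp)
  show "cont2 (%x y. 2 * ?n (?P x y) + 2 * (?B * int01 (%y. (norm (G (?P x y)))^2)))"
   by (intro cont2_add cont2_mult cont2_const cF cont2_fst cont2_integral_snd cS)
 qed (rule pt)
 also have "... = sqint (%x y. 2 * ?n (?P x y)) + sqint (%x y. 2 * (?B * int01 (%y. (norm (G (?P x y)))^2)))"
  by (rule sqint_add) (intro cont2_mult cont2_const cF cont2_fst cont2_integral_snd cS)+
 also have "... = 2 * (sqint (%x y. ?n (?P x y)) + ?B * sqint (%x y. (norm (G (?P x y)))^2))"
  by (simp add: sqint_cmult sqint_fst) (simp add: sqint_def)
 also have "... = 2 * sqint (%x y. ?n (?P x y) + ?B * (norm (G (?P x y)))^2)" by (simp add: sqint_add sqint_cmult cF cS cont2_mult cont2_const)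
 also have "... = (2 / \<bar>cross2 a b\<bar>) * (\<bar>cross2 a b\<bar> * sqint (%x y. ?n (?P x y) + ?B * (norm (G (?P x y)))^2))" using d by simp
 also have "\<bar>cross2 a b\<bar> * sqint (%x y. ?n (?P x y) + ?B * (norm (G (?P x y)))^2)
   = (LINT z|leb (par p a b). ?n z + ?B * (norm (G z))^2)" by (rule integral_par[OF _ d, symmetric]) (intro continuous_intros cf cG)
 finally show ?thesis .
qed

lemma norm2_vec2: "(norm v)^2 = (v$1)^2 + (v$2)^2" for v :: "real^2"
 by (simp add: norm_vec_def L2_set_def sum_2 sum_nonneg)

lemma norm2_mat2: "(norm M)^2 = (M$1$1)^2 + (M$1$2)^2 + (M$2$1)^2 + (M$2$2)^2" for M :: "real^2^2"
 by (simp add: norm_vec_def L2_set_def sum_2 sum_nonneg)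

definition skew :: "real => real^2^2" where
 "skew k = vector [vector [0, k / 2], vector [- k / 2, 0]]"

lemma norm_diff_skew: "(norm (G - skew k))^2 = (norm (symm G))^2 + (curl2 G - k)^2 / 2"
 unfolding norm2_mat2 by (simp add: skew_def symm_def curl2_def transpose_def power2_eq_square field_simps)

lemma norm_skew: "(norm (skew k))^2 = k^2 / 2" and norm_skew_mult: "(norm (skew k *v v))^2 = k^2 / 4 * (norm v)^2"
 unfolding norm2_mat2 norm2_vec2 by (simp_all add: skew_def matrix_vector_mult_def sum_2 power2_eq_square field_simps)

lemma norm_add_square_le: "(norm (x + y))^2 <= 2 * (norm x)^2 + 2 * (norm y)^2" for x y :: "'a::real_inner"
proof -
 have "(norm (x + y))^2 + (norm (x - y))^2 = 2 * (norm x)^2 + 2 * (norm y)^2" by (simp add: power2_norm_eq_inner inner_add inner_diff inner_commute)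
 thus ?thesis using zero_le_power2[of "norm (x - y)"] by linarith
qed

lemma norm_diff_square_le: "(norm (x - y))^2 <= 2 * (norm x)^2 + 2 * (norm y)^2" for x y :: "'a::real_inner"
 using norm_add_square_le[of x "- y"] by simp

text \<open>The integral splits into the contributions of mean and variance, and the variance of \<open>x\<close> over \<open>A\<close> is positive.\<close>

lemma affine_on_positive_set:
 assumes A: "A : sets borel" "A <= {0..1::real}" and pos: "measure lborel A > 0"
 shows "EX \<kappa>>0. ALL q0 q1 :: real^2. \<kappa> * ((norm q0)^2 + (norm q1)^2) <= (LINT x|leb A. (norm (q0 + x *R q1))^2)"
proof -
 have Al: "A : sets lebesgue" "A : lmeasurable" using A bounded_subset[OF bounded_closed_interval A(2)] by (auto intro: bounded_set_imp_lmeasurable)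
 have int: "integrable (leb A) h" if "cont h" for h :: "real => real"
 proof -
  have "h absolutely_integrable_on {0..1}" by (rule absolutely_integrable_continuous_real, rule continuous_on_subset[OF that]) simp
  hence "h absolutely_integrable_on A" by (rule set_integrable_subset) (use Al A in auto)
  thus ?thesis using Al by (simp add: integrable_lebesgue_on_iff)
 qed
 define m where "m = measure lebesgue A"
 have m: "m > 0" using pos A by (simp add: m_def measure_completion)
 define b where "b = (LINT x|leb A. x) / m"
 define W where "W = (LINT x|leb A. (x - b)^2)"
 have c: "(LINT x|leb A. r) = r * m" for r :: real using Al by (simp add: m_def measure_restrict_space)
 have W: "W > 0"
 proof -
  have "W >= 0" unfolding W_def by simp
  moreover have "W ~= 0"
  proof
   assume "W = 0"
   hence "AE x in leb A. (x - b)^2 = 0" unfolding W_def by (subst (asm) integral_nonneg_eq_0_iff_AE) (auto intro!: int continuous_intros)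
   hence "AE x in lebesgue. x : A --> x = b" using Al by (simp add: AE_restrict_space_iff)
   hence "negligible (A - {b})" unfolding negligible_iff_null_sets
    by (intro AE_iff_null_sets[THEN iffD2]) (use Al in \<open>auto elim: eventually_mono\<close>)
   hence "negligible (insert b (A - {b}))" by (simp only: negligible_insert)
   hence "negligible A" by (rule negligible_subset) auto
   thus False using m negligible_imp_measure0[of A] by (simp add: m_def)
  qed
  ultimately show ?thesis by simp
 qed
 have eq: "(LINT x|leb A. (norm (q0 + x *R q1))^2) = m * (norm (q0 + b *R q1))^2 + W * (norm q1)^2" for q0 q1 :: "real^2"
 proof -
  let ?r = "q0 + b *R q1"
  have e: "(norm (q0 + x *R q1))^2 = ((norm ?r)^2 + (2 * (?r \<bullet> q1)) * (x - b)) + (norm q1)^2 * (x - b)^2" for x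
  proof -
   show ?thesis unfolding power2_norm_eq_inner by (simp add: inner_add inner_diff inner_commute[of q1 q0] power2_eq_square algebra_simps)
  qed
  have z: "(LINT x|leb A. x - b) = 0"
  proof -
   have "(LINT x|leb A. x - b) = (LINT x|leb A. x) - (LINT x|leb A. b)" by (rule lint_diff) (intro int continuous_intros)+
   thus ?thesis unfolding c b_def using m by simp
  qed
  have "(LINT x|leb A. (norm (q0 + x *R q1))^2)
   = ((LINT x|leb A. (norm ?r)^2) + (LINT x|leb A. (2 * (?r \<bullet> q1)) * (x - b)))
    + (LINT x|leb A. (norm q1)^2 * (x - b)^2)"
  proof -
   have "(LINT x|leb A. (norm (q0 + x *R q1))^2)
    = (LINT x|leb A. (norm ?r)^2 + (2 * (?r \<bullet> q1)) * (x - b)) + (LINT x|leb A. (norm q1)^2 * (x - b)^2)"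
    by (subst ext[OF e], rule lint_add) (intro int continuous_intros)+
   also have "(LINT x|leb A. (norm ?r)^2 + (2 * (?r \<bullet> q1)) * (x - b))
    = (LINT x|leb A. (norm ?r)^2) + (LINT x|leb A. (2 * (?r \<bullet> q1)) * (x - b))" by (rule lint_add) (intro int continuous_intros)+
   finally show ?thesis .
  qed
  also have "... = m * (norm ?r)^2 + W * (norm q1)^2" unfolding integral_mult_right_zero z c W_def[symmetric] by simp
  finally show ?thesis .
 qed
 define K where "K = 2 / m + (2 * b^2 + 1) / W"
 have K: "K > 0" unfolding K_def using m W by (intro add_pos_nonneg divide_pos_pos divide_nonneg_pos) auto
 have main: "(norm q0)^2 + (norm q1)^2 <= K * (LINT x|leb A. (norm (q0 + x *R q1))^2)" for q0 q1 :: "real^2"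
 proof -
  define r s where "r = (norm (q0 + b *R q1))^2" and "s = (norm q1)^2"
  have rs: "r >= 0" "s >= 0" by (auto simp: r_def s_def)
  have "q0 = (q0 + b *R q1) - b *R q1" by simp
  hence "(norm q0)^2 <= 2 * r + 2 * (b^2 * s)" using norm_diff_square_le[of "q0 + b *R q1" "b *R q1"] by (simp add: r_def s_def power_mult_distrib)
  hence "(norm q0)^2 + s <= 2 * r + (2 * b^2 + 1) * s" by (simp add: algebra_simps)
  also have "... = 2 / m * (m * r) + (2 * b^2 + 1) / W * (W * s)" using m W by simp
  also have "... <= K * (m * r) + K * (W * s)" using m W rs by (intro add_mono mult_right_mono) (auto simp: K_def)
  finally show ?thesis unfolding eq r_def s_def by (simp add: algebra_simps)
 qed
 show ?thesis by (rule exI[of _ "1 / K"]) (use K main in \<open>simp add: field_simps\<close>)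
qed

lemma C1_grad_minus_affine:
 assumes "C1_grad f G"
 shows "C1_grad (%z. f z - (M *v z + c)) (%z. G z - M)"
proof -
 have "((%z. f z - (M *v z + c)) has_derivative (%h. G z *v h - (M *v h + 0))) (at z)" for z using assms unfolding C1_grad_def
  by (intro has_derivative_diff has_derivative_add has_derivative_const
   bounded_linear_imp_has_derivative matrix_vector_mul_bounded_linear) auto
 moreover have "(%h. (G z - M) *v h) = (%h. G z *v h - (M *v h + 0))" for z by (simp add: fun_eq_iff matrix_vector_mult_diff_rdistrib)
 moreover have "cont (%z. G z - M)" using assms unfolding C1_grad_def by (auto intro!: continuous_intros)
 ultimately show ?thesis unfolding C1_grad_def by (simp only: simp_thms)
qed

lemma C1_grad_continuous: "C1_grad f G ==> continuous_on S f" "C1_grad f G ==> continuous_on S G"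
proof -
 assume *: "C1_grad f G"
 hence "cont f" unfolding C1_grad_def by (meson continuous_at_imp_continuous_on has_derivative_continuous)
 thus "continuous_on S f" using continuous_on_subset by blast
 show "continuous_on S G" using * continuous_on_subset unfolding C1_grad_def by blast
qed

lemma polygon_facts:
 assumes "S = convex hull V" "finite (V :: (real^2) set)"
 shows "S : sets lebesgue" "bounded S" "S : lmeasurable"
proof -
 have "compact S" unfolding assms(1) by (intro finite_imp_compact_convex_hull assms)
 thus "S : sets lebesgue" "bounded S" "S : lmeasurable"
  by (auto intro: compact_imp_bounded lmeasurable_compact lmeasurable_compact[THEN fmeasurableD])
qed

lemma poincare_polygon:
 fixes S :: "(real^2) set"
 assumes S: "S = convex hull V" "finite V" "interior S ~= {}"
 shows "EX C>=0. ALL f G. C1_grad f G --> (EX c. (LINT z|leb S. (norm (f z - c))^2) <= C * (LINT z|leb S. (norm (G z))^2))"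
proof -
 note Sf = polygon_facts[OF S(1,2)]
 have "near_const {(f, G). C1_grad f G} (%u z. fst u z $ i) (%u. LINT z|leb S. (norm (snd u z))^2) S" for i by (rule near_const_polygon[OF S])
   (auto intro!: near_const_par_component Sf continuous_intros C1_grad_continuous)
 hence "EX C>=0. ALL u:{(f, G). C1_grad f G}.
   EX k. (LINT z|leb S. (fst u z $ i - k)^2) <= C * (LINT z|leb S. (norm (snd u z))^2)" for i unfolding near_const_def by blast
 then obtain C where C: "!!i. C i >= 0" and *: "!!i u. u : {(f, G). C1_grad f G} ==>
   EX k. (LINT z|leb S. (fst u z $ i - k)^2) <= C i * (LINT z|leb S. (norm (snd u z))^2)" by metis
 have "EX c. (LINT z|leb S. (norm (f z - c))^2) <= (C 1 + C 2) * (LINT z|leb S. (norm (G z))^2)" if f: "C1_grad f G" for f G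
 proof -
  obtain k where k: "!!i. (LINT z|leb S. (f z $ i - k i)^2) <= C i * (LINT z|leb S. (norm (G z))^2)" using *[of "(f, G)"] f by simp metis
  have "(LINT z|leb S. (norm (f z - (\<chi> i. k i)))^2)
    = (LINT z|leb S. (f z $ 1 - k 1)^2) + (LINT z|leb S. (f z $ 2 - k 2)^2)" unfolding norm2_vec2 by (subst lint_add[symmetric])
    (auto intro!: integrable_continuous_bounded continuous_intros C1_grad_continuous[OF f] Sf)
  thus ?thesis using k[of 1] k[of 2] by (intro exI[of _ "\<chi> i. k i"]) (simp add: algebra_simps)
 qed
 thus ?thesis using C by (intro exI[of _ "C 1 + C 2"]) auto
qed

lemma korn_polygon:
 fixes S :: "(real^2) set"
 assumes S: "S = convex hull V" "finite V" "interior S ~= {}"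
 shows "EX C>=0. ALL \<phi> G. smooth \<phi> & C1_grad \<phi> G -->
  (EX k. (LINT z|leb S. (norm (G z - skew k))^2) <= C * (LINT z|leb S. (norm (symm (G z)))^2))"
proof -
 note Sf = polygon_facts[OF S(1,2)]
 have "near_const {(\<phi>, G). smooth \<phi> & C1_grad \<phi> G} (%u z. curl2 (snd u z)) (%u. LINT z|leb S. (norm (symm (snd u z)))^2) S"
  by (rule near_const_polygon[OF S]) (auto intro!: near_const_par_curl Sf continuous_intros C1_grad_continuous)
 then obtain C where C: "C >= 0" and *: "!!u. u : {(\<phi>, G). smooth \<phi> & C1_grad \<phi> G} ==>
   EX k. (LINT z|leb S. (curl2 (snd u z) - k)^2) <= C * (LINT z|leb S. (norm (symm (snd u z)))^2)" unfolding near_const_def by blast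
 have "EX k. (LINT z|leb S. (norm (G z - skew k))^2) <= (1 + C / 2) * (LINT z|leb S. (norm (symm (G z)))^2)"
  if f: "smooth \<phi> & C1_grad \<phi> G" for \<phi> G
 proof -
  obtain k where k: "(LINT z|leb S. (curl2 (G z) - k)^2) <= C * (LINT z|leb S. (norm (symm (G z)))^2)" using *[of "(\<phi>, G)"] f by auto
  have cG: "cont G" using f C1_grad_continuous by blast
  have "(LINT z|leb S. (norm (G z - skew k))^2)
    = (LINT z|leb S. (norm (symm (G z)))^2) + (LINT z|leb S. (curl2 (G z) - k)^2 / 2)" unfolding norm_diff_skew by (rule lint_add)
    (auto intro!: integrable_continuous_bounded continuous_intros cG Sf)
  thus ?thesis using k by (intro exI[of _ k]) (simp add: algebra_simps)
 qed
 thus ?thesis using C by (intro exI[of _ "1 + C / 2"]) auto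
qed

text \<open>Korn's and Poincare's inequalities bound \<open>\<phi>\<close> up to a rigid motion. On the side \<open>p + x a\<close> of the parallelogram the rigid
 motion is close to \<open>\<phi>\<close>, and there it is an affine function that \<open>affine_on_positive_set\<close> bounds.\<close>

lemma smooth_korn_inequality:
 fixes S :: "(real^2) set"
 assumes S: "S = convex hull V" "finite V" "interior S ~= {}"
  and P: "par p a b <= S" "cross2 a b ~= 0"
  and A: "A : sets borel" "A <= {0..1}" "measure lborel A > 0"
 shows "EX C>=0. ALL \<phi> G. smooth \<phi> & C1_grad \<phi> G --> (LINT z|leb S. (norm (\<phi> z))^2) + (LINT z|leb S. (norm (G z))^2)
  <= C * ((LINT z|leb S. (norm (symm (G z)))^2) + (LINT x|leb A. (norm (\<phi> (p + x *R a)))^2))"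
proof -
 note Sf = polygon_facts[OF S(1,2)]
 obtain C1 where C1: "C1 >= 0" and korn: "!!\<phi> G. smooth \<phi> & C1_grad \<phi> G ==>
  EX k. (LINT z|leb S. (norm (G z - skew k))^2) <= C1 * (LINT z|leb S. (norm (symm (G z)))^2)" using korn_polygon[OF S] by blast
 obtain C2 where C2: "C2 >= 0" and poin: "!!f G. C1_grad f G ==>
  EX c. (LINT z|leb S. (norm (f z - c))^2) <= C2 * (LINT z|leb S. (norm (G z))^2)" using poincare_polygon[OF S] by blast
 obtain \<kappa> where kap: "\<kappa> > 0" and affine: "!!q0 q1 :: real^2. \<kappa> * ((norm q0)^2 + (norm q1)^2)
   <= (LINT x|leb A. (norm (q0 + x *R q1))^2)" using affine_on_positive_set[OF A] by blast
 obtain R where R: "R > 0" "!!z. z : S ==> norm z <= R" using Sf(2) by (auto simp: bounded_pos)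
 define m where "m = measure lebesgue S"
 have m: "m >= 0" by (simp add: m_def)
 have na: "norm a > 0" using P(2) by (auto simp: cross2_def)
 have Al: "A : sets lebesgue" using A by auto
 have intA: "integrable (leb A) h" if "cont h" for h :: "real => real"
 proof -
  have "h absolutely_integrable_on {0..1}" by (rule absolutely_integrable_continuous_real, rule continuous_on_subset[OF that]) simp
  hence "h absolutely_integrable_on A" by (rule set_integrable_subset) (use Al A in auto)
  thus ?thesis using Al by (simp add: integrable_lebesgue_on_iff)
 qed
 define C3 where "C3 = (2 / \<bar>cross2 a b\<bar>) * (C2 * C1 + 2 * (norm b)^2 * C1)"
 have C3: "C3 >= 0" using C1 C2 by (simp add: C3_def)
 define D where "D = (2 + 2 * C3) / \<kappa>"
 have D: "D >= 0" using C3 kap by (simp add: D_def)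
 define Dk where "Dk = 4 * D / (norm a)^2"
 have Dk: "Dk >= 0" using D by (simp add: Dk_def)
 define Dc where "Dc = 2 * D + 2 * (Dk / 4 * (norm p)^2)"
 have Dc: "Dc >= 0" using D Dk by (simp add: Dc_def)
 define C where "C = 2 * (C2 * C1) + 2 * (2 * (Dk / 4 * R^2) + 2 * Dc) * m + (2 * C1 + Dk * m)"
 have C: "C >= 0" using C1 C2 Dk Dc m R by (simp add: C_def)
 have main: "(LINT z|leb S. (norm (\<phi> z))^2) + (LINT z|leb S. (norm (G z))^2) <= C * (E + B)"
  if phi: "smooth \<phi> & C1_grad \<phi> G" and E: "E = (LINT z|leb S. (norm (symm (G z)))^2)"
   and B: "B = (LINT x|leb A. (norm (\<phi> (p + x *R a)))^2)" for \<phi> G E B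
 proof -
  have EB: "E >= 0" "B >= 0" unfolding E B by simp_all
  have g: "C1_grad \<phi> G" using phi by blast
  obtain k where k: "(LINT z|leb S. (norm (G z - skew k))^2) <= C1 * E" using korn[OF phi] E by blast
  obtain c where c: "(LINT z|leb S. (norm (\<phi> z - (skew k *v z + 0) - c))^2) <= C2 * (LINT z|leb S. (norm (G z - skew k))^2)"
   using poin[OF C1_grad_minus_affine[OF g, of "skew k" 0]] by blast
  define f where "f = (%z. \<phi> z - (skew k *v z + c))"
  define H where "H = (%z. G z - skew k)"
  have fH: "C1_grad f H" unfolding f_def H_def by (rule C1_grad_minus_affine[OF g])
  note cf = C1_grad_continuous[OF fH] and cg = C1_grad_continuous[OF g]
  note iS = integrable_continuous_bounded[OF _ Sf(1,2)]
  have H: "(LINT z|leb S. (norm (H z))^2) <= C1 * E" using k by (simp add: H_def)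
  have "(LINT z|leb S. (norm (f z))^2) = (LINT z|leb S. (norm (\<phi> z - (skew k *v z + 0) - c))^2)" by (simp add: f_def algebra_simps)
  also have "... <= C2 * (C1 * E)" using c mult_left_mono[OF k C2] by linarith
  finally have F: "(LINT z|leb S. (norm (f z))^2) <= C2 * C1 * E" by simp
  have tr: "int01 (%x. (norm (f (p + x *R a)))^2) <= C3 * E"
  proof -
   have "int01 (%x. (norm (f (p + x *R a)))^2) <=
    (2 / \<bar>cross2 a b\<bar>) * (LINT z|leb (par p a b). (norm (f z))^2 + 2 * (norm b)^2 * (norm (H z))^2)" by (rule trace_par[OF fH P(2)])
   also have "... <= (2 / \<bar>cross2 a b\<bar>) * (LINT z|leb S. (norm (f z))^2 + 2 * (norm b)^2 * (norm (H z))^2)"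
    by (intro mult_left_mono integral_mono_set iS continuous_intros cf P Sf) auto
   also have "(LINT z|leb S. (norm (f z))^2 + 2 * (norm b)^2 * (norm (H z))^2)
    = (LINT z|leb S. (norm (f z))^2) + (LINT z|leb S. 2 * (norm b)^2 * (norm (H z))^2)" by (rule lint_add) (intro iS continuous_intros cf)+
   also have "... <= C2 * C1 * E + 2 * (norm b)^2 * (C1 * E)" unfolding integral_mult_right_zero by (intro add_mono F mult_left_mono H) auto
   finally show ?thesis unfolding C3_def by (simp add: algebra_simps mult_left_mono divide_right_mono)
  qed
  have cfa: "continuous_on T (%x. f (p + x *R a))" and cpa: "continuous_on T (%x. \<phi> (p + x *R a))" for T
   by (rule continuous_on_compose2[OF C1_grad_continuous(1)[OF fH, of UNIV]]
     continuous_on_compose2[OF C1_grad_continuous(1)[OF g, of UNIV]]; intro continuous_intros subset_UNIV)+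
  have FA: "(LINT x|leb A. (norm (f (p + x *R a)))^2) <= C3 * E"
  proof -
   let ?h = "%x. (norm (f (p + x *R a)))^2"
   have "?h absolutely_integrable_on {0..1}" by (intro absolutely_integrable_continuous_real continuous_intros cfa)
   moreover from this have "?h absolutely_integrable_on A" by (rule set_integrable_subset) (use Al A in auto)
   ultimately have "integral A ?h <= int01 ?h" by (intro integral_subset_le set_lebesgue_integral_eq_integral(1) A) auto
   moreover have "(LINT x|leb A. ?h x) = integral A ?h" by (rule lebesgue_integral_eq_integral[OF intA Al]) (intro continuous_intros cfa)
   ultimately show ?thesis using tr by simp
  qed
  define q0 q1 where "q0 = skew k *v p + c" and "q1 = skew k *v a"
  have q: "q0 + x *R q1 = \<phi> (p + x *R a) - f (p + x *R a)" for x
   unfolding q0_def q1_def f_def by (simp add: matrix_vector_right_distrib matrix_vector_mult_scaleR)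
  have "(LINT x|leb A. (norm (q0 + x *R q1))^2) <= (LINT x|leb A. 2 * (norm (\<phi> (p + x *R a)))^2 + 2 * (norm (f (p + x *R a)))^2)"
   unfolding q by (intro integral_mono intA continuous_intros cfa cpa norm_diff_square_le)
  also have "... = 2 * B + 2 * (LINT x|leb A. (norm (f (p + x *R a)))^2)" unfolding B integral_mult_right_zero[symmetric]
   by (rule lint_add) (intro intA continuous_intros cfa cpa)+
  also have "... <= (2 + 2 * C3) * (E + B)" using FA EB mult_nonneg_nonneg[OF EB(2) C3] by (simp add: algebra_simps)
  finally have "\<kappa> * ((norm q0)^2 + (norm q1)^2) <= (2 + 2 * C3) * (E + B)" using affine[of q0 q1] by linarith
  hence qD: "(norm q0)^2 + (norm q1)^2 <= D * (E + B)" unfolding D_def using kap by (simp add: field_simps)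
  have "k^2 / 4 * (norm a)^2 <= D * (E + B)" using qD zero_le_power2[of "norm q0"] unfolding q1_def norm_skew_mult by linarith
  hence kD: "k^2 <= Dk * (E + B)" unfolding Dk_def using na by (simp add: field_simps)
  have c_eq: "c = q0 - skew k *v p" by (simp add: q0_def)
  have kp: "k^2 / 4 * (norm p)^2 <= Dk / 4 * (norm p)^2 * (E + B)" using mult_right_mono[OF kD, of "(norm p)^2 / 4"] by (simp add: algebra_simps)
  have q0D: "(norm q0)^2 <= D * (E + B)" using qD zero_le_power2[of "norm q1"] by linarith
  have cD: "(norm c)^2 <= Dc * (E + B)" using norm_diff_square_le[of q0 "skew k *v p"] q0D kp
   unfolding c_eq[symmetric] norm_skew_mult Dc_def distrib_right by simp
  define r where "r = (2 * (Dk / 4 * R^2) + 2 * Dc) * (E + B)"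
  have aff: "(norm (skew k *v z + c))^2 <= r" if z: "z : S" for z
  proof -
   have "(norm z)^2 <= R^2" using R(2)[OF z] by (intro power_mono) auto
   hence "k^2 / 4 * (norm z)^2 <= (Dk * (E + B)) / 4 * R^2" using kD Dk EB by (intro mult_mono) auto
   also have "... = (Dk / 4 * R^2) * (E + B)" by simp
   finally show ?thesis using norm_add_square_le[of "skew k *v z" c] cD unfolding norm_skew_mult r_def distrib_right[of "2 * (Dk / 4 * R^2)"]
    by (simp only: mult.assoc)
  qed
  have "(LINT z|leb S. (norm (\<phi> z))^2) <= (LINT z|leb S. 2 * (norm (f z))^2 + 2 * r)"
  proof (rule integral_mono)
   fix z assume "z : space (leb S)"
   hence z: "z : S" by simp
   have "\<phi> z = f z + (skew k *v z + c)" by (simp add: f_def)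
   thus "(norm (\<phi> z))^2 <= 2 * (norm (f z))^2 + 2 * r" using norm_add_square_le[of "f z" "skew k *v z + c"] aff[OF z] by simp
  qed (intro iS continuous_intros cf cg)+
  also have "... = 2 * (LINT z|leb S. (norm (f z))^2) + 2 * r * m" using Sf(1) by (subst lint_add, (intro iS continuous_intros cf)+)
    (simp add: m_def measure_restrict_space)
  also have "... <= 2 * (C2 * C1 * E) + 2 * r * m" using F by simp
  finally have p1: "(LINT z|leb S. (norm (\<phi> z))^2) <= 2 * (C2 * C1 * E) + 2 * r * m" .
  have "(LINT z|leb S. (norm (G z))^2) <= (LINT z|leb S. 2 * (norm (H z))^2 + Dk * (E + B))"
  proof (rule integral_mono)
   fix z
   have "G z = H z + skew k" by (simp add: H_def)
   thus "(norm (G z))^2 <= 2 * (norm (H z))^2 + Dk * (E + B)" using norm_add_square_le[of "H z" "skew k"] kD unfolding norm_skew by simp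
  qed (intro iS continuous_intros cf cg)+
  also have "... = 2 * (LINT z|leb S. (norm (H z))^2) + Dk * (E + B) * m" using Sf(1) by (subst lint_add, (intro iS continuous_intros cf)+)
    (simp add: m_def measure_restrict_space)
  also have "... <= 2 * (C1 * E) + Dk * (E + B) * m" using H by simp
  finally have p2: "(LINT z|leb S. (norm (G z))^2) <= 2 * (C1 * E) + Dk * (E + B) * m" .
  have "2 * (C2 * C1 * E) + 2 * r * m + (2 * (C1 * E) + Dk * (E + B) * m) <= C * (E + B)"
  proof -
   have "2 * (C2 * C1 * E) <= 2 * (C2 * C1) * (E + B)" "2 * (C1 * E) <= 2 * C1 * (E + B)" using C1 C2 EB by (simp_all add: mult_left_mono)
   thus ?thesis unfolding C_def r_def by (simp add: algebra_simps)
  qed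
  thus ?thesis using p1 p2 by linarith
 qed
 show ?thesis by (rule exI[of _ C], intro conjI C allI impI, rule main) auto
qed

section \<open>Square integrable functions\<close>

lemma L2I: "f : borel_measurable (leb Om) ==> integrable (leb Om) (%x. (norm (f x))^2) ==> f : L2 Om"
 by (simp add: L2_def)

lemma L2_measurable: "f : L2 Om ==> f : borel_measurable (leb Om)"
 and L2_integrable: "f : L2 Om ==> integrable (leb Om) (%x. (norm (f x))^2)" by (simp_all add: L2_def)

lemma L2_dominated:
 assumes "f : borel_measurable (leb Om)" "integrable (leb Om) h"
  and "AE x in leb Om. (norm (f x))^2 <= h x"
 shows "f : L2 Om"
proof (rule L2I[OF assms(1)], rule lintegrable_bound[OF assms(2)])
 show "AE x in leb Om. norm ((norm (f x))^2) <= norm (h x)" using assms(3) by eventually_elim (auto intro: order_trans)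
 show "(%x. (norm (f x))^2) : borel_measurable (leb Om)" using assms(1) by measurable
qed

lemma L2_inner_integrable:
 assumes "f : L2 Om" "g : L2 Om"
 shows "integrable (leb Om) (%x. f x \<bullet> g x)"
proof (rule lintegrable_bound)
 show "integrable (leb Om) (%x. (norm (f x))^2 + (norm (g x))^2)" by (intro lintegrable_add L2_integrable assms)
 show "(%x. f x \<bullet> g x) : borel_measurable (leb Om)" using assms[THEN L2_measurable] by measurable
 have "\<bar>a \<bullet> b\<bar> <= (norm a)^2 + (norm b)^2" for a b :: 'a
 proof -
  have "\<bar>a \<bullet> b\<bar> <= norm a * norm b" by (rule Cauchy_Schwarz_ineq2)
  also have "... <= (norm a)^2 + (norm b)^2"
   using sum_squares_bound[of "norm a" "norm b"] mult_nonneg_nonneg[OF norm_ge_zero[of a] norm_ge_zero[of b]] by linarith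
  finally show ?thesis .
 qed
 thus "AE x in leb Om. norm (f x \<bullet> g x) <= norm ((norm (f x))^2 + (norm (g x))^2)" by (auto intro: order_trans)
qed

lemma L2_add: 
 assumes "f : L2 Om" "g : L2 Om" shows "(%x. f x + g x) : L2 Om"
proof (rule L2_dominated)
 show "(%x. f x + g x) : borel_measurable (leb Om)" using assms[THEN L2_measurable] by measurable
 show "integrable (leb Om) (%x. 2 * (norm (f x))^2 + 2 * (norm (g x))^2)" by (intro lintegrable_add integrable_mult_right L2_integrable assms)
qed (simp add: norm_add_square_le)

lemma L2_bounded_linear:
 assumes "bounded_linear h" "f : L2 Om" shows "(%x. h (f x)) : L2 Om"
proof -
 interpret bounded_linear h by fact
 obtain K where K: "!!x. norm (h x) <= norm x * K" using bounded by blast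
 show ?thesis
 proof (rule L2_dominated)
  show "(%x. h (f x)) : borel_measurable (leb Om)"
   using measurable_compose[OF L2_measurable[OF assms(2)] borel_measurable_continuous_onI[OF linear_continuous_on[OF assms(1)]]] .
  show "integrable (leb Om) (%x. K^2 * (norm (f x))^2)" by (intro integrable_mult_right L2_integrable assms)
  have "(norm (h (f x)))^2 <= K^2 * (norm (f x))^2" for x using power_mono[OF K[of "f x"], of 2] by (simp add: power_mult_distrib mult.commute)
  thus "AE x in leb Om. (norm (h (f x)))^2 <= K^2 * (norm (f x))^2" by simp
 qed
qed

lemma L2_scaleR: "f : L2 Om ==> (%x. c *R f x) : L2 Om"
 by (rule L2_bounded_linear[OF bounded_linear_scaleR_right])

lemma L2_diff: "f : L2 Om ==> g : L2 Om ==> (%x. f x - g x) : L2 Om"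
 using L2_add[of f Om "%x. (-1) *R g x"] L2_scaleR[of g Om "-1"] by simp

lemma L2_zero: "(%x. 0) : L2 Om" by (rule L2I) auto

lemma L2_norm_nonneg: "L2_norm Om f >= 0" by (simp add: L2_norm_def)

lemma L2_norm_power2: "(L2_norm Om f)^2 = (LINT x|leb Om. (norm (f x))^2)"
 by (simp add: L2_norm_def)

lemma L2_norm_cong_AE:
 assumes "f : L2 Om" "g : L2 Om" "AE x in leb Om. f x = g x"
 shows "L2_norm Om f = L2_norm Om g" unfolding L2_norm_def by (rule arg_cong[where f=sqrt], rule integral_cong_AE)
  (use assms(3) L2_integrable[OF assms(1)] L2_integrable[OF assms(2)] in \<open>auto elim: eventually_mono\<close>)

lemma L2_norm_scaleR: "L2_norm Om (%x. c *R f x) = \<bar>c\<bar> * L2_norm Om f"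
 by (simp add: L2_norm_def power_mult_distrib real_sqrt_mult)

lemma L2_norm_eq_0:
 assumes "f : L2 Om" "L2_norm Om f = 0" shows "AE x in leb Om. f x = 0"
proof -
 have "(LINT x|leb Om. (norm (f x))^2) = 0" using assms(2) by (simp add: L2_norm_def)
 hence "AE x in leb Om. (norm (f x))^2 = 0" by (subst (asm) integral_nonneg_eq_0_iff_AE) (auto intro: L2_integrable assms)
 thus ?thesis by simp
qed

lemma L2_Cauchy_Schwarz:
 assumes f: "f : L2 Om" and g: "g : L2 Om"
 shows "\<bar>LINT x|leb Om. f x \<bullet> g x\<bar> <= L2_norm Om f * L2_norm Om g"
proof -
 define A B C where "A = (LINT x|leb Om. (norm (f x))^2)"
  and "B = (LINT x|leb Om. f x \<bullet> g x)" and "C = (LINT x|leb Om. (norm (g x))^2)"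
 note i = L2_integrable[OF f] L2_integrable[OF g] L2_inner_integrable[OF f g]
 have q: "0 <= A - 2 * t * B + t^2 * C" for t
 proof -
  have "0 <= (LINT x|leb Om. (norm (f x - t *R g x))^2)" by simp
  also have "... = (LINT x|leb Om. ((norm (f x))^2 - (2 * t) * (f x \<bullet> g x)) + t^2 * (norm (g x))^2)" unfolding power2_norm_eq_inner
   by (rule lint_cong) (simp_all add: inner_diff inner_commute power2_eq_square algebra_simps)
  also have "... = A - (2 * t) * B + t^2 * C" using i by (simp add: lint_add lint_diff A_def B_def C_def)
  finally show ?thesis .
 qed
 have AC: "A >= 0" "C >= 0" by (simp_all add: A_def C_def)
 have "B^2 <= A * C"
 proof (cases "C = 0")
  case True
  hence "AE x in leb Om. g x = 0" using L2_norm_eq_0[OF g] by (simp add: L2_norm_def C_def)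
  hence "B = (LINT x|leb Om. 0)" unfolding B_def using i by (intro integral_cong_AE) (auto elim: eventually_mono)
  thus ?thesis using True by simp
 next
  case False
  thus ?thesis using q[of "B / C"] AC by (simp add: power2_eq_square field_simps)
 qed
 hence "sqrt (B^2) <= sqrt (A * C)" by (rule real_sqrt_le_mono)
 thus ?thesis unfolding L2_norm_def A_def[symmetric] B_def[symmetric] C_def[symmetric] by (simp add: real_sqrt_mult)
qed

lemma L2_norm_triangle:
 assumes f: "f : L2 Om" and g: "g : L2 Om"
 shows "L2_norm Om (%x. f x + g x) <= L2_norm Om f + L2_norm Om g"
proof (rule power2_le_imp_le)
 note i = L2_integrable[OF f] L2_integrable[OF g] L2_inner_integrable[OF f g]
 have "(L2_norm Om (%x. f x + g x))^2 = (LINT x|leb Om. ((norm (f x))^2 + 2 * (f x \<bullet> g x)) + (norm (g x))^2)" unfolding L2_norm_power2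
  by (rule lint_cong) (simp_all add: power2_norm_eq_inner inner_add inner_commute algebra_simps)
 also have "... = (L2_norm Om f)^2 + 2 * (LINT x|leb Om. f x \<bullet> g x) + (L2_norm Om g)^2" using i by (simp add: lint_add L2_norm_power2)
 also have "... <= (L2_norm Om f + L2_norm Om g)^2" using L2_Cauchy_Schwarz[OF f g] by (simp add: power2_sum)
 finally show "(L2_norm Om (%x. f x + g x))^2 <= (L2_norm Om f + L2_norm Om g)^2" .
qed (simp add: L2_norm_nonneg)

lemma L2_norm_triangle_diff:
 assumes f: "f : L2 Om" and g: "g : L2 Om"
 shows "L2_norm Om (%x. f x - g x) <= L2_norm Om f + L2_norm Om g"
 using L2_norm_triangle[OF f L2_scaleR[OF g, of "-1"]] L2_norm_scaleR[of Om "-1" g] by simp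

lemma L2_norm_mono:
 assumes "f : L2 Om" "g : L2 Om" "AE x in leb Om. norm (f x) <= norm (g x)"
 shows "L2_norm Om f <= L2_norm Om g" unfolding L2_norm_def by (rule real_sqrt_le_mono, rule integral_mono_AE)
  (use assms in \<open>auto intro: L2_integrable elim!: eventually_mono intro!: power_mono\<close>)

lemma continuous_bounded_L2:
 fixes f :: "real^2 => 'b::euclidean_space"
 assumes "cont f" "Om : sets lebesgue" "bounded Om"
 shows "f : L2 Om"
proof (rule L2I)
 show "f : borel_measurable (leb Om)" using integrable_continuous_bounded[OF assms] by auto
 show "integrable (leb Om) (%x. (norm (f x))^2)" by (intro integrable_continuous_bounded continuous_intros assms)
qed

section \<open>Bump functions\<close>

text \<open>\<open>p(1/t) exp(-1/t)\<close>, extended by zero; this class is closed under differentiation.\<close>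

definition flat_exp :: "real poly => real => real" where
 "flat_exp p t = (if t > 0 then poly p (1 / t) * exp (- 1 / t) else 0)"

lemma poly_times_exp_tendsto_0: "((%s. poly p s * exp (- s)) \<longlongrightarrow> 0) at_top" for p :: "real poly"
proof -
 have "((%s. \<Sum>i\<le>degree p. coeff p i * (s ^ i / exp s)) \<longlongrightarrow> (\<Sum>i\<le>degree p. coeff p i * 0)) at_top"
  by (intro tendsto_intros tendsto_power_div_exp_0)
 thus ?thesis by (simp add: poly_altdef exp_minus divide_inverse sum_distrib_right mult.assoc)
qed

lemma flat_exp_tendsto_0: "((%t. flat_exp p t) \<longlongrightarrow> 0) (at 0)"
proof (rule filterlim_split_at)
 show "((%t. flat_exp p t) \<longlongrightarrow> 0) (at_left 0)" by (rule tendsto_eventually) (auto simp: flat_exp_def eventually_at_filter)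
 have "((%t. poly p (inverse t) * exp (- (inverse t))) \<longlongrightarrow> 0) (at_right 0)"
  by (rule filterlim_compose[OF poly_times_exp_tendsto_0 filterlim_inverse_at_top_right])
 thus "((%t. flat_exp p t) \<longlongrightarrow> 0) (at_right 0)" by (rule Lim_transform_eventually)
   (auto simp: flat_exp_def eventually_at_filter inverse_eq_divide)
qed

lemma flat_exp_deriv:
 "(flat_exp p has_real_derivative flat_exp (monom 1 2 * (p - pderiv p)) t) (at t)"
proof (cases t "0::real" rule: linorder_cases)
 case less
 have "((%t. 0) has_real_derivative flat_exp (monom 1 2 * (p - pderiv p)) t) (at t)" using less by (simp add: flat_exp_def)
 thus ?thesis by (rule DERIV_cong_ev[THEN iffD1, rotated -1])
   (use less eventually_nhds_in_open[of "{..<0}" t] in \<open>auto simp: flat_exp_def elim!: eventually_mono\<close>)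
next
 case greater
 have "((%t. poly p (1 / t) * exp (- 1 / t)) has_real_derivative flat_exp (monom 1 2 * (p - pderiv p)) t) (at t)" using greater
  by (auto intro!: derivative_eq_intros DERIV_chain2[where f="poly p"] poly_DERIV
   simp: flat_exp_def poly_monom power2_eq_square field_simps)
 thus ?thesis by (rule DERIV_cong_ev[THEN iffD1, rotated -1])
   (use greater eventually_nhds_in_open[of "{0<..}" t] in \<open>auto simp: flat_exp_def elim!: eventually_mono\<close>)
next
 case equal
 have "((%s. (flat_exp p s - flat_exp p 0) / (s - 0)) \<longlongrightarrow> 0) (at 0)"
  by (rule Lim_transform_eventually[OF flat_exp_tendsto_0[of "monom 1 1 * p"]]) (auto simp: flat_exp_def poly_monom eventually_at_filter)
 thus ?thesis using equal by (simp add: has_field_derivative_iff flat_exp_def)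
qed

text \<open>Closure under products makes higher derivatives of \<open>box_bump\<close> accessible without computing them.\<close>

inductive_set flat_algebra :: "(real => real) set" where
 base: "(%x. flat_exp p (c * x + d)) : flat_algebra"
| add: "f : flat_algebra ==> g : flat_algebra ==> (%x. f x + g x) : flat_algebra"
| mult: "f : flat_algebra ==> g : flat_algebra ==> (%x. f x * g x) : flat_algebra"

lemma flat_algebra_deriv:
 assumes "f : flat_algebra"
 shows "EX f':flat_algebra. ALL x. (f has_real_derivative f' x) (at x)" using assms
proof induction
 case (base p c d)
 let ?q = "smult c (monom 1 2 * (p - pderiv p))"
 have sm: "flat_exp (smult c q) t = c * flat_exp q t" for q t by (simp add: flat_exp_def)
 have "((%x. flat_exp p (c * x + d)) has_real_derivative flat_exp ?q (c * x + d)) (at x)" for x unfolding sm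
  by (rule DERIV_chain2[OF flat_exp_deriv, THEN DERIV_cong]) (auto intro!: derivative_eq_intros)
 thus ?case by (intro bexI[of _ "%x. flat_exp ?q (c * x + d)"] allI flat_algebra.base)
next
 case (add f g)
 then obtain f' g' where *: "f' : flat_algebra" "!!x. (f has_real_derivative f' x) (at x)"
  "g' : flat_algebra" "!!x. (g has_real_derivative g' x) (at x)" by blast
 hence "((%x. f x + g x) has_real_derivative f' x + g' x) (at x)" for x by (auto intro!: derivative_eq_intros)
 thus ?case using flat_algebra.add[OF *(1,3)] by (intro bexI[of _ "%x. f' x + g' x"]) auto
next
 case (mult f g)
 then obtain f' g' where *: "f' : flat_algebra" "!!x. (f has_real_derivative f' x) (at x)"
  "g' : flat_algebra" "!!x. (g has_real_derivative g' x) (at x)" by blast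
 hence "((%x. f x * g x) has_real_derivative f' x * g x + f x * g' x) (at x)" for x by (auto intro!: derivative_eq_intros)
 thus ?case using flat_algebra.add[OF flat_algebra.mult[OF *(1) mult.hyps(2)] flat_algebra.mult[OF mult.hyps(1) *(3)]]
  by (intro bexI[of _ "%x. f' x * g x + f x * g' x"]) auto
qed

lemma flat_algebra_derivative_sequence:
 assumes "f : flat_algebra"
 obtains d where "d 0 = f" "!!k x. (d k has_real_derivative d (Suc k) x) (at x)"
proof -
 obtain D where D: "!!f. f : flat_algebra ==> D f : flat_algebra & (ALL x. (f has_real_derivative D f x) (at x))" using flat_algebra_deriv by metis
 have "(D ^^ k) f : flat_algebra" for k by (induction k) (use D assms in auto)
 thus ?thesis using D by (intro that[of "%k. (D ^^ k) f"]) auto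
qed

lemma smooth_tensor:
 assumes "f : flat_algebra" "g : flat_algebra"
 shows "smooth (%z::real^2. f (z$1) * g (z$2))"
proof -
 obtain d where d: "d 0 = f" "!!k x. (d k has_real_derivative d (Suc k) x) (at x)" using flat_algebra_derivative_sequence[OF assms(1)] by blast
 obtain e where e: "e 0 = g" "!!k x. (e k has_real_derivative e (Suc k) x) (at x)" using flat_algebra_derivative_sequence[OF assms(2)] by blast
 have nth: "((%z::real^2. h (z $ i)) has_derivative (%v. v $ i * h' (z $ i))) (at z)" if "!!x. (h has_real_derivative h' x) (at x)" for h h' i z
 proof -
  have "((%z::real^2. h (z $ i)) has_derivative (%v. h' (z $ i) * v $ i)) (at z)" using that[of "z $ i"] unfolding has_field_derivative_def
   by (rule has_derivative_compose[OF vec_nth_has_derivative])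
  thus ?thesis by (simp add: mult.commute)
 qed
 show ?thesis unfolding smooth_def
 proof (intro exI[of _ "%i j z. d i (z$1) * e j (z$2)"] conjI allI)
  show "(%z. d 0 (z$1) * e 0 (z$2)) = (%z::real^2. f (z$1) * g (z$2))" using d e by simp
  fix i j and x :: "real^2"
  show "((%z. d i (z$1) * e j (z$2)) has_derivative (%h. h$1 *R (d (Suc i) (x$1) * e j (x$2)) + h$2 *R (d i (x$1) * e (Suc j) (x$2)))) (at x)"
   by (rule has_derivative_eq_rhs[OF has_derivative_mult[OF nth[OF d(2)] nth[OF e(2)]]]) (simp add: fun_eq_iff algebra_simps)
 qed
qed

text \<open>Positive exactly on the box between \<open>l\<close> and \<open>u\<close>, and tending to its indicator.\<close>

definition box_bump :: "real^2 => real^2 => nat => real^2 => real" where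
 "box_bump l u n z = (\<Prod>i\<in>{1, 2}. flat_exp 1 (real (Suc n) * z $ i + - (real (Suc n) * l $ i)) *
   flat_exp 1 (- real (Suc n) * z $ i + real (Suc n) * u $ i))"

lemma flat_exp_1: "0 <= flat_exp 1 t" "flat_exp 1 t <= 1" "flat_exp 1 t ~= 0 \<longleftrightarrow> t > 0"
 by (auto simp: flat_exp_def)

lemma box_bump_bounds: "0 <= box_bump l u n z" "box_bump l u n z <= 1"
 unfolding box_bump_def using flat_exp_1 by (auto intro!: prod_nonneg prod_le_1 mult_le_one)

lemma box_bump_nonzero: "box_bump l u n z ~= 0 \<longleftrightarrow> z : box l u"
proof -
 have p: "real (Suc n) * s + - (real (Suc n) * t) > 0 \<longleftrightarrow> t < s" "- real (Suc n) * t + real (Suc n) * s > 0 \<longleftrightarrow> t < s" for s t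
 proof -
  have "real (Suc n) * s + - (real (Suc n) * t) = real (Suc n) * (s - t)"
   "- real (Suc n) * t + real (Suc n) * s = real (Suc n) * (s - t)" by (simp_all add: algebra_simps)
  thus "real (Suc n) * s + - (real (Suc n) * t) > 0 \<longleftrightarrow> t < s" "- real (Suc n) * t + real (Suc n) * s > 0 \<longleftrightarrow> t < s"
   by (simp_all add: zero_less_mult_iff)
 qed
 have "box_bump l u n z ~= 0 \<longleftrightarrow> (ALL i:{1,2}. l $ i < z $ i & z $ i < u $ i)" unfolding box_bump_def using flat_exp_1(3) p by simp
 thus ?thesis by (auto simp: mem_box_cart forall_2)
qed

lemma test_function_box_bump:
 assumes "cbox l u <= Om"
 shows "test_function Om (box_bump l u n)"
proof -
 have "box_bump l u n = (%z. (flat_exp 1 (real (Suc n) * z $ 1 + - (real (Suc n) * l $ 1)) *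
   flat_exp 1 (- real (Suc n) * z $ 1 + real (Suc n) * u $ 1)) * (flat_exp 1 (real (Suc n) * z $ 2 + - (real (Suc n) * l $ 2)) *
   flat_exp 1 (- real (Suc n) * z $ 2 + real (Suc n) * u $ 2)))" by (simp add: fun_eq_iff box_bump_def)
 hence "smooth (box_bump l u n)" using smooth_tensor[OF flat_algebra.mult[OF flat_algebra.base flat_algebra.base]
    flat_algebra.mult[OF flat_algebra.base flat_algebra.base]] by (simp only:)
 moreover have "{z. box_bump l u n z ~= 0} = box l u" using box_bump_nonzero by blast
 moreover have "closure (box l u) <= cbox l u" by (intro closure_minimal box_subset_cbox closed_cbox)
 moreover from this have "compact (closure (box l u))" by (meson bounded_box compact_closure)
 ultimately show ?thesis using assms unfolding test_function_def by auto
qed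

lemma box_bump_tendsto: "(%n. box_bump l u n z) \<longlonglongrightarrow> indicator (box l u) z"
proof (cases "z : box l u")
 case False
 hence "box_bump l u n z = 0" for n using box_bump_nonzero by blast
 thus ?thesis using False by simp
next
 case True
 have lim: "(%n. flat_exp 1 (real (Suc n) * t)) \<longlonglongrightarrow> 1" if "t > 0" for t
 proof -
  have "(%n. exp (- (1 / t) * inverse (real (Suc n)))) \<longlonglongrightarrow> exp (- (1 / t) * 0)"
   by (intro tendsto_intros LIMSEQ_inverse_real_of_nat)
  moreover have "flat_exp 1 (real (Suc n) * t) = exp (- (1 / t) * inverse (real (Suc n)))" for n
   using that by (simp add: flat_exp_def divide_inverse mult.commute)
  ultimately show ?thesis by simp
 qed
 have b: "z $ i - l $ i > 0" "u $ i - z $ i > 0" for i using True by (auto simp: mem_box_cart)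
 have "box_bump l u n z = (\<Prod>i\<in>{1, 2}. flat_exp 1 (real (Suc n) * (z $ i - l $ i)) * flat_exp 1 (real (Suc n) * (u $ i - z $ i)))" for n
  unfolding box_bump_def by (simp add: algebra_simps)
 moreover have "(%n. \<Prod>i\<in>{1, 2::2}. flat_exp 1 (real (Suc n) * (z $ i - l $ i)) * flat_exp 1 (real (Suc n) * (u $ i - z $ i)))
   \<longlonglongrightarrow> (\<Prod>i\<in>{1, 2::2}. 1 * 1)" by (intro tendsto_prod tendsto_mult lim b)
 ultimately show ?thesis using True by simp
qed

section \<open>Test functions determine integrable functions\<close>

lemma AE_zero_of_box_integrals:
 fixes h :: "real^2 => real"
 assumes h: "integrable lborel h" and tot: "(LINT x|lborel. h x) = 0"
  and box: "!!l u. (LINT x|lborel. indicator (box l u) x * h x) = 0"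
 shows "AE x in lborel. h x = 0"
proof -
 have int: "integrable lborel (%x. indicator A x * h x)" if "A : sets borel" for A using integrable_mult_indicator[OF _ h, of A] that by simp
 have all: "(LINT x|lborel. indicator A x * h x) = 0" if "A : sets borel" for A
 proof -
  have "Int_stable (range (%(a, b). box a b :: (real^2) set))" by (auto simp: Int_stable_def box_Int_box)
  moreover have "range (%(a, b). box a b :: (real^2) set) <= Pow UNIV" by simp
  moreover have "A : sigma_sets UNIV (range (%(a, b). box a b :: (real^2) set))" using that unfolding borel_eq_box by (simp add: sets_measure_of)
  ultimately show ?thesis
  proof (induction rule: sigma_sets_induct_disjoint)
   case (basic A) then show ?case using box by auto
  next
   case empty then show ?case by simp
  next
   case (compl A)
   hence A: "A : sets borel" unfolding borel_eq_box by (simp add: sets_measure_of)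
   have "(LINT x|lborel. indicator (UNIV - A) x * h x) = (LINT x|lborel. h x - indicator A x * h x)" by (rule lint_cong) (auto simp: indicator_def)
   also have "... = 0" using int[OF A] h compl tot by (simp add: lint_diff)
   finally show ?case .
  next
   case (union A)
   hence A: "A i : sets borel" for i unfolding borel_eq_box by (auto simp: sets_measure_of)
   have "(LINT x:(\<Union>i. A i)|lborel. h x) = (\<Sum>i. (LINT x:(A i)|lborel. h x))" by (rule lebesgue_integral_countable_add)
     (use A union int[of "\<Union>i. A i"] in \<open>auto simp: disjoint_family_on_def set_integrable_def\<close>)
   thus ?case using union by (simp add: set_lebesgue_integral_def)
  qed
 qed
 have hm[measurable]: "h : borel_measurable borel" using h by auto
 let ?P = "{x. h x > 0}" and ?N = "{x. h x < 0}"
 have PN: "?P : sets borel" "?N : sets borel" by measurable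
 have "AE x in lborel. indicator ?P x * h x = 0" using all[OF PN(1)] int[OF PN(1)]
  by (subst (asm) integral_nonneg_eq_0_iff_AE) (auto simp: indicator_def)
 moreover have "AE x in lborel. - (indicator ?N x * h x) = 0"
  using all[OF PN(2)] int[OF PN(2)] integral_nonneg_eq_0_iff_AE[of lborel "%x. - (indicator ?N x * h x)"]
  by (auto simp: indicator_def split: if_splits)
 ultimately show ?thesis by eventually_elim (auto simp: indicator_def split: if_splits)
qed

lemma L2_imp_integrable:
 fixes h :: "real^2 => 'b::euclidean_space"
 assumes "h : L2 Om" "Om : sets lebesgue" "bounded Om"
 shows "integrable (leb Om) h"
proof (rule lintegrable_bound)
 show "integrable (leb Om) (%x. 1 + (norm (h x))^2)" by (intro lintegrable_add L2_integrable assms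
   integrable_continuous_bounded[OF continuous_on_const])
 have "r <= 1 + r^2" for r :: real using zero_le_power2[of "r - 1/2"] by (simp add: power2_eq_square algebra_simps)
 thus "AE x in leb Om. norm (h x) <= norm (1 + (norm (h x))^2)" by simp
qed (use L2_measurable assms in auto)

lemma AE_lebesgue_on_countable_Union:
 assumes "countable I" "!!i. i : I ==> A i : sets lebesgue" "!!i. i : I ==> AE x in leb (A i). P x"
  "(\<Union>i\<in>I. A i) : sets lebesgue"
 shows "AE x in leb (\<Union>i\<in>I. A i). P x"
proof -
 have "AE x in lebesgue. ALL i:I. x : A i --> P x" using assms by (subst AE_ball_countable) (auto simp: AE_restrict_space_iff)
 thus ?thesis using assms by (auto simp: AE_restrict_space_iff elim!: eventually_mono)
qed

lemma smooth_continuous: "smooth f ==> continuous_on S f"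
proof -
 assume "smooth f"
 then obtain D where "D 0 0 = f" "!!x. (D 0 0 has_derivative (%h. h$1 *R D (Suc 0) 0 x + h$2 *R D 0 (Suc 0) x)) (at x)" unfolding smooth_def by blast
 thus ?thesis by (intro continuous_at_imp_continuous_on ballI) (auto intro: has_derivative_continuous)
qed

text \<open>Limits of \<open>box_bump\<close> give the boxes inside \<open>\<Omega>\<close>, and countably many of these cover \<open>\<Omega>\<close>.\<close>

lemma AE_zero_of_test_functions:
 fixes h :: "real^2 => real"
 assumes O: "open Om" "bounded Om" and h: "integrable (leb Om) h"
  and test: "!!\<phi>. test_function Om \<phi> ==> (LINT x|leb Om. h x * \<phi> x) = 0"
 shows "AE x in leb Om. h x = 0"
proof -
 have Om: "Om : sets lebesgue" using O by (simp add: borel_open)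
 have hm: "h : borel_measurable (leb Om)" using h by auto
 have bx: "(LINT x|leb Om. indicator (box l u) x * h x) = 0" if lu: "cbox l u <= Om" for l u
 proof -
  have m: "box_bump l u n : borel_measurable (leb Om)" for n
  proof -
   have "smooth (box_bump l u n)" using test_function_box_bump[OF lu] by (simp add: test_function_def)
   hence "cont (box_bump l u n)" by (rule smooth_continuous)
   thus ?thesis using integrable_continuous_bounded[OF _ Om O(2)] by blast
  qed
  have "(%n. LINT x|leb Om. h x * box_bump l u n x) \<longlonglongrightarrow> (LINT x|leb Om. h x * indicator (box l u) x)"
  proof (rule integral_dominated_convergence[where w="%x. \<bar>h x\<bar>"])
   show "AE x in leb Om. (%n. h x * box_bump l u n x) \<longlonglongrightarrow> h x * indicator (box l u) x"
    by (intro AE_I2 tendsto_mult tendsto_const box_bump_tendsto)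
   show "AE x in leb Om. norm (h x * box_bump l u n x) <= \<bar>h x\<bar>" for n
    using box_bump_bounds[of l u n] by (auto simp: abs_mult intro!: mult_left_le)
   show "(%x. h x * indicator (box l u) x) : borel_measurable (leb Om)"
    using hm measurable_restrict_space1[OF borel_measurable_indicator[of "box l u" lebesgue], of Om] by (intro borel_measurable_times) auto
  qed (use h hm m in auto)
  moreover have "(LINT x|leb Om. h x * box_bump l u n x) = 0" for n by (rule test[OF test_function_box_bump[OF lu]])
  ultimately have "(LINT x|leb Om. h x * indicator (box l u) x) = 0" using LIMSEQ_unique tendsto_const by (simp add: LIMSEQ_const_iff)
  thus ?thesis by (simp add: mult.commute)
 qed
 have loc: "AE x in leb (cbox l0 u0). h x = 0" if lu: "cbox l0 u0 <= Om" for l0 u0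
 proof -
  define k where "k = (%x. indicator (box l0 u0) x * h x)"
  have hO: "integrable lebesgue (%x. indicator Om x * h x)" using h Om by (simp add: integrable_restrict_space)
  have "integrable lebesgue (%x. indicator (box l0 u0) x *R (indicator Om x * h x))" by (rule integrable_mult_indicator[OF _ hO]) auto
  moreover have "(%x. indicator (box l0 u0) x *R (indicator Om x * h x)) = k"
   using lu box_subset_cbox[of l0 u0] by (auto simp: k_def indicator_def fun_eq_iff)
  ultimately have ik: "integrable lebesgue k" by simp
  hence "k : borel_measurable (completion lborel)" by auto
  then obtain k' where k': "k' : borel_measurable lborel" "AE x in lborel. k x = k' x" using completion_ex_borel_measurable_real by blast
  hence ae: "AE x in lebesgue. k x = k' x" by (simp add: AE_completion)
  have k'l: "k' : borel_measurable lebesgue" using k'(1) by (rule measurable_completion)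
  have "integrable lebesgue k'" using integrable_cong_AE[of k lebesgue k'] ik ae k'l by auto
  hence ik': "integrable lborel k'" using k'(1) by (simp add: integrable_completion)
  have eq: "(LINT x|lborel. indicator A x * k' x) = (LINT x|lebesgue. indicator A x * k x)" if "A : sets borel" for A
  proof -
   have "(LINT x|lborel. indicator A x * k' x) = (LINT x|lebesgue. indicator A x * k' x)"
    using k'(1) that by (intro integral_completion[symmetric] borel_measurable_times borel_measurable_indicator) auto
   also have "... = (LINT x|lebesgue. indicator A x * k x)" using ae k'l ik that
    by (intro integral_cong_AE borel_measurable_times borel_measurable_indicator) (auto elim: eventually_mono)
   finally show ?thesis .
  qed
  have bk: "(LINT x|lebesgue. indicator (box l u) x * k x) = 0" for l u
  proof -
   obtain l' u' where b: "box l u \<inter> box l0 u0 = box l' u'" by (rule that[OF box_Int_box])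
   show ?thesis
   proof (cases "box l' u' = {}")
    case True
    hence z: "indicator (box l u) x * k x = 0" for x using b by (auto simp: k_def indicator_def)
    show ?thesis unfolding z by simp
   next
    case False
    hence "cbox l' u' <= cbox l0 u0" using b closure_box[of l' u'] closure_mono[of "box l' u'" "cbox l0 u0"] box_subset_cbox[of l0 u0]
     by (metis Int_lower2 closed_cbox closure_closed subset_trans)
    hence bx0: "(LINT x|leb Om. indicator (box l' u') x * h x) = 0" using lu by (intro bx) auto
    have pt: "indicator Om x *R (indicator (box l' u') x * h x) = indicator (box l u) x * k x" for x
    proof -
     have "x : box l u & x : box l0 u0 \<longleftrightarrow> x : box l' u'" using b by blast
     moreover have "x : box l0 u0 ==> x : Om" using lu box_subset_cbox[of l0 u0] by blast
     ultimately show ?thesis by (auto simp: k_def indicator_def)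
    qed
    have "(LINT x|leb Om. indicator (box l' u') x * h x) = (LINT x|lebesgue. indicator (box l u) x * k x)"
     unfolding pt[symmetric] using Om by (simp add: integral_restrict_space)
    with bx0 show ?thesis by simp
   qed
  qed
  have "AE x in lborel. k' x = 0"
  proof (rule AE_zero_of_box_integrals[OF ik'])
   show "(LINT x|lborel. indicator (box l u) x * k' x) = 0" for l u using eq bk by simp
   have "(LINT x|lborel. k' x) = (LINT x|lborel. indicator UNIV x * k' x)" by simp
   also have "... = (LINT x|lebesgue. indicator UNIV x * k x)" by (rule eq) simp
   also have "... = (LINT x|lebesgue. indicator (box l0 u0) x * k x)" by (rule lint_cong) (auto simp: k_def indicator_def)
   finally show "(LINT x|lborel. k' x) = 0" using bk by simp
  qed
  hence "AE x in lebesgue. k' x = 0" by (simp add: AE_completion)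
  moreover have "AE x in lebesgue. x ~: cbox l0 u0 - box l0 u0"
   using negligible_frontier_interval[of l0 u0] by (intro AE_not_in) (simp add: negligible_iff_null_sets)
  ultimately have "AE x in lebesgue. x : cbox l0 u0 --> h x = 0" using ae by eventually_elim (auto simp: k_def indicator_def split: if_splits)
  thus ?thesis by (simp add: AE_restrict_space_iff)
 qed
 obtain D where D: "countable D" "!!X. X : D ==> X <= Om" "!!X. X : D ==> EX a b. X = cbox a b" "\<Union>D = Om"
  using open_countable_Union_open_cbox[OF O(1)] by (metis PowD subsetD)
 have "AE x in leb (\<Union>X\<in>D. X). h x = 0"
 proof (rule AE_lebesgue_on_countable_Union[OF D(1)])
  fix X assume "X : D"
  then obtain a b where "X = cbox a b" "cbox a b <= Om" using D by metis
  thus "AE x in leb X. h x = 0" "X : sets lebesgue" using loc by auto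
 qed (use D Om in auto)
 thus ?thesis by (simp only: image_ident D(4))
qed

section \<open>Weak gradients\<close>

lemma integral_lebesgue_on_extend:
 fixes f :: "real^2 => real"
 assumes "A : sets lebesgue" "B : sets lebesgue" "A <= B" "!!x. x : B - A ==> f x = 0"
 shows "(LINT x|leb A. f x) = (LINT x|leb B. f x)"
proof -
 have "(%x. indicator A x *R f x) = (%x. indicator B x *R f x)" using assms(3,4) by (auto simp: indicator_def fun_eq_iff)
 thus ?thesis using assms(1,2) by (simp only: integral_restrict_space sets.Int sets.top)
qed

lemma integral_partial_derivative_zero:
 fixes h :: "real^2 => real"
 assumes h: "!!z. (h has_derivative h' z) (at z)" and c: "cont (%z. h' z (axis j 1))"
  and z: "!!z. z : cbox l u ==> z $ j = l $ j \<or> z $ j = u $ j ==> h z = 0"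
 shows "(LINT z|leb (cbox l u). h' z (axis j 1)) = 0"
proof (cases "l $ j <= u $ j")
 case False
 have "x ~: cbox l u" for x
 proof
  assume "x : cbox l u"
  hence "l $ j <= x $ j" "x $ j <= u $ j" by (auto simp: mem_box_cart)
  with False show False by linarith
 qed
 hence "cbox l u = {}" by blast
 thus ?thesis by (simp add: integral_restrict_space)
next
 case True
 let ?i = "j + 1"
 have ij: "?i + 1 = j" by (rule index2(3))
 have v: "vec2 ?i y x = y *R axis ?i 1 + x *R axis j 1" for x y by (simp only: vec2_def ij)
 have "(LINT z|leb (cbox l u). h' z (axis j 1)) =
   integral {l $ ?i..u $ ?i} (%y. integral {l $ j..u $ j} (%x. h' (vec2 ?i y x) (axis j 1)))" using integral_cbox_vec2[OF c, of l u ?i] unfolding ij .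
 also have "... = integral {l $ ?i..u $ ?i} (%y. 0)"
 proof (rule hk_integral_cong)
  fix y assume y: "y : {l $ ?i..u $ ?i}"
  have "((%x. h' (vec2 ?i y x) (axis j 1)) has_integral h (vec2 ?i y (u $ j)) - h (vec2 ?i y (l $ j))) {l $ j..u $ j}"
  proof (rule fundamental_theorem_of_calculus[OF True])
   fix x
   have "((%x. 1 \<bullet> h (y *R axis ?i 1 + x *R axis j 1)) has_real_derivative
     1 \<bullet> h' (y *R axis ?i 1 + x *R axis j 1) (axis j 1)) (at x)" by (rule has_derivative_along_line[OF h])
   thus "((%x. h (vec2 ?i y x)) has_vector_derivative h' (vec2 ?i y x) (axis j 1)) (at x within {l $ j..u $ j})"
    unfolding v by (auto simp flip: has_real_derivative_iff_has_vector_derivative intro: has_field_derivative_at_within)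
  qed
  moreover have "h (vec2 ?i y t) = 0" if "t = l $ j \<or> t = u $ j" for t
  proof (rule z)
   have "vec2 ?i y t $ j = t" using vec2_nth(2)[of ?i y t] unfolding ij .
   thus "vec2 ?i y t $ j = l $ j \<or> vec2 ?i y t $ j = u $ j" using that by simp
   show "vec2 ?i y t : cbox l u" unfolding vec2_mem_cbox ij using y that True by auto
  qed
  ultimately show "integral {l $ j..u $ j} (%x. h' (vec2 ?i y x) (axis j 1)) = 0" by (simp add: integral_unique)
 qed
 finally show ?thesis by simp
qed

lemma smooth_real_derivative:
 fixes \<phi> :: "real^2 => real"
 assumes "smooth \<phi>"
 shows "(\<phi> has_derivative frechet_derivative \<phi> (at x)) (at x)"
  and "continuous_on S (%x. frechet_derivative \<phi> (at x) v)"
proof -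
 obtain D where D0: "D 0 0 = \<phi>" and D: "!!i j x. (D i j has_derivative (%h. h$1 *R D (Suc i) j x + h$2 *R D i (Suc j) x)) (at x)"
  using assms unfolding smooth_def by blast
 have e: "frechet_derivative \<phi> (at x) = (%h. h$1 *R D (Suc 0) 0 x + h$2 *R D 0 (Suc 0) x)" for x
  using frechet_derivative_at[OF D[of 0 0 x]] D0 by simp
 show "(\<phi> has_derivative frechet_derivative \<phi> (at x)) (at x)" unfolding e using D[of 0 0 x] D0 by simp
 have "continuous_on S (D i j)" for i j by (intro continuous_at_imp_continuous_on ballI) (rule has_derivative_continuous[OF D])
 thus "continuous_on S (%x. frechet_derivative \<phi> (at x) v)" unfolding e by (intro continuous_intros)
qed

lemma test_function_outside:
 assumes "test_function Om \<phi>" "x ~: Om"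
 shows "\<phi> x = 0" "frechet_derivative \<phi> (at x) v = 0"
proof -
 let ?S = "closure {x. \<phi> x ~= 0}"
 have x: "x ~: ?S" using assms unfolding test_function_def by blast
 thus "\<phi> x = 0" using closure_subset[of "{x. \<phi> x ~= 0}"] by blast
 have "(\<phi> has_derivative (%_. 0)) (at x)" by (rule has_derivative_transform_within_open[OF has_derivative_const[of 0], of "- ?S"])
   (use x closure_subset[of "{x. \<phi> x ~= 0}"] in auto)
 thus "frechet_derivative \<phi> (at x) v = 0" using frechet_derivative_at by metis
qed

lemma test_function_smooth: "test_function Om \<phi> ==> smooth \<phi>"
 by (simp add: test_function_def)

lemma test_function_mono: "test_function A \<phi> ==> A <= B ==> test_function B \<phi>"
 by (auto simp: test_function_def)

lemma C1_grad_has_weak_gradient: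
 assumes O: "open Om" "bounded Om" and u: "C1_grad u G"
 shows "has_weak_gradient Om u G"
proof -
 have Om: "Om : sets lebesgue" using O by (simp add: borel_open)
 note cu = C1_grad_continuous[OF u]
 obtain R where R: "R > 0" "!!x. x : Om ==> norm x < R" using O(2) bounded_pos_less[of Om] by (auto)
 define l r where "l = (\<chi> i::2. - R)" and "r = (\<chi> i::2. R)"
 have sub: "x : cbox l r" "x $ j ~= l $ j" "x $ j ~= r $ j" if "x : Om" for x j
 proof -
  have lt: "- R < x $ i" "x $ i < R" for i using component_le_norm_cart[of x i] R(2)[OF that] by linarith+
  thus "x : cbox l r" by (simp add: mem_box_cart l_def r_def less_imp_le)
  show "x $ j ~= l $ j" "x $ j ~= r $ j" using lt[of j] by (auto simp: l_def r_def)
 qed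
 have "(LINT x|leb Om. u x $ i * frechet_derivative \<phi> (at x) (axis j 1)) =
   - (LINT x|leb Om. G x $ i $ j * \<phi> x)" if t: "test_function Om \<phi>" for \<phi> i j
 proof -
  note sm = smooth_real_derivative[OF test_function_smooth[OF t]]
  note cphi = smooth_continuous[OF test_function_smooth[OF t]]
  let ?A = "%x. u x $ i * frechet_derivative \<phi> (at x) (axis j 1)" and ?B = "%x. G x $ i $ j * \<phi> x"
  have Gv: "(G z *v axis j 1) $ i = G z $ i $ j" for z by (simp add: matrix_vector_mult_basis column_def)
  have d: "((%z. u z $ i * \<phi> z) has_derivative (%v. u z $ i * frechet_derivative \<phi> (at z) v + (G z *v v) $ i * \<phi> z)) (at z)" for z
   using u unfolding C1_grad_def by (intro has_derivative_mult sm(1) bounded_linear.has_derivative[OF bounded_linear_vec_nth]) auto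
  have "(LINT z|leb (cbox l r). ?A z + (G z *v axis j 1) $ i * \<phi> z) = 0"
  proof (rule integral_partial_derivative_zero[OF d])
   show "cont (%z. ?A z + (G z *v axis j 1) $ i * \<phi> z)" by (intro continuous_intros cu sm cphi)
   fix z assume "z $ j = l $ j \<or> z $ j = r $ j"
   hence "z ~: Om" using sub by blast
   thus "u z $ i * \<phi> z = 0" using test_function_outside[OF t] by simp
  qed
  moreover have "(LINT z|leb (cbox l r). ?A z + ?B z) = (LINT z|leb (cbox l r). ?A z) + (LINT z|leb (cbox l r). ?B z)"
   by (intro lint_add integrable_continuous_bounded continuous_intros cu sm cphi bounded_cbox) auto
  moreover have "(LINT z|leb Om. ?A z) = (LINT z|leb (cbox l r). ?A z)"
   "(LINT z|leb Om. ?B z) = (LINT z|leb (cbox l r). ?B z)" by (rule integral_lebesgue_on_extend; use Om sub test_function_outside[OF t] in auto)+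
  ultimately show ?thesis unfolding Gv by linarith
 qed
 thus ?thesis unfolding has_weak_gradient_def using continuous_bounded_L2[OF cu(1) Om O(2)] continuous_bounded_L2[OF cu(2) Om O(2)] by blast
qed

lemma L2_component: "f : L2 Om ==> (%x. f x $ i) : L2 Om" for f :: "real^2 => ('b::euclidean_space)^'n"
 by (rule L2_bounded_linear[OF bounded_linear_vec_nth])

lemma L2_times_test:
 assumes "f : L2 Om" "open Om" "bounded Om" "cont g"
 shows "integrable (leb Om) (%x. f x * g x :: real)" using L2_inner_integrable[OF assms(1) continuous_bounded_L2[OF assms(4)]] assms(2,3)
 by (simp add: borel_open)

lemma has_weak_gradient_add:
 assumes O: "open Om" "bounded Om" and u: "has_weak_gradient Om u G" and v: "has_weak_gradient Om v H"
 shows "has_weak_gradient Om (%x. u x + v x) (%x. G x + H x)" unfolding has_weak_gradient_def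
proof (intro conjI allI impI)
 show "(%x. u x + v x) : L2 Om" "(%x. G x + H x) : L2 Om" using u v by (auto simp: has_weak_gradient_def intro: L2_add)
 fix \<phi> i j assume t: "test_function Om \<phi>"
 note sm = smooth_real_derivative(2)[OF test_function_smooth[OF t]] smooth_continuous[OF test_function_smooth[OF t]]
 have L: "u : L2 Om" "v : L2 Om" "G : L2 Om" "H : L2 Om" using u v by (auto simp: has_weak_gradient_def)
 have i: "integrable (leb Om) (%x. u x $ i * frechet_derivative \<phi> (at x) (axis j 1))"
  "integrable (leb Om) (%x. v x $ i * frechet_derivative \<phi> (at x) (axis j 1))"
  "integrable (leb Om) (%x. G x $ i $ j * \<phi> x)" "integrable (leb Om) (%x. H x $ i $ j * \<phi> x)" by (intro L2_times_test O sm L2_component L)+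
 show "(LINT x|leb Om. (u x + v x) $ i * frechet_derivative \<phi> (at x) (axis j 1)) =
   - (LINT x|leb Om. (G x + H x) $ i $ j * \<phi> x)" using u v t i by (simp add: has_weak_gradient_def distrib_right lint_add)
qed

lemma has_weak_gradient_scaleR:
 assumes u: "has_weak_gradient Om u G"
 shows "has_weak_gradient Om (%x. c *R u x) (%x. c *R G x)" using u by (auto simp: has_weak_gradient_def mult.assoc intro: L2_scaleR)

text \<open>A weak gradient is determined on an open subset by test functions supported there; on an element this identifies it
 with the classical gradient.\<close>

lemma weak_gradient_local_AE:
 assumes U: "open U" "bounded U" "U <= Om" and O: "open Om" "bounded Om" and u: "has_weak_gradient Om u G"
  and M: "!!i j. integrable (leb U) (%x. M x $ i $ j)"
  and parts: "!!\<phi> i j. test_function U \<phi> ==> (LINT x|leb U. u x $ i * frechet_derivative \<phi> (at x) (axis j 1)) =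
   - (LINT x|leb U. M x $ i $ j * \<phi> x)"
 shows "AE x in leb U. G x = (M x :: real^2^2)"
proof -
 have S: "U : sets lebesgue" "Om : sets lebesgue" using U O by (auto simp: borel_open)
 have GL: "G : L2 Om" using u by (simp add: has_weak_gradient_def)
 have Gi: "integrable (leb U) (%x. G x $ i $ j)" for i j
 proof -
  have "integrable (leb Om) (%x. G x $ i $ j)" by (rule L2_imp_integrable[OF L2_component[OF L2_component[OF GL]] S(2) O(2)])
  hence "set_integrable lebesgue Om (%x. G x $ i $ j)" using S by (simp add: integrable_lebesgue_on_iff)
  hence "set_integrable lebesgue U (%x. G x $ i $ j)" by (rule set_integrable_subset) (use S U in auto)
  thus ?thesis using S by (simp add: integrable_lebesgue_on_iff)
 qed
 have "AE x in leb U. G x $ i $ j - M x $ i $ j = 0" for i j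
 proof (rule AE_zero_of_test_functions[OF U(1,2)])
  show "integrable (leb U) (%x. G x $ i $ j - M x $ i $ j)" using Gi M by auto
  fix \<phi> assume t: "test_function U \<phi>"
  hence t': "test_function Om \<phi>" using U(3) by (rule test_function_mono)
  have ip: "integrable (leb U) (%x. h x * \<phi> x)" if h: "integrable (leb U) h" for h :: "real^2 => real"
  proof -
   have cp: "cont \<phi>" by (rule smooth_continuous[OF test_function_smooth[OF t]])
   have "compact (closure {x. \<phi> x ~= 0})" using t by (simp add: test_function_def)
   hence "compact (\<phi> ` closure {x. \<phi> x ~= 0})" by (rule compact_continuous_image[OF continuous_on_subset[OF cp subset_UNIV]])
   hence "bounded (\<phi> ` closure {x. \<phi> x ~= 0})" by (rule compact_imp_bounded)
   then obtain B where B: "!!x. x : closure {x. \<phi> x ~= 0} ==> \<bar>\<phi> x\<bar> <= B" "B > 0" by (auto simp: bounded_pos)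
   have B': "\<bar>\<phi> x\<bar> <= B" for x using B closure_subset[of "{x. \<phi> x ~= 0}"] by (cases "\<phi> x = 0") auto
   show ?thesis
   proof (rule lintegrable_bound)
    show "integrable (leb U) (%x. B * h x)" using h by simp
    show "(%x. h x * \<phi> x) : borel_measurable (leb U)" using h integrable_continuous_bounded[OF cp S(1) U(2)] by auto
    show "AE x in leb U. norm (h x * \<phi> x) <= norm (B * h x)" using B' B(2) by (auto simp: abs_mult mult.commute intro!: mult_right_mono)
   qed
  qed
  have "(LINT x|leb U. u x $ i * frechet_derivative \<phi> (at x) (axis j 1)) =
    (LINT x|leb Om. u x $ i * frechet_derivative \<phi> (at x) (axis j 1))"
   "(LINT x|leb U. G x $ i $ j * \<phi> x) = (LINT x|leb Om. G x $ i $ j * \<phi> x)"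
   by (rule integral_lebesgue_on_extend[OF S U(3)]; use test_function_outside[OF t] in simp)+
  hence "(LINT x|leb U. G x $ i $ j * \<phi> x) = (LINT x|leb U. M x $ i $ j * \<phi> x)"
   using u t' parts[OF t, of i j] by (simp add: has_weak_gradient_def)
  thus "(LINT x|leb U. (G x $ i $ j - M x $ i $ j) * \<phi> x) = 0" using ip[OF Gi] ip[OF M] by (simp add: left_diff_distrib lint_diff)
 qed
 hence "AE x in leb U. ALL i:UNIV. ALL j:UNIV. G x $ i $ j - M x $ i $ j = 0" by (simp add: AE_all_countable)
 thus ?thesis by eventually_elim (simp add: vec_eq_iff)
qed

lemma has_weak_gradient_unique:
 assumes O: "open Om" "bounded Om" and u: "has_weak_gradient Om u G" and v: "has_weak_gradient Om v H"
  and uv: "AE x in leb Om. u x = v x"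
 shows "AE x in leb Om. G x = H x"
proof (rule weak_gradient_local_AE[OF O subset_refl O u])
 have Om: "Om : sets lebesgue" using O by (simp add: borel_open)
 have L: "u : L2 Om" "v : L2 Om" "H : L2 Om" using u v by (auto simp: has_weak_gradient_def)
 show "integrable (leb Om) (%x. H x $ i $ j)" for i j by (rule L2_imp_integrable[OF L2_component[OF L2_component[OF L(3)]] Om O(2)])
 fix \<phi> i j assume t: "test_function Om \<phi>"
 note sm = smooth_real_derivative(2)[OF test_function_smooth[OF t]]
 have "(LINT x|leb Om. u x $ i * frechet_derivative \<phi> (at x) (axis j 1)) =
  (LINT x|leb Om. v x $ i * frechet_derivative \<phi> (at x) (axis j 1))" by (rule integral_cong_AE)
   (use uv L2_times_test[OF L2_component[OF L(1)] O sm] L2_times_test[OF L2_component[OF L(2)] O sm]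
    in \<open>auto elim: eventually_mono\<close>)
 thus "(LINT x|leb Om. u x $ i * frechet_derivative \<phi> (at x) (axis j 1)) = - (LINT x|leb Om. H x $ i $ j * \<phi> x)"
  using v t by (simp add: has_weak_gradient_def)
qed

lemma H1_weak_grad: "u : H1 Om ==> has_weak_gradient Om u (weak_grad Om u)"
proof -
 assume "u : H1 Om"
 hence "EX G. has_weak_gradient Om u G" unfolding H1_def by blast
 thus ?thesis unfolding weak_grad_def by (rule someI_ex)
qed

lemma H1I: "has_weak_gradient Om u G ==> u : H1 Om"
 by (auto simp: H1_def)

lemma H1_L2: "u : H1 Om ==> u : L2 Om" and weak_grad_L2: "u : H1 Om ==> weak_grad Om u : L2 Om"
 using H1_weak_grad by (auto simp: has_weak_gradient_def)

lemma weak_grad_AE: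
 assumes "open Om" "bounded Om" "has_weak_gradient Om u G"
 shows "AE x in leb Om. weak_grad Om u x = G x" by (rule has_weak_gradient_unique[OF assms(1,2) H1_weak_grad[OF H1I[OF assms(3)]] assms(3)]) simp

lemma H1_lincomb:
 assumes "open Om" "bounded Om" "u : H1 Om" "v : H1 Om"
 shows "(%x. a *R u x + b *R v x) : H1 Om"
  "AE x in leb Om. weak_grad Om (%x. a *R u x + b *R v x) x = a *R weak_grad Om u x + b *R weak_grad Om v x"
proof -
 have w: "has_weak_gradient Om (%x. a *R u x + b *R v x) (%x. a *R weak_grad Om u x + b *R weak_grad Om v x)"
  by (intro has_weak_gradient_add has_weak_gradient_scaleR assms H1_weak_grad)
 show "(%x. a *R u x + b *R v x) : H1 Om" by (rule H1I[OF w])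
 show "AE x in leb Om. weak_grad Om (%x. a *R u x + b *R v x) x = a *R weak_grad Om u x + b *R weak_grad Om v x"
  by (rule weak_grad_AE[OF assms(1,2) w])
qed

lemma H1_seminorm_lincomb:
 assumes O: "open Om" "bounded Om" and uv: "u : H1 Om" "v : H1 Om"
 shows "H1_seminorm Om (%x. a *R u x + b *R v x) <= \<bar>a\<bar> * H1_seminorm Om u + \<bar>b\<bar> * H1_seminorm Om v"
proof -
 note L = weak_grad_L2[OF uv(1)] weak_grad_L2[OF uv(2)]
 have "H1_seminorm Om (%x. a *R u x + b *R v x) = L2_norm Om (%x. a *R weak_grad Om u x + b *R weak_grad Om v x)" unfolding H1_seminorm_def
  by (intro L2_norm_cong_AE weak_grad_L2 H1_lincomb O uv L2_add L2_scaleR L)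
 also have "... <= L2_norm Om (%x. a *R weak_grad Om u x) + L2_norm Om (%x. b *R weak_grad Om v x)" by (intro L2_norm_triangle L2_scaleR L)
 finally show ?thesis by (simp add: L2_norm_scaleR H1_seminorm_def)
qed

lemma H1_norm_bounds:
 "L2_norm Om u <= H1_norm Om u" "H1_seminorm Om u <= H1_norm Om u"
 "H1_norm Om u <= L2_norm Om u + H1_seminorm Om u" "0 <= H1_norm Om u" "0 <= H1_seminorm Om u"
proof -
 have n: "0 <= L2_norm Om u" "0 <= H1_seminorm Om u" by (simp_all add: L2_norm_nonneg H1_seminorm_def)
 thus "0 <= H1_seminorm Om u" by simp
 show "L2_norm Om u <= H1_norm Om u" "H1_seminorm Om u <= H1_norm Om u" unfolding H1_norm_def by (intro real_le_rsqrt; simp)+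
 show "H1_norm Om u <= L2_norm Om u + H1_seminorm Om u" unfolding H1_norm_def using n by (intro real_le_lsqrt) (auto simp: power2_sum)
 show "0 <= H1_norm Om u" by (simp add: H1_norm_def)
qed

lemma H1_norm_lincomb:
 assumes O: "open Om" "bounded Om" and uv: "u : H1 Om" "v : H1 Om"
 shows "H1_norm Om (%x. a *R u x + b *R v x) <= 2 * (\<bar>a\<bar> * H1_norm Om u + \<bar>b\<bar> * H1_norm Om v)"
proof -
 have "L2_norm Om (%x. a *R u x + b *R v x) <= \<bar>a\<bar> * L2_norm Om u + \<bar>b\<bar> * L2_norm Om v"
  using L2_norm_triangle[OF L2_scaleR[OF H1_L2[OF uv(1)], of a] L2_scaleR[OF H1_L2[OF uv(2)], of b]] by (simp add: L2_norm_scaleR)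
 moreover have "\<bar>a\<bar> * L2_norm Om u <= \<bar>a\<bar> * H1_norm Om u" "\<bar>b\<bar> * L2_norm Om v <= \<bar>b\<bar> * H1_norm Om v"
  "\<bar>a\<bar> * H1_seminorm Om u <= \<bar>a\<bar> * H1_norm Om u" "\<bar>b\<bar> * H1_seminorm Om v <= \<bar>b\<bar> * H1_norm Om v"
  by (intro mult_left_mono H1_norm_bounds; simp)+
 moreover have "N <= 2 * (A + B)" if "L <= a1 + b1" "a1 <= A" "b1 <= B" "a2 <= A" "b2 <= B" "S <= a2 + b2" "N <= L + S"
  for N A B L S a1 a2 b1 b2 :: real using that by simp
 ultimately show ?thesis using H1_seminorm_lincomb[OF assms, of a b] H1_norm_bounds(3)[of Om "%x. a *R u x + b *R v x"] by blast
qed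

lemma smooth_lincomb:
 assumes "smooth f" "smooth g"
 shows "smooth (%x. a *R f x + b *R g x)"
proof -
 obtain D where D: "D 0 0 = f" "!!i j x. (D i j has_derivative (%h. h$1 *R D (Suc i) j x + h$2 *R D i (Suc j) x)) (at x)"
  using assms(1) unfolding smooth_def by blast
 obtain E where E: "E 0 0 = g" "!!i j x. (E i j has_derivative (%h. h$1 *R E (Suc i) j x + h$2 *R E i (Suc j) x)) (at x)"
  using assms(2) unfolding smooth_def by blast
 show ?thesis unfolding smooth_def
 proof (intro exI[of _ "%i j x. a *R D i j x + b *R E i j x"] conjI allI)
  show "(%x. a *R D 0 0 x + b *R E 0 0 x) = (%x. a *R f x + b *R g x)" using D E by simp
  fix i j x
  show "((%x. a *R D i j x + b *R E i j x) has_derivative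
   (%h. h$1 *R (a *R D (Suc i) j x + b *R E (Suc i) j x) + h$2 *R (a *R D i (Suc j) x + b *R E i (Suc j) x))) (at x)"
   by (rule has_derivative_eq_rhs[OF has_derivative_add[OF has_derivative_scaleR_right[OF D(2)] has_derivative_scaleR_right[OF E(2)]]])
    (simp add: fun_eq_iff algebra_simps)
 qed
qed

lemma smooth_H1:
 fixes \<phi> :: "real^2 => real^2"
 assumes "open Om" "bounded Om" "smooth \<phi>" shows "\<phi> : H1 Om"
 using smooth_has_C1_grad[OF assms(3)] C1_grad_has_weak_gradient[OF assms(1,2)] H1I by metis

lemma disp_space_lincomb:
 assumes O: "open Om" "bounded Om" and u: "u : disp_space Om GD" and v: "v : disp_space Om GD"
 shows "(%x. a *R u x + b *R v x) : disp_space Om GD"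
proof -
 obtain g \<phi> where u': "u : H1 Om" "AE x in arclength Om. x : GD --> g x = 0" "g : borel_measurable borel"
  "!!n. smooth (\<phi> n)" "(%n. H1_norm Om (%x. u x - \<phi> n x)) \<longlonglongrightarrow> 0"
  "(%n. \<integral>\<^sup>+ x. ennreal ((norm (g x - \<phi> n x))^2) \<partial>arclength Om) \<longlonglongrightarrow> 0"
  using u unfolding disp_space_def has_boundary_trace_def by blast
 obtain h \<psi> where v': "v : H1 Om" "AE x in arclength Om. x : GD --> h x = 0" "h : borel_measurable borel"
  "!!n. smooth (\<psi> n)" "(%n. H1_norm Om (%x. v x - \<psi> n x)) \<longlonglongrightarrow> 0"
  "(%n. \<integral>\<^sup>+ x. ennreal ((norm (h x - \<psi> n x))^2) \<partial>arclength Om) \<longlonglongrightarrow> 0"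
  using v unfolding disp_space_def has_boundary_trace_def by blast
 define k w where "k = (%x. a *R g x + b *R h x)" and "w = (%n x. a *R \<phi> n x + b *R \<psi> n x)"
 have m: "k : borel_measurable borel" unfolding k_def using u' v' by measurable
 have s: "smooth (w n)" for n unfolding w_def by (intro smooth_lincomb u' v')
 have H: "(%x. f x - \<theta> x) : H1 Om" if "f : H1 Om" "smooth \<theta>" for f \<theta>
  using H1_lincomb(1)[OF O that(1) smooth_H1[OF O that(2)], of 1 "-1"] by simp
 have "(%n. H1_norm Om (%x. (a *R u x + b *R v x) - w n x)) \<longlonglongrightarrow> 0"
 proof (rule tendsto_sandwich[OF _ _ tendsto_const])
  show "\<forall>\<^sub>F n in sequentially. 0 <= H1_norm Om (%x. (a *R u x + b *R v x) - w n x)" by (simp add: H1_norm_bounds)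
  have "H1_norm Om (%x. (a *R u x + b *R v x) - w n x) <=
   2 * (\<bar>a\<bar> * H1_norm Om (%x. u x - \<phi> n x) + \<bar>b\<bar> * H1_norm Om (%x. v x - \<psi> n x))" for n
   using H1_norm_lincomb[OF O H[OF u'(1,4)] H[OF v'(1,4)], of a n b n] by (simp add: w_def algebra_simps)
  thus "\<forall>\<^sub>F n in sequentially. H1_norm Om (%x. (a *R u x + b *R v x) - w n x) <=
   2 * (\<bar>a\<bar> * H1_norm Om (%x. u x - \<phi> n x) + \<bar>b\<bar> * H1_norm Om (%x. v x - \<psi> n x))" by simp
  show "(%n. 2 * (\<bar>a\<bar> * H1_norm Om (%x. u x - \<phi> n x) + \<bar>b\<bar> * H1_norm Om (%x. v x - \<psi> n x))) \<longlonglongrightarrow> 0"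
   using u'(5) v'(5) by (auto intro!: tendsto_eq_intros)
 qed
 moreover have "(%n. \<integral>\<^sup>+ x. ennreal ((norm (k x - w n x))^2) \<partial>arclength Om) \<longlonglongrightarrow> 0"
 proof (rule tendsto_sandwich[OF _ _ tendsto_const])
  let ?I = "%n. ennreal (2 * a^2) * (\<integral>\<^sup>+ x. ennreal ((norm (g x - \<phi> n x))^2) \<partial>arclength Om)
    + ennreal (2 * b^2) * (\<integral>\<^sup>+ x. ennreal ((norm (h x - \<psi> n x))^2) \<partial>arclength Om)"
  have "(%n. ?I n) \<longlonglongrightarrow> ennreal (2 * a^2) * 0 + ennreal (2 * b^2) * 0" by (intro tendsto_add ennreal_tendsto_cmult u' v') auto
  thus "?I \<longlonglongrightarrow> 0" by simp
  have "(\<integral>\<^sup>+ x. ennreal ((norm (k x - w n x))^2) \<partial>arclength Om) <= ?I n" for n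
  proof -
   have mb: "\<phi> n : borel_measurable borel" "\<psi> n : borel_measurable borel"
    using smooth_continuous[OF u'(4)] smooth_continuous[OF v'(4)] by (auto intro: borel_measurable_continuous_onI)
   have sa: "sets (arclength Om) = sets borel" by (simp add: arclength_def)
   have ms: "(%x. ennreal ((norm (g x - \<phi> n x))^2)) : borel_measurable (arclength Om)"
    "(%x. ennreal ((norm (h x - \<psi> n x))^2)) : borel_measurable (arclength Om)"
    unfolding measurable_cong_sets[OF sa refl] using mb u'(3) v'(3) by measurable
   have "(\<integral>\<^sup>+ x. ennreal ((norm (k x - w n x))^2) \<partial>arclength Om) <=
    (\<integral>\<^sup>+ x. ennreal (2 * a^2) * ennreal ((norm (g x - \<phi> n x))^2) + ennreal (2 * b^2) * ennreal ((norm (h x - \<psi> n x))^2) \<partial>arclength Om)"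
   proof (rule nn_integral_mono)
    fix x
    have "k x - w n x = a *R (g x - \<phi> n x) + b *R (h x - \<psi> n x)" by (simp add: k_def w_def algebra_simps)
    hence "(norm (k x - w n x))^2 <= 2 * a^2 * (norm (g x - \<phi> n x))^2 + 2 * b^2 * (norm (h x - \<psi> n x))^2"
     using norm_add_square_le[of "a *R (g x - \<phi> n x)" "b *R (h x - \<psi> n x)"] by (simp add: power_mult_distrib)
    thus "ennreal ((norm (k x - w n x))^2) <= ennreal (2 * a^2) * ennreal ((norm (g x - \<phi> n x))^2) + ennreal (2 * b^2) * ennreal ((norm (h x - \<psi> n x))^2)"
     by (simp flip: ennreal_mult ennreal_plus add: ennreal_leI)
   qed
   also have "... = ?I n" using ms by (simp add: nn_integral_add nn_integral_cmult)
   finally show ?thesis .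
  qed
  thus "\<forall>\<^sub>F n in sequentially. (\<integral>\<^sup>+ x. ennreal ((norm (k x - w n x))^2) \<partial>arclength Om) <= ?I n" by simp
 qed simp
 moreover have "AE x in arclength Om. x : GD --> k x = 0" using u'(2) v'(2) by eventually_elim (simp add: k_def)
 ultimately show ?thesis using H1_lincomb(1)[OF O u'(1) v'(1)] m s unfolding disp_space_def has_boundary_trace_def by blast
qed

lemma zero_disp_space:
 assumes O: "open Om" "bounded Om" shows "(%x. 0) : disp_space Om GD"
proof -
 have s: "smooth (%x. 0 :: real^2)" unfolding smooth_def by (rule exI[of _ "%i j x. 0"]) simp
 have H: "(%x. 0 :: real^2) : H1 Om" by (rule smooth_H1[OF O s])
 have "H1_norm Om (%x. 0) <= 0" using H1_norm_lincomb[OF O H H, of 0 0] by simp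
 hence "H1_norm Om (%x. 0) = 0" using H1_norm_bounds(4)[of Om "%x. 0"] by linarith
 thus ?thesis unfolding disp_space_def has_boundary_trace_def using H s by (intro CollectI conjI exI[of _ "%x. 0"] exI[of _ "%n x. 0"]) auto
qed

section \<open>Arc length on the boundary of a convex polygon\<close>

lemma sets_arclength [simp]: "sets (arclength Om) = sets borel"
 by (simp add: arclength_def)

lemma finite_edge_ends:
 assumes "polytope (closure Om)"
 shows "finite (edge_ends Om)"
proof -
 let ?X = "{x. x extreme_point_of closure Om}"
 have "edge_ends Om <= ?X \<times> ?X"
 proof
  fix e assume e: "e : edge_ends Om"
  obtain a b where ab: "e = (a, b)" by (cases e)
  have f: "closed_segment a b face_of closure Om" using e ab by (auto simp: edge_ends_def edge_of_def)
  have "a extreme_point_of closed_segment a b" "b extreme_point_of closed_segment a b" by (auto simp: extreme_point_of_segment)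
  thus "e : ?X \<times> ?X" using extreme_point_of_face[OF f] ab by auto
 qed
 moreover have "finite ?X" by (rule finite_polyhedron_extreme_points[OF polytope_imp_polyhedron[OF assms]])
 ultimately show ?thesis by (meson finite_SigmaI finite_subset)
qed

lemma nn_integral_arclength:
 assumes fin: "finite (edge_ends Om)" and f: "f : borel_measurable borel"
 shows "(\<integral>\<^sup>+ x. f x \<partial>arclength Om) = (\<Sum>(a, b)\<in>edge_ends Om.
   \<integral>\<^sup>+ t. ennreal (dist a b / 2) * indicator {0..1} t * f ((1 - t) *R a + t *R b) \<partial>lborel)"
proof -
 let ?M = "count_space (edge_ends Om) \<Otimes>\<^sub>M (lborel :: real measure)"
 let ?d = "%((a, b), t). ennreal (dist a b / 2) * indicator {0..1} (t::real)"
 let ?p = "%((a, b), t). (1 - t) *R a + t *R (b :: real^2)"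
 have cnt: "countable (edge_ends Om)" using fin by (rule countable_finite)
 have m1: "?p : ?M \<rightarrow>\<^sub>M borel" by (rule measurable_pair_measure_countable1[OF cnt])
   (auto simp: split_beta intro!: borel_measurable_continuous_onI continuous_intros)
 have m2: "?d : borel_measurable ?M" by (rule measurable_pair_measure_countable1[OF cnt]) (auto simp: split_beta)
 have mf: "(%x. f (?p x)) : borel_measurable ?M" by (rule measurable_compose[OF m1 f])
 have "(\<integral>\<^sup>+ x. f x \<partial>arclength Om) = (\<integral>\<^sup>+ x. ?d x * f (?p x) \<partial>?M)"
  unfolding arclength_def using m1 m2 mf f by (subst nn_integral_distr) (auto simp: nn_integral_density)
 also have "... = (\<integral>\<^sup>+ e. (\<integral>\<^sup>+ t. ?d (e, t) * f (?p (e, t)) \<partial>lborel) \<partial>count_space (edge_ends Om))"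
  by (rule lborel.nn_integral_fst[symmetric]) (intro borel_measurable_times_ennreal m2 mf)
 also have "... = (\<Sum>e\<in>edge_ends Om. \<integral>\<^sup>+ t. ?d (e, t) * f (?p (e, t)) \<partial>lborel)"
  by (rule nn_integral_count_space_finite[OF fin])
 finally show ?thesis by (simp add: split_beta)
qed

lemma edge_ends_swap: "(a, b) : edge_ends Om ==> (b, a) : edge_ends Om"
 by (simp add: edge_ends_def closed_segment_commute)

lemma domain_facts:
 assumes "convex_polygonal_domain Om"
 shows "open Om" "convex Om" "Om ~= {}" "bounded Om" "Om : sets lebesgue" "interior (closure Om) = Om"
  "polytope (closure Om)" "negligible (closure Om - Om)"
proof -
 show o: "open Om" "convex Om" "Om ~= {}" "polytope (closure Om)" using assms by (auto simp: convex_polygonal_domain_def)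
 thus "bounded Om" using polytope_imp_bounded bounded_subset closure_subset by blast
 show "Om : sets lebesgue" using o by (simp add: borel_open)
 show i: "interior (closure Om) = Om" using convex_interior_closure[OF o(2)] interior_open[OF o(1)] by simp
 show "negligible (closure Om - Om)" using negligible_convex_frontier[OF o(2)] interior_open[OF o(1)] by (simp add: frontier_def)
qed

text \<open>Some half of some edge meets \<open>\<Gamma>D\<close> in positive length. It is a side of a parallelogram inside the triangle that this
 edge spans with an interior point; exchanging the end points allows the half to be the first one.\<close>

lemma edge_par_exists:
 assumes dom: "convex_polygonal_domain Om" and D: "GD : sets borel" and pos: "emeasure (arclength Om) GD > 0"
 shows "EX p a b A \<kappa>. par p a b <= closure Om & cross2 a b ~= 0 & A : sets borel & A <= {0..1} \<and>
  measure lborel A > 0 & \<kappa> > 0 & (ALL f : borel_measurable borel.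
   ennreal \<kappa> * (\<integral>\<^sup>+ x. indicator A x * f (p + x *R a) \<partial>lborel) <= (\<integral>\<^sup>+ z. indicator GD z * f z \<partial>arclength Om))"
proof -
 note df = domain_facts[OF dom]
 have fin: "finite (edge_ends Om)" by (rule finite_edge_ends[OF df(7)])
 let ?I = "%S a b. \<integral>\<^sup>+ t. indicator S t * indicator GD ((1 - t) *R a + t *R b) \<partial>lborel"
 have mseg: "(%t. f ((1 - t) *R a + t *R b)) : borel_measurable borel" if "f : borel_measurable borel" for f :: "real^2 => ennreal" and a b
  by (rule measurable_compose[OF _ that]) (intro borel_measurable_continuous_onI continuous_intros)
 have mD: "(indicator GD :: real^2 => ennreal) : borel_measurable borel" using D by simp
 have "(\<integral>\<^sup>+ x. indicator GD x \<partial>arclength Om) > 0" using pos D by simp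
 hence "(\<Sum>(a, b)\<in>edge_ends Om. \<integral>\<^sup>+ t. ennreal (dist a b / 2) * indicator {0..1} t *
   indicator GD ((1 - t) *R a + t *R b) \<partial>lborel) ~= 0" unfolding nn_integral_arclength[OF fin mD] by simp
 then obtain e where e: "e : edge_ends Om" "(case e of (a, b) => \<integral>\<^sup>+ t. ennreal (dist a b / 2) * indicator {0..1} t *
   indicator GD ((1 - t) *R a + t *R b) \<partial>lborel) ~= 0" by (rule sum.not_neutral_contains_not_neutral)
 obtain a b where eab: "e = (a, b)" by (cases e)
 have ab: "(a, b) : edge_ends Om" using e eab by simp
 have "(\<integral>\<^sup>+ t. ennreal (dist a b / 2) * indicator {0..1} t * indicator GD ((1 - t) *R a + t *R b) \<partial>lborel) ~= 0"
  using e eab by simp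
 moreover have "(\<integral>\<^sup>+ t. ennreal (dist a b / 2) * indicator {0..1} t * indicator GD ((1 - t) *R a + t *R b) \<partial>lborel)
   = ennreal (dist a b / 2) * ?I {0..1} a b" unfolding mult.assoc by (rule nn_integral_cmult) (use mseg[OF mD] in measurable)
 ultimately have d: "dist a b > 0" and I: "?I {0..1} a b ~= 0" by auto
 have "EX \<alpha> \<beta>. (\<alpha>, \<beta>) : edge_ends Om & dist \<alpha> \<beta> > 0 & ?I {0..1/2} \<alpha> \<beta> ~= 0"
 proof (rule ccontr)
  assume "\<not> ?thesis"
  hence z: "?I {0..1/2} a b = 0" "?I {0..1/2} b a = 0" using ab edge_ends_swap[OF ab] d by (auto simp: dist_commute)
  have "?I {0..1/2} b a = (\<integral>\<^sup>+ t. indicator {0..1/2} (1 + (-1) * t) * indicator GD ((1 - (1 + (-1) * t)) *R b + (1 + (-1) * t) *R a) \<partial>lborel)"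
   by (subst nn_integral_real_affine[where c="-1" and t=1]) (use mseg[OF mD] in \<open>auto\<close>)
  also have "... = ?I {1/2..1} a b" by (rule nn_integral_cong) (auto simp: indicator_def algebra_simps)
  finally have z2: "?I {1/2..1} a b = 0" using z by simp
  have "?I {0..1} a b <= (\<integral>\<^sup>+ t. indicator {0..1/2} t * indicator GD ((1 - t) *R a + t *R b)
    + indicator {1/2..1} t * indicator GD ((1 - t) *R a + t *R b) \<partial>lborel)" by (rule nn_integral_mono) (auto simp: indicator_def)
  also have "... = ?I {0..1/2} a b + ?I {1/2..1} a b" by (rule nn_integral_add) (use mseg[OF mD] in measurable)
  finally show False using I z z2 by simp
 qed
 then obtain \<alpha> \<beta> where e: "(\<alpha>, \<beta>) : edge_ends Om" and d: "dist \<alpha> \<beta> > 0" and I: "?I {0..1/2} \<alpha> \<beta> ~= 0" by blast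
 have seg: "closed_segment \<alpha> \<beta> <= closure Om" using e by (auto simp: edge_ends_def edge_of_def dest: face_of_imp_subset)
 have "\<not> Om <= {z. cross2 (\<beta> - \<alpha>) (z - \<alpha>) = 0}"
 proof
  assume s: "Om <= {z. cross2 (\<beta> - \<alpha>) (z - \<alpha>) = 0}"
  have "\<beta> - \<alpha> ~= 0" using d by auto
  hence "negligible Om" by (rule negligible_subset[OF cross2_linear_level_negligible s])
  thus False using open_not_negligible[OF df(1,3)] by blast
 qed
 then obtain \<gamma> where g: "\<gamma> : Om" "cross2 (\<beta> - \<alpha>) (\<gamma> - \<alpha>) ~= 0" by blast
 define v w where "v = (1/2) *R (\<beta> - \<alpha>)" and "w = (1/2) *R (\<gamma> - \<alpha>)"
 have 1: "par \<alpha> v w <= closure Om"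
 proof -
  have "{\<alpha>, \<beta>, \<gamma>} <= closure Om" using seg g closure_subset by auto
  hence "convex hull {\<alpha>, \<beta>, \<gamma>} <= closure Om" by (intro hull_minimal convex_closure df(2))
  thus ?thesis using convex_hull_3_par[of \<alpha> \<beta> \<gamma>] by (auto simp: v_def w_def)
 qed
 have 2: "cross2 v w ~= 0" using g(2) by (auto simp: v_def w_def cross2_def)
 define A where "A = {x : {0..1}. \<alpha> + x *R v : GD}"
 have mA: "(%x. \<alpha> + x *R v) : borel \<rightarrow>\<^sub>M borel" by (intro borel_measurable_continuous_onI continuous_intros)
 have A: "A : sets borel" "A <= {0..1}"
 proof -
  have "A = {0..1} \<inter> ((%x. \<alpha> + x *R v) -` GD \<inter> space borel)" by (auto simp: A_def)
  thus "A : sets borel" using measurable_sets[OF mA D] by simp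
  show "A <= {0..1}" by (auto simp: A_def)
 qed
 have pt: "(1 - x / 2) *R \<alpha> + (x / 2) *R \<beta> = \<alpha> + x *R v" for x by (simp add: v_def algebra_simps)
 have half: "(\<integral>\<^sup>+ t. indicator {0..1/2} t * (indicator GD ((1 - t) *R \<alpha> + t *R \<beta>) * f ((1 - t) *R \<alpha> + t *R \<beta>)) \<partial>lborel)
   = ennreal (1/2) * (\<integral>\<^sup>+ x. indicator A x * f (\<alpha> + x *R v) \<partial>lborel)" if f: "f : borel_measurable borel" for f
 proof -
  have m: "(%t. indicator {0..1/2} t * (indicator GD ((1 - t) *R \<alpha> + t *R \<beta>) * f ((1 - t) *R \<alpha> + t *R \<beta>))) : borel_measurable borel"
   using mseg[OF mD, of \<alpha> \<beta>] mseg[OF f, of \<alpha> \<beta>] by measurable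
  have "(\<integral>\<^sup>+ t. indicator {0..1/2} t * (indicator GD ((1 - t) *R \<alpha> + t *R \<beta>) * f ((1 - t) *R \<alpha> + t *R \<beta>)) \<partial>lborel)
   = ennreal \<bar>1/2\<bar> * (\<integral>\<^sup>+ x. indicator {0..1/2} (0 + 1/2 * x) * (indicator GD ((1 - (0 + 1/2 * x)) *R \<alpha> + (0 + 1/2 * x) *R \<beta>)
     * f ((1 - (0 + 1/2 * x)) *R \<alpha> + (0 + 1/2 * x) *R \<beta>)) \<partial>lborel)"
   by (rule nn_integral_real_affine[where c="1/2" and t=0, OF m]) simp
  also have "(\<integral>\<^sup>+ x. indicator {0..1/2} (0 + 1/2 * x) * (indicator GD ((1 - (0 + 1/2 * x)) *R \<alpha> + (0 + 1/2 * x) *R \<beta>)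
     * f ((1 - (0 + 1/2 * x)) *R \<alpha> + (0 + 1/2 * x) *R \<beta>)) \<partial>lborel) = (\<integral>\<^sup>+ x. indicator A x * f (\<alpha> + x *R v) \<partial>lborel)"
   by (rule nn_integral_cong) (auto simp: A_def indicator_def pt)
  finally show ?thesis by simp
 qed
 have emA: "emeasure lborel A ~= 0" using half[of "%_. 1"] I A(1) by auto
 have "emeasure lborel A <= emeasure lborel {0..1::real}" using A by (intro emeasure_mono) auto
 hence "emeasure lborel A ~= \<infinity>" by (auto simp: top_unique)
 hence 3: "measure lborel A > 0" using emA by (simp add: measure_def enn2real_positive_iff less_top zero_less_iff_neq_zero)
 \<comment> \<open>one half is in the density of \<open>arclength\<close>, the other comes from parametrising half an edge over the unit interval\<close>
 define \<kappa> where "\<kappa> = dist \<alpha> \<beta> / 4"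
 have 4: "\<kappa> > 0" using d by (simp add: \<kappa>_def)
 have "ennreal \<kappa> * (\<integral>\<^sup>+ x. indicator A x * f (\<alpha> + x *R v) \<partial>lborel) <= (\<integral>\<^sup>+ z. indicator GD z * f z \<partial>arclength Om)"
  if f: "f : borel_measurable borel" for f
 proof -
  let ?F = "%z. indicator GD z * f z"
  have mF: "?F : borel_measurable borel" using mD f by measurable
  have "ennreal \<kappa> * (\<integral>\<^sup>+ x. indicator A x * f (\<alpha> + x *R v) \<partial>lborel) =
    ennreal (dist \<alpha> \<beta> / 2) * (ennreal (1/2) * (\<integral>\<^sup>+ x. indicator A x * f (\<alpha> + x *R v) \<partial>lborel))"
  proof -
   have "ennreal \<kappa> = ennreal (dist \<alpha> \<beta> / 2) * ennreal (1/2)" by (subst ennreal_mult[symmetric]) (auto simp: \<kappa>_def)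
   thus ?thesis by (simp only: mult.assoc)
  qed
  also have "... = ennreal (dist \<alpha> \<beta> / 2) * (\<integral>\<^sup>+ t. indicator {0..1/2} t * ?F ((1 - t) *R \<alpha> + t *R \<beta>) \<partial>lborel)"
   unfolding half[OF f] ..
  also have "... = (\<integral>\<^sup>+ t. ennreal (dist \<alpha> \<beta> / 2) * (indicator {0..1/2} t * ?F ((1 - t) *R \<alpha> + t *R \<beta>)) \<partial>lborel)"
   by (rule nn_integral_cmult[symmetric]) (use mseg[OF mF, of \<alpha> \<beta>] in measurable)
  also have "... <= (\<integral>\<^sup>+ t. ennreal (dist \<alpha> \<beta> / 2) * indicator {0..1} t * ?F ((1 - t) *R \<alpha> + t *R \<beta>) \<partial>lborel)"
   by (rule nn_integral_mono) (auto simp: indicator_def)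
  also have "... <= (\<Sum>(a, b)\<in>edge_ends Om. \<integral>\<^sup>+ t. ennreal (dist a b / 2) * indicator {0..1} t * ?F ((1 - t) *R a + t *R b) \<partial>lborel)"
   using member_le_sum[OF e, of "%(a, b). \<integral>\<^sup>+ t. ennreal (dist a b / 2) * indicator {0..1} t * ?F ((1 - t) *R a + t *R b) \<partial>lborel"] fin
   by simp
  also have "... = (\<integral>\<^sup>+ z. ?F z \<partial>arclength Om)" by (rule nn_integral_arclength[OF fin mF, symmetric])
  finally show ?thesis .
 qed
 thus ?thesis using 1 2 3 4 A by blast
qed

section \<open>Korn's inequality on the displacement space\<close>

lemma norm_symm_le: "norm (symm A) <= norm A"
proof -
 have "(norm A)^2 = (norm (symm A))^2 + (curl2 A)^2 / 2" using norm_diff_skew[of A 0] by (simp add: skew_def) (simp add: norm2_mat2)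
 hence "(norm (symm A))^2 <= (norm A)^2" by simp
 thus ?thesis by (rule power2_le_imp_le) simp
qed

lemma symm_add: "symm (A + B) = symm A + symm B" and symm_scaleR: "symm (c *R A) = c *R symm A"
 by (simp_all add: symm_def transpose_def vec_eq_iff algebra_simps)

lemma bounded_linear_symm: "bounded_linear symm"
 by (rule bounded_linear_intro[where K=1]) (auto simp: symm_add symm_scaleR norm_symm_le)

lemma strain_eq_symm: "strain Om u = (%x. symm (weak_grad Om u x))"
 by (simp add: strain_def symm_def fun_eq_iff)

lemma strain_L2: "u : H1 Om ==> strain Om u : L2 Om"
 unfolding strain_eq_symm by (intro L2_bounded_linear[OF bounded_linear_symm] weak_grad_L2)

lemma L2_norm_symm_le:
 assumes "M : L2 Om" shows "L2_norm Om (%x. symm (M x)) <= L2_norm Om M"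
 by (rule L2_norm_mono[OF L2_bounded_linear[OF bounded_linear_symm assms] assms]) (simp add: norm_symm_le)

lemma integral_closure_domain:
 fixes f :: "real^2 => real"
 assumes dom: "convex_polygonal_domain Om" and f: "cont f"
 shows "(LINT z|leb (closure Om). f z) = (LINT z|leb Om. f z)"
proof -
 note df = domain_facts[OF dom]
 have m: "f : borel_measurable lebesgue" using measurable_completion[of f lborel borel] borel_measurable_continuous_onI[OF f] by simp
 have "AE z in lebesgue. z ~: closure Om - Om" using df(8)[unfolded negligible_iff_null_sets] by (rule AE_not_in)
 hence ae: "AE z in lebesgue. indicator (closure Om) z *R f z = indicator Om z *R f z"
  by eventually_elim (use closure_subset[of Om] in \<open>auto simp: indicator_def\<close>)
 have c: "closure Om : sets lebesgue" by (simp add: borel_closed)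
 show ?thesis using df(5) c m ae by (simp only: integral_restrict_space sets.Int sets.top)
   (intro integral_cong_AE borel_measurable_scaleR borel_measurable_indicator; assumption)
qed

lemma matrix_entry_le: "\<bar>A $ i $ j\<bar> <= norm A" for A :: "real^2^2"
proof -
 have "\<bar>A $ i $ j\<bar> <= norm (A $ i)" by (rule component_le_norm_cart)
 also have "... <= norm A" by (rule Finite_Cartesian_Product.norm_nth_le)
 finally show ?thesis .
qed

lemma bounded_linear_trace: "bounded_linear (trace :: real^2^2 => real)"
proof (rule bounded_linear_intro[where K=2])
 fix A B :: "real^2^2" and r :: real
 show "trace (A + B) = trace A + trace B" "trace (r *R A) = r *R trace A" by (simp_all add: trace_def sum_2 algebra_simps)
 from matrix_entry_le[of A 1 1] matrix_entry_le[of A 2 2] show "norm (trace A) <= norm A * 2" by (simp add: trace_def sum_2)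
qed

lemma L2_norm_trace_le:
 assumes "M : L2 Om" shows "L2_norm Om (%x. trace (M x :: real^2^2)) <= sqrt 2 * L2_norm Om M"
proof -
 have "norm (trace A) <= norm (sqrt 2 *R A)" for A :: "real^2^2"
 proof (rule power2_le_imp_le)
  show "(norm (trace A))^2 <= (norm (sqrt 2 *R A))^2" unfolding norm_scaleR power_mult_distrib norm2_mat2 using sum_squares_bound[of "A$1$1" "A$2$2"]
   by (simp add: trace_def sum_2 power2_sum algebra_simps) (rule order_trans, assumption, simp)
 qed simp
 hence "L2_norm Om (%x. trace (M x)) <= L2_norm Om (%x. sqrt 2 *R M x)"
  by (intro L2_norm_mono[OF L2_bounded_linear[OF bounded_linear_trace assms] L2_scaleR[OF assms]] AE_I2)
 thus ?thesis by (simp add: L2_norm_scaleR)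
qed

text \<open>On \<open>\<Gamma>D\<close> the approximating functions tend to the boundary trace, which is zero there.\<close>

lemma disp_space_approximation:
 assumes O: "open Om" "bounded Om" and u: "u : disp_space Om GD"
 obtains \<phi> G where "!!n. smooth (\<phi> n)" "!!n. C1_grad (\<phi> n) (G n)" "!!n. \<phi> n : L2 Om" "!!n. G n : L2 Om"
  "(%n. L2_norm Om (%x. u x - \<phi> n x)) \<longlonglongrightarrow> 0" "(%n. L2_norm Om (%x. weak_grad Om u x - G n x)) \<longlonglongrightarrow> 0"
  "(%n. \<integral>\<^sup>+ x. indicator GD x * ennreal ((norm (\<phi> n x))^2) \<partial>arclength Om) \<longlonglongrightarrow> 0"
proof -
 obtain g \<phi> where uH: "u : H1 Om" and g: "AE x in arclength Om. x : GD --> g x = 0"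
  and sm: "!!n. smooth (\<phi> n)" and e0: "(%n. H1_norm Om (%x. u x - \<phi> n x)) \<longlonglongrightarrow> 0"
  and g0: "(%n. \<integral>\<^sup>+ x. ennreal ((norm (g x - \<phi> n x))^2) \<partial>arclength Om) \<longlonglongrightarrow> 0"
  using u unfolding disp_space_def has_boundary_trace_def by blast
 have "EX G. C1_grad (\<phi> n) G" for n by (rule smooth_has_C1_grad[OF sm[of n]]) blast
 then obtain G where G: "!!n. C1_grad (\<phi> n) (G n)" by metis
 have w: "has_weak_gradient Om (\<phi> n) (G n)" for n by (rule C1_grad_has_weak_gradient[OF O G])
 hence L: "\<phi> n : L2 Om" "G n : L2 Om" for n by (auto simp: has_weak_gradient_def)
 have le: "L2_norm Om (%x. weak_grad Om u x - G n x) <= H1_norm Om (%x. u x - \<phi> n x)" for n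
 proof -
  have d: "has_weak_gradient Om (%x. u x - \<phi> n x) (%x. weak_grad Om u x - G n x)"
   using has_weak_gradient_add[OF O H1_weak_grad[OF uH] has_weak_gradient_scaleR[OF w, of "-1"]] by simp
  have "L2_norm Om (%x. weak_grad Om u x - G n x) = H1_seminorm Om (%x. u x - \<phi> n x)" unfolding H1_seminorm_def using weak_grad_AE[OF O d]
   by (intro L2_norm_cong_AE weak_grad_L2 H1I[OF d] L2_diff uH L) (auto elim: eventually_mono)
  thus ?thesis using H1_norm_bounds(2) by simp
 qed
 show ?thesis
 proof (rule that[OF sm G L])
  show "(%n. L2_norm Om (%x. u x - \<phi> n x)) \<longlonglongrightarrow> 0"
   by (rule tendsto_sandwich[OF _ _ tendsto_const e0]) (auto simp: L2_norm_nonneg H1_norm_bounds)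
  show "(%n. L2_norm Om (%x. weak_grad Om u x - G n x)) \<longlonglongrightarrow> 0"
   by (rule tendsto_sandwich[OF _ _ tendsto_const e0]) (auto simp: L2_norm_nonneg le)
  have "(\<integral>\<^sup>+ x. indicator GD x * ennreal ((norm (\<phi> n x))^2) \<partial>arclength Om) <= (\<integral>\<^sup>+ x. ennreal ((norm (g x - \<phi> n x))^2) \<partial>arclength Om)" for n
   by (rule nn_integral_mono_AE) (use g in \<open>auto elim!: eventually_mono simp: indicator_def\<close>)
  thus "(%n. \<integral>\<^sup>+ x. indicator GD x * ennreal ((norm (\<phi> n x))^2) \<partial>arclength Om) \<longlonglongrightarrow> 0"
   by (intro tendsto_sandwich[OF _ _ tendsto_const g0]) auto
 qed
qed

theorem korn_disp_space:
 assumes dom: "convex_polygonal_domain Om" and D: "GD : sets borel" and pos: "emeasure (arclength Om) GD > 0"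
 shows "EX C>0. ALL u:disp_space Om GD. H1_norm Om u <= C * L2_norm Om (strain Om u)"
proof -
 note df = domain_facts[OF dom]
 obtain p a b A \<kappa> where P: "par p a b <= closure Om" "cross2 a b ~= 0" and A: "A : sets borel" "A <= {0..1}"
  "measure lborel A > 0" and kap: "\<kappa> > 0" and arc: "!!f. f : borel_measurable borel ==>
   ennreal \<kappa> * (\<integral>\<^sup>+ x. indicator A x * f (p + x *R a) \<partial>lborel) <= (\<integral>\<^sup>+ z. indicator GD z * f z \<partial>arclength Om)"
  using edge_par_exists[OF dom D pos] by blast
 obtain V where V: "finite V" "closure Om = convex hull V" using df(7) unfolding polytope_def by blast
 have int: "interior (closure Om) ~= {}" using df by simp
 obtain C where C: "C >= 0" and korn: "!!\<phi> G. smooth \<phi> & C1_grad \<phi> G ==>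
  (LINT z|leb (closure Om). (norm (\<phi> z))^2) + (LINT z|leb (closure Om). (norm (G z))^2)
  <= C * ((LINT z|leb (closure Om). (norm (symm (G z)))^2) + (LINT x|leb A. (norm (\<phi> (p + x *R a)))^2))"
  using smooth_korn_inequality[OF V(2,1) int P A] by blast
 have main: "(H1_norm Om u)^2 <= 2 * C * (L2_norm Om (strain Om u))^2" if u: "u : disp_space Om GD" for u
 proof -
  have uH: "u : H1 Om" using u by (simp add: disp_space_def)
  obtain \<phi> G where sm: "!!n. smooth (\<phi> n)" and G: "!!n. C1_grad (\<phi> n) (G n)" and L: "!!n. \<phi> n : L2 Om" "!!n. G n : L2 Om"
   and lim: "(%n. L2_norm Om (%x. u x - \<phi> n x)) \<longlonglongrightarrow> 0" "(%n. L2_norm Om (%x. weak_grad Om u x - G n x)) \<longlonglongrightarrow> 0"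
   and g0: "(%n. \<integral>\<^sup>+ x. indicator GD x * ennreal ((norm (\<phi> n x))^2) \<partial>arclength Om) \<longlonglongrightarrow> 0"
   by (rule disp_space_approximation[OF df(1,4) u]) blast
  define d e where "d = (%n. L2_norm Om (%x. u x - \<phi> n x))" and "e = (%n. L2_norm Om (%x. weak_grad Om u x - G n x))"
  define B where "B = (%n. LINT x|leb A. (norm (\<phi> n (p + x *R a)))^2)"
  define s where "s = L2_norm Om (strain Om u)"
  have B0: "B \<longlonglongrightarrow> 0"
  proof -
   have Bn: "B n >= 0" for n by (simp add: B_def)
   have le: "ennreal (\<kappa> * B n) <= (\<integral>\<^sup>+ z. indicator GD z * ennreal ((norm (\<phi> n z))^2) \<partial>arclength Om)" for n
   proof -
    let ?h = "%x. (norm (\<phi> n (p + x *R a)))^2"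
    have ch: "continuous_on S ?h" for S by (intro continuous_intros continuous_on_compose2[OF smooth_continuous[OF sm, of UNIV]]) auto
    have Al: "A : sets lebesgue" using A by auto
    have "?h absolutely_integrable_on {0..1}" by (intro absolutely_integrable_continuous_real ch)
    hence "?h absolutely_integrable_on A" by (rule set_integrable_subset) (use Al A in auto)
    hence i: "integrable (leb A) ?h" using Al by (simp add: integrable_lebesgue_on_iff)
    have "ennreal (B n) = (\<integral>\<^sup>+ x. ennreal (?h x) \<partial>leb A)"
     unfolding B_def by (rule nn_integral_eq_integral[symmetric, OF i]) simp
    also have "... = (\<integral>\<^sup>+ x. ennreal (?h x) * indicator A x \<partial>lebesgue)" by (rule nn_integral_restrict_space) (use Al in simp)
    also have "... = (\<integral>\<^sup>+ x. indicator A x * ennreal (?h x) \<partial>lborel)" by (simp add: nn_integral_completion mult.commute)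
    finally have "ennreal (\<kappa> * B n) = ennreal \<kappa> * (\<integral>\<^sup>+ x. indicator A x * ennreal (?h x) \<partial>lborel)"
     using kap Bn by (simp add: ennreal_mult)
    also have "... <= (\<integral>\<^sup>+ z. indicator GD z * ennreal ((norm (\<phi> n z))^2) \<partial>arclength Om)"
     by (rule arc, intro measurable_compose[OF borel_measurable_continuous_onI measurable_ennreal] continuous_intros smooth_continuous[OF sm])
    finally show ?thesis .
   qed
   have "(%n. ennreal (\<kappa> * B n)) \<longlonglongrightarrow> 0" by (rule tendsto_sandwich[OF _ _ tendsto_const g0]) (auto simp: le)
   hence "(%n. \<kappa> * B n) \<longlonglongrightarrow> 0" using kap Bn by (subst (asm) tendsto_ennreal_iff[of _ _ 0, simplified]) auto
   hence "(%n. (1 / \<kappa>) * (\<kappa> * B n)) \<longlonglongrightarrow> (1 / \<kappa>) * 0" by (intro tendsto_mult tendsto_const)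
   thus ?thesis using kap by simp
  qed
  have step: "(H1_norm Om u)^2 <= 2 * (C * ((s + e n)^2 + B n)) + 2 * (d n)^2 + 2 * (e n)^2" for n
  proof -
   note Ls = L2_bounded_linear[OF bounded_linear_symm] and wL = weak_grad_L2[OF uH]
   have 1: "L2_norm Om u <= L2_norm Om (\<phi> n) + d n" using L2_norm_triangle[OF L(1) L2_diff[OF H1_L2[OF uH] L(1)], of n n] unfolding d_def by simp
   have 2: "H1_seminorm Om u <= L2_norm Om (G n) + e n"
    using L2_norm_triangle[OF L(2) L2_diff[OF wL L(2)], of n n] unfolding e_def H1_seminorm_def by simp
   have "L2_norm Om (%x. symm (G n x)) = L2_norm Om (%x. symm (weak_grad Om u x) - symm (weak_grad Om u x - G n x))"
    using linear_diff[OF bounded_linear.linear[OF bounded_linear_symm]] by simp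
   also have "... <= s + L2_norm Om (%x. symm (weak_grad Om u x - G n x))"
    unfolding s_def strain_eq_symm by (rule L2_norm_triangle_diff[OF Ls[OF wL] Ls[OF L2_diff[OF wL L(2)]]])
   finally have 3: "L2_norm Om (%x. symm (G n x)) <= s + e n" using L2_norm_symm_le[OF L2_diff[OF wL L(2)], of n] unfolding e_def by linarith
   have "(L2_norm Om (\<phi> n))^2 + (L2_norm Om (G n))^2 <= C * ((L2_norm Om (%x. symm (G n x)))^2 + B n)"
   proof -
    have "(LINT z|leb (closure Om). (norm (\<phi> n z))^2) = (L2_norm Om (\<phi> n))^2"
     "(LINT z|leb (closure Om). (norm (G n z))^2) = (L2_norm Om (G n))^2"
     "(LINT z|leb (closure Om). (norm (symm (G n z)))^2) = (L2_norm Om (%z. symm (G n z)))^2" unfolding L2_norm_power2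
     by (intro integral_closure_domain[OF dom] continuous_intros C1_grad_continuous[OF G])+
    thus ?thesis using korn[of "\<phi> n" "G n"] sm G unfolding B_def by simp
   qed
   moreover have "(L2_norm Om (%x. symm (G n x)))^2 <= (s + e n)^2" by (rule power_mono[OF 3]) (simp add: L2_norm_nonneg)
   ultimately have k: "(L2_norm Om (\<phi> n))^2 + (L2_norm Om (G n))^2 <= C * ((s + e n)^2 + B n)"
    using mult_left_mono[OF _ C] by (smt (verit, best))
   have sq: "x^2 <= 2 * y^2 + 2 * w^2" if "x <= y + w" "0 <= x" for x y w :: real using power_mono[OF that, of 2] norm_add_square_le[of y w] by simp
   have "(H1_norm Om u)^2 = (L2_norm Om u)^2 + (H1_seminorm Om u)^2" by (simp add: H1_norm_def)
   thus ?thesis using sq[OF 1 L2_norm_nonneg] sq[OF 2 H1_norm_bounds(5)] k by linarith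
  qed
  have "(%n. 2 * (C * ((s + e n)^2 + B n)) + 2 * (d n)^2 + 2 * (e n)^2) \<longlonglongrightarrow> 2 * (C * ((s + 0)^2 + 0)) + 2 * 0^2 + 2 * 0^2"
   using lim B0 unfolding d_def[symmetric] e_def[symmetric] by (intro tendsto_intros)
  hence "(H1_norm Om u)^2 <= 2 * (C * ((s + 0)^2 + 0)) + 2 * 0^2 + 2 * 0^2" by (rule tendsto_lowerbound) (auto simp: step)
  thus ?thesis by (simp add: s_def)
 qed
 have "H1_norm Om u <= (sqrt (2 * C) + 1) * L2_norm Om (strain Om u)" if u: "u : disp_space Om GD" for u
  using real_le_rsqrt[OF main[OF u]] L2_norm_nonneg[of Om "strain Om u"] by (simp add: real_sqrt_mult distrib_right)
 moreover have "sqrt (2 * C) + 1 > 0" using C by (intro add_nonneg_pos) auto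
 ultimately show ?thesis by blast
qed

section \<open>Integrals of divergences\<close>

lemma frontier_subset_edges:
 assumes dom: "convex_polygonal_domain Om" and z: "z : frontier Om"
 shows "EX (a, b):edge_ends Om. z : closed_segment a b"
proof -
 note df = domain_facts[OF dom]
 have ne: "interior (closure Om) ~= {}" using df by simp
 have "frontier (closure Om) = frontier Om" using df by (simp add: frontier_def interior_open)
 hence "z : rel_frontier (closure Om)" using z rel_frontier_nonempty_interior[OF ne] by simp
 then obtain F where F: "F facet_of closure Om" "z : F" unfolding rel_frontier_of_polyhedron[OF polytope_imp_polyhedron[OF df(7)]] by blast
 have "aff_dim (closure Om) = 2" using aff_dim_nonempty_interior[OF ne] by simp
 hence f: "F face_of closure Om" "aff_dim F = 1" using F(1) by (auto simp: facet_of_def)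
 have "compact F" using f(1) df(7) by (meson face_of_imp_compact polytope_imp_compact polytope_imp_convex)
 moreover have "convex F" using f(1) by (rule face_of_imp_convex)
 moreover have "collinear F" using f(2) by (simp add: collinear_aff_dim)
 ultimately obtain a b where "F = closed_segment a b" using compact_convex_collinear_segment F(2) by blast
 thus ?thesis using f F(2) unfolding edge_ends_def edge_of_def by auto
qed

lemma edges_subset_frontier:
 assumes dom: "convex_polygonal_domain Om" and e: "(a, b) : edge_ends Om"
 shows "closed_segment a b <= frontier Om"
proof -
 note df = domain_facts[OF dom]
 have ne: "interior (closure Om) ~= {}" using df by simp
 have f: "closed_segment a b face_of closure Om" "aff_dim (closed_segment a b) = 1" using e by (auto simp: edge_ends_def edge_of_def)
 have "aff_dim (closure Om) = 2" using aff_dim_nonempty_interior[OF ne] by simp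
 hence "closed_segment a b ~= closure Om" using f(2) by auto
 hence "closed_segment a b <= rel_frontier (closure Om)" using f(1) by (rule face_of_subset_rel_frontier[rotated])
 moreover have "rel_frontier (closure Om) = frontier (closure Om)" by (rule rel_frontier_nonempty_interior[OF ne])
 moreover have "frontier (closure Om) = frontier Om" using df by (simp add: frontier_def interior_open)
 ultimately show ?thesis by simp
qed

lemma open_convex_bounded_real:
 fixes S :: "real set"
 assumes "open S" "convex S" "bounded S" "S ~= {}"
 obtains l r where "l < r" "S = {l<..<r}"
proof -
 have bd: "bdd_below S" "bdd_above S" using assms(3) by (auto simp: bounded_imp_bdd_below bounded_imp_bdd_above)
 have io: "is_interval S" using assms(2) by (simp add: is_interval_convex_1)
 have lt: "Inf S < x" "x < Sup S" if "x : S" for x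
 proof -
  obtain e where e: "e > 0" "cball x e <= S" using assms(1) \<open>x : S\<close> open_contains_cball by blast
  hence "x - e : S" "x + e : S" by (auto simp: subset_eq dist_real_def)
  hence "Inf S <= x - e" "x + e <= Sup S" using bd by (auto intro: cInf_lower cSup_upper)
  thus "Inf S < x" "x < Sup S" using e by auto
 qed
 have "S = {Inf S<..<Sup S}"
 proof (rule set_eqI, rule iffI)
  fix x assume "x : {Inf S<..<Sup S}"
  hence x: "Inf S < x" "x < Sup S" by auto
  obtain s1 where "s1 : S" "s1 < x" using cInf_lessD[OF assms(4) x(1)] by blast
  moreover obtain s2 where "s2 : S" "x < s2" using less_cSupD[OF assms(4) x(2)] by blast
  ultimately show "x : S" using io unfolding is_interval_1 by (meson less_imp_le)
 qed (use lt in auto)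
 moreover obtain x where "x : S" using assms(4) by blast
 ultimately show ?thesis using that lt by (meson less_trans)
qed

lemma integral_open_interval_FTC:
 fixes F :: "real => real"
 assumes "l < r" "!!x. (F has_real_derivative f x) (at x)" "cont f"
 shows "(LINT x|lborel. indicator {l<..<r} x * f x) = F r - F l"
proof -
 have cf: "continuous_on S f" for S using assms(3) continuous_on_subset by blast
 have bm: "f : borel_measurable borel" by (rule borel_measurable_continuous_onI[OF assms(3)])
 have "(LINT x|lborel. indicator {l<..<r} x * f x) = (LINT x|lborel. indicator {l..r} x * f x)"
 proof (rule integral_cong_AE)
  show "AE x in lborel. indicator {l<..<r} x * f x = indicator {l..r} x * f x"
   using AE_lborel_singleton[of l] AE_lborel_singleton[of r] by eventually_elim (auto simp: indicator_def)
 qed (use bm in measurable)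
 also have "... = (LINT x|leb {l..r}. f x)" by (rule integral_lebesgue_on_lborel[symmetric]) (auto simp: bm)
 also have "... = integral {l..r} f"
  by (intro lebesgue_integral_eq_integral absolutely_integrable_imp_integrable absolutely_integrable_continuous_real cf) auto
 also have "... = F r - F l" by (intro integral_unique fundamental_theorem_of_calculus)
   (use assms in \<open>auto intro: has_field_derivative_at_within simp flip: has_real_derivative_iff_has_vector_derivative\<close>)
 finally show ?thesis .
qed

text \<open>The polygon meets a line parallel to the axis \<open>j\<close> in an interval with end points on the boundary, where the
 fundamental theorem applies. For almost every line these end points lie on edges that the other coordinate
 parametrises.\<close>

lemma partial_derivative_integral_boundary_bound:
 fixes h :: "real^2 => real"
 assumes dom: "convex_polygonal_domain Om"
  and h: "!!z. (h has_derivative h' z) (at z)" and c: "cont (%z. h' z (axis j 1))"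
 shows "ennreal \<bar>LINT z|leb Om. h' z (axis j 1)\<bar> <= 4 * (\<integral>\<^sup>+ z. ennreal \<bar>h z\<bar> \<partial>arclength Om)"
proof -
 note df = domain_facts[OF dom]
 have fin: "finite (edge_ends Om)" by (rule finite_edge_ends[OF df(7)])
 let ?i = "j + 1"
 have ij: "?i + 1 = j" by (rule index2(3))
 let ?v = "vec2 ?i"
 have vn: "?v y x $ ?i = y" "?v y x $ j = x" for x y using vec2_nth[of ?i y x] unfolding ij by auto
 have v: "?v y x = y *R axis ?i 1 + x *R axis j 1" for x y by (simp only: vec2_def ij)
 let ?D = "%z. h' z (axis j 1)"
 have ch: "continuous_on S h" for S using h by (intro continuous_at_imp_continuous_on ballI) (auto intro: has_derivative_continuous)
 have hm: "h : borel_measurable borel" by (rule borel_measurable_continuous_onI[OF ch])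
 have Ob: "Om : sets borel" using df(1) by simp
 have Dm: "?D : borel_measurable borel" by (rule borel_measurable_continuous_onI[OF c])
 define f where "f = (%z. indicator Om z * ?D z)"
 have fm: "f : borel_measurable borel" unfolding f_def using Dm Ob by measurable
 define F where "F = (%y. LINT x|lborel. f (?v y x))"
 have fi: "integrable lborel f"
 proof -
  have "integrable (leb Om) ?D" by (rule integrable_continuous_bounded[OF c df(5,4)])
  hence "integrable lebesgue f" using df(5) by (simp add: integrable_restrict_space f_def)
  thus ?thesis using fm by (simp add: integrable_completion)
 qed
 hence fi2: "integrable (lborel \<Otimes>\<^sub>M lborel) (%p. f (?v (fst p) (snd p)))"
  using integral_lborel_vec2(2)[OF fm, of ?i] by (simp add: lborel_prod)
 have "(LINT z|leb Om. ?D z) = (LINT z|lborel. f z)" unfolding f_def by (rule integral_lebesgue_on_lborel[OF Ob Dm])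
 also have "... = (LINT p|(lborel \<Otimes>\<^sub>M lborel). f (?v (fst p) (snd p)))"
  using integral_lborel_vec2(1)[OF fm, of ?i] by (simp add: lborel_prod)
 also have "... = (LINT y|lborel. F y)" using lborel_pair.integral_fst'[OF fi2] by (simp add: F_def)
 finally have int: "(LINT z|leb Om. ?D z) = (LINT y|lborel. F y)" .
 have iF: "integrable lborel F" using lborel_pair.integrable_fst'[OF fi2] by (simp add: F_def)
 define N where "N = (%(a, b). a $ ?i) ` edge_ends Om"
 have finN: "finite N" using fin by (simp add: N_def)
 define T where "T = (%(a, b) y. if a $ ?i = b $ ?i then 0 else
   indicator {0..1} ((y - a $ ?i) / (b $ ?i - a $ ?i)) *
    ennreal \<bar>h ((1 - (y - a $ ?i) / (b $ ?i - a $ ?i)) *R a + ((y - a $ ?i) / (b $ ?i - a $ ?i)) *R b)\<bar>)"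
 have endpoint: "ennreal \<bar>h z\<bar> <= (\<Sum>e\<in>edge_ends Om. T e (z $ ?i))" if z: "z : frontier Om" "z $ ?i ~: N" for z
 proof -
  obtain a b where e: "(a, b) : edge_ends Om" "z : closed_segment a b" using frontier_subset_edges[OF dom z(1)] by blast
  then obtain t where t: "0 <= t" "t <= 1" "z = (1 - t) *R a + t *R b" unfolding in_segment by blast
  have "a $ ?i : N" using e(1) unfolding N_def by force
  hence za: "z $ ?i ~= a $ ?i" using z(2) by auto
  have zi: "z $ ?i - a $ ?i = t * (b $ ?i - a $ ?i)" unfolding t(3) by (simp add: algebra_simps)
  hence ne: "b $ ?i ~= a $ ?i" using za by auto
  hence "(z $ ?i - a $ ?i) / (b $ ?i - a $ ?i) = t" using zi by simp
  hence "ennreal \<bar>h z\<bar> = T (a, b) (z $ ?i)" using t ne by (simp add: T_def)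
  also have "... <= (\<Sum>e\<in>edge_ends Om. T e (z $ ?i))" using member_le_sum[OF e(1), of "%e. T e (z $ ?i)"] fin by simp
  finally show ?thesis .
 qed
 have pt: "ennreal (norm (F y)) <= 2 * (\<Sum>e\<in>edge_ends Om. T e y)" if y: "y ~: N" for y
 proof -
  define S where "S = {x. ?v y x : Om}"
  have cv: "cont (%x. ?v y x)" by (intro continuous_intros)
  have Feq: "F y = (LINT x|lborel. indicator S x * ?D (?v y x))" unfolding F_def f_def S_def by (rule lint_cong) (auto simp: indicator_def)
  show ?thesis
  proof (cases "S = {}")
   case True then show ?thesis using Feq by simp
  next
   case False
   have "S = (%x. ?v y x) -` Om" by (auto simp: S_def)
   hence oS: "open S" using open_vimage[OF df(1) cv] by simp
   have cS: "convex S"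
   proof (rule convexI)
    fix x x' u w :: real assume "x : S" "x' : S" "0 <= u" "0 <= w" "u + w = 1"
    hence "u *R ?v y x + w *R ?v y x' : Om" using df(2) by (auto simp: S_def intro: convexD)
    moreover have "u *R ?v y x + w *R ?v y x' = ?v ((u + w) * y) (u *R x + w *R x')" unfolding v by (simp add: algebra_simps)
    ultimately show "u *R x + w *R x' : S" using \<open>u + w = 1\<close> by (simp add: S_def)
   qed
   have bS: "bounded S"
   proof -
    obtain B where B: "!!z. z : Om ==> norm z <= B" using df(4) by (auto simp: bounded_iff)
    have "norm x <= B" if "x : S" for x using component_le_norm_cart[of "?v y x" j] B[of "?v y x"] that vn by (simp add: S_def)
    thus ?thesis by (auto simp: bounded_iff)
   qed
   obtain l r where lr: "l < r" "S = {l<..<r}" by (rule open_convex_bounded_real[OF oS cS bS False])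
   have d: "((%x. h (?v y x)) has_real_derivative ?D (?v y x)) (at x)" for x
    using has_derivative_along_line[OF h, where c=1 and q="y *R axis ?i 1" and v="axis j 1" and t=x] by (simp add: v)
   have cD: "cont (%x. ?D (?v y x))" by (rule continuous_on_compose2[OF c cv]) auto
   have Fy: "F y = h (?v y r) - h (?v y l)" unfolding Feq lr(2) by (rule integral_open_interval_FTC[OF lr(1) d cD])
   have fr: "?v y t : frontier Om" if t: "t = l \<or> t = r" for t
   proof -
    have "t ~: S" using t lr by auto
    hence "?v y t ~: Om" by (simp add: S_def)
    moreover have "t : closure S" unfolding lr(2) using t lr(1) by (auto simp: closure_greaterThanLessThan)
    hence "?v y t : (%x. ?v y x) ` closure S" by blast
    hence "?v y t : closure ((%x. ?v y x) ` S)"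
     using image_closure_subset[OF continuous_on_subset[OF cv subset_UNIV] closed_closure closure_subset] by blast
    hence "?v y t : closure Om" using closure_mono[of "(%x. ?v y x) ` S" Om] by (auto simp: S_def)
    ultimately show ?thesis using df(1) by (simp add: frontier_def interior_open)
   qed
   have "ennreal (norm (F y)) <= ennreal (\<bar>h (?v y r)\<bar> + \<bar>h (?v y l)\<bar>)" unfolding Fy by (intro ennreal_leI) simp
   also have "... = ennreal \<bar>h (?v y r)\<bar> + ennreal \<bar>h (?v y l)\<bar>" by (simp add: ennreal_plus)
   also have "... <= (\<Sum>e\<in>edge_ends Om. T e y) + (\<Sum>e\<in>edge_ends Om. T e y)"
    using endpoint[of "?v y r"] endpoint[of "?v y l"] fr y by (intro add_mono) (auto simp: vn)
   finally show ?thesis by (simp add: mult_2)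
  qed
 qed
 have mT: "T e : borel_measurable borel" for e
 proof -
  obtain a b where e: "e = (a, b)" by (cases e)
  have m1: "(%y. h ((1 - (y - a $ ?i) / (b $ ?i - a $ ?i)) *R a + ((y - a $ ?i) / (b $ ?i - a $ ?i)) *R b)) : borel_measurable borel"
   unfolding divide_inverse by (intro borel_measurable_continuous_onI continuous_on_compose2[OF ch[of UNIV]] continuous_intros) auto
  show ?thesis unfolding T_def e prod.case using m1 by (cases "a $ ?i = b $ ?i") (simp_all, measurable)
 qed
 have IT: "(\<integral>\<^sup>+ y. T (a, b) y \<partial>lborel) <= 2 * (\<integral>\<^sup>+ t. ennreal (dist a b / 2) * indicator {0..1} t * ennreal \<bar>h ((1 - t) *R a + t *R b)\<bar> \<partial>lborel)" for a b
 proof (cases "a $ ?i = b $ ?i")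
  case True then show ?thesis by (simp add: T_def)
 next
  case False
  define d where "d = b $ ?i - a $ ?i"
  have d: "d ~= 0" using False by (simp add: d_def)
  let ?g = "%t. indicator {0..1} t * ennreal \<bar>h ((1 - t) *R a + t *R b)\<bar>"
  have gm: "?g : borel_measurable borel"
  proof -
   have "(%t. h ((1 - t) *R a + t *R b)) : borel_measurable borel"
    by (intro borel_measurable_continuous_onI continuous_on_compose2[OF ch[of UNIV]] continuous_intros) auto
   thus ?thesis by measurable
  qed
  have Tt: "T (a, b) (a $ ?i + d * t) = ?g t" for t using False d unfolding T_def prod.case d_def[symmetric] by simp
  have "(\<integral>\<^sup>+ y. T (a, b) y \<partial>lborel) = ennreal \<bar>d\<bar> * (\<integral>\<^sup>+ t. ?g t \<partial>lborel)"
   using nn_integral_real_affine[of "T (a, b)" d "a $ ?i"] mT d by (simp add: Tt)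
  also have "... <= ennreal (dist a b) * (\<integral>\<^sup>+ t. ?g t \<partial>lborel)"
  proof (intro mult_right_mono ennreal_leI)
   show "\<bar>d\<bar> <= dist a b" using component_le_norm_cart[of "b - a" ?i] by (simp add: d_def dist_norm norm_minus_commute)
  qed simp
  also have "... = 2 * (ennreal (dist a b / 2) * (\<integral>\<^sup>+ t. ?g t \<partial>lborel))"
  proof -
   have "ennreal (dist a b) = 2 * ennreal (dist a b / 2)" using ennreal_mult[of 2 "dist a b / 2"] by simp
   thus ?thesis by (simp only: mult.assoc)
  qed
  also have "ennreal (dist a b / 2) * (\<integral>\<^sup>+ t. ?g t \<partial>lborel) = (\<integral>\<^sup>+ t. ennreal (dist a b / 2) * ?g t \<partial>lborel)"
   by (rule nn_integral_cmult[symmetric]) (use gm in simp)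
  finally show ?thesis by (simp only: mult.assoc)
 qed
 have "ennreal \<bar>LINT z|leb Om. ?D z\<bar> <= (\<integral>\<^sup>+ y. ennreal (norm (F y)) \<partial>lborel)"
  unfolding int using integral_norm_bound_ennreal[OF iF] by simp
 also have "... <= (\<integral>\<^sup>+ y. 2 * (\<Sum>e\<in>edge_ends Om. T e y) \<partial>lborel)"
 proof (rule nn_integral_mono_AE)
  have "AE y in lborel. y ~: N" using finN by (intro AE_not_in) (simp add: finite_imp_null_set_lborel)
  thus "AE y in lborel. ennreal (norm (F y)) <= 2 * (\<Sum>e\<in>edge_ends Om. T e y)" by eventually_elim (rule pt)
 qed
 also have "... = 2 * (\<Sum>e\<in>edge_ends Om. \<integral>\<^sup>+ y. T e y \<partial>lborel)"
  using mT by (simp add: nn_integral_cmult nn_integral_sum)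
 also have "... <= 2 * (\<Sum>(a, b)\<in>edge_ends Om. 2 * (\<integral>\<^sup>+ t. ennreal (dist a b / 2) * indicator {0..1} t * ennreal \<bar>h ((1 - t) *R a + t *R b)\<bar> \<partial>lborel))"
  by (intro mult_left_mono sum_mono) (auto intro!: IT)
 also have "... = 4 * (\<integral>\<^sup>+ z. ennreal \<bar>h z\<bar> \<partial>arclength Om)"
 proof -
  have "(%z. ennreal \<bar>h z\<bar>) : borel_measurable borel" using hm by measurable
  thus ?thesis by (simp add: nn_integral_arclength[OF fin] split_beta sum_distrib_left[symmetric] mult.assoc[symmetric])
 qed
 finally show ?thesis .
qed

lemma divergence_L2: "u : H1 Om ==> divergence Om u : L2 Om"
 using L2_bounded_linear[OF bounded_linear_trace weak_grad_L2[of u Om]] by (simp add: divergence_def[abs_def])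

lemma divergence_integral_boundary_bound:
 assumes dom: "convex_polygonal_domain Om" and u: "C1_grad u G"
 shows "ennreal \<bar>LINT z|leb Om. trace (G z)\<bar> <= 8 * (\<integral>\<^sup>+ z. ennreal (norm (u z)) \<partial>arclength Om)"
proof -
 note df = domain_facts[OF dom]
 note cu = C1_grad_continuous[OF u]
 have Gv: "(G z *v axis j 1) $ j = G z $ j $ j" for z j by (simp add: matrix_vector_mult_basis column_def)
 have b: "ennreal \<bar>LINT z|leb Om. G z $ j $ j\<bar> <= 4 * (\<integral>\<^sup>+ z. ennreal (norm (u z)) \<partial>arclength Om)" for j
 proof -
  have "ennreal \<bar>LINT z|leb Om. (G z *v axis j 1) $ j\<bar> <= 4 * (\<integral>\<^sup>+ z. ennreal \<bar>u z $ j\<bar> \<partial>arclength Om)"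
  proof (rule partial_derivative_integral_boundary_bound[OF dom])
   show "((%z. u z $ j) has_derivative (%v. (G z *v v) $ j)) (at z)" for z
    using u unfolding C1_grad_def by (intro bounded_linear.has_derivative[OF bounded_linear_vec_nth]) auto
   show "cont (%z. (G z *v axis j 1) $ j)" unfolding Gv by (intro continuous_intros cu)
  qed
  also have "... <= 4 * (\<integral>\<^sup>+ z. ennreal (norm (u z)) \<partial>arclength Om)"
   by (intro mult_left_mono nn_integral_mono ennreal_leI component_le_norm_cart) simp
  finally show ?thesis unfolding Gv .
 qed
 have "(LINT z|leb Om. trace (G z)) = (LINT z|leb Om. G z $ 1 $ 1) + (LINT z|leb Om. G z $ 2 $ 2)" unfolding trace_def sum_2
  by (intro lint_add integrable_continuous_bounded continuous_intros cu df)
 hence "ennreal \<bar>LINT z|leb Om. trace (G z)\<bar> <= ennreal (\<bar>LINT z|leb Om. G z $ 1 $ 1\<bar> + \<bar>LINT z|leb Om. G z $ 2 $ 2\<bar>)"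
  by (intro ennreal_leI) simp
 also have "... = ennreal \<bar>LINT z|leb Om. G z $ 1 $ 1\<bar> + ennreal \<bar>LINT z|leb Om. G z $ 2 $ 2\<bar>" by (simp add: ennreal_plus)
 also have "... <= 4 * (\<integral>\<^sup>+ z. ennreal (norm (u z)) \<partial>arclength Om) + 4 * (\<integral>\<^sup>+ z. ennreal (norm (u z)) \<partial>arclength Om)"
  by (intro add_mono b)
 also have "... = 8 * (\<integral>\<^sup>+ z. ennreal (norm (u z)) \<partial>arclength Om)" by (simp flip: distrib_right)
 finally show ?thesis .
qed

text \<open>The bound by boundary values passes to the limit along smooth functions that become small on the boundary.\<close>

theorem divergence_integral_zero:
 assumes dom: "convex_polygonal_domain Om" and u: "u : disp_space Om (frontier Om)"
 shows "(LINT x|leb Om. divergence Om u x) = 0"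
proof -
 note df = domain_facts[OF dom] and fin = finite_edge_ends[OF domain_facts(7)[OF dom]] and Lt = L2_bounded_linear[OF bounded_linear_trace]
 have uH: "u : H1 Om" using u by (simp add: disp_space_def)
 obtain \<phi> G where sm: "!!n. smooth (\<phi> n)" and G: "!!n. C1_grad (\<phi> n) (G n)" and L: "!!n. \<phi> n : L2 Om" "!!n. G n : L2 Om"
  and lim: "(%n. L2_norm Om (%x. weak_grad Om u x - G n x)) \<longlonglongrightarrow> 0"
  and g0: "(%n. \<integral>\<^sup>+ x. indicator (frontier Om) x * ennreal ((norm (\<phi> n x))^2) \<partial>arclength Om) \<longlonglongrightarrow> 0"
  by (rule disp_space_approximation[OF df(1,4) u]) blast
 define I J where "I = (LINT x|leb Om. divergence Om u x)" and "J n = (LINT z|leb Om. trace (G n z))" for n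
 define L where "L = (\<integral>\<^sup>+ x. 1^2 \<partial>arclength Om)"
 have "L = (\<Sum>(a, b)\<in>edge_ends Om. \<integral>\<^sup>+ t. ennreal (dist a b / 2) * indicator {0..1::real} t * 1^2 \<partial>lborel)"
  unfolding L_def by (rule nn_integral_arclength[OF fin]) simp
 hence Lfin: "L < \<infinity>" by (simp add: split_beta nn_integral_cmult_indicator fin)
 have JI: "J \<longlonglongrightarrow> I"
 proof -
  have one: "(%x. 1::real) : L2 Om" by (rule continuous_bounded_L2[OF continuous_on_const df(5,4)])
  have "norm (J n - I) <= (sqrt 2 * L2_norm Om (%x. 1::real)) * L2_norm Om (%x. weak_grad Om u x - G n x)" for n
  proof -
   note dL = L2_diff[OF weak_grad_L2[OF uH] L(2)[of n]]
   have "I - J n = (LINT x|leb Om. trace (weak_grad Om u x - G n x) \<bullet> 1)"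
    using L2_imp_integrable[OF Lt[OF L(2)[of n]] df(5,4)] L2_imp_integrable[OF Lt[OF weak_grad_L2[OF uH]] df(5,4)]
    by (simp add: I_def J_def divergence_def linear_diff[OF bounded_linear.linear[OF bounded_linear_trace]])
   hence "norm (J n - I) <= L2_norm Om (%x. trace (weak_grad Om u x - G n x)) * L2_norm Om (%x. 1::real)"
    using L2_Cauchy_Schwarz[OF Lt[OF dL] one] by (simp add: abs_minus_commute)
   also have "... <= (sqrt 2 * L2_norm Om (%x. weak_grad Om u x - G n x)) * L2_norm Om (%x. 1::real)"
    by (intro mult_right_mono L2_norm_trace_le dL L2_norm_nonneg)
   finally show ?thesis by (simp only: mult_ac)
  qed
  hence "(%n. J n - I) \<longlonglongrightarrow> 0" by (intro Lim_null_comparison[OF always_eventually tendsto_mult_right_zero[OF lim]] allI)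
  thus ?thesis by (rule Lim_null[THEN iffD2])
 qed
 have bound: "ennreal ((J n)^2) <= 64 * L * (\<integral>\<^sup>+ x. indicator (frontier Om) x * ennreal ((norm (\<phi> n x))^2) \<partial>arclength Om)" for n
 proof -
  let ?f = "%x. ennreal (norm (\<phi> n x))"
  have m: "?f : borel_measurable borel"
   by (intro measurable_compose[OF borel_measurable_continuous_onI measurable_ennreal] continuous_intros smooth_continuous[OF sm])
  have fr: "(\<integral>\<^sup>+ x. (?f x)^2 \<partial>arclength Om) = (\<integral>\<^sup>+ x. indicator (frontier Om) x * (?f x)^2 \<partial>arclength Om)"
  proof -
   have "h = h' ==> c * indicator {0..1} t * h = c * indicator {0..1::real} t * h'" for c h h' :: ennreal and t by simp
   have "ennreal (dist a b / 2) * indicator {0..1} t * (?f ((1 - t) *R a + t *R b))^2 = ennreal (dist a b / 2) * indicator {0..1} t *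
     (indicator (frontier Om) ((1 - t) *R a + t *R b) * (?f ((1 - t) *R a + t *R b))^2)" if e: "(a, b) : edge_ends Om" for a b t
   proof (cases "t : {0..1}")
    case True
    hence "(1 - t) *R a + t *R b : closed_segment a b" by (auto simp: closed_segment_def)
    thus ?thesis using edges_subset_frontier[OF dom e] by auto
   qed simp
   moreover have "(%x. indicator (frontier Om) x * (?f x)^2) : borel_measurable borel" using m by (simp add: borel_closed)
   ultimately show ?thesis using m by (subst (1 2) nn_integral_arclength[OF fin]) (auto intro!: sum.cong)
  qed
  have "ennreal ((J n)^2) = (ennreal \<bar>J n\<bar>)^2" by (simp add: ennreal_power)
  also have "... <= (8 * (\<integral>\<^sup>+ x. ?f x * 1 \<partial>arclength Om))^2"
   using divergence_integral_boundary_bound[OF dom G[of n]] unfolding J_def by (intro power_mono) auto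
  also have "... = 64 * (\<integral>\<^sup>+ x. ?f x * 1 \<partial>arclength Om)^2" by (simp add: power_mult_distrib)
  also have "... <= 64 * ((\<integral>\<^sup>+ x. (?f x)^2 \<partial>arclength Om) * L)"
   unfolding L_def by (rule mult_left_mono[OF Cauchy_Schwarz_nn_integral])
    (use m in \<open>simp_all add: measurable_cong_sets[OF sets_arclength refl]\<close>)
  finally show ?thesis unfolding fr by (simp add: ennreal_power mult_ac)
 qed
 have "(%n. ennreal ((J n)^2)) \<longlonglongrightarrow> ennreal (I^2)" by (intro tendsto_ennrealI tendsto_power JI)
 moreover have "(%n. 64 * L * (\<integral>\<^sup>+ x. indicator (frontier Om) x * ennreal ((norm (\<phi> n x))^2) \<partial>arclength Om)) \<longlonglongrightarrow> 64 * L * 0"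
  using Lfin by (intro ennreal_tendsto_cmult g0) (simp add: ennreal_mult_less_top)
 ultimately have "ennreal (I^2) <= 64 * L * 0" by (rule LIMSEQ_le) (use bound in blast)
 thus ?thesis by (simp add: I_def)
qed

section \<open>Convex quadrilaterals and their bilinear maps\<close>

lemma cross2_simps:
 "cross2 (a + b) c = cross2 a c + cross2 b c" "cross2 a (b + c) = cross2 a b + cross2 a c"
 "cross2 (a - b) c = cross2 a c - cross2 b c" "cross2 a (b - c) = cross2 a b - cross2 a c"
 "cross2 (r *R a) c = r * cross2 a c" "cross2 a (r *R c) = r * cross2 a c"
 "cross2 a a = 0" "cross2 (- a) c = - cross2 a c" "cross2 a (- c) = - cross2 a c" by (simp_all add: cross2_def algebra_simps)

definition jac :: "quad => real^2 => real" where
 "jac K z = cross2 (coef1 K) (coef2 K) + z$1 * cross2 (coef1 K) (coef12 K) + z$2 * cross2 (coef12 K) (coef2 K)"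

lemma jac_cross: "jac K z = cross2 (coef1 K + z$2 *R coef12 K) (coef2 K + z$1 *R coef12 K)"
 by (simp add: jac_def cross2_simps)

lemma jac_corners:
 "jac K (vector [-1, -1]) = cross2 (K$1 - K$4) (K$2 - K$1) / 4"
 "jac K (vector [1, -1]) = cross2 (K$2 - K$1) (K$3 - K$2) / 4"
 "jac K (vector [1, 1]) = cross2 (K$3 - K$2) (K$4 - K$3) / 4"
 "jac K (vector [-1, 1]) = cross2 (K$4 - K$3) (K$1 - K$4) / 4" by (simp_all add: jac_def cross2_def coef1_def coef2_def coef12_def field_simps)

lemma index4_wrap: "(0::4) = 4" "(5::4) = 1" by simp_all

lemma index4: "(1::4) + 1 = 2" "(2::4) + 1 = 3" "(3::4) + 1 = 4" "(4::4) + 1 = 1"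
 "(1::4) - 1 = 4" "(2::4) - 1 = 1" "(3::4) - 1 = 2" "(4::4) - 1 = 3" by (simp_all, (simp add: eq_diff_eq diff_eq_eq)?)

lemma ref_square_cbox: "ref_square = cbox (vec (-1)) (vec 1)"
 by (auto simp: ref_square_def mem_box_cart abs_le_iff minus_le_iff)

lemma ref_square_memI: "\<bar>z$1\<bar> <= 1 ==> \<bar>z$2\<bar> <= 1 ==> z : ref_square"
 and ref_square_memD: "z : ref_square ==> \<bar>z$i\<bar> <= 1" by (simp_all add: ref_square_def forall_2[of "%i. \<bar>z $ i\<bar> <= 1"])
  (metis (full_types) exhaust_2)

text \<open>Jacobians are affine, so bounds for them need only be checked at the corners.\<close>

lemma affine_ref_square_bounds:
 fixes p q r m :: real
 assumes z: "z : ref_square"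
  and "m <= p + q + r" "m <= p + q - r" "m <= p - q + r" "m <= p - q - r"
 shows "m <= p + z$1 * q + z$2 * r"
proof -
 have "\<bar>z$1 * q\<bar> <= 1 * \<bar>q\<bar>" "\<bar>z$2 * r\<bar> <= 1 * \<bar>r\<bar>"
  using ref_square_memD[OF z] unfolding abs_mult by (intro mult_right_mono; simp)+
 moreover have "m <= p - \<bar>q\<bar> - \<bar>r\<bar>" using assms(2-) by (auto simp: abs_if)
 ultimately show ?thesis by linarith
qed

lemma jac_ge:
 assumes "z : ref_square" "!!i. 4 * m <= cross2 (K $ i - K $ (i - 1)) (K $ (i + 1) - K $ i)"
 shows "m <= jac K z"
proof -
 have "m <= jac K (vector [-1, -1])" "m <= jac K (vector [1, -1])" "m <= jac K (vector [1, 1])" "m <= jac K (vector [-1, 1])"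
  unfolding jac_corners using assms(2)[of 1] assms(2)[of 2] assms(2)[of 3] assms(2)[of 4] by (simp_all add: index4 index4_wrap)
 thus ?thesis unfolding jac_def by (intro affine_ref_square_bounds[OF assms(1)]) simp_all
qed

lemma jac_le:
 assumes "z : ref_square" "!!i. cross2 (K $ i - K $ (i - 1)) (K $ (i + 1) - K $ i) <= 4 * m"
 shows "jac K z <= m"
proof -
 have "jac K (vector [-1, -1]) <= m" "jac K (vector [1, -1]) <= m" "jac K (vector [1, 1]) <= m" "jac K (vector [-1, 1]) <= m"
  unfolding jac_corners using assms(2)[of 1] assms(2)[of 2] assms(2)[of 3] assms(2)[of 4] by (simp_all add: index4 index4_wrap)
 hence "- m <= - cross2 (coef1 K) (coef2 K) + z$1 * - cross2 (coef1 K) (coef12 K) + z$2 * - cross2 (coef12 K) (coef2 K)"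
  unfolding jac_def by (intro affine_ref_square_bounds[OF assms(1)]) simp_all
 thus ?thesis by (simp add: jac_def)
qed

lemma jac_pos: "convex_quad K ==> z : ref_square ==> jac K z > 0"
proof -
 assume K: "convex_quad K" "z : ref_square"
 define m where "m = (MIN i. cross2 (K $ i - K $ (i - 1)) (K $ (i + 1) - K $ i))"
 have "m : range (%i. cross2 (K $ i - K $ (i - 1)) (K $ (i + 1) - K $ i))" unfolding m_def by (rule Min_in) auto
 hence "m > 0" using K(1) by (auto simp: convex_quad_def)
 moreover have "m / 4 <= jac K z" by (rule jac_ge[OF K(2)]) (simp add: m_def)
 ultimately show ?thesis by linarith
qed

lemma bilinear_map_diff:
 "bilinear_map K z - bilinear_map K w =
   (z$1 - w$1) *R (coef1 K + ((1/2) *R (z + w))$2 *R coef12 K) + (z$2 - w$2) *R (coef2 K + ((1/2) *R (z + w))$1 *R coef12 K)"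
 by (simp add: bilinear_map_def vec_eq_iff field_simps)

text \<open>A difference of values of the map is its derivative at the midpoint applied to the difference of the arguments.\<close>

lemma inj_bilinear_map:
 assumes K: "convex_quad K"
 shows "inj_on (bilinear_map K) ref_square"
proof (rule inj_onI)
 fix z w assume zw: "z : ref_square" "w : ref_square" "bilinear_map K z = bilinear_map K w"
 define a b where "a = coef1 K + ((1/2) *R (z + w))$2 *R coef12 K" and "b = coef2 K + ((1/2) *R (z + w))$1 *R coef12 K"
 have "(1/2) *R (z + w) : ref_square"
  using ref_square_memD[OF zw(1), of 1] ref_square_memD[OF zw(2), of 1] ref_square_memD[OF zw(1), of 2] ref_square_memD[OF zw(2), of 2]
  by (intro ref_square_memI) (auto simp: abs_le_iff)
 hence "cross2 a b > 0" using jac_pos[OF K, of "(1/2) *R (z + w)"] unfolding jac_cross a_def b_def by blast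
 moreover have e: "(z$1 - w$1) *R a + (z$2 - w$2) *R b = 0" using bilinear_map_diff[of K z w] zw(3) by (simp add: a_def b_def)
 have "(z$1 - w$1) * cross2 a b = cross2 ((z$1 - w$1) *R a + (z$2 - w$2) *R b) b"
  "(z$2 - w$2) * cross2 a b = cross2 a ((z$1 - w$1) *R a + (z$2 - w$2) *R b)" by (simp_all add: cross2_simps)
 ultimately have "z$1 = w$1" "z$2 = w$2" unfolding e by (auto simp: cross2_def)
 thus "z = w" by (simp add: vec_eq_iff forall_2)
qed

definition bilinear_deriv :: "quad => real^2 => real^2 => real^2" where
 "bilinear_deriv K z h = h$1 *R (coef1 K + z$2 *R coef12 K) + h$2 *R (coef2 K + z$1 *R coef12 K)"

lemma bilinear_map_has_derivative: "(bilinear_map K has_derivative bilinear_deriv K z) (at z within S)"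
 unfolding bilinear_map_def[abs_def] bilinear_deriv_def[abs_def] by (rule derivative_eq_intros vec_nth_has_derivative refl | simp)+
  (simp add: fun_eq_iff algebra_simps)

lemma det_bilinear_deriv: "det (matrix (bilinear_deriv K z)) = jac K z"
 by (simp add: det_2 matrix_def bilinear_deriv_def jac_cross cross2_def axis_def algebra_simps)

lemma continuous_bilinear_map: "continuous_on S (bilinear_map K)"
 using bilinear_map_has_derivative by (rule has_derivative_continuous_on)

lemma bilinear_map_in_hull:
 assumes z: "z : ref_square" shows "bilinear_map K z : quad_hull K"
proof -
 define x y where "x = z$1" and "y = z$2"
 have xy: "\<bar>x\<bar> <= 1" "\<bar>y\<bar> <= 1" using ref_square_memD[OF z] by (auto simp: x_def y_def)
 define c :: "4 => real" where "c = (%i. if i = 1 then (1 - x) * (1 - y) / 4 else if i = 2 then (1 + x) * (1 - y) / 4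
  else if i = 3 then (1 + x) * (1 + y) / 4 else (1 - x) * (1 + y) / 4)"
 have "(\<Sum>i\<in>UNIV. c i *R K $ i) : convex hull (range (($) K))"
 proof (rule convex_sum)
  show "finite (UNIV :: 4 set)" "convex (convex hull (range (($) K)))" by auto
  show "(\<Sum>i\<in>UNIV. c i) = 1" by (simp add: sum_4 c_def field_simps)
  show "0 <= c i" for i using xy unfolding c_def by (auto simp: abs_le_iff)
  show "K $ i : convex hull (range (($) K))" for i by (rule hull_inc) auto
 qed
 moreover have "(\<Sum>i\<in>UNIV. c i *R K $ i) = bilinear_map K z"
  by (simp add: sum_4 c_def bilinear_map_def coef0_def coef1_def coef2_def coef12_def x_def y_def vec_eq_iff field_simps)
 ultimately show ?thesis unfolding quad_hull_def by simp
qed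

lemma hull_left_of_sides:
 assumes K: "convex_quad K" and x: "x : quad_hull K"
 shows "cross2 (K $ (i + 1) - K $ i) (x - K $ i) >= 0"
proof -
 have v: "cross2 (K $ (i + 1) - K $ i) (K $ j - K $ i) >= 0" for j
 proof -
  have c: "cross2 (K $ i - K $ (i - 1)) (K $ (i + 1) - K $ i) > 0" for i using K by (simp add: convex_quad_def)
  show ?thesis using exhaust_4[of i] exhaust_4[of j] c[of 1] c[of 2] c[of 3] c[of 4]
   by (elim disjE; simp add: index4 index4_wrap cross2_def algebra_simps)
 qed
 have "quad_hull K <= {x. cross2 (K $ (i + 1) - K $ i) (x - K $ i) >= 0}" unfolding quad_hull_def
 proof (rule hull_minimal)
  show "range (($) K) <= {x. cross2 (K $ (i + 1) - K $ i) (x - K $ i) >= 0}" using v by auto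
  define a where "a = (vector [- (K $ (i + 1) - K $ i)$2, (K $ (i + 1) - K $ i)$1] :: real^2)"
  have "{x. cross2 (K $ (i + 1) - K $ i) (x - K $ i) >= 0} = {x. a \<bullet> x >= a \<bullet> K $ i}"
   by (auto simp: cross2_def a_def inner_vec_def sum_2 algebra_simps)
  thus "convex {x. cross2 (K $ (i + 1) - K $ i) (x - K $ i) >= 0}" by (simp add: convex_halfspace_ge)
 qed
 thus ?thesis using x by auto
qed

lemma side_not_interior:
 assumes K: "convex_quad K" and x: "cross2 (K $ (i + 1) - K $ i) (x - K $ i) = 0"
 shows "x ~: interior (quad_hull K)"
proof
 assume "x : interior (quad_hull K)"
 then obtain e where e: "e > 0" "cball x e <= quad_hull K" unfolding mem_interior_cball by blast
 define d where "d = K $ (i + 1) - K $ i"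
 have "d ~= 0" using K[unfolded convex_quad_def] unfolding d_def by (auto simp: cross2_def dest: spec[of _ i])
 define n where "n = (vector [d$2, - d$1] :: real^2)"
 have nn: "cross2 d n < 0"
 proof -
  have "cross2 d n = - ((d$1)^2 + (d$2)^2)" by (simp add: cross2_def n_def power2_eq_square)
  moreover have "(d$1)^2 + (d$2)^2 > 0" using \<open>d ~= 0\<close> by (simp add: sum_power2_gt_zero_iff vec_eq_iff forall_2)
  ultimately show ?thesis by linarith
 qed
 hence "n ~= 0" by (auto simp: cross2_def)
 hence "x + (e / norm n) *R n : cball x e" using e(1) by (simp add: dist_norm)
 hence "cross2 d (x + (e / norm n) *R n - K $ i) >= 0" using hull_left_of_sides[OF K] e(2) unfolding d_def by auto
 moreover have "cross2 d (x + (e / norm n) *R n - K $ i) = (e / norm n) * cross2 d n" using x unfolding d_def[symmetric] by (simp add: cross2_simps)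
 ultimately show False using nn e(1) \<open>n ~= 0\<close> by (simp add: zero_le_mult_iff zero_le_divide_iff)
qed

lemma bilinear_map_boundary:
 assumes K: "convex_quad K" and z: "z $ j = -1 \<or> z $ j = 1"
 shows "bilinear_map K z ~: interior (quad_hull K)"
proof -
 note defs = bilinear_map_def coef0_def coef1_def coef2_def coef12_def vec_eq_iff field_simps
 consider "z$2 = -1" | "z$1 = 1" | "z$2 = 1" | "z$1 = -1" using z exhaust_2[of j] by auto
 hence "EX i t. bilinear_map K z - K $ i = t *R (K $ (i + 1) - K $ i)"
 proof cases
  case 1 then show ?thesis by (intro exI[of _ 1] exI[of _ "(1 + z$1) / 2"]) (simp add: index4 defs)
 next
  case 2 then show ?thesis by (intro exI[of _ 2] exI[of _ "(1 + z$2) / 2"]) (simp add: index4 defs)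
 next
  case 3 then show ?thesis by (intro exI[of _ 3] exI[of _ "(1 - z$1) / 2"]) (simp add: index4 defs)
 next
  case 4 then show ?thesis by (intro exI[of _ 4] exI[of _ "(1 - z$2) / 2"]) (simp add: index4 index4_wrap defs)
 qed
 then obtain i t where "bilinear_map K z - K $ i = t *R (K $ (i + 1) - K $ i)" by blast
 hence "cross2 (K $ (i + 1) - K $ i) (bilinear_map K z - K $ i) = 0" by (simp only: cross2_simps(6,7) mult_zero_right)
 thus ?thesis by (rule side_not_interior[OF K])
qed

text \<open>The image of the open square is open by invariance of domain, and relatively closed in the interior of the
 quadrilateral because the sides go to its boundary; connectedness gives surjectivity.\<close>

lemma bilinear_map_surj:
 assumes K: "convex_quad K"
 shows "bilinear_map K ` box (vec (-1)) (vec 1) = interior (quad_hull K)" "bilinear_map K ` ref_square = quad_hull K"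
proof -
 let ?F = "bilinear_map K" and ?B = "box (vec (-1)) (vec 1) :: (real^2) set" and ?H = "interior (quad_hull K)"
 have B: "?B <= ref_square" unfolding ref_square_cbox by (rule box_subset_cbox)
 have sub: "?F ` ref_square <= quad_hull K" using bilinear_map_in_hull by blast
 have op: "open (?F ` ?B)" by (rule invariance_of_domain[OF continuous_bilinear_map open_box inj_on_subset[OF inj_bilinear_map[OF K] B]])
 have comp: "compact (?F ` ref_square)" by (rule compact_continuous_image[OF continuous_bilinear_map]) (simp add: ref_square_cbox)
 have FB: "?F ` ?B <= ?H" using op sub B by (intro interior_maximal) auto
 have eq: "?H \<inter> ?F ` ref_square = ?F ` ?B"
 proof
  show "?F ` ?B <= ?H \<inter> ?F ` ref_square" using FB B by auto
  show "?H \<inter> ?F ` ref_square <= ?F ` ?B"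
  proof
   fix x assume "x : ?H \<inter> ?F ` ref_square"
   then obtain z where z: "z : ref_square" "x = ?F z" "x : ?H" by auto
   have "z $ j ~= -1 & z $ j ~= 1" for j using bilinear_map_boundary[OF K] z by blast
   hence "-1 < z $ j & z $ j < 1" for j using ref_square_memD[OF z(1), of j] by (simp add: less_le abs_le_iff) (metis minus_le_iff)
   hence "z : ?B" by (simp add: mem_box_cart)
   thus "x : ?F ` ?B" using z by simp
  qed
 qed
 have cv: "convex (quad_hull K)" unfolding quad_hull_def by simp
 hence "connected ?H" by (intro convex_connected convex_interior)
 moreover have "openin (top_of_set ?H) (?F ` ?B)" using op FB by (simp add: open_openin_trans)
 moreover have "closedin (top_of_set ?H) (?F ` ?B)" unfolding eq[symmetric] using comp by (simp add: compact_imp_closed closedin_closed_Int)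
 moreover have "0 : ?B" by (simp add: mem_box_cart)
 hence ne: "?F ` ?B ~= {}" by auto
 ultimately show 1: "?F ` ?B = ?H" unfolding connected_clopen by blast
 have "closure ?H = closure (quad_hull K)" using 1 ne by (intro convex_closure_interior[OF cv]) auto
 moreover have "closure ?H <= ?F ` ref_square" using 1 B comp by (intro closure_minimal) (auto simp: compact_imp_closed)
 ultimately show "?F ` ref_square = quad_hull K" using sub closure_subset by blast
qed

lemma compact_quad_hull: "compact (quad_hull K)"
 unfolding quad_hull_def by (intro finite_imp_compact_convex_hull) auto

lemma quad_hull_sets [simp]: "quad_hull K : sets lebesgue" "ref_square : sets lebesgue"
 "interior (quad_hull K) : sets lebesgue" using compact_quad_hull[of K] by (auto simp: lmeasurable_compact fmeasurableD ref_square_cbox borel_open)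

lemma quad_change_of_variables:
 fixes f :: "real^2 => real"
 assumes K: "convex_quad K"
 shows "integrable (leb (quad_hull K)) f \<longleftrightarrow> integrable RS (%z. jac K z * f (bilinear_map K z))"
  and "(LINT x|leb (quad_hull K). f x) = (LINT z|RS. jac K z * f (bilinear_map K z))"
proof -
 have j: "\<bar>det (matrix (bilinear_deriv K z))\<bar> = jac K z" if "z : ref_square" for z
  using jac_pos[OF K that] by (simp add: det_bilinear_deriv)
 note cv = change_of_variables_scalar(1,2)[OF quad_hull_sets(2) bilinear_map_has_derivative inj_bilinear_map[OF K],
   unfolded bilinear_map_surj(2)[OF K], where f=f]
 show "integrable (leb (quad_hull K)) f \<longleftrightarrow> integrable RS (%z. jac K z * f (bilinear_map K z))"
  unfolding cv(1) by (rule lintegrable_cong[OF refl]) (simp add: j)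
 show "(LINT x|leb (quad_hull K). f x) = (LINT z|RS. jac K z * f (bilinear_map K z))" unfolding cv(2) by (rule lint_cong[OF refl]) (simp add: j)
qed

lemma AE_lebesgue_on_negligible:
 assumes "S : sets lebesgue"
 shows "(AE x in leb S. P x) \<longleftrightarrow> negligible {x : S. \<not> P x}"
proof -
 have "(AE x in leb S. P x) \<longleftrightarrow> (AE x in lebesgue. x : S --> P x)" using assms by (intro AE_restrict_space_iff) auto
 also have "... \<longleftrightarrow> negligible {x : S. \<not> P x}"
 proof
  assume "AE x in lebesgue. x : S --> P x"
  then obtain N where N: "N : null_sets lebesgue" "{x : space lebesgue. \<not> (x : S --> P x)} <= N" unfolding eventually_ae_filter by blast
  have "{x : S. \<not> P x} <= N" using N(2) by auto
  with N(1)[folded negligible_iff_null_sets] show "negligible {x : S. \<not> P x}" by (rule negligible_subset)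
 next
  assume "negligible {x : S. \<not> P x}"
  thus "AE x in lebesgue. x : S --> P x" unfolding negligible_iff_null_sets by (rule AE_I') auto
 qed
 finally show ?thesis .
qed

lemma quad_AE:
 assumes K: "convex_quad K"
 shows "(AE x in leb (quad_hull K). P x) \<longleftrightarrow> (AE z in RS. P (bilinear_map K z))"
proof
 assume "AE x in leb (quad_hull K). P x"
 hence n: "negligible {x : quad_hull K. \<not> P x}" (is "negligible ?N") by (simp add: AE_lebesgue_on_negligible)
 define f :: "real^2 => real" where "f = indicator ?N"
 have m: "f : borel_measurable (leb (quad_hull K))"
  unfolding f_def using n by (intro measurable_restrict_space1 borel_measurable_indicator) (simp add: negligible_iff_null_sets null_setsD2)
 have "AE x in leb (quad_hull K). f x = 0"
  unfolding AE_lebesgue_on_negligible[OF quad_hull_sets(1)] by (rule negligible_subset[OF n]) (auto simp: f_def)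
 hence "integrable (leb (quad_hull K)) f" "(LINT x|leb (quad_hull K). f x) = 0"
  using m integrable_cong_AE[OF m, of "%x. 0"] integral_cong_AE[OF m, of "%x. 0"] by auto
 hence "integrable RS (%z. jac K z * f (bilinear_map K z))"
  "(LINT z|RS. jac K z * f (bilinear_map K z)) = 0" unfolding quad_change_of_variables[OF K] by auto
 moreover have "AE z in RS. 0 <= jac K z * f (bilinear_map K z)"
  using jac_pos[OF K] by (intro AE_I2 mult_nonneg_nonneg) (auto simp: f_def less_imp_le)
 ultimately have "AE z in RS. jac K z * f (bilinear_map K z) = 0" by (simp add: integral_nonneg_eq_0_iff_AE)
 thus "AE z in RS. P (bilinear_map K z)"
 proof (rule AE_mp, intro AE_I2 impI)
  fix z assume z: "z : space RS" "jac K z * f (bilinear_map K z) = 0"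
  hence "f (bilinear_map K z) = 0" using jac_pos[OF K, of z] by simp
  thus "P (bilinear_map K z)" using bilinear_map_in_hull[of z K] z(1) by (auto simp: f_def indicator_def split: if_splits)
 qed
next
 assume "AE z in RS. P (bilinear_map K z)"
 hence n: "negligible {z : ref_square. \<not> P (bilinear_map K z)}" by (simp add: AE_lebesgue_on_negligible)
 have "negligible (bilinear_map K ` {z : ref_square. \<not> P (bilinear_map K z)})"
  using bilinear_map_has_derivative by (intro negligible_differentiable_image_negligible[OF _ n])
   (auto simp: differentiable_on_def differentiable_def)
 thus "AE x in leb (quad_hull K). P x" unfolding AE_lebesgue_on_negligible[OF quad_hull_sets(1)]
  by (rule negligible_subset) (auto simp: bilinear_map_surj(2)[OF K, symmetric])
qed

section \<open>Shape regular quadrilaterals\<close>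

lemma affine_inradius:
 assumes D: "cball c r <= {x. 0 <= cross2 e (x - p) & cross2 e (x - p) <= D}" and r: "r >= 0"
 shows "2 * r * norm e <= D"
proof (cases "e = 0")
 case True
 have "c : cball c r" using r by simp
 hence "0 <= cross2 e (c - p) & cross2 e (c - p) <= D" using D by blast
 thus ?thesis using True by simp
next
 case False
 define n where "n = (vector [- e$2, e$1] :: real^2)"
 have en: "cross2 e n = (norm e)^2" unfolding norm2_vec2 by (simp add: cross2_def n_def power2_eq_square)
 have "(norm n)^2 = (norm e)^2" by (simp add: n_def norm2_vec2)
 hence nn: "norm n = norm e" by simp
 have m: "c + (s / norm e) *R n : cball c r" if "\<bar>s\<bar> <= r" for s using that False by (simp add: dist_norm nn)
 have v: "cross2 e (c + (s / norm e) *R n - p) = cross2 e (c - p) + s * norm e" for s using False by (simp add: cross2_simps en power2_eq_square)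
 have "0 <= cross2 e (c - p) + (- r) * norm e" "cross2 e (c - p) + r * norm e <= D"
  using subsetD[OF D m[of "-r"]] subsetD[OF D m[of r]] r unfolding v[symmetric] by auto
 thus ?thesis by linarith
qed

lemma convex_cross2_le: "convex {x. 0 <= cross2 e (x - p) & cross2 e (x - p) <= D}"
proof -
 define a where "a = (vector [- e$2, e$1] :: real^2)"
 have "{x. 0 <= cross2 e (x - p) & cross2 e (x - p) <= D} = {x. a \<bullet> x >= a \<bullet> p} \<inter> {x. a \<bullet> x <= D + a \<bullet> p}"
  by (auto simp: cross2_def a_def inner_vec_def sum_2 algebra_simps)
 thus ?thesis by (simp add: convex_Int convex_halfspace_ge convex_halfspace_le)
qed

text \<open>A disc in the triangle is at most as wide as the heights on the two sides at \<open>q\<close>. The doubled area is the product of a side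
 and its height, and at most the product of the two sides.\<close>

lemma incircle_diameter_le:
 assumes "cross2 (q - p) (s - q) > 0"
 shows "incircle_diameter (convex hull {p, q, s}) <= sqrt (cross2 (q - p) (s - q))" unfolding incircle_diameter_def
proof (rule cSup_least)
 show "{2 * r |r. r >= 0 & (EX c. cball c r <= convex hull {p, q, s})} ~= {}"
  using hull_inc[of q "{p, q, s}"] by (auto intro!: exI[of _ 0] exI[of _ q])
 fix d assume "d : {2 * r |r. r >= 0 & (EX c. cball c r <= convex hull {p, q, s})}"
 then obtain r c where r: "d = 2 * r" "r >= 0" and c: "cball c r <= convex hull {p, q, s}" by blast
 define D where "D = cross2 (q - p) (s - q)"
 have D0: "D > 0" using assms by (simp add: D_def)
 have "convex hull {p, q, s} <= {x. 0 <= cross2 (q - p) (x - p) & cross2 (q - p) (x - p) <= D}"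
  using D0 by (intro hull_minimal convex_cross2_le) (auto simp: D_def cross2_def algebra_simps)
 hence h1: "2 * r * norm (q - p) <= D" using c r(2) by (intro affine_inradius) auto
 have "convex hull {p, q, s} <= {x. 0 <= cross2 (s - q) (x - q) & cross2 (s - q) (x - q) <= D}"
  using D0 by (intro hull_minimal convex_cross2_le) (auto simp: D_def cross2_def algebra_simps)
 hence h2: "2 * r * norm (s - q) <= D" using c r(2) by (intro affine_inradius) auto
 have "D^2 <= (norm (q - p) * norm (s - q))^2" unfolding power_mult_distrib norm2_vec2 D_def cross2_def
  using zero_le_power2[of "(q-p)$1 * (s-q)$1 + (q-p)$2 * (s-q)$2"] by (simp add: power2_eq_square algebra_simps)
 hence "D <= norm (q - p) * norm (s - q)" by (rule power2_le_imp_le) simp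
 hence "D * d^2 <= (norm (q - p) * norm (s - q)) * d^2" by (intro mult_right_mono) auto
 also have "... = (d * norm (q - p)) * (d * norm (s - q))" by (simp add: power2_eq_square)
 also have "... <= D * D" using h1 h2 r D0 by (intro mult_mono) auto
 finally have "d^2 <= D" using D0 by simp
 thus "d <= sqrt (cross2 (q - p) (s - q))" unfolding D_def[symmetric] by (rule real_le_rsqrt)
qed

lemma cross2_le: "cross2 a b <= norm a * norm b"
proof -
 have "(cross2 a b)^2 <= (norm a * norm b)^2" unfolding power_mult_distrib norm2_vec2 cross2_def
  using zero_le_power2[of "a$1 * b$1 + a$2 * b$2"] by (simp add: power2_eq_square algebra_simps)
 thus ?thesis using abs_le_square_iff[of "cross2 a b" "norm a * norm b"] by simp
qed

text \<open>The corner Jacobians are half the areas of the corner triangles, which the incircles bound below.\<close>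

lemma quad_bounds:
 assumes K: "convex_quad K" and r: "diameter (quad_hull K) <= \<rho> * rho K" "\<rho> > 0"
 defines "h \<equiv> diameter (quad_hull K)"
 shows "h > 0" "!!z. z : ref_square ==> h^2 / (4 * \<rho>^2) <= jac K z" "!!z. z : ref_square ==> jac K z <= h^2 / 4"
  "norm (coef1 K) <= h / 2" "norm (coef2 K) <= h / 2"
  "\<bar>cross2 (coef1 K) (coef12 K)\<bar> + \<bar>cross2 (coef12 K) (coef2 K)\<bar> <= cross2 (coef1 K) (coef2 K)"
proof -
 define D where "D i = cross2 (K $ i - K $ (i - 1)) (K $ (i + 1) - K $ i)" for i
 have D: "D i > 0" for i using K by (simp add: convex_quad_def D_def)
 have bd: "bounded (quad_hull K)" using compact_quad_hull by (rule compact_imp_bounded)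
 have e: "norm (K $ i - K $ j) <= h" for i j
 proof -
  have "K $ i : quad_hull K" "K $ j : quad_hull K" unfolding quad_hull_def by (auto intro: hull_inc)
  thus ?thesis unfolding h_def dist_norm[symmetric] by (intro diameter_bounded_bound[OF bd])
 qed
 have h0: "h >= 0" unfolding h_def by (rule diameter_ge_0[OF bd])
 have up: "D i <= h^2" for i unfolding D_def power2_eq_square by (rule order_trans[OF cross2_le mult_mono[OF e e h0]]) simp
 show hp: "h > 0" using up[of 1] D[of 1] h0 by (cases "h = 0") auto
 have lo: "h^2 / \<rho>^2 <= D i" for i
 proof -
  have "rho K <= incircle_diameter (corner_triangle K i)" unfolding rho_def by (rule Min_le) auto
  also have "... <= sqrt (D i)" unfolding corner_triangle_def D_def by (rule incircle_diameter_le) (use D[of i] in \<open>simp add: D_def\<close>)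
  finally have "h <= \<rho> * sqrt (D i)" using r by (smt (verit) h_def mult_left_mono)
  hence "h^2 <= (\<rho> * sqrt (D i))^2" using h0 by (rule power_mono)
  also have "... = \<rho>^2 * D i" using D[of i] by (simp add: power_mult_distrib)
  finally show ?thesis using r(2) by (simp add: divide_le_eq mult.commute)
 qed
 show "h^2 / (4 * \<rho>^2) <= jac K z" if "z : ref_square" for z using lo by (intro jac_ge[OF that]) (simp add: D_def)
 show "jac K z <= h^2 / 4" if "z : ref_square" for z using up by (intro jac_le[OF that]) (simp add: D_def)
 have "coef1 K = (1/4) *R ((K$2 - K$1) + (K$3 - K$4))" "coef2 K = (1/4) *R ((K$4 - K$1) + (K$3 - K$2))" by (simp_all add: coef1_def coef2_def)
 thus "norm (coef1 K) <= h / 2" "norm (coef2 K) <= h / 2"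
  using norm_triangle_ineq[of "K$2 - K$1" "K$3 - K$4"] norm_triangle_ineq[of "K$4 - K$1" "K$3 - K$2"]
   e[of 2 1] e[of 3 4] e[of 4 1] e[of 3 2] by auto
 have "jac K (vector [- sgn (cross2 (coef1 K) (coef12 K)), - sgn (cross2 (coef12 K) (coef2 K))]) > 0"
  by (rule jac_pos[OF K ref_square_memI]) (auto simp: abs_sgn_eq)
 thus "\<bar>cross2 (coef1 K) (coef12 K)\<bar> + \<bar>cross2 (coef12 K) (coef2 K)\<bar> <= cross2 (coef1 K) (coef2 K)"
  by (simp add: jac_def abs_sgn mult.commute)
qed

section \<open>Integration over a mesh\<close>

lemma convex_mesh_overlap_negligible:
 assumes "conforming_mesh Om T" "K : T" "L : T" "K ~= L"
 shows "negligible (quad_hull K \<inter> quad_hull L)"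
proof -
 have c: "convex (quad_hull K)" "convex (quad_hull L)" unfolding quad_hull_def by auto
 have "interior (quad_hull K) \<inter> interior (quad_hull L) = {}" using assms unfolding conforming_mesh_def by blast
 hence "quad_hull K \<inter> quad_hull L <= frontier (quad_hull K) \<union> frontier (quad_hull L)"
  unfolding frontier_def using closure_subset[of "quad_hull K"] closure_subset[of "quad_hull L"] by blast
 thus ?thesis by (rule negligible_subset[rotated]) (intro negligible_Un negligible_convex_frontier c)
qed

lemma mesh_facts:
 assumes "conforming_mesh Om T"
 shows "finite T" "K : T ==> convex_quad K" "closure Om = (\<Union>K\<in>T. quad_hull K)" using assms unfolding conforming_mesh_def by auto

lemma mesh_AE:
 assumes dom: "convex_polygonal_domain Om" and T: "conforming_mesh Om T"
 shows "(AE x in leb Om. P x) \<longleftrightarrow> (ALL K:T. AE z in RS. P (bilinear_map K z))"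
proof -
 note df = domain_facts[OF dom] and mf = mesh_facts[OF T]
 have "(AE x in leb Om. P x) \<longleftrightarrow> (ALL K:T. AE x in leb (quad_hull K). P x)"
  unfolding AE_lebesgue_on_negligible[OF df(5)] AE_lebesgue_on_negligible[OF quad_hull_sets(1)]
 proof (intro iffI ballI)
  fix K assume n: "negligible {x : Om. \<not> P x}" and K: "K : T"
  show "negligible {x : quad_hull K. \<not> P x}" by (rule negligible_subset[OF negligible_Un[OF n df(8)]]) (use mf(3) K in blast)
 next
  assume "ALL K:T. negligible {x : quad_hull K. \<not> P x}"
  hence n: "negligible (\<Union>K\<in>T. {x : quad_hull K. \<not> P x})" using mf(1) by (intro negligible_Union) auto
  have "Om <= (\<Union>K\<in>T. quad_hull K)" using mf(3) closure_subset by blast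
  thus "negligible {x : Om. \<not> P x}" by (intro negligible_subset[OF n]) blast
 qed
 thus ?thesis using quad_AE mf(2) by blast
qed

lemma mesh_integral:
 fixes f :: "real^2 => real"
 assumes dom: "convex_polygonal_domain Om" and T: "conforming_mesh Om T" and f: "integrable (leb Om) f"
 shows "K : T ==> integrable RS (%z. jac K z * f (bilinear_map K z))"
  and "(LINT x|leb Om. f x) = (\<Sum>K\<in>T. LINT z|RS. jac K z * f (bilinear_map K z))"
proof -
 note df = domain_facts[OF dom] and mf = mesh_facts[OF T]
 have sub: "Om <= closure Om" by (rule closure_subset)
 have ab: "f absolutely_integrable_on Om" using f unfolding integrable_lebesgue_on_iff[OF df(5)] .
 have n: "negligible {x : Om - closure Om. f x ~= 0}" "negligible {x : closure Om - Om. f x ~= 0}"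
  using sub by (auto intro: negligible_subset[OF df(8)] simp: Diff_eq_empty_iff[THEN iffD2])
 have abc: "f absolutely_integrable_on (closure Om)" using ab absolutely_integrable_spike_set[OF _ n] by blast
 have hull: "f absolutely_integrable_on (quad_hull K)" if "K : T" for K by (rule set_integrable_subset[OF abc]) (use that mf(3) in auto)
 hence hi: "integrable (leb (quad_hull K)) f" if "K : T" for K using that unfolding integrable_lebesgue_on_iff[OF quad_hull_sets(1)] by blast
 thus "K : T ==> integrable RS (%z. jac K z * f (bilinear_map K z))" using quad_change_of_variables(1) mf(2) by blast
 have "(f has_integral (\<Sum>K\<in>T. integral (quad_hull K) f)) (\<Union>K\<in>T. quad_hull K)"
 proof (rule has_integral_UN[OF mf(1)])
  show "(f has_integral integral (quad_hull K) f) (quad_hull K)" if "K : T" for K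
   using hull[OF that] by (intro integrable_integral set_lebesgue_integral_eq_integral(1))
  show "pairwise (%K L. negligible (quad_hull K \<inter> quad_hull L)) T" using convex_mesh_overlap_negligible[OF T] by (auto simp: pairwise_def)
 qed
 hence "integral (closure Om) f = (\<Sum>K\<in>T. integral (quad_hull K) f)" unfolding mf(3) by (rule integral_unique)
 moreover have "integral Om f = integral (closure Om) f" by (rule integral_spike_set[OF n])
 moreover have "(LINT x|leb Om. f x) = integral Om f" by (rule lebesgue_integral_eq_integral[OF f df(5)])
 moreover have "integral (quad_hull K) f = (LINT z|RS. jac K z * f (bilinear_map K z))" if "K : T" for K
  unfolding quad_change_of_variables(2)[OF mf(2)[OF that], symmetric]
  by (rule lebesgue_integral_eq_integral[OF hi[OF that] quad_hull_sets(1), symmetric])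
 ultimately show "(LINT x|leb Om. f x) = (\<Sum>K\<in>T. LINT z|RS. jac K z * f (bilinear_map K z))" by simp
qed

lemma integral_quadratic: "((%x. p + x * q + x^2 * r) has_integral 2 * p + 2 / 3 * r) {-1..1::real}"
proof -
 have "((%x. p + x * q + x^2 * r) has_integral (%x. x * p + x^2 / 2 * q + x^3 / 3 * r) 1 - (%x. x * p + x^2 / 2 * q + x^3 / 3 * r) (-1)) {-1..1}"
 proof (rule fundamental_theorem_of_calculus)
  fix x :: real
  have "((%x. x * p + x^2 / 2 * q + x^3 / 3 * r) has_real_derivative p + x * q + x^2 * r) (at x)"
   by (auto intro!: derivative_eq_intros simp: power2_eq_square)
  thus "((%x. x * p + x^2 / 2 * q + x^3 / 3 * r) has_vector_derivative p + x * q + x^2 * r) (at x within {-1..1})"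
   by (simp add: has_real_derivative_iff_has_vector_derivative has_vector_derivative_at_within)
 qed simp
 thus ?thesis by (simp add: algebra_simps)
qed

definition aff :: "'b::real_vector => 'b => 'b => real^2 => 'b" where
 "aff a b c z = a + z$1 *R b + z$2 *R c"

lemma continuous_aff: "continuous_on S (aff a b c)" for a :: "'b::euclidean_space"
 unfolding aff_def[abs_def] by (intro continuous_intros)

lemma ref_square_integrable:
 fixes h :: "real^2 => 'b::euclidean_space"
 assumes "cont h" shows "integrable RS h"
 by (rule integrable_continuous_bounded[OF assms]) (auto simp: ref_square_cbox[symmetric], simp add: ref_square_cbox)

lemma integral_aff_inner:
 fixes a :: "'b::euclidean_space"
 shows "(LINT z|RS. aff a b c z \<bullet> aff a' b' c' z) = 4 * (a \<bullet> a') + 4 / 3 * (b \<bullet> b' + c \<bullet> c')"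
proof -
 have c: "cont (%z. aff a b c z \<bullet> aff a' b' c' z)" by (intro continuous_intros continuous_aff)
 have i2: "(1::2) + 1 = 2" by simp
 have v: "vec2 1 x y $ 2 = y" for x y using vec2_nth(2)[of 1 x y] by simp
 have "(LINT z|RS. aff a b c z \<bullet> aff a' b' c' z) =
   integral {-1..1} (%x. integral {-1..1} (%y. aff a b c (vec2 1 x y) \<bullet> aff a' b' c' (vec2 1 x y)))"
  unfolding ref_square_cbox integral_cbox_vec2[OF c, where i=1] by simp
 also have "... = integral {-1..1} (%x. (2 * (a \<bullet> a') + 2 / 3 * (c \<bullet> c')) + x * (2 * (a \<bullet> b' + b \<bullet> a')) + x^2 * (2 * (b \<bullet> b')))"
 proof (rule hk_integral_cong)
  fix x :: real
  have "(%y. aff a b c (vec2 1 x y) \<bullet> aff a' b' c' (vec2 1 x y)) =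
   (%y. (a + x *R b) \<bullet> (a' + x *R b') + y * (c \<bullet> (a' + x *R b') + (a + x *R b) \<bullet> c') + y^2 * (c \<bullet> c'))"
   by (simp add: fun_eq_iff aff_def v inner_simps power2_eq_square algebra_simps)
  thus "integral {-1..1} (%y. aff a b c (vec2 1 x y) \<bullet> aff a' b' c' (vec2 1 x y)) =
    (2 * (a \<bullet> a') + 2 / 3 * (c \<bullet> c')) + x * (2 * (a \<bullet> b' + b \<bullet> a')) + x^2 * (2 * (b \<bullet> b'))"
   by (simp only: integral_unique[OF integral_quadratic]) (simp add: inner_simps power2_eq_square algebra_simps)
 qed
 also have "... = 4 * (a \<bullet> a') + 4 / 3 * (b \<bullet> b' + c \<bullet> c')"
  unfolding integral_unique[OF integral_quadratic] by (simp add: algebra_simps)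
 finally show ?thesis .
qed

section \<open>Gradients of isoparametric bilinear functions\<close>

definition perp :: "real^2 => real^2" where "perp a = vector [a$2, - a$1]"

lemma perp_nth [simp]: "perp a $ 1 = a$2" "perp a $ 2 = - a$1" by (simp_all add: perp_def)

definition outer :: "real^2 => real^2 => real^2^2" where "outer a b = (\<chi> i j. a$i * b$j)"

lemma outer_nth [simp]: "outer a b $ i $ j = a$i * b$j" by (simp add: outer_def)

text \<open>\<open>J\<close> times the gradient of \<open>c0 + \<xi> c1 + \<eta> c2 + \<xi> \<eta> c12\<close>; the quadratic terms cancel.\<close>

definition poly_grad :: "quad => real^2 => real^2 => real^2 => real^2 => real^2^2" where
 "poly_grad K c1 c2 c12 = aff (outer c1 (perp (coef2 K)) - outer c2 (perp (coef1 K))) (outer c1 (perp (coef12 K)) - outer c12 (perp (coef1 K)))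
   (outer c12 (perp (coef2 K)) - outer c2 (perp (coef12 K)))"

lemma linear_real2: "linear f ==> f x = x$1 * f (axis 1 1) + x$2 * f (axis 2 1)" for f :: "real^2 => real"
proof -
 assume f: "linear f"
 have "x = x$1 *R axis 1 1 + x$2 *R axis 2 1" by (simp add: vec_eq_iff forall_2 axis_def)
 hence "f x = f (x$1 *R axis 1 1 + x$2 *R axis 2 1)" by simp
 thus ?thesis by (simp add: linear_add[OF f] linear_cmul[OF f])
qed

text \<open>Integration by parts in the reference coordinates, where \<open>J D\<phi>\<close> is the cofactor matrix times the gradient of \<open>\<phi> \<circ> F\<close>; the
 derivatives of the cofactors cancel.\<close>

lemma poly_grad_by_parts:
 assumes \<phi>: "!!x. (\<phi> has_derivative D x) (at x)" "!!v. cont (%x. D x v)"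
  and zero: "!!z i. z $ i = -1 \<or> z $ i = 1 ==> \<phi> (bilinear_map K z) = (0::real)"
 shows "(LINT z|RS. jac K z * ((c0 + z$1 *R c1 + z$2 *R c2 + (z$1 * z$2) *R c12) $ i * D (bilinear_map K z) (axis j 1)))
  = - (LINT z|RS. poly_grad K c1 c2 c12 z $ i $ j * \<phi> (bilinear_map K z))"
proof -
 let ?F = "bilinear_map K"
 define p where "p z = (c0 + z$1 *R c1 + z$2 *R c2 + (z$1 * z$2) *R c12) $ i" for z :: "real^2"
 define f1 where "f1 z = coef1 K + z$2 *R coef12 K" for z :: "real^2"
 define f2 where "f2 z = coef2 K + z$1 *R coef12 K" for z :: "real^2"
 define p' where "p' z h = (h$1 *R (c1 + z$2 *R c12) + h$2 *R (c2 + z$1 *R c12)) $ i" for z h :: "real^2"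
 define h1' where "h1' z h = p' z h * (\<phi> (?F z) * perp (f2 z) $ j) + p z * (D (?F z) (bilinear_deriv K z h) * perp (f2 z) $ j
   + \<phi> (?F z) * (h$1 * perp (coef12 K) $ j))" for z h
 define h2' where "h2' z h = p' z h * (\<phi> (?F z) * perp (f1 z) $ j) + p z * (D (?F z) (bilinear_deriv K z h) * perp (f1 z) $ j
   + \<phi> (?F z) * (h$2 * perp (coef12 K) $ j))" for z h
 have lin: "linear (D x)" for x using \<phi>(1)[of x] by (rule has_derivative_linear)
 have perp1: "perp (f1 z) $ j = perp (coef1 K) $ j + z$2 * perp (coef12 K) $ j" for z using exhaust_2[of j] by (auto simp: f1_def)
 have perp2: "perp (f2 z) $ j = perp (coef2 K) $ j + z$1 * perp (coef12 K) $ j" for z using exhaust_2[of j] by (auto simp: f2_def)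
 have dp: "(p has_derivative p' z) (at z)" for z unfolding p_def[abs_def] p'_def[abs_def] vector_add_component vector_scaleR_component
  by (rule derivative_eq_intros vec_nth_has_derivative refl | simp)+ (simp add: fun_eq_iff algebra_simps)
 have dF: "((%z. \<phi> (?F z)) has_derivative (%h. D (?F z) (bilinear_deriv K z h))) (at z)" for z
  using diff_chain_at[OF bilinear_map_has_derivative \<phi>(1)] by (simp add: o_def)
 have d1: "((%z. perp (f1 z) $ j) has_derivative (%h. h$2 * perp (coef12 K) $ j)) (at z)" for z
  unfolding perp1 by (rule derivative_eq_intros vec_nth_has_derivative refl | simp)+
 have d2: "((%z. perp (f2 z) $ j) has_derivative (%h. h$1 * perp (coef12 K) $ j)) (at z)" for z
  unfolding perp2 by (rule derivative_eq_intros vec_nth_has_derivative refl | simp)+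
 have h1: "((%z. p z * (\<phi> (?F z) * perp (f2 z) $ j)) has_derivative h1' z) (at z)" for z
  using has_derivative_mult[OF dp has_derivative_mult[OF dF d2], of z] unfolding h1'_def[abs_def] by (simp add: add.commute)
 have h2: "((%z. p z * (\<phi> (?F z) * perp (f1 z) $ j)) has_derivative h2' z) (at z)" for z
  using has_derivative_mult[OF dp has_derivative_mult[OF dF d1], of z] unfolding h2'_def[abs_def] by (simp add: add.commute)
 have cF: "cont (%z. \<phi> (?F z))" using dF by (intro has_derivative_continuous_on) (rule has_derivative_at_withinI)
 have cD: "cont (%z. D (?F z) v)" for v by (rule continuous_on_compose2[OF \<phi>(2) continuous_bilinear_map]) auto
 have e1: "bilinear_deriv K z (axis 1 1) = f1 z" and e2: "bilinear_deriv K z (axis 2 1) = f2 z" for z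
  by (simp_all add: bilinear_deriv_def f1_def f2_def axis_def)
 have c: "cont (%z. h1' z (axis 1 1))" "cont (%z. h2' z (axis 2 1))"
  unfolding h1'_def h2'_def e1 e2 linear_real2[OF lin, of _ "f1 _"] linear_real2[OF lin, of _ "f2 _"] perp1 perp2
  unfolding p_def p'_def f1_def f2_def by (intro continuous_intros cF cD)+
 have z1: "(LINT z|RS. h1' z (axis 1 1)) = 0"
  unfolding ref_square_cbox by (rule integral_partial_derivative_zero[OF h1 c(1)]) (use zero[of _ 1] in simp)
 have z2: "(LINT z|RS. h2' z (axis 2 1)) = 0"
  unfolding ref_square_cbox by (rule integral_partial_derivative_zero[OF h2 c(2)]) (use zero[of _ 2] in simp)
 have key: "jac K z * (p z * D (?F z) (axis j 1)) = h1' z (axis 1 1) - h2' z (axis 2 1) - poly_grad K c1 c2 c12 z $ i $ j * \<phi> (?F z)" for z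
 proof -
  have 1: "jac K z * D (?F z) (axis j 1) = D (?F z) (f1 z) * perp (f2 z) $ j - D (?F z) (f2 z) * perp (f1 z) $ j"
   using exhaust_2[of j] unfolding linear_real2[OF lin, of _ "f1 z"] linear_real2[OF lin, of _ "f2 z"] jac_cross f1_def[symmetric] f2_def[symmetric]
   by (auto simp: cross2_def algebra_simps)
  have 2: "poly_grad K c1 c2 c12 z $ i $ j = p' z (axis 1 1) * perp (f2 z) $ j - p' z (axis 2 1) * perp (f1 z) $ j"
   unfolding perp1 perp2 by (simp add: poly_grad_def aff_def p'_def axis_def algebra_simps)
  have 3: "axis 1 (1::real) $ (1::2) = 1" "axis 2 (1::real) $ (2::2) = 1" by (simp_all add: axis_def)
  have "jac K z * (p z * D (?F z) (axis j 1)) = p z * (jac K z * D (?F z) (axis j 1))" by simp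
  thus ?thesis unfolding h1'_def h2'_def e1 e2 1 2 3 by (simp only: algebra_simps mult_1_left)
 qed
 have cg: "cont (%z. poly_grad K c1 c2 c12 z $ i $ j * \<phi> (?F z))" unfolding poly_grad_def by (intro continuous_intros continuous_aff cF)
 show ?thesis unfolding p_def[symmetric] key using z1 z2 ref_square_integrable[OF c(1)] ref_square_integrable[OF c(2)] ref_square_integrable[OF cg]
  by simp
qed

lemma isoparametric_weak_gradient:
 assumes dom: "convex_polygonal_domain Om" and K: "convex_quad K" "quad_hull K <= closure Om" and v: "v : H1 Om"
  and poly: "AE z in RS.
   v (bilinear_map K z) = c0 + z$1 *R c1 + z$2 *R c2 + (z$1 * z$2) *R c12"
 shows "AE z in RS. jac K z *R weak_grad Om v (bilinear_map K z) = poly_grad K c1 c2 c12 z"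
proof -
 note df = domain_facts[OF dom]
 let ?F = "bilinear_map K" and ?U = "interior (quad_hull K)"
 define M where "M x = (let z = inv_into ref_square ?F x in (1 / jac K z) *R poly_grad K c1 c2 c12 z)" for x
 have MF: "jac K z *R M (?F z) = poly_grad K c1 c2 c12 z" if "z : ref_square" for z
  using jac_pos[OF K(1) that] by (simp add: M_def Let_def inv_into_f_f[OF inj_bilinear_map[OF K(1)] that])
 have MFij: "jac K z * (M (?F z) $ i $ j) = poly_grad K c1 c2 c12 z $ i $ j" if "z : ref_square" for z i j
  using arg_cong[OF MF[OF that], of "%A. A $ i $ j"] by simp
 have cg: "cont (%z. poly_grad K c1 c2 c12 z $ i $ j)" for i j unfolding poly_grad_def by (intro continuous_intros continuous_aff)
 have iM: "integrable (leb (quad_hull K)) (%x. M x $ i $ j)" for i j unfolding quad_change_of_variables(1)[OF K(1)]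
  by (rule lintegrable_cong[THEN iffD1, OF refl _ ref_square_integrable[OF cg[of i j]]]) (simp add: MFij)
 have U: "?U <= quad_hull K" "?U <= Om" "bounded ?U" using interior_subset K(2) df(6) interior_mono[OF K(2)] compact_quad_hull[of K]
  by (auto intro: bounded_subset compact_imp_bounded)
 have "AE x in leb ?U. weak_grad Om v x = M x"
 proof (rule weak_gradient_local_AE[OF open_interior U(3,2) df(1,4) H1_weak_grad[OF v]])
  show "integrable (leb ?U) (%x. M x $ i $ j)" for i j
   using iM[of i j] unfolding integrable_lebesgue_on_iff[OF quad_hull_sets(1)] integrable_lebesgue_on_iff[OF quad_hull_sets(3)]
   by (rule set_integrable_subset) (use U(1) in auto)
  fix \<phi> i j assume \<phi>: "test_function ?U \<phi>"
  let ?D = "%x. frechet_derivative \<phi> (at x)"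
  have out: "\<phi> x = 0" "?D x w = 0" if "x ~: ?U" for x w using test_function_outside[OF \<phi> that] by auto
  have "(LINT x|leb ?U. v x $ i * ?D x (axis j 1)) = (LINT x|leb (quad_hull K). v x $ i * ?D x (axis j 1))"
   by (rule integral_lebesgue_on_extend) (use U out in auto)
  also have "... = (LINT z|RS. jac K z * (v (?F z) $ i * ?D (?F z) (axis j 1)))" by (rule quad_change_of_variables(2)[OF K(1)])
  also have "... = (LINT z|RS. jac K z * ((c0 + z$1 *R c1 + z$2 *R c2 + (z$1 * z$2) *R c12) $ i * ?D (?F z) (axis j 1)))"
  proof (rule integral_cong_AE)
   have "integrable (leb Om) (%x. v x $ i * ?D x (axis j 1))"
    using L2_component[OF H1_L2[OF v]] smooth_real_derivative(2)[OF test_function_smooth[OF \<phi>]] by (intro L2_times_test df(1,4))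
   hence "integrable (leb ?U) (%x. v x $ i * ?D x (axis j 1))"
    unfolding integrable_lebesgue_on_iff[OF df(5)] integrable_lebesgue_on_iff[OF quad_hull_sets(3)] by (rule set_integrable_subset) (use U(2) in auto)
   hence "integrable (leb (quad_hull K)) (%x. v x $ i * ?D x (axis j 1))"
    unfolding integrable_lebesgue_on_iff[OF quad_hull_sets(1)] integrable_lebesgue_on_iff[OF quad_hull_sets(3)]
    by (rule absolutely_integrable_spike_set) (auto simp: out intro: negligible_subset[OF negligible_empty] dest: U(1)[THEN subsetD])
   thus "(%z. jac K z * (v (?F z) $ i * ?D (?F z) (axis j 1))) : borel_measurable RS"
    unfolding quad_change_of_variables(1)[OF K(1)] by (rule borel_measurable_integrable)
   have cD: "cont (%z. ?D (?F z) (axis j 1))"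
    by (rule continuous_on_compose2[OF smooth_real_derivative(2)[OF test_function_smooth[OF \<phi>]] continuous_bilinear_map]) auto
   show "(%z. jac K z * ((c0 + z$1 *R c1 + z$2 *R c2 + (z$1 * z$2) *R c12) $ i * ?D (?F z) (axis j 1))) : borel_measurable RS"
    unfolding jac_def by (intro borel_measurable_integrable ref_square_integrable continuous_intros cD)
   show "AE z in RS. jac K z * (v (?F z) $ i * ?D (?F z) (axis j 1)) =
    jac K z * ((c0 + z$1 *R c1 + z$2 *R c2 + (z$1 * z$2) *R c12) $ i * ?D (?F z) (axis j 1))"
    using poly by (rule AE_mp) (intro AE_I2 impI, simp only:)
  qed
  also have "... = - (LINT z|RS. poly_grad K c1 c2 c12 z $ i $ j * \<phi> (?F z))"
  proof (rule poly_grad_by_parts)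
   show "(\<phi> has_derivative ?D x) (at x)" for x by (rule smooth_real_derivative(1)[OF test_function_smooth[OF \<phi>]])
   show "cont (%x. ?D x w)" for w by (rule smooth_real_derivative(2)[OF test_function_smooth[OF \<phi>]])
   show "\<phi> (?F z) = 0" if "z $ k = -1 \<or> z $ k = 1" for z k using bilinear_map_boundary[OF K(1) that] by (rule out)
  qed
  also have "(LINT z|RS. poly_grad K c1 c2 c12 z $ i $ j * \<phi> (?F z)) = (LINT z|RS. jac K z * (M (?F z) $ i $ j * \<phi> (?F z)))"
   by (rule lint_cong[OF refl]) (simp add: MFij[symmetric])
  also have "... = (LINT x|leb (quad_hull K). M x $ i $ j * \<phi> x)" by (rule quad_change_of_variables(2)[OF K(1), symmetric])
  also have "... = (LINT x|leb ?U. M x $ i $ j * \<phi> x)" by (rule integral_lebesgue_on_extend[symmetric]) (use U out in auto)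
  finally show "(LINT x|leb ?U. v x $ i * ?D x (axis j 1)) = - (LINT x|leb ?U. M x $ i $ j * \<phi> x)" .
 qed
 hence n: "negligible {x : ?U. weak_grad Om v x ~= M x}" by (simp add: AE_lebesgue_on_negligible)
 have "negligible (frontier (quad_hull K))" by (rule negligible_convex_frontier) (simp add: quad_hull_def)
 moreover have "{x : quad_hull K. weak_grad Om v x ~= M x} <= {x : ?U. weak_grad Om v x ~= M x} \<union> frontier (quad_hull K)"
  using closure_subset[of "quad_hull K"] unfolding frontier_def by blast
 ultimately have "AE x in leb (quad_hull K). weak_grad Om v x = M x"
  unfolding AE_lebesgue_on_negligible[OF quad_hull_sets(1)] using negligible_subset[OF negligible_Un[OF n]] by blast
 hence "AE z in RS. weak_grad Om v (?F z) = M (?F z)" unfolding quad_AE[OF K(1)] .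
 thus ?thesis by (rule AE_mp) (intro AE_I2 impI, simp add: MF)
qed

section \<open>Stability on one element\<close>

definition shape_eta :: "quad => real^2^2" where
 "shape_eta K = outer ((1 / coef1 K $ 1) *R coef1 K) ((1 / coef1 K $ 1) *R coef1 K)"
definition shape_xi :: "quad => real^2^2" where
 "shape_xi K = outer ((1 / coef2 K $ 2) *R coef2 K) ((1 / coef2 K $ 2) *R coef2 K)"

lemma transpose_mat2: "transpose A = A \<longleftrightarrow> A$1$2 = (A::real^2^2)$2$1"
 by (auto simp: vec_eq_iff forall_2 transpose_def)

lemma shape_symmetric: "transpose (shape_eta K) = shape_eta K" "transpose (shape_xi K) = shape_xi K"
 by (simp_all add: transpose_mat2 shape_eta_def shape_xi_def)

lemma norm_outer: "norm (outer a b) = norm a * norm b"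
proof -
 have "(norm (outer a b))^2 = (norm a * norm b)^2" unfolding norm2_mat2 power_mult_distrib norm2_vec2 by (simp add: power2_eq_square algebra_simps)
 thus ?thesis by (rule power2_eq_imp_eq) simp_all
qed

lemma norm_outer_self: "norm (outer a a) = (norm a)^2" "trace (outer a a) = (norm a)^2"
proof -
 show "norm (outer a a) = (norm a)^2" by (simp add: norm_outer power2_eq_square)
 show "trace (outer a a) = (norm a)^2" unfolding norm2_vec2 by (simp add: trace_def sum_2 power2_eq_square)
qed

lemma shape_norm_le:
 assumes "coef1 K $ 1 > 0" "coef2 K $ 2 > 0" "\<bar>coef1 K $ 2\<bar> <= coef1 K $ 1" "\<bar>coef2 K $ 1\<bar> <= c * coef2 K $ 2" "c >= 1"
 shows "norm (shape_eta K) <= 1 + c^2" "norm (shape_xi K) <= 1 + c^2"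
proof -
 have "\<bar>coef1 K $ 2 / coef1 K $ 1\<bar> <= \<bar>1\<bar>" "\<bar>coef2 K $ 1 / coef2 K $ 2\<bar> <= \<bar>c\<bar>" "\<bar>1\<bar> <= \<bar>c\<bar>"
  using assms by (auto simp: divide_le_eq abs_divide)
 hence "(coef1 K $ 2 / coef1 K $ 1)^2 <= 1^2" "(coef2 K $ 1 / coef2 K $ 2)^2 <= c^2" "1^2 <= c^2" unfolding abs_le_square_iff .
 thus "norm (shape_eta K) <= 1 + c^2" "norm (shape_xi K) <= 1 + c^2"
  using assms(1,2) unfolding shape_eta_def shape_xi_def norm_outer_self norm2_vec2 by auto
qed

lemma inner_symm: "transpose A = A ==> A \<bullet> symm E = A \<bullet> E"
 unfolding transpose_mat2 by (simp add: inner_vec_def sum_2 symm_def transpose_def field_simps)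

text \<open>\<open>E0 + \<xi> E1 + \<eta> E2\<close> is \<open>J\<close> times the gradient. With \<open>D\<close> as in the proof, \<open>J0 E1\<close> and \<open>J0 E2\<close> differ from multiples of \<open>E0\<close>
 by rank-one matrices in \<open>D\<close>. Testing with \<open>N\<close> and \<open>M\<close> yields \<open>A1 \<bullet> D\<close> and \<open>A2 \<bullet> D\<close>, which determine \<open>D\<close> since \<open>A1\<close>, \<open>A2\<close>
 are a basis with a determinant comparable to the squares of their lengths.\<close>

lemma local_stability:
 fixes A1 A2 A12 c1 c2 c12 :: "real^2"
 assumes J: "J0 = cross2 A1 A2" "J1 = cross2 A1 A12" "J2 = cross2 A12 A2" "J0 > 0" "\<bar>J1\<bar> <= J0" "\<bar>J2\<bar> <= J0"
  and E: "E0 = outer c1 (perp A2) - outer c2 (perp A1)" "E1 = outer c1 (perp A12) - outer c12 (perp A1)"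
   "E2 = outer c12 (perp A2) - outer c2 (perp A12)"
  and ab: "0 < A1$1" "0 < A2$2" and k: "norm A1 <= k" "norm A2 <= k" "k^2 <= r * J0" "r >= 0"
  and N: "N = outer ((1 / A1$1) *R A1) ((1 / A1$1) *R A1)" "norm N <= B"
  and M: "M = outer ((1 / A2$2) *R A2) ((1 / A2$2) *R A2)" "norm M <= B"
  and B: "B >= 1"
 shows "4 * (norm (symm E0))^2 + 4 / 3 * ((norm (symm E1))^2 + (norm (symm E2))^2)
  <= 9 * (1 + 2 * r^2 * B)^2 * (4 * (norm (symm E0))^2 + 4 / 3 * ((M \<bullet> E1)^2 + (N \<bullet> E2)^2))"
proof -
 define D where "D = J0 *R c12 - J2 *R c1 - J1 *R c2"
 define e X Y Q where "e = norm (symm E0)" and "X = \<bar>N \<bullet> E2\<bar>" and "Y = \<bar>M \<bullet> E1\<bar>" and "Q = X + Y + 2 * B * e"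
 have k0: "k >= 0" using k(1) norm_ge_zero[of A1] by linarith
 have [simp]: "e >= 0" "X >= 0" "Y >= 0" by (auto simp: e_def X_def Y_def)
 have Q0: "Q >= 0" using B by (simp add: Q_def)
 have np: "norm (perp a) = norm a" for a
 proof -
  have "(norm (perp a))^2 = (norm a)^2" unfolding norm2_vec2 by simp
  thus ?thesis by simp
 qed
 \<comment> \<open>the linear parts of the gradient in terms of its central value and \<open>D\<close>\<close>
 have i1: "J0 *R E1 = J1 *R E0 - outer D (perp A1)" and i2: "J0 *R E2 = J2 *R E0 + outer D (perp A2)"
  unfolding E D_def J by (simp_all add: vec_eq_iff forall_2 cross2_def algebra_simps)
 \<comment> \<open>expansion of \<open>D\<close> in the dual basis of \<open>A1\<close>, \<open>A2\<close>\<close>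
 have i3: "J0 *R D = (A1 \<bullet> D) *R perp A2 - (A2 \<bullet> D) *R perp A1"
  unfolding J by (simp add: vec_eq_iff forall_2 cross2_def inner_vec_def sum_2 algebra_simps)
 have NM: "transpose N = N" "transpose M = M" by (simp_all add: transpose_mat2 N(1) M(1))
 have "(A1$1)^2 * (N \<bullet> outer D (perp A2)) = (A1 \<bullet> D) * J0" "(A2$2)^2 * (M \<bullet> outer D (perp A1)) = - (A2 \<bullet> D) * J0"
  using ab unfolding N(1) M(1) J by (simp_all add: inner_vec_def sum_2 cross2_def power2_eq_square field_simps)
 moreover have "J0 * (N \<bullet> E2) - J2 * (N \<bullet> E0) = N \<bullet> outer D (perp A2)" "J0 * (M \<bullet> E1) - J1 * (M \<bullet> E0) = - (M \<bullet> outer D (perp A1))"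
  using arg_cong[OF i1, of "%A. M \<bullet> A"] arg_cong[OF i2, of "%A. N \<bullet> A"] by (simp_all add: inner_simps)
 ultimately have AD: "(A1 \<bullet> D) * J0 = (A1$1)^2 * (J0 * (N \<bullet> E2) - J2 * (N \<bullet> E0))"
  "(A2 \<bullet> D) * J0 = (A2$2)^2 * (J0 * (M \<bullet> E1) - J1 * (M \<bullet> E0))" by simp_all
 have NE: "\<bar>N \<bullet> E0\<bar> <= B * e" "\<bar>M \<bullet> E0\<bar> <= B * e"
  using Cauchy_Schwarz_ineq2[of N "symm E0"] Cauchy_Schwarz_ineq2[of M "symm E0"]
   mult_right_mono[OF N(2) norm_ge_zero[of "symm E0"]] mult_right_mono[OF M(2) norm_ge_zero[of "symm E0"]]
  unfolding inner_symm[OF NM(1)] inner_symm[OF NM(2)] e_def by linarith+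
 have bnd: "\<bar>p\<bar> <= k^2 * (\<bar>x\<bar> + B * e)"
  if "p * J0 = a^2 * (J0 * x - j * y)" "\<bar>a\<bar> <= k" "\<bar>j\<bar> <= J0" "\<bar>y\<bar> <= B * e" for p a x j y :: real
 proof -
  have "\<bar>J0 * x - j * y\<bar> <= J0 * \<bar>x\<bar> + \<bar>j\<bar> * \<bar>y\<bar>" using abs_triangle_ineq4[of "J0 * x" "j * y"] J(4) by (simp add: abs_mult)
  also have "... <= J0 * \<bar>x\<bar> + J0 * (B * e)" using that J(4) by (intro add_left_mono mult_mono) auto
  finally have 1: "\<bar>J0 * x - j * y\<bar> <= J0 * (\<bar>x\<bar> + B * e)" by (simp add: distrib_left)
  have "a^2 <= k^2" using that(2) k0 by (simp add: abs_le_square_iff[symmetric])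
  hence "a^2 * \<bar>J0 * x - j * y\<bar> <= k^2 * (J0 * (\<bar>x\<bar> + B * e))" using 1 by (intro mult_mono) auto
  moreover have "\<bar>p\<bar> * J0 = a^2 * \<bar>J0 * x - j * y\<bar>" using arg_cong[OF that(1), of abs] J(4) by (simp add: abs_mult)
  ultimately have "\<bar>p\<bar> * J0 <= (k^2 * (\<bar>x\<bar> + B * e)) * J0" by (simp add: mult_ac)
  thus ?thesis using J(4) by simp
 qed
 have a1: "\<bar>A1 \<bullet> D\<bar> <= k^2 * (X + B * e)"
  unfolding X_def by (rule bnd[OF AD(1) _ J(6) NE(1)]) (use component_le_norm_cart[of A1 1] k(1) in linarith)
 have a2: "\<bar>A2 \<bullet> D\<bar> <= k^2 * (Y + B * e)"
  unfolding Y_def by (rule bnd[OF AD(2) _ J(5) NE(2)]) (use component_le_norm_cart[of A2 2] k(2) in linarith)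
 have "J0 * norm D = norm ((A1 \<bullet> D) *R perp A2 - (A2 \<bullet> D) *R perp A1)" using J(4) unfolding i3[symmetric] by simp
 also have "... <= \<bar>A1 \<bullet> D\<bar> * norm A2 + \<bar>A2 \<bullet> D\<bar> * norm A1"
  using norm_triangle_ineq4[of "(A1 \<bullet> D) *R perp A2" "(A2 \<bullet> D) *R perp A1"] by (simp add: np)
 also have "... <= (k^2 * (X + B * e)) * k + (k^2 * (Y + B * e)) * k" using a1 a2 k k0 B by (intro add_mono mult_mono) auto
 finally have D1: "J0 * norm D <= k * k^2 * Q" by (simp add: Q_def algebra_simps)
 have D2: "norm D * norm A <= J0 * (r^2 * Q)" if "norm A <= k" for A :: "real^2"
 proof -
  have "J0 * (norm D * norm A) <= (k * k^2 * Q) * k" using mult_mono[OF D1 that] k0 Q0 by (simp add: mult.assoc)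
  also have "... = k^2 * k^2 * Q" by (simp add: power2_eq_square)
  also have "... <= (r * J0) * (r * J0) * Q" using k(3) Q0 J(4) k(4) by (intro mult_right_mono mult_mono) auto
  also have "... = J0 * (J0 * (r^2 * Q))" by (simp add: power2_eq_square)
  finally show ?thesis using J(4) by simp
 qed
 have fin: "(norm (symm E))^2 <= 3 * (1 + 2 * r^2 * B)^2 * (e^2 + X^2 + Y^2)"
  if i: "J0 *R E = j *R E0 + s *R outer D (perp A)" "\<bar>j\<bar> <= J0" "\<bar>s\<bar> = 1" "norm A <= k" for E A j s
 proof -
  have "J0 * norm (symm E) = norm (symm (J0 *R E))" using J(4) by (simp add: symm_scaleR)
  also have "... <= \<bar>j\<bar> * e + norm (outer D (perp A))" unfolding i(1) symm_add symm_scaleR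
   using norm_triangle_ineq[of "j *R symm E0" "s *R symm (outer D (perp A))"] norm_symm_le[of "outer D (perp A)"] i(3) by (simp add: e_def)
  also have "... <= J0 * e + J0 * (r^2 * Q)" using D2[OF i(4)] i(2) unfolding norm_outer np by (intro add_mono mult_right_mono) auto
  finally have "norm (symm E) <= e + r^2 * Q" using J(4) by (simp add: distrib_left[symmetric])
  also have "... <= (1 + 2 * r^2 * B) * (e + X + Y)"
  proof -
   have "r^2 * X <= r^2 * B * X" "r^2 * Y <= r^2 * B * Y" using B by (auto intro!: mult_right_mono simp: mult_left_mono[of 1 B "r^2", simplified])
   moreover have "0 <= r^2 * B * X" "0 <= r^2 * B * Y" "0 <= X" "0 <= Y" using B by auto
   moreover have "(1 + 2 * r^2 * B) * (e + X + Y) = e + X + Y + 2 * (r^2 * B * X) + 2 * (r^2 * B * Y) + 2 * r^2 * B * e"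
    "r^2 * Q = r^2 * X + r^2 * Y + 2 * r^2 * B * e" by (simp_all add: Q_def algebra_simps)
   ultimately show ?thesis by linarith
  qed
  finally have "(norm (symm E))^2 <= ((1 + 2 * r^2 * B) * (e + X + Y))^2" by (rule power_mono) simp
  also have "... = (1 + 2 * r^2 * B)^2 * (e + X + Y)^2" by (rule power_mult_distrib)
  also have "... <= (1 + 2 * r^2 * B)^2 * (3 * (e^2 + X^2 + Y^2))"
   using zero_le_power2[of "e - X"] zero_le_power2[of "e - Y"] zero_le_power2[of "X - Y"]
   by (intro mult_left_mono zero_le_power2) (simp add: power2_eq_square algebra_simps)
  finally show ?thesis by (simp only: mult_ac)
 qed
 have "(norm (symm E1))^2 <= 3 * (1 + 2 * r^2 * B)^2 * (e^2 + X^2 + Y^2)" by (rule fin[of _ J1 "-1" A1]) (use i1 J(5) k(1) in auto)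
 moreover have "(norm (symm E2))^2 <= 3 * (1 + 2 * r^2 * B)^2 * (e^2 + X^2 + Y^2)" by (rule fin[of _ J2 1 A2]) (use i2 J(6) k(2) in auto)
 moreover have "1 * e^2 <= (1 + 2 * r^2 * B)^2 * e^2" using B by (intro mult_right_mono one_le_power) auto
 moreover have "0 <= (1 + 2 * r^2 * B)^2 * X^2" "0 <= (1 + 2 * r^2 * B)^2 * Y^2" "0 <= (1 + 2 * r^2 * B)^2 * e^2" by auto
 moreover have "4 * e2 + 4 / 3 * (p + q) <= 9 * P * (4 * e2 + 4 / 3 * (y + x))"
  if "p <= 3 * P * (e2 + x + y)" "q <= 3 * P * (e2 + x + y)" "1 * e2 <= P * e2" "0 <= P * x" "0 <= P * y" "0 <= P * e2" for P p q e2 x y :: real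
  using that unfolding distrib_left by linarith
 ultimately have "4 * e^2 + 4 / 3 * ((norm (symm E1))^2 + (norm (symm E2))^2) <= 9 * (1 + 2 * r^2 * B)^2 * (4 * e^2 + 4 / 3 * (Y^2 + X^2))" by metis
 thus ?thesis by (simp add: X_def Y_def e_def)
qed

section \<open>The discrete stress space and its inf-sup condition\<close>

definition piecewise :: "quad set => (quad => real^2 => 'b::real_vector) => real^2 => 'b" where
 "piecewise T p x = (\<Sum>K\<in>T. indicator (interior (quad_hull K)) x *R p K (inv_into ref_square (bilinear_map K) x))"

lemma piecewise_AE:
 assumes T: "conforming_mesh Om T" and K: "K : T"
 shows "AE z in RS. piecewise T p (bilinear_map K z) = p K z"
proof -
 note mf = mesh_facts[OF T]
 let ?B = "box (vec (-1)) (vec 1) :: (real^2) set"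
 have eq: "piecewise T p (bilinear_map K z) = p K z" if z: "z : ?B" for z
 proof -
  have zr: "z : ref_square" using z box_subset_cbox unfolding ref_square_cbox by blast
  have F: "bilinear_map K z : interior (quad_hull K)" using z bilinear_map_surj(1)[OF mf(2)[OF K]] by blast
  have "bilinear_map K z ~: interior (quad_hull L)" if "L : T" "L ~= K" for L using F T that K unfolding conforming_mesh_def by blast
  hence "piecewise T p (bilinear_map K z) = (\<Sum>L\<in>{K}. indicator (interior (quad_hull L)) (bilinear_map K z) *R p L (inv_into ref_square (bilinear_map L) (bilinear_map K z)))"
   unfolding piecewise_def using mf(1) K by (intro sum.mono_neutral_right) auto
  thus ?thesis using F by (simp add: inv_into_f_f[OF inj_bilinear_map[OF mf(2)[OF K]] zr])
 qed
 have "negligible (ref_square - ?B)" unfolding ref_square_cbox by (simp add: negligible_frontier_interval)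
 thus ?thesis unfolding AE_lebesgue_on_negligible[OF quad_hull_sets(2)] by (rule negligible_subset) (use eq in blast)
qed

lemma piecewise_L2:
 fixes p :: "quad => real^2 => 'b::euclidean_space"
 assumes dom: "convex_polygonal_domain Om" and T: "conforming_mesh Om T" and p: "!!K. K : T ==> cont (p K)"
 shows "piecewise T p : L2 Om"
proof -
 note df = domain_facts[OF dom] and mf = mesh_facts[OF T]
 define t where "t K x = indicator (interior (quad_hull K)) x *R p K (inv_into ref_square (bilinear_map K) x)" for K x
 have t: "t K : L2 Om" if K: "K : T" for K
 proof -
  let ?F = "bilinear_map K" and ?U = "interior (quad_hull K)"
  have cr: "compact ref_square" by (simp add: ref_square_cbox)
  have "continuous_on (?F ` ref_square) (inv_into ref_square ?F)"
   by (rule continuous_on_inv[OF continuous_bilinear_map cr]) (simp add: inv_into_f_f[OF inj_bilinear_map[OF mf(2)[OF K]]])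
  hence "continuous_on ?U (inv_into ref_square ?F)"
   unfolding bilinear_map_surj(2)[OF mf(2)[OF K]] by (rule continuous_on_subset) (rule interior_subset)
  hence "continuous_on ?U (%x. p K (inv_into ref_square ?F x))" by (rule continuous_on_compose2[OF p[OF K]]) auto
  hence m: "t K : borel_measurable borel" unfolding t_def[abs_def] by (rule borel_measurable_continuous_on_indicator[rotated]) simp
  have "compact (p K ` ref_square)" by (rule compact_continuous_image[OF continuous_on_subset[OF p[OF K]] cr]) simp
  then obtain b where b: "!!z. z : ref_square ==> norm (p K z) <= b" using compact_imp_bounded bounded_pos by (metis image_eqI)
  have "norm (p K 0) <= b" by (rule b) (simp add: ref_square_def)
  hence b0: "b >= 0" using norm_ge_zero[of "p K 0"] by linarith
  have "norm (t K x) <= b" for x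
  proof (cases "x : ?U")
   case True
   hence "x : ?F ` ref_square" using interior_subset bilinear_map_surj(2)[OF mf(2)[OF K]] by blast
   thus ?thesis using True b[OF inv_into_into] by (simp add: t_def)
  qed (use b0 in \<open>simp add: t_def\<close>)
  hence "(norm (t K x))^2 <= b^2" for x by (intro power_mono) auto
  moreover have "t K : borel_measurable (leb Om)" using m by (intro measurable_restrict_space1 measurable_completion) simp
  moreover have "integrable (leb Om) (%x. b^2)" by (rule integrable_continuous_bounded[OF _ df(5,4)]) simp
  ultimately show ?thesis by (intro L2_dominated[of _ _ "%x. b^2"]) auto
 qed
 have "(%x. \<Sum>K\<in>S. t K x) : L2 Om" if "finite S" "S <= T" for S
  using that by (induction S rule: finite_induct) (auto simp: L2_zero intro: L2_add t)
 thus ?thesis using mf(1) unfolding piecewise_def[abs_def] t_def by blast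
qed

locale shape_regular_mesh =
 fixes Om GN :: "(real^2) set" and T :: "quad set" and \<rho> c :: real
 assumes dom: "convex_polygonal_domain Om" and mesh: "conforming_mesh Om T" and GN: "GN ~= {}"
  and ordering: "node_ordering c T" and c1: "c >= 1" and regular: "shape_regular \<rho> T" and rho_pos: "\<rho> > 0"
begin

lemmas df = domain_facts[OF dom] and mf = mesh_facts[OF mesh]

lemma stress_space_iff: "\<tau> : stress_space Om GN \<longleftrightarrow> \<tau> : L2 Om & (AE x in leb Om. transpose (\<tau> x) = \<tau> x)"
 using GN by (simp add: stress_space_def)

lemma order: "K : T ==> coef1 K $ 1 > 0" "K : T ==> coef2 K $ 2 > 0"
  "K : T ==> \<bar>coef1 K $ 2\<bar> <= coef1 K $ 1" "K : T ==> \<bar>coef2 K $ 1\<bar> <= c * coef2 K $ 2"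
 using ordering by (auto simp: node_ordering_def)

definition ps_mode :: "quad => (real^2 => real^2^2) => bool" where
 "ps_mode K p \<longleftrightarrow> (EX T0 s t. transpose T0 = T0 & p = aff T0 (s *R shape_xi K) (t *R shape_eta K))"

lemma ps_mode_symmetric: "ps_mode K p ==> transpose (p z) = p z"
 using shape_symmetric[of K] by (auto simp: ps_mode_def transpose_mat2 aff_def)

lemma ps_mode_continuous: "ps_mode K p ==> continuous_on S p"
 by (auto simp: ps_mode_def intro: continuous_aff)

definition ps_entries :: "quad => real^5 => real^2 => real^2^2 => bool" where
 "ps_entries K \<beta> z t \<longleftrightarrow>
   t$1$1 = \<beta>$1 + z$2 * \<beta>$4 + (coef2 K $ 1)^2 / (coef2 K $ 2)^2 * z$1 * \<beta>$5 \<and>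
   t$2$2 = \<beta>$2 + (coef1 K $ 2)^2 / (coef1 K $ 1)^2 * z$2 * \<beta>$4 + z$1 * \<beta>$5 \<and>
   t$1$2 = \<beta>$3 + coef1 K $ 2 / coef1 K $ 1 * z$2 * \<beta>$4 + coef2 K $ 1 / coef2 K $ 2 * z$1 * \<beta>$5"

text \<open>The five parameters are a symmetric constant and multiples of the two rank-one modes.\<close>

lemma Sigma_PS_iff:
 "\<tau> : Sigma_PS Om GN T \<longleftrightarrow> \<tau> : L2 Om & (ALL K:T. EX p. ps_mode K p & (AE z in RS. \<tau> (bilinear_map K z) = p z))"
proof (intro iffI conjI ballI)
 assume \<tau>: "\<tau> : Sigma_PS Om GN T"
 thus "\<tau> : L2 Om" by (simp add: Sigma_PS_def stress_space_def)
 fix K assume K: "K : T"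
 have "AE x in leb Om. transpose (\<tau> x) = \<tau> x" using \<tau> by (simp add: Sigma_PS_def stress_space_def)
 hence s: "AE z in RS. transpose (\<tau> (bilinear_map K z)) = \<tau> (bilinear_map K z)" using K unfolding mesh_AE[OF dom mesh] by blast
 from \<tau> K obtain \<beta> :: "real^5" where b: "AE z in RS. ps_entries K \<beta> z (\<tau> (bilinear_map K z))"
  unfolding Sigma_PS_def Let_def ps_entries_def by blast
 define p where "p = aff (\<chi> i j. if i = j then if i = 1 then \<beta>$1 else \<beta>$2 else \<beta>$3) (\<beta>$5 *R shape_xi K) (\<beta>$4 *R shape_eta K)"
 have "AE z in RS. \<tau> (bilinear_map K z) = p z" using b s
 proof eventually_elim
  case (elim z)
  thus ?case using order(1,2)[OF K]
   by (simp add: p_def ps_entries_def vec_eq_iff[of "\<tau> _"] vec_eq_iff[of "\<tau> _ $ _"] forall_2 transpose_mat2 aff_def shape_xi_def shape_eta_def power2_eq_square mult_ac)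
 qed
 moreover have "transpose (\<chi> i j. if i = j then if i = 1 then \<beta>$1 else \<beta>$2 else \<beta>$3) = ((\<chi> i j. if i = j then if i = 1 then \<beta>$1 else \<beta>$2 else \<beta>$3) :: real^2^2)"
  by (simp add: transpose_mat2)
 hence "ps_mode K p" unfolding ps_mode_def p_def by blast
 ultimately show "EX p. ps_mode K p & (AE z in RS. \<tau> (bilinear_map K z) = p z)" by blast
next
 assume R: "\<tau> : L2 Om & (ALL K:T. EX p. ps_mode K p & (AE z in RS. \<tau> (bilinear_map K z) = p z))"
 have "AE x in leb Om. transpose (\<tau> x) = \<tau> x" unfolding mesh_AE[OF dom mesh]
 proof
  fix K assume "K : T"
  then obtain p where p: "ps_mode K p" "AE z in RS. \<tau> (bilinear_map K z) = p z" using R by blast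
  show "AE z in RS. transpose (\<tau> (bilinear_map K z)) = \<tau> (bilinear_map K z)"
   using p(2) by eventually_elim (simp add: ps_mode_symmetric[OF p(1)])
 qed
 moreover have "EX \<beta> :: real^5. AE z in RS. ps_entries K \<beta> z (\<tau> (bilinear_map K z))" if K: "K : T" for K
 proof -
  obtain p where p: "ps_mode K p" "AE z in RS. \<tau> (bilinear_map K z) = p z" using R K by blast
  obtain T0 s t where q: "p = aff T0 (s *R shape_xi K) (t *R shape_eta K)" using p(1) unfolding ps_mode_def by blast
  define \<beta> :: "real^5" where "\<beta> = (\<chi> i. if i = 1 then T0$1$1 else if i = 2 then T0$2$2 else if i = 3 then T0$1$2 else if i = 4 then t else s)"
  show ?thesis
  proof (rule exI[of _ \<beta>])
   show "AE z in RS. ps_entries K \<beta> z (\<tau> (bilinear_map K z))" using p(2) by eventually_elim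
     (use order(1,2)[OF K] in \<open>simp add: q ps_entries_def \<beta>_def aff_def shape_xi_def shape_eta_def power2_eq_square mult_ac\<close>)
  qed
 qed
 ultimately show "\<tau> : Sigma_PS Om GN T" using R unfolding Sigma_PS_def Let_def stress_space_iff ps_entries_def by blast
qed

lemma piecewise_Sigma_PS: "(!!K. K : T ==> ps_mode K (p K)) ==> piecewise T p : Sigma_PS Om GN T"
 unfolding Sigma_PS_iff using piecewise_L2[OF dom mesh, of p] piecewise_AE[OF mesh, of _ p] ps_mode_continuous by blast

lemma mesh_L2_norm:
 fixes f :: "real^2 => 'b::euclidean_space"
 assumes "f : L2 Om"
 shows "(L2_norm Om f)^2 = (\<Sum>K\<in>T. LINT z|RS. jac K z * (norm (f (bilinear_map K z)))^2)"
 unfolding L2_norm_power2 by (rule mesh_integral(2)[OF dom mesh L2_integrable[OF assms]])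

definition "hmin K = (diameter (quad_hull K))^2 / (4 * \<rho>^2)"
definition "hmax K = (diameter (quad_hull K))^2 / 4"

lemma jac_bounds:
 assumes K: "K : T"
 shows "hmin K > 0" "hmax K = \<rho>^2 * hmin K" "z : ref_square ==> hmin K <= jac K z" "z : ref_square ==> jac K z <= hmax K"
 using quad_bounds(1-3)[OF mf(2)[OF K] _ rho_pos] regular K rho_pos by (auto simp: shape_regular_def hmin_def hmax_def)

lemma jac_integrable:
 fixes h :: "real^2 => real" assumes "cont h"
 shows "integrable RS (%z. jac K z * h z)" unfolding jac_def by (intro ref_square_integrable continuous_intros assms)

definition coef_norm2 :: "'b::euclidean_space => 'b => 'b => real" where
 "coef_norm2 a b d = 4 * (norm a)^2 + 4 / 3 * ((norm b)^2 + (norm d)^2)"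

lemma integral_aff_norm:
 fixes a :: "'b::euclidean_space"
 shows "(LINT z|RS. (norm (aff a b d z))^2) = coef_norm2 a b d" unfolding power2_norm_eq_inner coef_norm2_def by (rule integral_aff_inner)

lemma continuous_norm_aff: "continuous_on S (%z. (norm (aff a b d z))^2)" for a :: "'b::euclidean_space"
 by (intro continuous_intros continuous_aff)

lemma weighted_aff_bounds:
 fixes a :: "'b::euclidean_space"
 assumes K: "K : T"
 shows "hmin K * coef_norm2 a b d <= (LINT z|RS. jac K z * (norm (aff a b d z))^2)"
  "(LINT z|RS. jac K z * (norm (aff a b d z))^2) <= hmax K * coef_norm2 a b d"
proof -
 have i: "integrable RS (%z. k * (norm (aff a b d z))^2)" for k by (rule integrable_mult_right, rule ref_square_integrable, rule continuous_norm_aff)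
 have e: "k * coef_norm2 a b d = (LINT z|RS. k * (norm (aff a b d z))^2)" for k by (simp add: integral_aff_norm)
 show "hmin K * coef_norm2 a b d <= (LINT z|RS. jac K z * (norm (aff a b d z))^2)"
  unfolding e by (rule integral_mono[OF i jac_integrable[OF continuous_norm_aff]]) (use jac_bounds(3)[OF K] in \<open>auto intro: mult_right_mono\<close>)
 show "(LINT z|RS. jac K z * (norm (aff a b d z))^2) <= hmax K * coef_norm2 a b d"
  unfolding e by (rule integral_mono[OF jac_integrable[OF continuous_norm_aff] i]) (use jac_bounds(4)[OF K] in \<open>auto intro: mult_right_mono\<close>)
qed

lemma pullback_integral_cong:
 assumes K: "K : T" and g: "integrable (leb Om) g" and h: "cont h"
  and eq: "AE z in RS. jac K z * g (bilinear_map K z) = h z"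
 shows "(LINT z|RS. jac K z * g (bilinear_map K z)) = (LINT z|RS. h z)" using eq borel_measurable_integrable[OF mesh_integral(1)[OF dom mesh g K]]
  borel_measurable_integrable[OF ref_square_integrable[OF h]] by (intro integral_cong_AE) auto

end

definition dev :: "real^2^2 => real^2^2" where "dev A = A - (trace A / 2) *R mat 1"

lemma bounded_linear_dev: "bounded_linear dev"
 unfolding dev_def[abs_def] using bounded_linear_trace
 by (intro bounded_linear_sub bounded_linear_ident bounded_linear_compose[OF bounded_linear_scaleR_left])
  (simp add: bounded_linear_divide[THEN bounded_linear_compose])

lemma dev_norm: "(norm A)^2 = (norm (dev A))^2 + (trace A)^2 / 2"
 unfolding norm2_mat2 by (simp add: dev_def trace_def sum_2 mat_def power2_eq_square field_simps)

lemma dev_inner: "A \<bullet> E = dev A \<bullet> E + trace A * trace E / 2"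
 by (simp add: dev_def trace_def sum_2 mat_def inner_vec_def field_simps)

lemma bounded_linear_aff: "bounded_linear f ==> f (aff a b d z) = aff (f a) (f b) (f d) z"
 by (simp add: aff_def linear_add[OF bounded_linear.linear] linear_cmul[OF bounded_linear.linear])

context shape_regular_mesh
begin

text \<open>Take for \<open>q\<close> the trace in the centre of each cell; the rest of the trace comes from the rank-one modes.\<close>

lemma trace_oscillation:
 assumes \<tau>: "\<tau> : Sigma_PS Om GN T"
 shows "EX q:Wbar Om T. (L2_norm Om (%x. trace (\<tau> x) - q x))^2 <= 2 * \<rho>^2 * (L2_norm Om (%x. dev (\<tau> x)))^2"
proof -
 from \<tau> have \<tau>L: "\<tau> : L2 Om" and "ALL K:T. EX p. ps_mode K p & (AE z in RS. \<tau> (bilinear_map K z) = p z)"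
  unfolding Sigma_PS_iff by auto
 then obtain p where p: "!!K. K : T ==> ps_mode K (p K)"
   "!!K. K : T ==> AE z in RS. \<tau> (bilinear_map K z) = p K z"
  using bchoice[of T "%K p. ps_mode K p & (AE z in RS. \<tau> (bilinear_map K z) = p z)"] by blast
 define q where "q = piecewise T (%K z. trace (p K 0))"
 have qL: "q : L2 Om" unfolding q_def by (rule piecewise_L2[OF dom mesh]) simp
 have qAE: "AE z in RS. q (bilinear_map K z) = trace (p K 0)" if "K : T" for K unfolding q_def by (rule piecewise_AE[OF mesh that])
 have qW: "q : Wbar Om T" unfolding Wbar_def using qL qAE quad_AE[OF mf(2)] by blast
 have dL: "(%x. trace (\<tau> x) - q x) : L2 Om" "(%x. dev (\<tau> x)) : L2 Om"
  by (intro L2_diff L2_bounded_linear[OF bounded_linear_trace \<tau>L] qL L2_bounded_linear[OF bounded_linear_dev \<tau>L])+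
 have "(LINT z|RS. jac K z * (norm (trace (\<tau> (bilinear_map K z)) - q (bilinear_map K z)))^2) <=
   2 * \<rho>^2 * (LINT z|RS. jac K z * (norm (dev (\<tau> (bilinear_map K z))))^2)" if K: "K : T" for K
 proof -
  obtain T0 s t where P: "p K = aff T0 (s *R shape_xi K) (t *R shape_eta K)" using p(1)[OF K] unfolding ps_mode_def by blast
  define xi eta where "xi = s *R shape_xi K" and "eta = t *R shape_eta K"
  have P: "p K = aff T0 xi eta" by (simp add: P xi_def eta_def)
  \<comment> \<open>in two dimensions the deviator of \<open>a a\<^sup>T\<close> has the norm \<open>|a|\<^sup>2 / sqrt 2\<close>\<close>
  have rank1: "(trace (r *R outer a a))^2 = 2 * (norm (dev (r *R outer a a)))^2" for r a
  proof -
   have "trace (r *R outer a a) = r * (norm a)^2" by (simp add: linear_cmul[OF bounded_linear.linear[OF bounded_linear_trace]] norm_outer_self)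
   thus ?thesis using dev_norm[of "r *R outer a a"] by (simp add: norm_outer_self power_mult_distrib)
  qed
  have R: "(norm (trace xi))^2 + (norm (trace eta))^2 = 2 * ((norm (dev xi))^2 + (norm (dev eta))^2)"
   unfolding xi_def eta_def shape_xi_def shape_eta_def by (simp add: rank1 del: scaleR_scaleR)
  have "(LINT z|RS. jac K z * (norm (trace (\<tau> (bilinear_map K z)) - q (bilinear_map K z)))^2)
    = (LINT z|RS. jac K z * (norm (aff 0 (trace xi) (trace eta) z))^2)"
  proof (rule pullback_integral_cong[OF K L2_integrable[OF dL(1)]])
   show "AE z in RS. jac K z * (norm (trace (\<tau> (bilinear_map K z)) - q (bilinear_map K z)))^2 =
     jac K z * (norm (aff 0 (trace xi) (trace eta) z))^2" using p(2)[OF K] qAE[OF K]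
   proof eventually_elim
    case (elim z)
    thus ?case by (simp add: P bounded_linear_aff[OF bounded_linear_trace]) (simp add: aff_def)
   qed
  qed (unfold jac_def, intro continuous_intros continuous_aff)
  also have "... <= hmax K * coef_norm2 0 (trace xi) (trace eta)" by (rule weighted_aff_bounds(2)[OF K])
  also have "... <= hmax K * (2 * coef_norm2 (dev T0) (dev xi) (dev eta))"
   unfolding coef_norm2_def R using jac_bounds(1,2)[OF K] by (intro mult_left_mono) (auto simp: algebra_simps)
  also have "... = 2 * \<rho>^2 * (hmin K * coef_norm2 (dev T0) (dev xi) (dev eta))" by (simp add: jac_bounds(2)[OF K])
  also have "... <= 2 * \<rho>^2 * (LINT z|RS. jac K z * (norm (aff (dev T0) (dev xi) (dev eta) z))^2)"
   by (intro mult_left_mono weighted_aff_bounds(1)[OF K]) simp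
  also have "(LINT z|RS. jac K z * (norm (aff (dev T0) (dev xi) (dev eta) z))^2) = (LINT z|RS. jac K z * (norm (dev (\<tau> (bilinear_map K z))))^2)"
  proof (rule pullback_integral_cong[OF K L2_integrable[OF dL(2)], symmetric])
   show "AE z in RS. jac K z * (norm (dev (\<tau> (bilinear_map K z))))^2 = jac K z * (norm (aff (dev T0) (dev xi) (dev eta) z))^2"
    using p(2)[OF K] by eventually_elim (simp add: P bounded_linear_aff[OF bounded_linear_dev])
  qed (unfold jac_def, intro continuous_intros continuous_aff)
  finally show ?thesis .
 qed
 thus ?thesis by (intro bexI[OF _ qW], unfold mesh_L2_norm[OF dL(1)] mesh_L2_norm[OF dL(2)] sum_distrib_left) (rule sum_mono)
qed

lemma strain_pullback:
 assumes K: "K : T" and v: "v : Vh Om GD T"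
 obtains c1 c2 c12 where "AE z in RS. jac K z *R strain Om v (bilinear_map K z) = symm (poly_grad K c1 c2 c12 z)"
proof -
 have vH: "v : H1 Om" using v by (simp add: Vh_def disp_space_def)
 from v K obtain c0 c1 c2 c12 where p: "AE z in RS.
     v (bilinear_map K z) = c0 + z$1 *R c1 + z$2 *R c2 + (z$1 * z$2) *R c12" unfolding Vh_def by blast
 have "quad_hull K <= closure Om" using mf(3) K by blast
 hence "AE z in RS. jac K z *R weak_grad Om v (bilinear_map K z) = poly_grad K c1 c2 c12 z"
  by (rule isoparametric_weak_gradient[OF dom mf(2)[OF K] _ vH p])
 hence "AE z in RS. jac K z *R strain Om v (bilinear_map K z) = symm (poly_grad K c1 c2 c12 z)"
  by eventually_elim (simp add: strain_eq_symm symm_scaleR[symmetric])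
 thus ?thesis by (rule that)
qed

lemma pullback_inner_measurable:
 assumes K: "K : T" and v: "v : H1 Om" and p: "cont p"
 shows "(%z. jac K z * (p z \<bullet> strain Om v (bilinear_map K z))) : borel_measurable RS"
proof -
 have 1: "(%z. jac K z * (strain Om v (bilinear_map K z) $ i $ j)) : borel_measurable RS" for i j
  by (intro borel_measurable_integrable mesh_integral(1)[OF dom mesh _ K] L2_imp_integrable[OF _ df(5,4)] L2_component strain_L2 v)
 have 2: "(%z. p z $ i $ j) : borel_measurable RS" for i j by (intro borel_measurable_integrable ref_square_integrable continuous_intros p)
 have "(%z. \<Sum>i\<in>UNIV. \<Sum>j\<in>UNIV. p z $ i $ j * (jac K z * (strain Om v (bilinear_map K z) $ i $ j))) : borel_measurable RS"
  by (intro borel_measurable_sum, rule borel_measurable_times[OF 2 1])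
 thus ?thesis by (simp add: inner_vec_def sum_distrib_left mult_ac)
qed

definition "stab = 9 * (1 + 2 * (\<rho>^2)^2 * (1 + c^2))^2"

text \<open>The constant part of the stress is \<open>symm E0\<close>, and each mode is weighted by its pairing with the linear part of the strain,
 all divided by \<open>J0\<close>. The Jacobian cancels in the pairing, which becomes the right hand side of \<open>local_stability\<close>.\<close>

lemma infsup_local:
 assumes K: "K : T" and v: "v : Vh Om GD T"
 shows "EX p b. ps_mode K p & (LINT z|RS. jac K z * (p z \<bullet> strain Om v (bilinear_map K z))) = b \<and>
   (LINT z|RS. jac K z * (norm (p z))^2) <= \<rho>^2 * (1 + c^2)^2 * b \<and>
   (LINT z|RS. jac K z * (norm (strain Om v (bilinear_map K z)))^2) <= \<rho>^2 * stab * b"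
proof -
 have vH: "v : H1 Om" using v by (simp add: Vh_def disp_space_def)
 let ?e = "%z. strain Om v (bilinear_map K z)"
 obtain c1 c2 c12 where g: "AE z in RS. jac K z *R ?e z = symm (poly_grad K c1 c2 c12 z)" using strain_pullback[OF K v] .
 define A1 A2 A12 where "A1 = coef1 K" and "A2 = coef2 K" and "A12 = coef12 K"
 define E0 E1 E2 where "E0 = outer c1 (perp A2) - outer c2 (perp A1)" and "E1 = outer c1 (perp A12) - outer c12 (perp A1)"
  and "E2 = outer c12 (perp A2) - outer c2 (perp A12)"
 define J0 where "J0 = cross2 A1 A2"
 define M N where "M = shape_xi K" and "N = shape_eta K"
 define Q where "Q = 4 * (norm (symm E0))^2 + 4 / 3 * ((M \<bullet> E1)^2 + (N \<bullet> E2)^2)"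
 define p where "p = aff ((1 / J0) *R symm E0) (((M \<bullet> E1) / J0) *R M) (((N \<bullet> E2) / J0) *R N)"
 have sg: "symm (poly_grad K c1 c2 c12 z) = aff (symm E0) (symm E1) (symm E2) z" for z
  unfolding poly_grad_def bounded_linear_aff[OF bounded_linear_symm] E0_def E1_def E2_def A1_def A2_def A12_def ..
 have "(0 :: real^2) : ref_square" by (simp add: ref_square_def)
 note jb = jac_bounds(1,2)[OF K] jac_bounds(3,4)[OF K this]
 have J0: "hmin K <= J0" "J0 <= hmax K" "J0 > 0" using jb by (auto simp: jac_def J0_def A1_def A2_def)
 have B: "norm N <= 1 + c^2" "norm M <= 1 + c^2" unfolding M_def N_def using shape_norm_le[OF order(1)[OF K] order(2)[OF K] order(3)[OF K] order(4)[OF K] c1] by auto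
 note qb = quad_bounds[OF mf(2)[OF K] _ rho_pos]
 have reg: "diameter (quad_hull K) <= \<rho> * rho K" using regular K by (simp add: shape_regular_def)
 have "coef_norm2 (symm E0) (symm E1) (symm E2) <= 9 * (1 + 2 * (\<rho>^2)^2 * (1 + c^2))^2 * Q" unfolding coef_norm2_def Q_def
 proof (rule local_stability[OF J0_def refl refl J0(3) _ _ E0_def E1_def E2_def])
  show "\<bar>cross2 A1 A12\<bar> <= J0" "\<bar>cross2 A12 A2\<bar> <= J0" using qb(6)[OF reg] by (auto simp: J0_def A1_def A2_def A12_def)
  show "0 < A1 $ 1" "0 < A2 $ 2" using order[OF K] by (auto simp: A1_def A2_def)
  show "norm A1 <= diameter (quad_hull K) / 2" "norm A2 <= diameter (quad_hull K) / 2" using qb(4,5)[OF reg] by (auto simp: A1_def A2_def)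
  have "(diameter (quad_hull K) / 2)^2 = \<rho>^2 * hmin K" using jb(2) by (simp add: hmax_def power_divide)
  thus "(diameter (quad_hull K) / 2)^2 <= \<rho>^2 * J0" using J0(1) by (simp add: mult_left_mono)
  show "N = outer ((1 / A1 $ 1) *R A1) ((1 / A1 $ 1) *R A1)" "M = outer ((1 / A2 $ 2) *R A2) ((1 / A2 $ 2) *R A2)"
   by (simp_all add: M_def N_def shape_xi_def shape_eta_def A1_def A2_def)
 qed (use B in auto)
 hence st: "coef_norm2 (symm E0) (symm E1) (symm E2) <= stab * Q" by (simp add: stab_def)
 have Q0: "Q >= 0" by (simp add: Q_def)
 have "transpose ((1 / J0) *R symm E0) = (1 / J0) *R symm E0" unfolding transpose_mat2 by (simp add: symm_def transpose_def add.commute)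
 hence "ps_mode K p" unfolding ps_mode_def p_def M_def N_def by blast
 moreover have "(LINT z|RS. jac K z * (p z \<bullet> ?e z)) = (LINT z|RS. p z \<bullet> aff (symm E0) (symm E1) (symm E2) z)"
 proof (rule integral_cong_AE)
  have "AE z in RS. jac K z * (p z \<bullet> ?e z) = p z \<bullet> aff (symm E0) (symm E1) (symm E2) z"
   using g by eventually_elim (simp add: sg[symmetric] inner_scaleR_right[symmetric] del: inner_scaleR_right)
  thus "AE z in RS. jac K z * (p z \<bullet> ?e z) = p z \<bullet> aff (symm E0) (symm E1) (symm E2) z" .
  show m: "(%z. p z \<bullet> aff (symm E0) (symm E1) (symm E2) z) : borel_measurable RS"
   unfolding p_def by (intro borel_measurable_integrable ref_square_integrable continuous_intros continuous_aff)
  show "(%z. jac K z * (p z \<bullet> ?e z)) : borel_measurable RS" by (rule pullback_inner_measurable[OF K vH]) (simp add: p_def continuous_aff)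
 qed
 moreover have "(LINT z|RS. p z \<bullet> aff (symm E0) (symm E1) (symm E2) z) = Q / J0"
  unfolding p_def integral_aff_inner using shape_symmetric[of K] J0(3)
  by (simp add: inner_symm M_def[symmetric] N_def[symmetric] Q_def power2_norm_eq_inner[unfolded power2_eq_square, symmetric] power2_eq_square field_simps)
 moreover have "(LINT z|RS. jac K z * (norm (p z))^2) <= \<rho>^2 * (1 + c^2)^2 * (Q / J0)"
 proof -
  have sq: "(norm M)^2 <= (1 + c^2)^2" "(norm N)^2 <= (1 + c^2)^2" "1 <= (1 + c^2)^2" using B by (auto intro!: power_mono one_le_power)
  have "coef_norm2 ((1 / J0) *R symm E0) (((M \<bullet> E1) / J0) *R M) (((N \<bullet> E2) / J0) *R N) =
    (4 * (norm (symm E0))^2 * 1 + 4 / 3 * ((M \<bullet> E1)^2 * (norm M)^2 + (N \<bullet> E2)^2 * (norm N)^2)) / J0^2"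
   by (simp add: coef_norm2_def power_mult_distrib power_divide add_divide_distrib)
  also have "... <= (4 * (norm (symm E0))^2 * (1 + c^2)^2 + 4 / 3 * ((M \<bullet> E1)^2 * (1 + c^2)^2 + (N \<bullet> E2)^2 * (1 + c^2)^2)) / J0^2"
   using sq by (intro divide_right_mono add_mono mult_left_mono) auto
  also have "... = (1 + c^2)^2 * Q / J0^2" by (simp add: Q_def algebra_simps)
  finally have "(LINT z|RS. jac K z * (norm (p z))^2) <= hmax K * ((1 + c^2)^2 * Q / J0^2)"
   unfolding p_def using jb(1,2) by (intro order_trans[OF weighted_aff_bounds(2)[OF K]] mult_left_mono) auto
  also have "... <= (\<rho>^2 * J0) * ((1 + c^2)^2 * Q / J0^2)" unfolding jb(2) using J0(1) Q0 by (intro mult_right_mono mult_left_mono) auto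
  also have "... = \<rho>^2 * (1 + c^2)^2 * (Q / J0)" using J0(3) by (simp add: power2_eq_square)
  finally show ?thesis .
 qed
 moreover have "(LINT z|RS. jac K z * (norm (?e z))^2) <= \<rho>^2 * stab * (Q / J0)"
 proof -
  have "(LINT z|RS. jac K z * (norm (?e z))^2) <= (LINT z|RS. (1 / hmin K) * (norm (aff (symm E0) (symm E1) (symm E2) z))^2)"
  proof (rule integral_mono_AE)
   have inr: "AE z in RS. z : ref_square" by (rule AE_I2) simp
   show "integrable RS (%z. jac K z * (norm (?e z))^2)" by (rule mesh_integral(1)[OF dom mesh L2_integrable[OF strain_L2[OF vH]] K])
   show "integrable RS (%z. (1 / hmin K) * (norm (aff (symm E0) (symm E1) (symm E2) z))^2)"
    by (rule integrable_mult_right, rule ref_square_integrable, rule continuous_norm_aff)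
   show "AE z in RS. jac K z * (norm (?e z))^2 <= (1 / hmin K) * (norm (aff (symm E0) (symm E1) (symm E2) z))^2" using g inr
   proof eventually_elim
    case (elim z)
    hence h: "hmin K <= jac K z" by (intro jac_bounds(3)[OF K]) simp
    hence "hmin K * jac K z <= jac K z * jac K z" by (rule mult_right_mono) (use h jb(1) in linarith)
    hence "(hmin K * jac K z) * (norm (?e z))^2 <= (jac K z * jac K z) * (norm (?e z))^2" by (rule mult_right_mono) simp
    also have "... = (norm (jac K z *R ?e z))^2" by (simp add: power_mult_distrib power2_eq_square)
    also have "... = (norm (aff (symm E0) (symm E1) (symm E2) z))^2" unfolding elim(1) sg ..
    finally show ?case using jb(1) by (simp add: field_simps)
   qed
  qed
  also have "... = (1 / hmin K) * coef_norm2 (symm E0) (symm E1) (symm E2)" by (simp add: integral_aff_norm)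
  also have "... <= (1 / hmin K) * (stab * Q)" using st jb(1) by (intro mult_left_mono) auto
  also have "... <= (\<rho>^2 / J0) * (stab * Q)"
  proof (rule mult_right_mono)
   show "1 / hmin K <= \<rho>^2 / J0" using J0 jb(1,2) by (simp add: field_simps)
   show "0 <= stab * Q" using Q0 by (simp add: stab_def)
  qed
  finally show ?thesis by simp
 qed
 ultimately show ?thesis by auto
qed

lemma discrete_infsup:
 assumes v: "v : Vh Om GD T"
 shows "EX \<tau>:Sigma_PS Om GN T. (L2_norm Om \<tau>)^2 <= \<rho>^2 * (1 + c^2)^2 * strain_pairing Om \<tau> v \<and>
   (L2_norm Om (strain Om v))^2 <= \<rho>^2 * stab * strain_pairing Om \<tau> v"
proof -
 have vH: "v : H1 Om" using v by (simp add: Vh_def disp_space_def)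
 let ?e = "%K z. strain Om v (bilinear_map K z)"
 define b where "b p K = (LINT z|RS. jac K z * (p z \<bullet> ?e K z))" for p K
 have "ALL K:T. EX p. ps_mode K p & (LINT z|RS. jac K z * (norm (p z))^2) <= \<rho>^2 * (1 + c^2)^2 * b p K \<and>
   (LINT z|RS. jac K z * (norm (?e K z))^2) <= \<rho>^2 * stab * b p K"
 proof
  fix K assume "K : T"
  from infsup_local[OF this v] obtain p b' where "ps_mode K p" "b p K = b'"
   "(LINT z|RS. jac K z * (norm (p z))^2) <= \<rho>^2 * (1 + c^2)^2 * b'"
   "(LINT z|RS. jac K z * (norm (?e K z))^2) <= \<rho>^2 * stab * b'" unfolding b_def by blast
  thus "EX p. ps_mode K p & (LINT z|RS. jac K z * (norm (p z))^2) <= \<rho>^2 * (1 + c^2)^2 * b p K \<and>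
   (LINT z|RS. jac K z * (norm (?e K z))^2) <= \<rho>^2 * stab * b p K" by (intro exI[of _ p]) simp
 qed
 from bchoice[OF this] obtain p where p: "!!K. K : T ==> ps_mode K (p K)"
  "!!K. K : T ==> (LINT z|RS. jac K z * (norm (p K z))^2) <= \<rho>^2 * (1 + c^2)^2 * b (p K) K"
  "!!K. K : T ==> (LINT z|RS. jac K z * (norm (?e K z))^2) <= \<rho>^2 * stab * b (p K) K" by blast
 define \<tau> where "\<tau> = piecewise T p"
 have \<tau>: "\<tau> : Sigma_PS Om GN T" unfolding \<tau>_def using p(1) by (rule piecewise_Sigma_PS)
 hence \<tau>L: "\<tau> : L2 Om" unfolding Sigma_PS_iff by blast
 have AE: "AE z in RS. \<tau> (bilinear_map K z) = p K z" if "K : T" for K unfolding \<tau>_def by (rule piecewise_AE[OF mesh that])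
 note bi = L2_inner_integrable[OF \<tau>L strain_L2[OF vH]]
 have s: "strain_pairing Om \<tau> v = (\<Sum>K\<in>T. b (p K) K)" unfolding strain_pairing_def mesh_integral(2)[OF dom mesh bi] b_def
 proof (rule sum.cong[OF refl])
  fix K assume K: "K : T"
  have m: "(%z. jac K z * (p K z \<bullet> ?e K z)) : borel_measurable RS"
   by (rule pullback_inner_measurable[OF K vH ps_mode_continuous[OF p(1)[OF K]]])
  show "(LINT z|RS. jac K z * (\<tau> (bilinear_map K z) \<bullet> ?e K z)) = (LINT z|RS. jac K z * (p K z \<bullet> ?e K z))"
   by (rule integral_cong_AE[OF borel_measurable_integrable[OF mesh_integral(1)[OF dom mesh bi K]] m])
    (use AE[OF K] in \<open>eventually_elim, simp\<close>)
 qed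
 have "(LINT z|RS. jac K z * (norm (\<tau> (bilinear_map K z)))^2) = (LINT z|RS. jac K z * (norm (p K z))^2)" if K: "K : T" for K
  by (rule pullback_integral_cong[OF K L2_integrable[OF \<tau>L]])
   (unfold jac_def, intro continuous_intros ps_mode_continuous[OF p(1)[OF K]], use AE[OF K] in \<open>eventually_elim, simp\<close>)
 hence "(L2_norm Om \<tau>)^2 <= \<rho>^2 * (1 + c^2)^2 * strain_pairing Om \<tau> v"
  unfolding mesh_L2_norm[OF \<tau>L] s sum_distrib_left using p(2) by (intro sum_mono) simp
 moreover have "(L2_norm Om (strain Om v))^2 <= \<rho>^2 * stab * strain_pairing Om \<tau> v"
  unfolding mesh_L2_norm[OF strain_L2[OF vH]] s sum_distrib_left using p(3) by (intro sum_mono) simp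
 ultimately show ?thesis using \<tau> by blast
qed

end

section \<open>Stability of the discrete mixed problem\<close>

lemma form_a_eq:
 assumes "\<sigma> : L2 Om" "\<tau> : L2 Om"
 shows "form_a Om \<mu> lam \<sigma> \<tau> = 1 / (2 * \<mu>) * ((LINT x|leb Om. \<sigma> x \<bullet> \<tau> x)
   - lam / (2 * (\<mu> + lam)) * (LINT x|leb Om. trace (\<sigma> x) * trace (\<tau> x)))"
proof -
 have i: "integrable (leb Om) (%x. \<sigma> x \<bullet> \<tau> x)" by (rule L2_inner_integrable[OF assms])
 have j: "integrable (leb Om) (%x. trace (\<sigma> x) * trace (\<tau> x))"
  using L2_inner_integrable[OF L2_bounded_linear[OF bounded_linear_trace assms(1)] L2_bounded_linear[OF bounded_linear_trace assms(2)]] by simp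
 show ?thesis unfolding form_a_def
  by (simp only: mult.assoc) (simp add: lint_diff[OF i integrable_mult_right[OF j]] del: times_divide_eq_left times_divide_eq_right)
qed

lemma form_a_commute: "form_a Om \<mu> lam \<sigma> \<tau> = form_a Om \<mu> lam \<tau> \<sigma>"
 by (simp add: form_a_def inner_commute mult_ac)

lemma form_a_lincomb:
 assumes "\<sigma> : L2 Om" "\<sigma>' : L2 Om" "\<tau> : L2 Om"
 shows "form_a Om \<mu> lam (%x. a *R \<sigma> x + b *R \<sigma>' x) \<tau> = a * form_a Om \<mu> lam \<sigma> \<tau> + b * form_a Om \<mu> lam \<sigma>' \<tau>"
proof -
 note t = L2_bounded_linear[OF bounded_linear_trace]
 have tr: "trace (a *R \<sigma> x + b *R \<sigma>' x) = a * trace (\<sigma> x) + b * trace (\<sigma>' x)" for x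
  by (simp add: trace_def sum_2 algebra_simps)
 have "(LINT x|leb Om. (a *R \<sigma> x + b *R \<sigma>' x) \<bullet> \<tau> x) = a * (LINT x|leb Om. \<sigma> x \<bullet> \<tau> x) + b * (LINT x|leb Om. \<sigma>' x \<bullet> \<tau> x)"
  using L2_inner_integrable[OF assms(1,3)] L2_inner_integrable[OF assms(2,3)] by (simp add: inner_add_left)
 moreover have "(LINT x|leb Om. trace (a *R \<sigma> x + b *R \<sigma>' x) * trace (\<tau> x)) =
   a * (LINT x|leb Om. trace (\<sigma> x) * trace (\<tau> x)) + b * (LINT x|leb Om. trace (\<sigma>' x) * trace (\<tau> x))"
  unfolding tr using L2_inner_integrable[OF t[OF assms(1)] t[OF assms(3)]] L2_inner_integrable[OF t[OF assms(2)] t[OF assms(3)]]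
  by (simp add: distrib_right mult.assoc)
 ultimately show ?thesis
  unfolding form_a_eq[OF assms(1,3)] form_a_eq[OF assms(2,3)] form_a_eq[OF L2_add[OF L2_scaleR[OF assms(1)] L2_scaleR[OF assms(2)]] assms(3)]
  by (simp add: algebra_simps)
qed

lemma sqrt2_prod: "sqrt 2 * a * (sqrt 2 * b) = 2 * (a * b)" for a b :: real
proof -
 have "sqrt 2 * a * (sqrt 2 * b) = (sqrt 2 * sqrt 2) * (a * b)" by (simp only: mult_ac)
 thus ?thesis by simp
qed

lemma form_a_bound:
 assumes "\<sigma> : L2 Om" "\<tau> : L2 Om" "\<mu> > 0" "lam > 0"
 shows "\<bar>form_a Om \<mu> lam \<sigma> \<tau>\<bar> <= 1 / \<mu> * (L2_norm Om \<sigma> * L2_norm Om \<tau>)"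
proof -
 note t = L2_bounded_linear[OF bounded_linear_trace]
 define I J N where "I = (LINT x|leb Om. \<sigma> x \<bullet> \<tau> x)" and "J = (LINT x|leb Om. trace (\<sigma> x) * trace (\<tau> x))"
  and "N = L2_norm Om \<sigma> * L2_norm Om \<tau>"
 have I: "\<bar>I\<bar> <= N" unfolding I_def N_def by (rule L2_Cauchy_Schwarz[OF assms(1,2)])
 have "\<bar>J\<bar> <= L2_norm Om (%x. trace (\<sigma> x)) * L2_norm Om (%x. trace (\<tau> x))"
  using L2_Cauchy_Schwarz[OF t[OF assms(1)] t[OF assms(2)]] by (simp add: J_def)
 also have "... <= (sqrt 2 * L2_norm Om \<sigma>) * (sqrt 2 * L2_norm Om \<tau>)"
  using assms(1,2) by (intro mult_mono L2_norm_trace_le) (auto simp: L2_norm_nonneg)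
 finally have J: "\<bar>J\<bar> <= 2 * N" by (simp only: N_def sqrt2_prod)
 define k where "k = lam / (2 * (\<mu> + lam))"
 have k: "\<bar>k\<bar> <= 1 / 2" unfolding k_def using assms(3,4) by (auto simp: field_simps abs_le_iff)
 have "\<bar>k * J\<bar> <= 1 / 2 * (2 * N)" unfolding abs_mult by (rule mult_mono[OF k J]) auto
 hence "\<bar>I - k * J\<bar> <= 2 * N" using I by linarith
 hence "1 / (2 * \<mu>) * \<bar>I - k * J\<bar> <= 1 / (2 * \<mu>) * (2 * N)" using assms(3) by (intro mult_left_mono) auto
 thus ?thesis using assms(3) unfolding form_a_eq[OF assms(1,2)] I_def[symmetric] J_def[symmetric] N_def[symmetric] k_def[symmetric]
  by (simp add: abs_mult)
qed

text \<open>Splitting off the trace, \<open>2\<mu> a\<close> is the deviator part plus \<open>\<mu>/(2(\<mu>+\<lambda>))\<close> times the trace part.\<close>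

lemma form_a_dev:
 assumes "\<sigma> : L2 Om" "\<mu> > 0" "lam > 0"
 shows "(L2_norm Om (%x. dev (\<sigma> x)))^2 <= 2 * \<mu> * form_a Om \<mu> lam \<sigma> \<sigma>"
proof -
 note t = L2_bounded_linear[OF bounded_linear_trace assms(1)]
 define k where "k = lam / (2 * (\<mu> + lam))"
 have k: "k <= 1 / 2" unfolding k_def using assms(2,3) by (auto simp: field_simps)
 have i: "integrable (leb Om) (%x. \<sigma> x \<bullet> \<sigma> x - k * trace (\<sigma> x) * trace (\<sigma> x))"
  using L2_inner_integrable[OF assms(1,1)] L2_inner_integrable[OF t t] by (simp add: mult.assoc)
 have "(L2_norm Om (%x. dev (\<sigma> x)))^2 <= (LINT x|leb Om. \<sigma> x \<bullet> \<sigma> x - k * trace (\<sigma> x) * trace (\<sigma> x))"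
  unfolding L2_norm_power2
 proof (rule integral_mono[OF L2_integrable[OF L2_bounded_linear[OF bounded_linear_dev assms(1)]] i])
  fix x
  have "k * (trace (\<sigma> x))^2 <= 1 / 2 * (trace (\<sigma> x))^2" using k by (intro mult_right_mono) auto
  thus "(norm (dev (\<sigma> x)))^2 <= \<sigma> x \<bullet> \<sigma> x - k * trace (\<sigma> x) * trace (\<sigma> x)"
   using dev_norm[of "\<sigma> x"] by (simp add: power2_norm_eq_inner[symmetric] power2_eq_square[of "trace _"] mult.assoc)
 qed
 thus ?thesis using assms(2) by (simp add: form_a_def k_def)
qed

lemma strain_pairing_lincomb:
 assumes "\<sigma> : L2 Om" "\<tau> : L2 Om" "v : H1 Om"
 shows "strain_pairing Om (%x. a *R \<sigma> x + b *R \<tau> x) v = a * strain_pairing Om \<sigma> v + b * strain_pairing Om \<tau> v"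
 unfolding strain_pairing_def using L2_inner_integrable[OF assms(1) strain_L2[OF assms(3)]] L2_inner_integrable[OF assms(2) strain_L2[OF assms(3)]]
 by (simp add: inner_add_left)

lemma strain_lincomb:
 assumes "open Om" "bounded Om" "v : H1 Om" "w : H1 Om"
 shows "AE x in leb Om. strain Om (%x. a *R v x + b *R w x) x = a *R strain Om v x + b *R strain Om w x"
 using H1_lincomb(2)[OF assms, of a b] unfolding strain_eq_symm by eventually_elim (simp add: symm_add symm_scaleR)

lemma strain_pairing_lincomb_right:
 assumes O: "open Om" "bounded Om" and \<tau>: "\<tau> : L2 Om" and vw: "v : H1 Om" "w : H1 Om"
 shows "strain_pairing Om \<tau> (%x. a *R v x + b *R w x) = a * strain_pairing Om \<tau> v + b * strain_pairing Om \<tau> w"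
proof -
 note i = L2_inner_integrable[OF \<tau> strain_L2[OF vw(1)]] L2_inner_integrable[OF \<tau> strain_L2[OF vw(2)]]
  L2_inner_integrable[OF \<tau> strain_L2[OF H1_lincomb(1)[OF O vw]], of a b]
 have "strain_pairing Om \<tau> (%x. a *R v x + b *R w x) = (LINT x|leb Om. a * (\<tau> x \<bullet> strain Om v x) + b * (\<tau> x \<bullet> strain Om w x))"
  unfolding strain_pairing_def
 proof (rule integral_cong_AE)
  show "AE x in leb Om. \<tau> x \<bullet> strain Om (%x. a *R v x + b *R w x) x = a * (\<tau> x \<bullet> strain Om v x) + b * (\<tau> x \<bullet> strain Om w x)"
   using strain_lincomb[OF O vw, of a b] by eventually_elim (simp add: inner_add_right)
 qed (use i in \<open>auto intro!: borel_measurable_integrable\<close>)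
 thus ?thesis unfolding strain_pairing_def using i by simp
qed

lemma strain_pairing_bounds:
 assumes "\<tau> : L2 Om" "v : H1 Om"
 shows "\<bar>strain_pairing Om \<tau> v\<bar> <= L2_norm Om \<tau> * L2_norm Om (strain Om v)"
  "\<bar>strain_pairing Om \<tau> v\<bar> <= L2_norm Om \<tau> * H1_seminorm Om v"
proof -
 show 1: "\<bar>strain_pairing Om \<tau> v\<bar> <= L2_norm Om \<tau> * L2_norm Om (strain Om v)"
  unfolding strain_pairing_def by (rule L2_Cauchy_Schwarz[OF assms(1) strain_L2[OF assms(2)]])
 have "L2_norm Om (strain Om v) <= H1_seminorm Om v" unfolding strain_eq_symm H1_seminorm_def by (rule L2_norm_symm_le[OF weak_grad_L2[OF assms(2)]])
 thus "\<bar>strain_pairing Om \<tau> v\<bar> <= L2_norm Om \<tau> * H1_seminorm Om v" using 1 by (meson L2_norm_nonneg mult_left_mono order_trans)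
qed

lemma trace_strain: "trace (strain Om v x) = divergence Om v x"
 by (simp add: strain_def divergence_def trace_def sum_2 transpose_def field_simps)

lemma absorb_quadratic:
 fixes n k \<delta> :: real
 assumes "n^2 <= k * (\<delta> * (n + \<delta>))" "k >= 0" "\<delta> >= 0" "n >= 0"
 shows "n <= (k + 1) * \<delta>"
proof (rule ccontr)
 assume "\<not> n <= (k + 1) * \<delta>"
 hence n: "(k + 1) * \<delta> < n" by simp
 moreover have "0 <= (k + 1) * \<delta>" using assms by simp
 ultimately have "n > 0" by linarith
 hence "(k + 1) * \<delta> * n < n^2" using n by (simp add: power2_eq_square)
 moreover have "\<delta> * ((k + 1) * \<delta>) <= \<delta> * n" using n assms(3) by (intro mult_left_mono) auto
 moreover have "0 <= \<delta> * \<delta>" by simp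
 moreover have "(k + 1) * \<delta> * n = k * (\<delta> * n) + \<delta> * n" "\<delta> * ((k + 1) * \<delta>) = k * (\<delta> * \<delta>) + \<delta> * \<delta>"
  "k * (\<delta> * (n + \<delta>)) = k * (\<delta> * n) + k * (\<delta> * \<delta>)" by (simp_all add: algebra_simps)
 ultimately show False using assms(1) by linarith
qed

context shape_regular_mesh
begin

text \<open>Let \<open>q\<close> be the cell constants of the trace and \<open>v\<close> a displacement whose divergence tests \<open>q\<close>. Twice the pairing of \<open>e\<close>
 with the strain of \<open>v\<close> is \<open>\<integral> tr e div v\<close> plus twice that of the deviator.\<close>

lemma stress_norm_from_deviator:
 assumes e: "e : Sigma_PS Om GN T" and c0: "c0 > 0"
  and D: "!!q. q : Wbar Om T ==> EX v:Vh Om GD T. (L2_norm Om q)^2 <= c0 * (LINT x|leb Om. q x * divergence Om v x) \<and>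
    (H1_seminorm Om v)^2 <= c0 * (L2_norm Om q)^2"
  and b: "!!y. y : Vh Om GD T ==> strain_pairing Om e y <= \<delta> * H1_seminorm Om y" and \<delta>: "\<delta> >= 0"
 shows "L2_norm Om e <= (1 + 2 * \<rho> + c0 * sqrt c0 * (2 * \<rho> + 2)) * (L2_norm Om (%x. dev (e x)) + \<delta>)"
proof -
 define d n where "d = L2_norm Om (%x. dev (e x))" and "n = L2_norm Om e"
 have d0: "d >= 0" by (simp add: d_def L2_norm_nonneg)
 have eL: "e : L2 Om" using e unfolding Sigma_PS_iff by blast
 note tL = L2_bounded_linear[OF bounded_linear_trace eL] and dL = L2_bounded_linear[OF bounded_linear_dev eL]
 obtain q where q: "q : Wbar Om T" "(L2_norm Om (%x. trace (e x) - q x))^2 <= 2 * \<rho>^2 * d^2"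
  using trace_oscillation[OF e] unfolding d_def by blast
 have qL: "q : L2 Om" using q(1) by (simp add: Wbar_def)
 define Q where "Q = L2_norm Om q"
 have osc: "L2_norm Om (%x. trace (e x) - q x) <= sqrt 2 * (\<rho> * d)"
 proof (rule power2_le_imp_le)
  show "(L2_norm Om (%x. trace (e x) - q x))^2 <= (sqrt 2 * (\<rho> * d))^2" by (rule order_trans[OF q(2)]) (simp add: power_mult_distrib)
  show "0 <= sqrt 2 * (\<rho> * d)" using d0 rho_pos by simp
 qed
 obtain v where v: "v : Vh Om GD T" "Q^2 <= c0 * (LINT x|leb Om. q x * divergence Om v x)" "(H1_seminorm Om v)^2 <= c0 * Q^2"
  using D[OF q(1)] unfolding Q_def by blast
 have vH: "v : H1 Om" using v(1) by (simp add: Vh_def disp_space_def)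
 define s where "s = H1_seminorm Om v"
 have s0: "s >= 0" "Q >= 0" by (simp_all add: s_def H1_norm_bounds Q_def L2_norm_nonneg)
 have s: "s <= sqrt c0 * Q"   proof (rule power2_le_imp_le)
  show "s^2 <= (sqrt c0 * Q)^2" unfolding s_def by (rule order_trans[OF v(3)]) (use c0 in \<open>simp add: power_mult_distrib\<close>)
  show "0 <= sqrt c0 * Q" using s0 c0 by simp
 qed
 have div: "L2_norm Om (divergence Om v) <= sqrt 2 * s"
  unfolding s_def H1_seminorm_def divergence_def[abs_def] by (rule L2_norm_trace_le[OF weak_grad_L2[OF vH]])
 note dvL = divergence_L2[OF vH] and sL = strain_L2[OF vH]
 have i: "integrable (leb Om) (%x. (trace (e x) - q x) * divergence Om v x)"
  "integrable (leb Om) (%x. e x \<bullet> strain Om v x)" "integrable (leb Om) (%x. dev (e x) \<bullet> strain Om v x)"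
  using L2_inner_integrable[OF L2_diff[OF tL qL] dvL] L2_inner_integrable[OF eL sL] L2_inner_integrable[OF dL sL] by auto
 have "q x * divergence Om v x = 2 * (e x \<bullet> strain Om v x) - 2 * (dev (e x) \<bullet> strain Om v x) - (trace (e x) - q x) * divergence Om v x" for x
  using dev_inner[of "e x" "strain Om v x"] by (simp add: trace_strain algebra_simps)
 hence "(LINT x|leb Om. q x * divergence Om v x) = 2 * strain_pairing Om e v - 2 * strain_pairing Om (%x. dev (e x)) v
   - (LINT x|leb Om. (trace (e x) - q x) * divergence Om v x)" unfolding strain_pairing_def using i by simp
 moreover have "strain_pairing Om e v <= \<delta> * s" unfolding s_def by (rule b[OF v(1)])
 moreover have "\<bar>strain_pairing Om (%x. dev (e x)) v\<bar> <= d * s" unfolding s_def d_def by (rule strain_pairing_bounds(2)[OF dL vH])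
 moreover have "\<bar>LINT x|leb Om. (trace (e x) - q x) * divergence Om v x\<bar> <= 2 * (\<rho> * d) * s"
 proof -
  have "\<bar>LINT x|leb Om. (trace (e x) - q x) * divergence Om v x\<bar> <= L2_norm Om (%x. trace (e x) - q x) * L2_norm Om (divergence Om v)"
   using L2_Cauchy_Schwarz[OF L2_diff[OF tL qL] dvL] by simp
  also have "... <= (sqrt 2 * (\<rho> * d)) * (sqrt 2 * s)" using osc div d0 rho_pos by (intro mult_mono) (auto simp: L2_norm_nonneg)
  finally show ?thesis unfolding sqrt2_prod by (simp only: mult.assoc)
 qed
 ultimately have "(LINT x|leb Om. q x * divergence Om v x) <= 2 * (\<delta> * s) + 2 * (d * s) + 2 * (\<rho> * d) * s" by linarith
 also have "... = ((2 * \<rho> + 2) * d + 2 * \<delta>) * s" by (simp add: algebra_simps)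
 also have "... <= ((2 * \<rho> + 2) * d + 2 * \<delta>) * (sqrt c0 * Q)" using s d0 \<delta> rho_pos by (intro mult_left_mono) auto
 finally have "Q^2 <= c0 * (((2 * \<rho> + 2) * d + 2 * \<delta>) * (sqrt c0 * Q))" using v(2) c0 by (smt (verit) mult_left_mono)
 hence "Q * Q <= (c0 * sqrt c0 * ((2 * \<rho> + 2) * d + 2 * \<delta>)) * Q" by (simp add: power2_eq_square mult_ac)
 hence Q: "Q <= c0 * sqrt c0 * ((2 * \<rho> + 2) * d + 2 * \<delta>)" using s0(2) d0 \<delta> rho_pos c0 by (cases "Q = 0") auto
 have "L2_norm Om (%x. trace (e x)) <= L2_norm Om (%x. trace (e x) - q x) + Q" using L2_norm_triangle[OF L2_diff[OF tL qL] qL] by (simp add: Q_def)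
 moreover have "sqrt 2 * (\<rho> * d) <= 2 * (\<rho> * d)" using real_sqrt_le_mono[of 2 4] d0 rho_pos by (intro mult_right_mono) auto
 ultimately have tr: "L2_norm Om (%x. trace (e x)) <= 2 * (\<rho> * d) + Q" using osc by linarith
 have "n^2 = (LINT x|leb Om. (norm (dev (e x)))^2 + (norm (trace (e x)))^2 / 2)" unfolding n_def L2_norm_power2 by (simp add: dev_norm[of "e _"])
 also have "... = d^2 + (L2_norm Om (%x. trace (e x)))^2 / 2" unfolding d_def L2_norm_power2 using L2_integrable[OF dL] L2_integrable[OF tL] by simp
 also have "... <= (d + L2_norm Om (%x. trace (e x)))^2"
  using d0 mult_nonneg_nonneg[OF d0 L2_norm_nonneg[of Om "%x. trace (e x)"]] by (simp add: power2_sum)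
 finally have "n <= d + L2_norm Om (%x. trace (e x))" by (rule power2_le_imp_le) (simp add: d0 L2_norm_nonneg)
 hence "n <= d + 2 * (\<rho> * d) + c0 * sqrt c0 * ((2 * \<rho> + 2) * d + 2 * \<delta>)" using tr Q by linarith
 also have "... <= (1 + 2 * \<rho> + c0 * sqrt c0 * (2 * \<rho> + 2)) * (d + \<delta>)"
 proof -
  have "0 <= c0 * sqrt c0 * \<rho> * \<delta>" "0 <= \<rho> * \<delta>" using c0 \<delta> rho_pos by auto
  thus ?thesis using \<delta> by (simp add: algebra_simps)
 qed
 finally show ?thesis unfolding n_def d_def .
qed

text \<open>The inf-sup condition and the first equation bound the strain of \<open>w\<close> by the norm \<open>n\<close> of \<open>e\<close> plus \<open>\<delta>\<close>. Testing with \<open>e\<close>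
 and \<open>w\<close> then bounds \<open>a(e, e)\<close>, hence the deviator of \<open>e\<close> squared, by \<open>\<delta> (n + \<delta>)\<close>. As \<open>n\<close> is bounded by the deviator
 plus \<open>\<delta>\<close>, a quadratic inequality for \<open>n\<close> results. No constant depends on \<open>lam\<close>.\<close>

lemma stability:
 assumes e: "e : Sigma_PS Om GN T" and w: "w : Vh Om GD T" and f: "f : L2 Om" and g: "g : H1 Om"
  and \<mu>: "\<mu> > 0" and lam: "lam > 0"
  and c0: "c0 > 0" and D: "!!q. q : Wbar Om T ==> EX v:Vh Om GD T. (L2_norm Om q)^2 <= c0 * (LINT x|leb Om. q x * divergence Om v x) \<and>
    (H1_seminorm Om v)^2 <= c0 * (L2_norm Om q)^2"
  and eq1: "!!t. t : Sigma_PS Om GN T ==> form_a Om \<mu> lam e t = form_a Om \<mu> lam f t - strain_pairing Om t g + strain_pairing Om t w"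
  and eq2: "!!y. y : Vh Om GD T ==> strain_pairing Om e y = strain_pairing Om f y"
  and \<delta>: "L2_norm Om f <= \<delta>" "H1_seminorm Om g <= \<delta>"
 defines "k1 \<equiv> 1 + 2 * \<rho> + c0 * sqrt c0 * (2 * \<rho> + 2)"
  and "k3 \<equiv> sqrt (\<rho>^2 * stab * (\<rho>^2 * (1 + c^2)^2)) * (1 / \<mu> + 1)"
 defines "k5 \<equiv> 2 * k1^2 * (2 * \<mu> * (1 / \<mu> + 1 + k3) + 1)"
 shows "L2_norm Om e <= (k5 + 1) * \<delta>" "L2_norm Om (strain Om w) <= k3 * (k5 + 2) * \<delta>"
proof -
 define n d X where "n = L2_norm Om e" and "d = L2_norm Om (%x. dev (e x))" and "X = L2_norm Om (strain Om w)"
 have nn: "n >= 0" "d >= 0" "X >= 0" by (simp_all add: n_def d_def X_def L2_norm_nonneg)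
 have \<delta>0: "\<delta> >= 0" using \<delta>(1) L2_norm_nonneg[of Om f] by linarith
 have eL: "e : L2 Om" using e unfolding Sigma_PS_iff by blast
 have wH: "w : H1 Om" using w by (simp add: Vh_def disp_space_def)
 have yb: "strain_pairing Om e y <= \<delta> * H1_seminorm Om y" if y: "y : Vh Om GD T" for y
 proof -
  have yH: "y : H1 Om" using y by (simp add: Vh_def disp_space_def)
  have "strain_pairing Om e y <= L2_norm Om f * H1_seminorm Om y" unfolding eq2[OF y] using strain_pairing_bounds(2)[OF f yH] by linarith
  also have "... <= \<delta> * H1_seminorm Om y" by (intro mult_right_mono \<delta>(1) H1_norm_bounds)
  finally show ?thesis .
 qed
 have "n <= k1 * (d + \<delta>)" unfolding n_def d_def k1_def by (rule stress_norm_from_deviator[OF e c0 D yb \<delta>0])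
 have k1: "k1 >= 0" unfolding k1_def using rho_pos c0 by simp
 have st: "stab >= 0" by (simp add: stab_def)
 define P S Y where "P = \<rho>^2 * (1 + c^2)^2" and "S = \<rho>^2 * stab" and "Y = 1 / \<mu> * (n + \<delta>) + \<delta>"
 have PSY: "P >= 0" "S >= 0" "Y >= 0" using st nn \<delta>0 \<mu> by (auto simp: P_def S_def Y_def)
 have k3: "k3 = sqrt (S * P) * (1 / \<mu> + 1)" by (simp add: k3_def S_def P_def)
 hence k30: "k3 >= 0" using PSY \<mu> by simp
 obtain t where t: "t : Sigma_PS Om GN T" "(L2_norm Om t)^2 <= P * strain_pairing Om t w" "X^2 <= S * strain_pairing Om t w"
  using discrete_infsup[OF w] unfolding P_def S_def X_def by blast
 have tL: "t : L2 Om" using t(1) unfolding Sigma_PS_iff by blast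
 define m where "m = L2_norm Om t"
 have m0: "m >= 0" by (simp add: m_def L2_norm_nonneg)
 have ae: "\<bar>form_a Om \<mu> lam e s\<bar> <= 1 / \<mu> * (n * L2_norm Om s)" "\<bar>form_a Om \<mu> lam f s\<bar> <= 1 / \<mu> * (\<delta> * L2_norm Om s)"
  "\<bar>strain_pairing Om s g\<bar> <= L2_norm Om s * \<delta>" if s: "s : L2 Om" for s
 proof -
  show "\<bar>form_a Om \<mu> lam e s\<bar> <= 1 / \<mu> * (n * L2_norm Om s)" unfolding n_def by (rule form_a_bound[OF eL s \<mu> lam])
  have "1 / \<mu> * (L2_norm Om f * L2_norm Om s) <= 1 / \<mu> * (\<delta> * L2_norm Om s)"
   using \<mu> by (intro mult_left_mono mult_right_mono \<delta>(1) L2_norm_nonneg) auto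
  thus "\<bar>form_a Om \<mu> lam f s\<bar> <= 1 / \<mu> * (\<delta> * L2_norm Om s)" using form_a_bound[OF f s \<mu> lam] by linarith
  have "L2_norm Om s * H1_seminorm Om g <= L2_norm Om s * \<delta>" by (intro mult_left_mono \<delta>(2) L2_norm_nonneg)
  thus "\<bar>strain_pairing Om s g\<bar> <= L2_norm Om s * \<delta>" using strain_pairing_bounds(2)[OF s g] by linarith
 qed
 have bt: "strain_pairing Om t w <= m * Y"
 proof -
  have "strain_pairing Om t w <= 1 / \<mu> * (n * m) + 1 / \<mu> * (\<delta> * m) + m * \<delta>"
   using ae[OF tL] eq1[OF t(1)] unfolding m_def by linarith
  also have "... = m * Y" by (simp add: Y_def algebra_simps add_divide_distrib)
  finally show ?thesis .
 qed
 have "m * m <= P * strain_pairing Om t w" using t(2) by (simp add: m_def power2_eq_square)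
 also have "... <= P * (m * Y)" by (rule mult_left_mono[OF bt PSY(1)])
 finally have "m * m <= (P * Y) * m" by (simp add: mult_ac)
 hence mY: "m <= P * Y" using m0 PSY by (cases "m = 0") auto
 have "X^2 <= S * (m * Y)" using t(3) mult_left_mono[OF bt PSY(2)] by linarith
 also have "... <= S * ((P * Y) * Y)" by (intro mult_left_mono mult_right_mono mY PSY)
 also have "... = (sqrt (S * P) * Y)^2" using PSY by (simp add: power_mult_distrib power2_eq_square[of Y] mult_ac)
 finally have "X <= sqrt (S * P) * Y" by (rule power2_le_imp_le) (simp add: PSY)
 also have "... <= sqrt (S * P) * ((1 / \<mu> + 1) * (n + \<delta>))" using nn PSY by (intro mult_left_mono) (auto simp: Y_def distrib_right)
 finally have X: "X <= k3 * (n + \<delta>)" by (simp add: k3 mult.assoc)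
 have "form_a Om \<mu> lam e e = form_a Om \<mu> lam f e - strain_pairing Om e g + strain_pairing Om f w" using eq1[OF e] eq2[OF w] by simp
 moreover have "strain_pairing Om f w <= \<delta> * X"
 proof -
  have "L2_norm Om f * X <= \<delta> * X" using nn(3) by (intro mult_right_mono \<delta>(1))
  thus ?thesis using strain_pairing_bounds(1)[OF f wH] unfolding X_def by linarith
 qed
 moreover have "\<delta> * X <= \<delta> * (k3 * (n + \<delta>))" by (rule mult_left_mono[OF X \<delta>0])
 ultimately have "form_a Om \<mu> lam e e <= 1 / \<mu> * (\<delta> * n) + n * \<delta> + \<delta> * (k3 * (n + \<delta>))"
  using ae(2,3)[OF eL] unfolding n_def[symmetric] by linarith
 also have "... <= (1 / \<mu> + 1 + k3) * (\<delta> * (n + \<delta>))"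
 proof -
  have "0 <= 1 / \<mu> * (\<delta> * \<delta>)" "0 <= \<delta> * \<delta>" using \<mu> \<delta>0 by auto
  moreover have "(1 / \<mu> + 1 + k3) * (\<delta> * (n + \<delta>)) = 1 / \<mu> * (\<delta> * n) + n * \<delta> + \<delta> * (k3 * (n + \<delta>)) + 1 / \<mu> * (\<delta> * \<delta>) + \<delta> * \<delta>"
   by (simp add: algebra_simps)
  ultimately show ?thesis by linarith
 qed
 finally have "2 * \<mu> * form_a Om \<mu> lam e e <= 2 * \<mu> * ((1 / \<mu> + 1 + k3) * (\<delta> * (n + \<delta>)))" using \<mu> by (intro mult_left_mono) auto
 hence d2: "d^2 <= 2 * \<mu> * ((1 / \<mu> + 1 + k3) * (\<delta> * (n + \<delta>)))" using form_a_dev[OF eL \<mu> lam] unfolding d_def by linarith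
 have "n^2 <= (k1 * (d + \<delta>))^2" using \<open>n <= k1 * (d + \<delta>)\<close> nn(1) by (rule power_mono)
 also have "... = k1^2 * (d + \<delta>)^2" by (rule power_mult_distrib)
 also have "... <= k1^2 * (2 * (d^2 + \<delta> * (n + \<delta>)))"
 proof (rule mult_left_mono)
  have "0 <= (d - \<delta>)^2" "0 <= \<delta> * n" using \<delta>0 nn by auto
  thus "(d + \<delta>)^2 <= 2 * (d^2 + \<delta> * (n + \<delta>))" by (simp add: power2_eq_square algebra_simps)
 qed simp
 also have "... <= k1^2 * (2 * (2 * \<mu> * ((1 / \<mu> + 1 + k3) * (\<delta> * (n + \<delta>))) + \<delta> * (n + \<delta>)))"
  using d2 by (intro mult_left_mono) auto
 also have "... = k5 * (\<delta> * (n + \<delta>))" unfolding k5_def by (simp add: algebra_simps)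
 finally have q: "n^2 <= k5 * (\<delta> * (n + \<delta>))" .
 have k5: "k5 >= 0" unfolding k5_def using \<mu> k30 by simp
 show n: "L2_norm Om e <= (k5 + 1) * \<delta>" using absorb_quadratic[OF q k5 \<delta>0 nn(1)] unfolding n_def .
 hence "k3 * (n + \<delta>) <= k3 * ((k5 + 1) * \<delta> + \<delta>)" unfolding n_def by (intro mult_left_mono k30) auto
 also have "... = k3 * (k5 + 2) * \<delta>" by (simp add: algebra_simps)
 finally show "L2_norm Om (strain Om w) <= k3 * (k5 + 2) * \<delta>" using X unfolding X_def by linarith
qed

end

section \<open>Symmetric problems on finite-dimensional spaces\<close>

text \<open>Discrete functions are determined only up to null sets, so linear algebra is done on representatives, with \<open>lin c x y\<close>
 meaning \<open>x + c y\<close>. Finite dimension is expressed by finitely many functionals.\<close>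

definition linear_on :: "(real => 'x => 'x => 'x) => 'x set => ('x => real) => bool" where
 "linear_on lin X f \<longleftrightarrow> (ALL x:X. ALL y:X. ALL c. f (lin c x y) = f x + c * f y)"

definition lin_closed :: "(real => 'x => 'x => 'x) => 'x set => bool" where
 "lin_closed lin X \<longleftrightarrow> X ~= {} & (ALL x:X. ALL y:X. ALL c. lin c x y : X)"

lemma linear_onD: "linear_on lin X f ==> x : X ==> y : X ==> f (lin c x y) = f x + c * f y"
 and lin_closedD: "lin_closed lin X ==> x : X ==> y : X ==> lin c x y : X" by (auto simp: linear_on_def lin_closed_def)

lemma linear_on_subset: "linear_on lin X f ==> Y <= X ==> linear_on lin Y f"
 by (auto simp: linear_on_def subset_eq)

lemma lin_closed_kernel:
 assumes "lin_closed lin X" "linear_on lin X f"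
 shows "lin_closed lin {x : X. f x = 0}"
proof -
 obtain x where x: "x : X" using assms(1) by (auto simp: lin_closed_def)
 have "f (lin (-1) x x) = 0" "lin (-1) x x : X" using linear_onD[OF assms(2) x x, of "-1"] lin_closedD[OF assms(1) x x] by auto
 thus ?thesis unfolding lin_closed_def using linear_onD[OF assms(2)] lin_closedD[OF assms(1)] by fastforce
qed

text \<open>\<open>xs\<close> plays the part of a basis modulo the common kernel: each functional contributes at most one element.\<close>

lemma finite_spanning_list:
 assumes "lin_closed lin X" "ALL f:set fs. linear_on lin X f"
 shows "EX xs. set xs <= X & (ALL g. linear_on lin X g --> (ALL x:X. (ALL f:set fs. f x = 0) --> g x = 0) -->
   (ALL x:set xs. g x = 0) --> (ALL x:X. g x = 0))" using assms
proof (induction fs arbitrary: X)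
 case Nil
 show ?case by (rule exI[of _ "[]"]) simp
next
 case (Cons f fs)
 have f: "linear_on lin X f" using Cons.prems(2) by simp
 show ?case
 proof (cases "ALL x:X. f x = 0")
  case True
  obtain xs where "set xs <= X" "ALL g. linear_on lin X g --> (ALL x:X. (ALL f:set fs. f x = 0) --> g x = 0) -->
   (ALL x:set xs. g x = 0) --> (ALL x:X. g x = 0)" using Cons.IH[OF Cons.prems(1)] Cons.prems(2) by auto
  with True show ?thesis by (intro exI[of _ xs]) simp
 next
  case False
  then obtain x0 where x0: "x0 : X" "f x0 ~= 0" by blast
  let ?X = "{x : X. f x = 0}"
  have "ALL h:set fs. linear_on lin ?X h" using Cons.prems(2) by (auto intro: linear_on_subset)
  from Cons.IH[OF lin_closed_kernel[OF Cons.prems(1) f] this] obtain xs where xs: "set xs <= ?X"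
   "!!g. linear_on lin ?X g ==> (ALL x:?X. (ALL f:set fs. f x = 0) --> g x = 0) ==> (ALL x:set xs. g x = 0) ==> ALL x:?X. g x = 0" by blast
  show ?thesis
  proof (intro exI[of _ "x0 # xs"] conjI allI impI)
   show "set (x0 # xs) <= X" using xs(1) x0(1) by auto
   fix g assume g: "linear_on lin X g" "ALL x:X. (ALL f:set (f # fs). f x = 0) --> g x = 0" "ALL x:set (x0 # xs). g x = 0"
   have z: "ALL x:?X. g x = 0" by (rule xs(2)) (use g in \<open>auto intro: linear_on_subset\<close>)
   show "ALL x:X. g x = 0"
   proof
    fix x assume x: "x : X"
    have "lin (- f x / f x0) x x0 : ?X" using lin_closedD[OF Cons.prems(1) x x0(1)] linear_onD[OF f x x0(1)] x0(2) by simp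
    hence "g (lin (- f x / f x0) x x0) = 0" using z by blast
    thus "g x = 0" using linear_onD[OF g(1) x x0(1)] g(3) by simp
   qed
  qed
 qed
qed

text \<open>Represent \<open>l\<close> on the kernel of \<open>B x\<close> and correct by a multiple of \<open>x\<close>.\<close>

lemma functional_representation:
 assumes "lin_closed lin X" "!!y. y : Y ==> linear_on lin X (%x. B x y)"
  and "lin_closed lin Y" "!!x. x : X ==> linear_on lin Y (B x)" "linear_on lin Y l"
  and "set xs <= X" "!!y. y : Y ==> (ALL x:set xs. B x y = 0) ==> l y = 0"
 shows "EX x:X. ALL y:Y. l y = B x y" using assms
proof (induction xs arbitrary: Y)
 case Nil
 obtain x where x: "x : X" using Nil.prems(1) by (auto simp: lin_closed_def)
 have "B (lin (-1) x x) y = 0" if "y : Y" for y using linear_onD[OF Nil.prems(2)[OF that] x x, of "-1"] by simp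
 thus ?case using lin_closedD[OF Nil.prems(1) x x, of "-1"] Nil.prems(7) by (intro bexI[of _ "lin (-1) x x"]) auto
next
 case (Cons x xs)
 let ?Y = "{y : Y. B x y = 0}"
 have x: "x : X" using Cons.prems(6) by simp
 note B = Cons.prems(4)[OF x]
 have "EX x':X. ALL y:?Y. l y = B x' y"
 proof (rule Cons.IH[OF Cons.prems(1) _ lin_closed_kernel[OF Cons.prems(3) B]])
  show "linear_on lin X (%x. B x y)" if "y : ?Y" for y using that Cons.prems(2) by simp
  show "linear_on lin ?Y (B x')" if "x' : X" for x' using Cons.prems(4)[OF that] by (rule linear_on_subset) auto
  show "linear_on lin ?Y l" using Cons.prems(5) by (rule linear_on_subset) auto
  show "set xs <= X" using Cons.prems(6) by simp
  show "l y = 0" if "y : ?Y" "ALL x:set xs. B x y = 0" for y using that by (intro Cons.prems(7)) auto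
 qed
 then obtain x' where x': "x' : X" "!!y. y : ?Y ==> l y = B x' y" by blast
 show ?case
 proof (cases "ALL y:Y. B x y = 0")
  case True then show ?thesis using x' by auto
 next
  case False
  then obtain y0 where y0: "y0 : Y" "B x y0 ~= 0" by blast
  define c where "c = (l y0 - B x' y0) / B x y0"
  have "l y = B (lin c x' x) y" if y: "y : Y" for y
  proof -
   let ?y = "lin (- B x y / B x y0) y y0"
   have "?y : ?Y" using lin_closedD[OF Cons.prems(3) y y0(1)] linear_onD[OF B y y0(1)] y0(2) by simp
   hence "l ?y = B x' ?y" by (rule x'(2))
   hence "l y - B x y / B x y0 * l y0 = B x' y - B x y / B x y0 * B x' y0"
    using linear_onD[OF Cons.prems(5) y y0(1)] linear_onD[OF Cons.prems(4)[OF x'(1)] y y0(1)] by simp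
   hence "l y = B x' y + c * B x y" unfolding c_def by (simp add: diff_divide_distrib algebra_simps)
   thus ?thesis using linear_onD[OF Cons.prems(2)[OF y] x'(1) x] by simp
  qed
  thus ?thesis using lin_closedD[OF Cons.prems(1) x'(1) x] by blast
 qed
qed

text \<open>In finite dimension a functional that vanishes on the radical of a symmetric form is in its range.\<close>

lemma symmetric_problem_solvable:
 assumes X: "lin_closed lin X" and B: "!!x. x : X ==> linear_on lin X (B x)" and sym: "!!x y. B x y = B y x"
  and l: "linear_on lin X l" and fs: "finite fs" "!!f. f : fs ==> linear_on lin X f"
  and ker: "!!x y. x : X ==> y : X ==> (!!f. f : fs ==> f x = 0) ==> B x y = 0"
  and rad: "!!x. x : X ==> (!!y. y : X ==> B x y = 0) ==> l x = 0"
 shows "EX x:X. ALL y:X. l y = B x y"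
proof -
 obtain fl where fl: "set fl = fs" using finite_list[OF fs(1)] by blast
 have "ALL f:set fl. linear_on lin X f" using fs(2) fl by blast
 from finite_spanning_list[OF X this] obtain xs where xs: "set xs <= X" "!!g. linear_on lin X g ==>
   (ALL x:X. (ALL f:set fl. f x = 0) --> g x = 0) ==> (ALL x:set xs. g x = 0) ==> ALL x:X. g x = 0" by blast
 have Bl: "linear_on lin X (%x. B x y)" if "y : X" for y unfolding sym[of _ y] by (rule B[OF that])
 show ?thesis
 proof (rule functional_representation[OF X Bl X B l xs(1)])
  fix y assume y: "y : X" "ALL x:set xs. B x y = 0"
  have "ALL x:X. B x y = 0" by (rule xs(2)[OF Bl[OF y(1)] _ y(2)]) (use ker y(1) fl in blast)
  thus "l y = 0" using sym by (intro rad[OF y(1)]) simp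
 qed
qed

context shape_regular_mesh
begin

section \<open>Discrete functions are determined by finitely many moments\<close>

lemma Sigma_PS_lincomb:
 assumes "\<sigma> : Sigma_PS Om GN T" "\<tau> : Sigma_PS Om GN T"
 shows "(%x. a *R \<sigma> x + b *R \<tau> x) : Sigma_PS Om GN T" unfolding Sigma_PS_iff
proof (intro conjI ballI)
 show "(%x. a *R \<sigma> x + b *R \<tau> x) : L2 Om" using assms unfolding Sigma_PS_iff by (intro L2_add L2_scaleR) auto
 fix K assume K: "K : T"
 obtain p where p: "ps_mode K p" "AE z in RS. \<sigma> (bilinear_map K z) = p z" using assms(1) K unfolding Sigma_PS_iff by blast
 obtain q where q: "ps_mode K q" "AE z in RS. \<tau> (bilinear_map K z) = q z" using assms(2) K unfolding Sigma_PS_iff by blast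
 obtain P s t where P: "transpose P = P" "p = aff P (s *R shape_xi K) (t *R shape_eta K)" using p(1) unfolding ps_mode_def by blast
 obtain Q s' t' where Q: "transpose Q = Q" "q = aff Q (s' *R shape_xi K) (t' *R shape_eta K)" using q(1) unfolding ps_mode_def by blast
 have "transpose (a *R P + b *R Q) = a *R P + b *R Q" using P(1) Q(1) unfolding transpose_mat2 by simp
 moreover have "(%z. a *R p z + b *R q z) = aff (a *R P + b *R Q) ((a * s + b * s') *R shape_xi K) ((a * t + b * t') *R shape_eta K)"
  unfolding P Q by (simp add: fun_eq_iff aff_def algebra_simps)
 ultimately have "ps_mode K (%z. a *R p z + b *R q z)" unfolding ps_mode_def by blast
 moreover have "AE z in RS. a *R \<sigma> (bilinear_map K z) + b *R \<tau> (bilinear_map K z) = a *R p z + b *R q z"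
  using p(2) q(2) by eventually_elim simp
 ultimately show "EX p. ps_mode K p & (AE z in RS. a *R \<sigma> (bilinear_map K z) + b *R \<tau> (bilinear_map K z) = p z)" by blast
qed

lemma Vh_lincomb:
 assumes "v : Vh Om GD T" "w : Vh Om GD T"
 shows "(%x. a *R v x + b *R w x) : Vh Om GD T" unfolding Vh_def mem_Collect_eq
proof (intro conjI ballI)
 show "(%x. a *R v x + b *R w x) : disp_space Om GD" using assms by (intro disp_space_lincomb df(1,4)) (auto simp: Vh_def)
 fix K assume K: "K : T"
 obtain c0 c1 c2 c3 where c: "AE z in RS. v (bilinear_map K z) = c0 + z$1 *R c1 + z$2 *R c2 + (z$1 * z$2) *R c3"
  using assms(1) K unfolding Vh_def by blast
 obtain d0 d1 d2 d3 where d: "AE z in RS. w (bilinear_map K z) = d0 + z$1 *R d1 + z$2 *R d2 + (z$1 * z$2) *R d3"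
  using assms(2) K unfolding Vh_def by blast
 have "AE z in RS. a *R v (bilinear_map K z) + b *R w (bilinear_map K z) = (a *R c0 + b *R d0) + z$1 *R (a *R c1 + b *R d1)
   + z$2 *R (a *R c2 + b *R d2) + (z$1 * z$2) *R (a *R c3 + b *R d3)" using c d by eventually_elim (simp add: algebra_simps)
 thus "EX c0 c1 c2 c12. AE z in RS. a *R v (bilinear_map K z) + b *R w (bilinear_map K z) =
   c0 + z$1 *R c1 + z$2 *R c2 + (z$1 * z$2) *R c12" by blast
qed

definition cell_monomial :: "quad => nat => nat => real^2 => real" where
 "cell_monomial K i j = piecewise T (%L z. if L = K then z$1 ^ i * z$2 ^ j else 0)"

lemma cell_monomial_L2: "cell_monomial K i j : L2 Om"
 unfolding cell_monomial_def
proof (rule piecewise_L2[OF dom mesh])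
 show "cont (%z :: real^2. if L = K then z$1 ^ i * z$2 ^ j else 0)" for L by (cases "L = K") (auto intro!: continuous_intros)
qed

text \<open>Some combination of the moments is the integral of \<open>h\<^sup>2\<close>.\<close>

lemma zero_of_moments:
 fixes h :: "real^2 => real"
 assumes h: "h : L2 Om"
  and poly: "!!K. K : T ==> EX c0 c1 c2 c12. AE z in RS. h (bilinear_map K z) = c0 + z$1 * c1 + z$2 * c2 + z$1 * z$2 * c12"
  and mom: "!!K i j. K : T ==> i : {0, 1} ==> j : {0, 1} ==> (LINT x|leb Om. cell_monomial K i j x * h x) = 0"
 shows "AE x in leb Om. h x = 0"
proof -
 have "ALL K:T. EX c :: nat => nat => real. AE z in RS. h (bilinear_map K z) = (\<Sum>i\<in>{0, 1}. \<Sum>j\<in>{0, 1}. c i j * (z$1 ^ i * z$2 ^ j))"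
 proof
  fix K assume "K : T"
  from poly[OF this] obtain c0 c1 c2 c12 where c: "AE z in RS. h (bilinear_map K z) = c0 + z$1 * c1 + z$2 * c2 + z$1 * z$2 * c12" by blast
  show "EX c :: nat => nat => real. AE z in RS. h (bilinear_map K z) = (\<Sum>i\<in>{0, 1}. \<Sum>j\<in>{0, 1}. c i j * (z$1 ^ i * z$2 ^ j))"
   by (rule exI[of _ "%i j. if i = 0 then if j = 0 then c0 else c2 else if j = 0 then c1 else c12"], use c in eventually_elim) (simp add: mult_ac)
 qed
 from bchoice[OF this] obtain c :: "quad => nat => nat => real" where
  c: "!!K. K : T ==> AE z in RS. h (bilinear_map K z) = (\<Sum>i\<in>{0, 1}. \<Sum>j\<in>{0, 1}. c K i j * (z$1 ^ i * z$2 ^ j))" by blast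
 define H where "H x = (\<Sum>L\<in>T. \<Sum>i\<in>{0, 1}. \<Sum>j\<in>{0, 1}. c L i j * cell_monomial L i j x)" for x
 have eq: "AE x in leb Om. h x = H x" unfolding mesh_AE[OF dom mesh]
 proof
  fix K assume K: "K : T"
  have "AE z in RS. cell_monomial L i j (bilinear_map K z) = (if K = L then z$1 ^ i * z$2 ^ j else 0)" for L i j
   unfolding cell_monomial_def by (rule piecewise_AE[OF mesh K])
  hence "AE z in RS. ALL L:T. ALL i:{0, 1}. ALL j:{0, 1}. cell_monomial L i j (bilinear_map K z) = (if K = L then z$1 ^ i * z$2 ^ j else 0)"
   by (intro AE_finite_allI mf(1)) auto
  thus "AE z in RS. h (bilinear_map K z) = H (bilinear_map K z)" using c[OF K]
  proof eventually_elim
   case (elim z)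
   have "H (bilinear_map K z) = (\<Sum>L\<in>T. if K = L then \<Sum>i\<in>{0, 1}. \<Sum>j\<in>{0, 1}. c L i j * (z$1 ^ i * z$2 ^ j) else 0)"
    unfolding H_def using elim(1) by (intro sum.cong) auto
   also have "... = h (bilinear_map K z)" using K mf(1) elim(2) by simp
   finally show ?case ..
  qed
 qed
 have i: "integrable (leb Om) (%x. cell_monomial L i j x * h x)" for L i j using L2_inner_integrable[OF cell_monomial_L2 h] by simp
 have Hh: "H x * h x = (\<Sum>L\<in>T. \<Sum>i\<in>{0, 1}. \<Sum>j\<in>{0, 1}. c L i j * (cell_monomial L i j x * h x))" for x
  unfolding H_def sum_distrib_right mult.assoc ..
 have "(L2_norm Om h)^2 = (LINT x|leb Om. H x * h x)" unfolding L2_norm_power2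
 proof (rule integral_cong_AE)
  show "AE x in leb Om. (norm (h x))^2 = H x * h x" using eq by eventually_elim (simp add: power2_eq_square)
  show "(%x. H x * h x) : borel_measurable (leb Om)"
   unfolding Hh by (intro borel_measurable_sum borel_measurable_times borel_measurable_const borel_measurable_integrable[OF i])
 qed (rule borel_measurable_integrable[OF L2_integrable[OF h]])
 also have "... = (\<Sum>L\<in>T. \<Sum>i\<in>{0, 1}. \<Sum>j\<in>{0, 1}. c L i j * (LINT x|leb Om. cell_monomial L i j x * h x))"
  unfolding Hh using i by (simp add: lint_sum)
 also have "... = 0" using mom by (intro sum.neutral ballI) simp
 finally show ?thesis using L2_norm_eq_0[OF h] by simp
qed

end

section \<open>Existence, uniqueness and quasi-optimality\<close>

lemma H1_seminorm_AE_zero: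
 assumes O: "open Om" "bounded Om" and v: "v : H1 Om" "AE x in leb Om. v x = 0"
 shows "H1_seminorm Om v = 0" "H1_norm Om v = 0"
proof -
 have z: "has_weak_gradient Om (%x. 0) (%x. 0)" using has_weak_gradient_scaleR[OF H1_weak_grad[OF v(1)], of 0] by simp
 have "AE x in leb Om. weak_grad Om v x = 0" by (rule has_weak_gradient_unique[OF O H1_weak_grad[OF v(1)] z]) (use v(2) in simp)
 hence "H1_seminorm Om v = L2_norm Om (%x. 0 :: real^2^2)" unfolding H1_seminorm_def by (intro L2_norm_cong_AE weak_grad_L2 v L2_zero)
 moreover have "L2_norm Om v = L2_norm Om (%x. 0 :: real^2)" by (intro L2_norm_cong_AE H1_L2 v L2_zero)
 ultimately show "H1_seminorm Om v = 0" "H1_norm Om v = 0" by (simp_all add: H1_norm_def L2_norm_def)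
qed

lemmas form_a_diff = form_a_lincomb[where a=1 and b="-1", simplified]
lemmas strain_pairing_diff = strain_pairing_lincomb[where a=1 and b="-1", simplified]
lemmas strain_pairing_diff_right = strain_pairing_lincomb_right[where a=1 and b="-1", simplified]

lemma le_cINF_add:
 fixes f :: "'a => real" and g :: "'b => real"
 assumes "A ~= {}" "B ~= {}" "C > 0" "!!s t. s : A ==> t : B ==> X <= C * (f s + g t)"
 shows "X <= C * ((INF s\<in>A. f s) + (INF t\<in>B. g t))"
proof -
 have "X / C <= f s + g t" if "s : A" "t : B" for s t using assms(4)[OF that] assms(3) by (simp add: divide_le_eq mult.commute)
 hence "X / C - g t <= f s" if "s : A" "t : B" for s t using that by (simp add: diff_le_eq)
 hence "X / C - g t <= (INF s\<in>A. f s)" if "t : B" for t using that assms(1) by (intro cINF_greatest)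
 hence "X / C - (INF s\<in>A. f s) <= g t" if "t : B" for t using that by (simp add: diff_le_eq add.commute)
 hence "X / C - (INF s\<in>A. f s) <= (INF t\<in>B. g t)" using assms(2) by (intro cINF_greatest)
 hence "X / C <= (INF s\<in>A. f s) + (INF t\<in>B. g t)" by simp
 thus ?thesis using assms(3) by (simp add: divide_le_eq mult.commute)
qed

text \<open>Test with \<open>\<psi> I\<close>, where \<open>\<psi>\<close> is the difference of the two sides up to a factor, to get \<open>\<integral> \<psi>\<^sup>2 = 0\<close>.\<close>

lemma trace_stress_divergence:
 assumes Om: "Om : sets lebesgue" and \<sigma>: "\<sigma> : L2 Om" and u: "u : H1 Om" and pos: "\<mu> > 0" "lam > 0"
  and eq: "!!\<tau>. \<tau> : L2 Om ==> (AE x in leb Om. transpose (\<tau> x) = \<tau> x) ==> form_a Om \<mu> lam \<sigma> \<tau> - strain_pairing Om \<tau> u = 0"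
 shows "AE x in leb Om. - (\<mu> + lam) * divergence Om u x = - (1/2) * trace (\<sigma> x)"
proof -
 define \<psi> where "\<psi> x = (1 / (2 * (\<mu> + lam))) *R trace (\<sigma> x) - divergence Om u x" for x
 note tL = L2_bounded_linear[OF bounded_linear_trace \<sigma>] and dL = divergence_L2[OF u]
 have \<psi>: "\<psi> : L2 Om" unfolding \<psi>_def[abs_def] by (intro L2_diff L2_scaleR tL dL)
 define \<tau> :: "real^2 => real^2^2" where "\<tau> x = \<psi> x *R mat 1" for x
 have \<tau>L: "\<tau> : L2 Om" unfolding \<tau>_def[abs_def] by (rule L2_bounded_linear[OF bounded_linear_scaleR_left \<psi>])
 have I: "A \<bullet> (r *R mat 1) = r * trace A" "trace (r *R mat 1 :: real^2^2) = 2 * r" for A :: "real^2^2" and r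
  by (simp_all add: inner_vec_def trace_def sum_2 mat_def algebra_simps)
 have i: "integrable (leb Om) (%x. trace (\<sigma> x) * \<psi> x)" "integrable (leb Om) (%x. divergence Om u x * \<psi> x)"
  using L2_inner_integrable[OF tL \<psi>] L2_inner_integrable[OF dL \<psi>] by auto
 have sq: "(norm (\<psi> x))^2 = 1 / (2 * (\<mu> + lam)) * (trace (\<sigma> x) * \<psi> x) - divergence Om u x * \<psi> x" for x
 proof -
  have "(norm (\<psi> x))^2 = (1 / (2 * (\<mu> + lam)) * trace (\<sigma> x) - divergence Om u x) * \<psi> x"
   by (simp add: power2_eq_square \<psi>_def)
  thus ?thesis by (simp only: left_diff_distrib mult.assoc)
 qed
 have "form_a Om \<mu> lam \<sigma> \<tau> = 1 / (2 * (\<mu> + lam)) * (LINT x|leb Om. trace (\<sigma> x) * \<psi> x)"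
 proof -
  have "\<sigma> x \<bullet> \<tau> x = trace (\<sigma> x) * \<psi> x" "trace (\<sigma> x) * trace (\<tau> x) = 2 * (trace (\<sigma> x) * \<psi> x)" for x unfolding \<tau>_def I by simp_all
  hence "form_a Om \<mu> lam \<sigma> \<tau> = 1 / (2 * \<mu>) * ((LINT x|leb Om. trace (\<sigma> x) * \<psi> x) - lam / (2 * (\<mu> + lam)) * (2 * (LINT x|leb Om. trace (\<sigma> x) * \<psi> x)))"
   unfolding form_a_eq[OF \<sigma> \<tau>L] by (simp only: integral_mult_right_zero)
  also have "... = 1 / (2 * (\<mu> + lam)) * (LINT x|leb Om. trace (\<sigma> x) * \<psi> x)"
   using pos by (simp add: divide_simps) (simp add: algebra_simps)
  finally show ?thesis .
 qed
 moreover have "strain_pairing Om \<tau> u = (LINT x|leb Om. divergence Om u x * \<psi> x)"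
  unfolding strain_pairing_def \<tau>_def inner_commute[of "_ *R mat 1"] I trace_strain by (simp add: mult.commute)
 moreover have "form_a Om \<mu> lam \<sigma> \<tau> - strain_pairing Om \<tau> u = 0"
  by (rule eq[OF \<tau>L]) (simp add: \<tau>_def transpose_mat2 mat_def)
 ultimately have "(L2_norm Om \<psi>)^2 = 0" unfolding L2_norm_power2 sq using i by simp
 hence "AE x in leb Om. \<psi> x = 0" using L2_norm_eq_0[OF \<psi>] by simp
 thus ?thesis
 proof eventually_elim
  case (elim x)
  thus ?case using pos by (simp add: \<psi>_def field_simps)
 qed
qed

locale ps_discretization = shape_regular_mesh +
 fixes GD :: "(real^2) set" and \<mu> lam c0 CK :: real
 assumes mu: "\<mu> > 0" and lam: "lam > 0" and c0: "c0 > 0" and CK: "CK > 0"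
  and korn: "!!v. v : disp_space Om GD ==> H1_norm Om v <= CK * L2_norm Om (strain Om v)"
  and infsup_div: "!!q. q : Wbar Om T ==> EX v:Vh Om GD T. (L2_norm Om q)^2 <= c0 * (LINT x|leb Om. q x * divergence Om v x) \<and>
    (H1_seminorm Om v)^2 <= c0 * (L2_norm Om q)^2"
begin

abbreviation "S \<equiv> Sigma_PS Om GN T"
abbreviation "W \<equiv> Vh Om GD T"
abbreviation "a \<equiv> form_a Om \<mu> lam"
abbreviation "b \<equiv> strain_pairing Om"

lemma S_L2: "\<tau> : S ==> \<tau> : L2 Om" and S_stress: "\<tau> : S ==> \<tau> : stress_space Om GN"
 by (simp_all add: Sigma_PS_def stress_space_def)

lemma W_V: "v : W ==> v : disp_space Om GD" and V_H1: "v : disp_space Om GD ==> v : H1 Om"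
 by (simp_all add: Vh_def disp_space_def)

lemma W_H1: "v : W ==> v : H1 Om" by (intro V_H1 W_V)

lemma zero_S: "(%x. 0) : S"
 unfolding Sigma_PS_iff
proof (intro conjI ballI)
 show "EX p. ps_mode K p & (AE z in RS. 0 = p z)" for K by (intro exI[of _ "aff 0 (0 *R shape_xi K) (0 *R shape_eta K)"] conjI)
   (auto simp: ps_mode_def aff_def transpose_mat2 intro!: exI[of _ 0] exI[of _ "0 :: real^2^2"])
qed (rule L2_zero)

lemma zero_W: "(%x. 0) : W"
 unfolding Vh_def mem_Collect_eq using zero_disp_space[OF df(1,4), of GD] by (intro conjI ballI exI[of _ 0]) auto

definition "k1 = 1 + 2 * \<rho> + c0 * sqrt c0 * (2 * \<rho> + 2)"
definition "k3 = sqrt (\<rho>^2 * stab * (\<rho>^2 * (1 + c^2)^2)) * (1 / \<mu> + 1)"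
definition "k5 = 2 * k1^2 * (2 * \<mu> * (1 / \<mu> + 1 + k3) + 1)"

lemma discrete_stability:
 assumes e: "e : S" and w: "w : W" and f: "f : L2 Om" and g: "g : H1 Om"
  and eq1: "!!t. t : S ==> a e t = a f t - b t g + b t w" and eq2: "!!y. y : W ==> b e y = b f y"
  and \<delta>: "L2_norm Om f <= \<delta>" "H1_seminorm Om g <= \<delta>"
 shows "L2_norm Om e <= (k5 + 1) * \<delta>" "H1_norm Om w <= CK * (k3 * (k5 + 2)) * \<delta>"
proof -
 note st = stability[OF e w f g mu lam c0 infsup_div eq1 eq2 \<delta>, folded k1_def k3_def, folded k5_def]
 show "L2_norm Om e <= (k5 + 1) * \<delta>" by (rule st(1))
 have "CK * L2_norm Om (strain Om w) <= CK * (k3 * (k5 + 2) * \<delta>)" using CK by (intro mult_left_mono st(2)) auto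
 thus "H1_norm Om w <= CK * (k3 * (k5 + 2)) * \<delta>" using korn[OF W_V[OF w]] by (simp add: mult.assoc)
qed

lemma discrete_unique:
 assumes e: "e : S" and w: "w : W" and eq1: "!!t. t : S ==> a e t = b t w" and eq2: "!!y. y : W ==> b e y = 0"
 shows "L2_norm Om e = 0" "H1_norm Om w = 0"
proof -
 have z: "b t (%x. 0) = 0" "a (%x. 0) t = 0" "b (%x. 0) y = 0" if "t : L2 Om" for t y
 proof -
  have "AE x in leb Om. strain Om (%x. 0) x = 0" using strain_lincomb[OF df(1,4) W_H1[OF w] W_H1[OF w], of 0 0] by simp
  hence "b t (%x. 0) = (LINT x|leb Om. 0)" unfolding strain_pairing_def using L2_inner_integrable[OF that strain_L2[OF W_H1[OF zero_W]]]
   by (intro integral_cong_AE) (auto elim: eventually_mono)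
  thus "b t (%x. 0) = 0" by simp
 qed (simp_all add: form_a_def strain_pairing_def trace_def)
 have s: "H1_seminorm Om (%x. 0) <= 0" using H1_seminorm_AE_zero(1)[OF df(1,4) W_H1[OF zero_W]] by simp
 have p: "a e t = a (%x. 0) t - b t (%x. 0) + b t w" if "t : S" for t using eq1[OF that] z[OF S_L2[OF that]] by simp
 have p': "b e y = b (%x. 0) y" if "y : W" for y using eq2[OF that] z(3)[OF L2_zero] by simp
 have "L2_norm Om (%x. 0 :: real^2^2) <= 0" by (simp add: L2_norm_def)
 note discrete_stability[OF e w L2_zero W_H1[OF zero_W] p p' this s]
 thus "L2_norm Om e = 0" "H1_norm Om w = 0" using L2_norm_nonneg[of Om e] H1_norm_bounds(4)[of Om w] by auto
qed

text \<open>\<open>B\<close> is the mixed form with the sign of the second equation reversed to make it symmetric. Its radical consists of null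
 functions by \<open>discrete_unique\<close>, and there \<open>F\<close> vanishes because it is bounded.\<close>

lemma discrete_exists:
 assumes F: "bounded_functional_on Om (disp_space Om GD) F"
 shows "EX \<sigma>h uh. mixed_solution Om \<mu> lam F S W \<sigma>h uh"
proof -
 from F obtain B0 where F1: "!!u v. u : disp_space Om GD ==> v : disp_space Om GD ==> F (%x. u x + v x) = F u + F v"
  and F2: "!!r v. v : disp_space Om GD ==> F (%x. r *R v x) = r * F v"
  and F3: "!!v. v : disp_space Om GD ==> \<bar>F v\<bar> <= B0 * H1_norm Om v" unfolding bounded_functional_on_def by blast
 define lin where "lin r p q = ((%x. 1 *R fst p x + r *R fst q x), (%x. 1 *R snd p x + r *R snd q x))"
  for r and p q :: "(real^2 => real^2^2) \<times> (real^2 => real^2)"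
 define B where "B p q = a (fst p) (fst q) - b (fst q) (snd p) - b (fst p) (snd q)" for p q
 define l where "l q = - F (snd q)" for q :: "(real^2 => real^2^2) \<times> (real^2 => real^2)"
 define comps :: "((real^2 => real^2^2) \<times> (real^2 => real^2) => real^2 => real) set"
  where "comps = range (%(i, j) q x. fst q x $ i $ j) \<union> range (%i q x. snd q x $ i)"
 \<comment> \<open>the four bilinear moments of every component on every element\<close>
 define fs where "fs = (%(K, m, n, k) q. LINT x|leb Om. cell_monomial K m n x * k q x) ` (T \<times> {0, 1} \<times> {0, 1} \<times> comps)"
 have "EX x:S \<times> W. ALL y:S \<times> W. l y = B x y"
 proof (rule symmetric_problem_solvable[where lin=lin and fs=fs])
  show "lin_closed lin (S \<times> W)" unfolding lin_closed_def
  proof (intro conjI ballI allI)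
   show "lin r x y : S \<times> W" if "x : S \<times> W" "y : S \<times> W" for x y r
    unfolding lin_def using that Sigma_PS_lincomb[of "fst x" "fst y" 1 r] Vh_lincomb[of "snd x" GD "snd y" 1 r] by auto
  qed (use zero_S zero_W in auto)
  show "linear_on lin (S \<times> W) (B p)" if "p : S \<times> W" for p
  proof -
   have p: "fst p : L2 Om" "snd p : H1 Om" using that S_L2 W_H1 by auto
   show ?thesis unfolding linear_on_def
   proof (intro ballI allI)
    fix x y r assume xy: "x : S \<times> W" "y : S \<times> W"
    hence L: "fst x : L2 Om" "snd x : H1 Om" "fst y : L2 Om" "snd y : H1 Om" using S_L2 W_H1 by auto
    show "B p (lin r x y) = B p x + r * B p y"
     unfolding B_def lin_def fst_conv snd_conv form_a_commute[of Om \<mu> lam "fst p"] form_a_lincomb[OF L(1,3) p(1)]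
      strain_pairing_lincomb[OF L(1,3) p(2)] strain_pairing_lincomb_right[OF df(1,4) p(1) L(2,4)] by (simp add: algebra_simps)
   qed
  qed
  show "B x y = B y x" for x y unfolding B_def form_a_commute[of Om \<mu> lam "fst x"] by simp
  show "linear_on lin (S \<times> W) l" unfolding linear_on_def
  proof (intro ballI allI)
   fix x y r assume "x : S \<times> W" "y : S \<times> W"
   hence V: "snd x : disp_space Om GD" "snd y : disp_space Om GD" using W_V by auto
   have "(%x. r *R snd y x) : disp_space Om GD" using disp_space_lincomb[OF df(1,4) V(2,2), of r 0] by simp
   thus "l (lin r x y) = l x + r * l y" unfolding l_def lin_def using F1[OF V(1)] F2[OF V(2)] by simp
  qed
  show "finite fs" unfolding fs_def comps_def using mf(1) by (intro finite_UnI finite_imageI finite_cartesian_product) auto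
  have i: "integrable (leb Om) (%x. cell_monomial K m n x * h x)" if "h : L2 Om" for K m n h
   using L2_inner_integrable[OF cell_monomial_L2 that] by simp
  show "linear_on lin (S \<times> W) f" if ff: "f : fs" for f unfolding linear_on_def
  proof (intro ballI allI)
   fix x y r assume xy: "x : S \<times> W" "y : S \<times> W"
   obtain K m n k where f: "f = (%q. LINT x|leb Om. cell_monomial K m n x * k q x)" and k: "k : comps"
   proof -
    from ff obtain t where t: "f = (%(K, m, n, k) q. LINT x|leb Om. cell_monomial K m n x * k q x) t" "t : T \<times> {0, 1} \<times> {0, 1} \<times> comps"
     unfolding fs_def by (rule imageE)
    thus thesis using that by (cases t) simp
   qed
   have L: "k x : L2 Om" "k y : L2 Om" using xy k S_L2 W_H1[THEN H1_L2] by (auto simp: comps_def intro!: L2_component)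
   have "k (lin r x y) z = k x z + r * k y z" for z using k by (auto simp: comps_def lin_def)
   thus "f (lin r x y) = f x + r * f y" using i[OF L(1)] i[OF L(2)] unfolding f by (simp add: distrib_left mult.left_commute[of _ r])
  qed
  show "B x y = 0" if xy: "x : S \<times> W" "y : S \<times> W" and z: "!!f. f : fs ==> f x = 0" for x y
  proof -
   obtain \<tau> v where x: "x = (\<tau>, v)" "\<tau> : S" "v : W" using xy(1) by auto
   have AE0: "AE z in leb Om. k x z = 0" if k: "k : comps" for k
   proof (rule zero_of_moments)
    show "k x : L2 Om" using k x S_L2 W_H1[THEN H1_L2] by (auto simp: comps_def intro!: L2_component)
    show "(LINT z|leb Om. cell_monomial K m n z * k x z) = 0" if "K : T" "m : {0, 1}" "n : {0, 1}" for K m n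
    proof -
     have "(%q. LINT z|leb Om. cell_monomial K m n z * k q z) : fs" unfolding fs_def by (rule image_eqI[of _ _ "(K, m, n, k)"]) (use that k in auto)
     thus ?thesis by (rule z)
    qed
    fix K assume K: "K : T"
    obtain p where p: "ps_mode K p" "AE z in RS. \<tau> (bilinear_map K z) = p z" using x(2) K unfolding Sigma_PS_iff by blast
    obtain P s t where P: "p = aff P (s *R shape_xi K) (t *R shape_eta K)" using p(1) unfolding ps_mode_def by blast
    obtain d0 d1 d2 d3 where d: "AE z in RS. v (bilinear_map K z) = d0 + z$1 *R d1 + z$2 *R d2 + (z$1 * z$2) *R d3"
     using x(3) K unfolding Vh_def by blast
    have "AE z in RS. \<tau> (bilinear_map K z) $ i $ j = P $ i $ j + z$1 * (s *R shape_xi K) $ i $ j + z$2 * (t *R shape_eta K) $ i $ j + z$1 * z$2 * 0" for i j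
     using p(2) by eventually_elim (simp add: P aff_def)
    hence "EX c0 c1 c2 c12. AE z in RS. \<tau> (bilinear_map K z) $ i $ j = c0 + z$1 * c1 + z$2 * c2 + z$1 * z$2 * c12" for i j by blast
    moreover have "AE z in RS. v (bilinear_map K z) $ i = d0 $ i + z$1 * d1 $ i + z$2 * d2 $ i + z$1 * z$2 * d3 $ i" for i
     using d by eventually_elim simp
    hence "EX c0 c1 c2 c12. AE z in RS. v (bilinear_map K z) $ i = c0 + z$1 * c1 + z$2 * c2 + z$1 * z$2 * c12" for i by blast
    ultimately show "EX c0 c1 c2 c12. AE z in RS. k x (bilinear_map K z) = c0 + z$1 * c1 + z$2 * c2 + z$1 * z$2 * c12"
     using k unfolding comps_def x by auto
   qed
   have "AE z in leb Om. \<tau> z $ i $ j = 0" "AE z in leb Om. v z $ i = 0" for i j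
   proof -
    have "(%q x. fst q x $ i $ j) : comps" unfolding comps_def by (rule UnI1, rule image_eqI[of _ _ "(i, j)"]) simp_all
    from AE0[OF this] show "AE z in leb Om. \<tau> z $ i $ j = 0" by (simp add: x)
    have "(%q x. snd q x $ i) : comps" unfolding comps_def by (rule UnI2) (rule rangeI)
    from AE0[OF this] show "AE z in leb Om. v z $ i = 0" by (simp add: x)
   qed
   hence "AE x in leb Om. (ALL i j. \<tau> x $ i $ j = 0) & (ALL i. v x $ i = 0)" by (simp add: AE_all_countable)
   hence AEt: "AE x in leb Om. \<tau> x = 0" and AEv: "AE x in leb Om. v x = 0" by (auto elim!: eventually_mono simp: vec_eq_iff)
   from AEt have "L2_norm Om \<tau> = L2_norm Om (%x. 0 :: real^2^2)" by (intro L2_norm_cong_AE S_L2 x L2_zero)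
   hence \<tau>0: "L2_norm Om \<tau> = 0" by (simp add: L2_norm_def)
   from AEv have v0: "H1_seminorm Om v = 0" by (rule H1_seminorm_AE_zero(1)[OF df(1,4) W_H1[OF x(3)]])
   have y: "fst y : L2 Om" "snd y : H1 Om" using xy(2) S_L2 W_H1 by auto
   have "a \<tau> (fst y) = 0" "b \<tau> (snd y) = 0" "b (fst y) v = 0"
    using form_a_bound[OF S_L2[OF x(2)] y(1) mu lam] strain_pairing_bounds(2)[OF S_L2[OF x(2)] y(2)]
     strain_pairing_bounds(2)[OF y(1) W_H1[OF x(3)]] \<tau>0 v0 by auto
   thus ?thesis by (simp add: B_def x)
  qed
  show "l x = 0" if x: "x : S \<times> W" and z: "!!y. y : S \<times> W ==> B x y = 0" for x
  proof -
   have xx: "fst x : S" "snd x : W" using x by auto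
   have b0: "b (fst x) (%x. 0) = 0" using strain_pairing_lincomb_right[OF df(1,4) S_L2[OF xx(1)] W_H1[OF xx(2)] W_H1[OF xx(2)], of 0 0] by simp
   have "a (fst x) t = b t (snd x)" if "t : S" for t using z[of "(t, %x. 0)"] zero_W that b0 by (simp add: B_def)
   moreover have "b (fst x) y = 0" if "y : W" for y using z[of "(%x. 0, y)"] zero_S that by (simp add: B_def form_a_def strain_pairing_def trace_def)
   ultimately have "H1_norm Om (snd x) = 0" by (intro discrete_unique(2)[OF xx])
   thus "l x = 0" using F3[OF W_V[OF xx(2)]] by (simp add: l_def)
  qed
 qed
 then obtain s u where su: "s : S" "u : W" "!!t y. t : S ==> y : W ==> - F y = a s t - b t u - b s y" unfolding l_def B_def by force
 have b0: "b s (%x. 0) = 0" using strain_pairing_lincomb_right[OF df(1,4) S_L2[OF su(1)] W_H1[OF su(2)] W_H1[OF su(2)], of 0 0] by simp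
 have F0: "F (%x. 0) = 0" using F2[OF W_V[OF zero_W], of 0] by simp
 have "mixed_solution Om \<mu> lam F S W s u" unfolding mixed_solution_def
 proof (intro conjI ballI su(1,2))
  show "a s t - b t u = 0" if "t : S" for t using su(3)[OF that zero_W] b0 F0 by simp
  show "b s y = F y" if "y : W" for y using su(3)[OF zero_S that] by (simp add: form_a_def strain_pairing_def trace_def)
 qed
 thus ?thesis by blast
qed

definition "quasi_const = k5 + 3 + CK * (k3 * (k5 + 2))"

lemma quasi_const_pos: "quasi_const > 0"
proof -
 have "k3 >= 0" unfolding k3_def using mu by (auto simp: stab_def)
 moreover from this have "k5 >= 0" unfolding k5_def using mu by auto
 ultimately have "k5 + 3 > 0" "CK * (k3 * (k5 + 2)) >= 0" using CK by auto
 thus ?thesis unfolding quasi_const_def by linarith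
qed

lemma discrete_quasi_optimal:
 assumes sol: "mixed_solution Om \<mu> lam F (stress_space Om GN) (disp_space Om GD) \<sigma> u"
  and disc: "mixed_solution Om \<mu> lam F S W \<sigma>h uh"
 shows "L2_norm Om (%x. \<sigma> x - \<sigma>h x) + H1_seminorm Om (%x. u x - uh x) <= quasi_const * best_approx Om S W \<sigma> u"
 unfolding best_approx_def
proof (rule le_cINF_add[OF _ _ quasi_const_pos])
 show "S ~= {}" "W ~= {}" using zero_S zero_W by auto
 fix \<tau> v assume \<tau>: "\<tau> : S" and v: "v : W"
 have \<sigma>: "\<sigma> : L2 Om" and u: "u : H1 Om" and \<sigma>h: "\<sigma>h : S" and uh: "uh : W"
  using sol disc V_H1 by (auto simp: mixed_solution_def stress_space_def)
 note L = S_L2[OF \<tau>] S_L2[OF \<sigma>h] W_H1[OF v] W_H1[OF uh]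
 define e w f g where "e = (%x. \<sigma>h x - \<tau> x)" and "w = (%x. uh x - v x)" and "f = (%x. \<sigma> x - \<tau> x)" and "g = (%x. u x - v x)"
 have e: "e : S" unfolding e_def using Sigma_PS_lincomb[OF \<sigma>h \<tau>, of 1 "-1"] by simp
 have w: "w : W" unfolding w_def using Vh_lincomb[OF uh v, of 1 "-1"] by simp
 have f: "f : L2 Om" unfolding f_def by (rule L2_diff[OF \<sigma> L(1)])
 have g: "g : H1 Om" unfolding g_def using H1_lincomb(1)[OF df(1,4) u L(3), of 1 "-1"] by simp
 define \<delta> where "\<delta> = L2_norm Om f + H1_seminorm Om g"
 have \<delta>: "L2_norm Om f <= \<delta>" "H1_seminorm Om g <= \<delta>" by (simp_all add: \<delta>_def H1_norm_bounds L2_norm_nonneg)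
 have eq1: "a e t = a f t - b t g + b t w" if t: "t : S" for t
  unfolding e_def f_def g_def w_def form_a_diff[OF L(2,1) S_L2[OF t]] form_a_diff[OF \<sigma> L(1) S_L2[OF t]]
   strain_pairing_diff_right[OF df(1,4) S_L2[OF t] u L(3)] strain_pairing_diff_right[OF df(1,4) S_L2[OF t] L(4,3)]
  using sol disc t S_stress[OF t] by (simp add: mixed_solution_def)
 have eq2: "b e y = b f y" if y: "y : W" for y
  unfolding e_def f_def strain_pairing_diff[OF L(2,1) W_H1[OF y]] strain_pairing_diff[OF \<sigma> L(1) W_H1[OF y]]
  using sol disc y W_V[OF y] by (simp add: mixed_solution_def)
 note st = discrete_stability[OF e w f g eq1 eq2 \<delta>]
 have "(%x. \<sigma> x - \<sigma>h x) = (%x. f x - e x)" "(%x. u x - uh x) = (%x. g x - w x)" by (auto simp: e_def f_def g_def w_def)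
 hence "L2_norm Om (%x. \<sigma> x - \<sigma>h x) <= L2_norm Om f + L2_norm Om e" "H1_seminorm Om (%x. u x - uh x) <= H1_seminorm Om g + H1_seminorm Om w"
  using L2_norm_triangle_diff[OF f S_L2[OF e]] H1_seminorm_lincomb[OF df(1,4) g W_H1[OF w], of 1 "-1"] by simp_all
 hence "L2_norm Om (%x. \<sigma> x - \<sigma>h x) + H1_seminorm Om (%x. u x - uh x) <= \<delta> + \<delta> + (k5 + 1) * \<delta> + CK * (k3 * (k5 + 2)) * \<delta>"
  using st \<delta> H1_norm_bounds(2)[of Om w] by linarith
 also have "... = quasi_const * \<delta>" by (simp add: quasi_const_def algebra_simps)
 finally show "L2_norm Om (%x. \<sigma> x - \<sigma>h x) + H1_seminorm Om (%x. u x - uh x) <= quasi_const * (L2_norm Om (%x. \<sigma> x - \<tau> x) + H1_seminorm Om (%x. u x - v x))"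
  unfolding \<delta>_def f_def g_def .
qed

end

lemma pure_displacement_contradiction:
 assumes dom: "convex_polygonal_domain Om"
  and q: "!!q. q : Wbar Om T ==> EX v:Vh Om (frontier Om) T. (L2_norm Om q)^2 <= c * (LINT x|leb Om. q x * divergence Om v x)"
 shows False
proof -
 note df = domain_facts[OF dom]
 have one: "(%x. 1 :: real) : L2 Om" by (rule continuous_bounded_L2[OF continuous_on_const df(5,4)])
 hence "(%x. 1) : Wbar Om T" by (auto simp: Wbar_def)
 from q[OF this] obtain v where v: "v : Vh Om (frontier Om) T" "(L2_norm Om (%x. 1 :: real))^2 <= c * (LINT x|leb Om. divergence Om v x)" by auto
 have "(LINT x|leb Om. divergence Om v x) = 0" by (rule divergence_integral_zero[OF dom]) (use v(1) in \<open>simp add: Vh_def\<close>)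
 hence "L2_norm Om (%x. 1 :: real) = 0" using v(2) by simp
 from L2_norm_eq_0[OF one this] have "negligible Om" unfolding AE_lebesgue_on_negligible[OF df(5)] by simp
 thus False using df(1,3) open_not_negligible by blast
qed

theorem theorem4p3:
  fixes \<Omega> \<Gamma>D \<Gamma>N :: "(real^2) set"
    and \<mu> \<rho> :: real
    and meshes :: "quad set set"
  assumes "convex_polygonal_domain \<Omega>"
    and "\<Gamma>D \<in> sets borel" "\<Gamma>N \<in> sets borel"
    and "\<Gamma>D \<inter> \<Gamma>N = {}" "\<Gamma>D \<union> \<Gamma>N = frontier \<Omega>"
    and "emeasure (arclength \<Omega>) \<Gamma>D > 0"
    and "emeasure (arclength \<Omega>) \<Gamma>N > 0 \<or> \<Gamma>N = {}"
    and "\<mu> > 0" and "\<rho> > 2"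
    and "\<forall>T\<in>meshes. conforming_mesh \<Omega> T"
    and "\<exists>c. \<forall>T\<in>meshes. node_ordering c T"
    and "\<forall>T\<in>meshes. shape_regular \<rho> T"
    and "\<exists>c>0. \<forall>T\<in>meshes. \<forall>q\<in>Wbar \<Omega> T. \<exists>v\<in>Vh \<Omega> \<Gamma>D T.
           (L2_norm \<Omega> q)\<^sup>2 \<le> c * (LINT x|lebesgue_on \<Omega>. q x * divergence \<Omega> v x) \<and>
           (H1_seminorm \<Omega> v)\<^sup>2 \<le> c * (L2_norm \<Omega> q)\<^sup>2"
  shows "\<exists>C>0. \<forall>lam>0. \<forall>T\<in>meshes. \<forall>F \<sigma> u.
    bounded_functional_on \<Omega> (disp_space \<Omega> \<Gamma>D) F \<longrightarrow>
    mixed_solution \<Omega> \<mu> lam F (stress_space \<Omega> \<Gamma>N) (disp_space \<Omega> \<Gamma>D) \<sigma> u \<longrightarrow>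
    (\<exists>\<sigma>h uh.
       mixed_solution \<Omega> \<mu> lam F (Sigma_PS \<Omega> \<Gamma>N T) (Vh \<Omega> \<Gamma>D T) \<sigma>h uh \<and>
       (\<forall>\<sigma>' u'. mixed_solution \<Omega> \<mu> lam F (Sigma_PS \<Omega> \<Gamma>N T) (Vh \<Omega> \<Gamma>D T) \<sigma>' u' \<longrightarrow>
          (AE x in lebesgue_on \<Omega>. \<sigma>' x = \<sigma>h x \<and> u' x = uh x)) \<and>
       L2_norm \<Omega> (\<lambda>x. \<sigma> x - \<sigma>h x) + H1_seminorm \<Omega> (\<lambda>x. u x - uh x)
         \<le> C * best_approx \<Omega> (Sigma_PS \<Omega> \<Gamma>N T) (Vh \<Omega> \<Gamma>D T) \<sigma> u \<and>
       (let p = (\<lambda>x. - (\<mu> + lam) * divergence \<Omega> u x);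
            ph = (\<lambda>x. - (1/2) * trace (\<sigma>h x))
        in (AE x in lebesgue_on \<Omega>. p x = - (1/2) * trace (\<sigma> x)) \<and>
           L2_norm \<Omega> (\<lambda>x. p x - ph x)
             \<le> C * best_approx \<Omega> (Sigma_PS \<Omega> \<Gamma>N T) (Vh \<Omega> \<Gamma>D T) \<sigma> u))"
proof -
 note df = domain_facts[OF assms(1)]
 obtain CK where CK: "CK > 0" "!!u. u : disp_space \<Omega> \<Gamma>D ==> H1_norm \<Omega> u <= CK * L2_norm \<Omega> (strain \<Omega> u)"
  using korn_disp_space[OF assms(1,2,6)] by blast
 obtain c where c: "!!T. T : meshes ==> node_ordering c T" using assms(11) by blast
 obtain c0 where c0: "c0 > 0" "!!T q. T : meshes ==> q : Wbar \<Omega> T ==> EX v:Vh \<Omega> \<Gamma>D T.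
      (L2_norm \<Omega> q)^2 <= c0 * (LINT x|leb \<Omega>. q x * divergence \<Omega> v x) \<and>
      (H1_seminorm \<Omega> v)^2 <= c0 * (L2_norm \<Omega> q)^2" using assms(13) by blast
 define Q where "Q = ps_discretization.quasi_const \<rho> (max c 1) \<mu> c0 CK"
 define C where "C = (if Q > 0 then Q else 1)"
 have order: "node_ordering (max c 1) T" if "T : meshes" for T unfolding node_ordering_def
 proof (intro ballI conjI)
  fix K assume "K : T"
  hence K: "coef1 K $ 1 > 0" "coef2 K $ 2 > 0" "\<bar>coef1 K $ 2\<bar> <= coef1 K $ 1" "\<bar>coef2 K $ 1\<bar> <= c * coef2 K $ 2"
   using c[OF that] by (auto simp: node_ordering_def)
  show "0 < coef1 K $ 1" "0 < coef2 K $ 2" "\<bar>coef1 K $ 2\<bar> <= coef1 K $ 1" by (rule K)+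
  have "c * coef2 K $ 2 <= max c 1 * coef2 K $ 2" using K(2) by (intro mult_right_mono) auto
  thus "\<bar>coef2 K $ 1\<bar> <= max c 1 * coef2 K $ 2" using K(4) by linarith
 qed
 have "C > 0" by (simp add: C_def)
 thus ?thesis unfolding Let_def
 proof (intro exI[of _ C] conjI allI ballI impI, goal_cases)
  case (2 lam T F \<sigma> u)
  hence lam: "lam > 0" and T: "T : meshes" and F: "bounded_functional_on \<Omega> (disp_space \<Omega> \<Gamma>D) F"
   and sol: "mixed_solution \<Omega> \<mu> lam F (stress_space \<Omega> \<Gamma>N) (disp_space \<Omega> \<Gamma>D) \<sigma> u" by blast+
  have N: "\<Gamma>N ~= {}"
  proof
   assume "\<Gamma>N = {}"
   hence "\<Gamma>D = frontier \<Omega>" using assms(5) by simp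
   thus False using pure_displacement_contradiction[OF assms(1), of T c0] c0(2)[OF T] by blast
  qed
  interpret ps_discretization \<Omega> \<Gamma>N T \<rho> "max c 1" \<Gamma>D \<mu> lam c0 CK
   using assms(1,8,9,10,12) T N order CK c0 lam by unfold_locales auto
  have CQ: "C = quasi_const" using quasi_const_pos by (simp add: C_def Q_def)
  obtain \<sigma>h uh where disc: "mixed_solution \<Omega> \<mu> lam F S W \<sigma>h uh" using discrete_exists[OF F] by blast
  have h: "\<sigma>h : S" "uh : W" using disc by (auto simp: mixed_solution_def)
  have \<sigma>: "\<sigma> : L2 \<Omega>" and u: "u : H1 \<Omega>" using sol V_H1 by (auto simp: mixed_solution_def stress_space_def)
  have unique: "AE x in leb \<Omega>. \<sigma>' x = \<sigma>h x & u' x = uh x" if d': "mixed_solution \<Omega> \<mu> lam F S W \<sigma>' u'" for \<sigma>' u'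
  proof -
   have h': "\<sigma>' : S" "u' : W" using d' by (auto simp: mixed_solution_def)
   note L = S_L2[OF h(1)] S_L2[OF h'(1)] W_H1[OF h(2)] W_H1[OF h'(2)]
   have e: "(%x. \<sigma>' x - \<sigma>h x) : S" using Sigma_PS_lincomb[OF h'(1) h(1), of 1 "-1"] by simp
   have w: "(%x. u' x - uh x) : W" using Vh_lincomb[OF h'(2) h(2), of 1 "-1"] by simp
   have "a (%x. \<sigma>' x - \<sigma>h x) t = b t (%x. u' x - uh x)" if t: "t : S" for t
    unfolding form_a_diff[OF L(2,1) S_L2[OF t]] strain_pairing_diff_right[OF df(1,4) S_L2[OF t] L(4,3)]
    using disc d' t by (simp add: mixed_solution_def)
   moreover have "b (%x. \<sigma>' x - \<sigma>h x) y = 0" if y: "y : W" for y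
    unfolding strain_pairing_diff[OF L(2,1) W_H1[OF y]] using disc d' y by (simp add: mixed_solution_def)
   ultimately have z: "L2_norm \<Omega> (%x. \<sigma>' x - \<sigma>h x) = 0" "H1_norm \<Omega> (%x. u' x - uh x) = 0"
    using discrete_unique[OF e w] by blast+
   have "L2_norm \<Omega> (%x. u' x - uh x) = 0"
    using z(2) H1_norm_bounds(1)[of \<Omega> "%x. u' x - uh x"] L2_norm_nonneg[of \<Omega> "%x. u' x - uh x"] by linarith
   thus ?thesis using L2_norm_eq_0[OF S_L2[OF e] z(1)] L2_norm_eq_0[OF H1_L2[OF W_H1[OF w]]] by auto
  qed
  have quasi: "L2_norm \<Omega> (%x. \<sigma> x - \<sigma>h x) + H1_seminorm \<Omega> (%x. u x - uh x) <= C * best_approx \<Omega> S W \<sigma> u"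
   unfolding CQ by (rule discrete_quasi_optimal[OF sol disc])
  have p: "AE x in leb \<Omega>. - (\<mu> + lam) * divergence \<Omega> u x = - (1/2) * trace (\<sigma> x)"
   using sol by (intro trace_stress_divergence[OF df(5) \<sigma> u assms(8) lam]) (auto simp: mixed_solution_def stress_space_iff)
  note sL = L2_diff[OF \<sigma> S_L2[OF h(1)]]
  have "L2_norm \<Omega> (%x. - (\<mu> + lam) * divergence \<Omega> u x - - (1/2) * trace (\<sigma>h x)) <= L2_norm \<Omega> (%x. \<sigma> x - \<sigma>h x)"
  proof (rule L2_norm_mono[OF _ sL])
   show "(%x. - (\<mu> + lam) * divergence \<Omega> u x - - (1/2) * trace (\<sigma>h x)) : L2 \<Omega>"
    using L2_diff[OF L2_scaleR[OF divergence_L2[OF u], of "- (\<mu> + lam)"]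
     L2_scaleR[OF L2_bounded_linear[OF bounded_linear_trace S_L2[OF h(1)]], of "- (1/2)"]] by simp
   show "AE x in leb \<Omega>. norm (- (\<mu> + lam) * divergence \<Omega> u x - - (1/2) * trace (\<sigma>h x)) <= norm (\<sigma> x - \<sigma>h x)"
    using p
   proof eventually_elim
    case (elim x)
    define A where "A = \<sigma> x - \<sigma>h x"
    have tr: "trace A = trace (\<sigma> x) - trace (\<sigma>h x)" by (simp add: A_def trace_def sum_2)
    have "(norm (trace A / 2))^2 <= (norm A)^2" unfolding dev_norm[of A] by (simp add: power_divide)
    hence "norm (trace A / 2) <= norm A" by (rule power2_le_imp_le) simp
    moreover have "norm (- (1/2) * trace (\<sigma> x) - - (1/2) * trace (\<sigma>h x)) = norm (trace A / 2)" unfolding tr by (simp add: field_simps)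
    ultimately show ?case unfolding elim A_def[symmetric] by linarith
   qed
  qed
  hence "L2_norm \<Omega> (%x. - (\<mu> + lam) * divergence \<Omega> u x - - (1/2) * trace (\<sigma>h x)) <= C * best_approx \<Omega> S W \<sigma> u"
   using quasi H1_norm_bounds(5)[of \<Omega> "%x. u x - uh x"] by linarith
  thus ?case using disc unique quasi p by blast
 qed
qed

end
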